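(* For every $1\le q\le\infty$, the Lorentz space $L^{(3,q)}(\mathbb R^3)$ is a good space.
   Context: $\mathcal S$, $\mathcal S'$ are the Schwartz space and the space of tempered distributions on $\mathbb R^3$. Lorentz spaces: for measurable $f$ on $\mathbb R^3$, $f^*(t)=\inf\{s\ge0:|\{|f|>s\}|\le t\}$. For $1\le p,q<\infty$, $f\in L^{(p,q)}$ iff $\|f\|_{L^{(p,q)}}=\big(\frac qp\int_0^\infty[t^{1/p}f^*(t)]^q\frac{dt}t\big)^{1/q}<\infty$; for $q=\infty$, iff $\|f\|_{L^{(p,\infty)}}=\sup_{t>0}t^{1/p}f^*(t)<\infty$. For $p>1$ there is a norm on $L^{(p,q)}$ equivalent to $\|\cdot\|_{L^{(p,q)}}$ making it complete; $L^{(3,q)}$ is considered with such a norm. Littlewood-Paley operators: fix $\varphi^0\in C^\infty([0,\infty))$ with $\varphi^0=1$ on $[0,\frac14]$ and $\operatorname{Supp}\varphi^0\subset[0,1]$, and put $\psi^0=\varphi^0(\frac{\cdot}{4})-\varphi^0$. For $j\in\mathbb Z$, $S_j=\varphi^0(-4^{-j}\Delta)$ and $\Delta_j=\psi^0(-4^{-j}\Delta)$, where $\Delta$ is the Laplacian (Fourier multipliers $\varphi^0(4^{-j}|\xi|^2)$ and $\psi^0(4^{-j}|\xi|^2)$). $\Gamma_j=\{\xi\in\mathbb R^3: 2^{j-1}\le|\xi|\le 2^{j+1}\}$. Functional space: a Banach space $E$ such that (a) $\mathcal S\subset E\subset\mathcal S'$ with continuous injections; (b) either $\mathcal S$ is dense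 in $E$, or $\mathcal S$ is dense in a Banach space of which $E$ is the dual; (c) for $f\in E$, $S_jf\to0$ in $\mathcal S'$ as $j\to-\infty$. Good space: a functional space $E$ which is invariant (for a suitable equivalent norm), i.e. $\|\lambda f(\lambda\cdot-x_0)\|_E=\|f\|_E$ for all $f\in E$, $x_0\in\mathbb R^3$, $\lambda>0$, and for which there is a nonnegative sequence $\eta=(\eta_n)_{n\in\mathbb Z}\in\ell^1(\mathbb Z)$ such that, whenever $f,g\in E$ with $\operatorname{Supp}\widehat f\subset\Gamma_k$, $\operatorname{Supp}\widehat g\subset\Gamma_l$, $k,l\in\mathbb Z$, and $j\in\mathbb Z$, one has $\Delta_j(fg)\in E$ and $$\|\Delta_j(fg)\|_E\le\eta_{\max(k-j,\,l-j)}\,2^{k+l-j}\,\|f\|_E\|g\|_E.$$ *)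

theory Defs
  imports "HOL-Analysis.Analysis"
begin

section \<open>Schwartz functions and tempered distributions on \<open>\<real>\<^sup>3\<close>\<close>

type_synonym R3 = "real ^ 3"
type_synonym fn = "R3 \<Rightarrow> complex"
type_synonym dist = "fn \<Rightarrow> complex"

definition partial :: "3 \<Rightarrow> fn \<Rightarrow> fn" where
  "partial i f x = frechet_derivative f (at x) (axis i 1)"

fun partials :: "3 list \<Rightarrow> fn \<Rightarrow> fn" where
  "partials [] f = f"
| "partials (i # is) f = partial i (partials is f)"

text \<open>All iterated partial derivatives exist and are Frechet differentiable, hence continuous;
  this is \<open>C\<^sup>\<infinity>\<close>.\<close>

definition smooth :: "fn \<Rightarrow> bool" where
  "smooth f \<longleftrightarrow> (\<forall>is x. partials is f differentiable (at x))"

definition schwartz :: "fn set" where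
  "schwartz = {f. smooth f \<and> (\<forall>m is. \<exists>C. \<forall>x. (1 + norm x) ^ m * norm (partials is f x) \<le> C)}"

text \<open>An increasing family of norms that generates the topology of the Schwartz space.\<close>

definition schwartz_norm :: "nat \<Rightarrow> fn \<Rightarrow> real" where
  "schwartz_norm m f =
     (SUP (is, x)\<in>{is. length is \<le> m} \<times> UNIV. (1 + norm x) ^ m * norm (partials is f x))"

text \<open>Outside the Schwartz functions a distribution takes the value 0, so that distinct
  elements of \<open>tempered\<close> are distinct functionals on the Schwartz space.\<close>

definition tempered :: "dist set" where
  "tempered = {T. (\<forall>f. f \<notin> schwartz \<longrightarrow> T f = 0) \<and>
     (\<forall>f\<in>schwartz. \<forall>g\<in>schwartz. T (\<lambda>x. f x + g x) = T f + T g) \<and>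
     (\<forall>c. \<forall>f\<in>schwartz. T (\<lambda>x. c * f x) = c * T f) \<and>
     (\<exists>C m. \<forall>f\<in>schwartz. norm (T f) \<le> C * schwartz_norm m f)}"

definition on_schwartz :: "dist \<Rightarrow> dist" where
  "on_schwartz T = (\<lambda>f. if f \<in> schwartz then T f else 0)"

definition dist_of :: "fn \<Rightarrow> dist" where
  "dist_of u = on_schwartz (\<lambda>f. integral\<^sup>L lebesgue (\<lambda>x. u x * f x))"

definition dist_vanishes_on :: "dist \<Rightarrow> R3 set \<Rightarrow> bool" where
  "dist_vanishes_on T U \<longleftrightarrow>
     (\<forall>f\<in>schwartz. compact (closure {x. f x \<noteq> 0}) \<and> closure {x. f x \<noteq> 0} \<subseteq> U \<longrightarrow> T f = 0)"

definition dist_support :: "dist \<Rightarrow> R3 set" where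
  "dist_support T = - \<Union>{U. open U \<and> dist_vanishes_on T U}"

text \<open>The distribution \<open>\<lambda> T(\<lambda>\<cdot> - x\<^sub>0)\<close>, by the change of variables \<open>y = \<lambda>x - x\<^sub>0\<close>
  (with Jacobian \<open>\<lambda>\<^sup>3\<close>) in \<open>\<integral> \<lambda> u(\<lambda>x - x\<^sub>0) f(x) dx\<close>.\<close>

definition dist_rescale :: "real \<Rightarrow> R3 \<Rightarrow> dist \<Rightarrow> dist" where
  "dist_rescale l x0 T =
     on_schwartz (\<lambda>f. of_real (l / l ^ 3) * T (\<lambda>y. f ((1 / l) *\<^sub>R (y + x0))))"

section \<open>Fourier multipliers and Littlewood--Paley operators\<close>

text \<open>With this normalisation the Laplacian is the Fourier multiplier \<open>-|\<xi>|\<^sup>2\<close>.\<close>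

definition fourier :: "fn \<Rightarrow> fn" where
  "fourier f \<xi> = integral\<^sup>L lebesgue (\<lambda>x. exp (- \<i> * of_real (x \<bullet> \<xi>)) * f x)"

definition inv_fourier :: "fn \<Rightarrow> fn" where
  "inv_fourier f x =
     of_real (1 / (2 * pi) ^ 3) * integral\<^sup>L lebesgue (\<lambda>\<xi>. exp (\<i> * of_real (x \<bullet> \<xi>)) * f \<xi>)"

definition dist_fourier :: "dist \<Rightarrow> dist" where
  "dist_fourier T = on_schwartz (\<lambda>f. T (fourier f))"

definition dist_inv_fourier :: "dist \<Rightarrow> dist" where
  "dist_inv_fourier T = on_schwartz (\<lambda>f. T (inv_fourier f))"

definition dist_smult :: "fn \<Rightarrow> dist \<Rightarrow> dist" where
  "dist_smult m T = on_schwartz (\<lambda>f. T (\<lambda>\<xi>. m \<xi> * f \<xi>))"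

definition fourier_multiplier :: "fn \<Rightarrow> dist \<Rightarrow> dist" where
  "fourier_multiplier m T = dist_inv_fourier (dist_smult m (dist_fourier T))"

definition smooth_half_line :: "(real \<Rightarrow> complex) \<Rightarrow> bool" where
  "smooth_half_line h \<longleftrightarrow> (\<exists>D :: nat \<Rightarrow> real \<Rightarrow> complex. D 0 = h \<and>
     (\<forall>n. \<forall>t\<ge>0. (D n has_vector_derivative D (Suc n) t) (at t within {0..})))"

text \<open>Only the values of \<open>\<phi>\<close> on \<open>[0,\<infinity>)\<close> matter.\<close>

definition lp_cutoff :: "(real \<Rightarrow> complex) \<Rightarrow> bool" where
  "lp_cutoff \<phi> \<longleftrightarrow> smooth_half_line \<phi> \<and> (\<forall>t\<in>{0..1/4}. \<phi> t = 1) \<and>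
     closure {t. 0 \<le> t \<and> \<phi> t \<noteq> 0} \<subseteq> {0..1}"

definition lp_S :: "(real \<Rightarrow> complex) \<Rightarrow> int \<Rightarrow> dist \<Rightarrow> dist" where
  "lp_S \<phi> j = fourier_multiplier (\<lambda>\<xi>. \<phi> (4 powi (- j) * (norm \<xi>)\<^sup>2))"

definition lp_\<psi> :: "(real \<Rightarrow> complex) \<Rightarrow> real \<Rightarrow> complex" where
  "lp_\<psi> \<phi> t = \<phi> (t / 4) - \<phi> t"

definition lp_\<Delta> :: "(real \<Rightarrow> complex) \<Rightarrow> int \<Rightarrow> dist \<Rightarrow> dist" where
  "lp_\<Delta> \<phi> j = fourier_multiplier (\<lambda>\<xi>. lp_\<psi> \<phi> (4 powi (- j) * (norm \<xi>)\<^sup>2))"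

definition \<Gamma>_annulus :: "int \<Rightarrow> R3 set" where
  "\<Gamma>_annulus j = {\<xi>. 2 powi (j - 1) \<le> norm \<xi> \<and> norm \<xi> \<le> 2 powi (j + 1)}"

text \<open>A tempered distribution whose Fourier transform has compact support is a smooth function
  of polynomial growth, and it is determined by this function.  The product of two such
  distributions is the pointwise product of the functions.\<close>

definition fun_of_dist :: "dist \<Rightarrow> fn" where
  "fun_of_dist T = (THE u. continuous_on UNIV u \<and>
     (\<exists>C m. \<forall>x. norm (u x) \<le> C * (1 + norm x) ^ m) \<and> dist_of u = T)"

definition dist_mult :: "dist \<Rightarrow> dist \<Rightarrow> dist" where
  "dist_mult T U = dist_of (\<lambda>x. fun_of_dist T x * fun_of_dist U x)"

section \<open>Banach spaces carried by sets of functions\<close>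

text \<open>The vector space operations are the pointwise ones; the norm is only relevant on the carrier.\<close>

definition subspace_on :: "('a \<Rightarrow> complex) set \<Rightarrow> bool" where
  "subspace_on V \<longleftrightarrow> (\<lambda>_. 0) \<in> V \<and>
     (\<forall>f\<in>V. \<forall>g\<in>V. (\<lambda>a. f a + g a) \<in> V) \<and> (\<forall>c. \<forall>f\<in>V. (\<lambda>a. c * f a) \<in> V)"

definition norm_on :: "('a \<Rightarrow> complex) set \<Rightarrow> (('a \<Rightarrow> complex) \<Rightarrow> real) \<Rightarrow> bool" where
  "norm_on V N \<longleftrightarrow>
     (\<forall>f\<in>V. 0 \<le> N f \<and> (N f = 0 \<longleftrightarrow> f = (\<lambda>_. 0))) \<and>
     (\<forall>f\<in>V. \<forall>g\<in>V. N (\<lambda>a. f a + g a) \<le> N f + N g) \<and>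
     (\<forall>c. \<forall>f\<in>V. N (\<lambda>a. c * f a) = norm c * N f)"

definition complete_on :: "('a \<Rightarrow> complex) set \<Rightarrow> (('a \<Rightarrow> complex) \<Rightarrow> real) \<Rightarrow> bool" where
  "complete_on V N \<longleftrightarrow> (\<forall>F :: nat \<Rightarrow> 'a \<Rightarrow> complex. (\<forall>n. F n \<in> V) \<and>
     (\<forall>e>0. \<exists>M. \<forall>m\<ge>M. \<forall>n\<ge>M. N (\<lambda>a. F m a - F n a) < e) \<longrightarrow>
     (\<exists>f\<in>V. (\<lambda>n. N (\<lambda>a. F n a - f a)) \<longlonglongrightarrow> 0))"

definition banach_on :: "('a \<Rightarrow> complex) set \<Rightarrow> (('a \<Rightarrow> complex) \<Rightarrow> real) \<Rightarrow> bool" where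
  "banach_on V N \<longleftrightarrow> subspace_on V \<and> norm_on V N \<and> complete_on V N"

definition equivalent_norm_on ::
  "('a \<Rightarrow> complex) set \<Rightarrow> (('a \<Rightarrow> complex) \<Rightarrow> real) \<Rightarrow> (('a \<Rightarrow> complex) \<Rightarrow> real) \<Rightarrow> bool" where
  "equivalent_norm_on V N N' \<longleftrightarrow> norm_on V N' \<and>
     (\<exists>c>0. \<exists>C>0. \<forall>f\<in>V. c * N f \<le> N' f \<and> N' f \<le> C * N f)"

definition dual_on ::
  "('a \<Rightarrow> complex) set \<Rightarrow> (('a \<Rightarrow> complex) \<Rightarrow> real) \<Rightarrow> (('a \<Rightarrow> complex) \<Rightarrow> complex) set" where
  "dual_on V N = {L. (\<forall>f. f \<notin> V \<longrightarrow> L f = 0) \<and>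
     (\<forall>f\<in>V. \<forall>g\<in>V. L (\<lambda>a. f a + g a) = L f + L g) \<and>
     (\<forall>c. \<forall>f\<in>V. L (\<lambda>a. c * f a) = c * L f) \<and>
     (\<exists>C. \<forall>f\<in>V. norm (L f) \<le> C * N f)}"

definition dual_norm_on ::
  "('a \<Rightarrow> complex) set \<Rightarrow> (('a \<Rightarrow> complex) \<Rightarrow> real) \<Rightarrow> (('a \<Rightarrow> complex) \<Rightarrow> complex) \<Rightarrow> real" where
  "dual_norm_on V N L = (SUP f\<in>{f\<in>V. N f \<le> 1}. norm (L f))"

section \<open>Functional spaces and good spaces\<close>

definition schwartz_embeds ::
  "(fn \<Rightarrow> 'a \<Rightarrow> complex) \<Rightarrow> ('a \<Rightarrow> complex) set \<Rightarrow> (('a \<Rightarrow> complex) \<Rightarrow> real) \<Rightarrow> bool" where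
  "schwartz_embeds \<iota> V N \<longleftrightarrow> \<iota> ` schwartz \<subseteq> V \<and> inj_on \<iota> schwartz \<and>
     (\<forall>f\<in>schwartz. \<forall>g\<in>schwartz. \<iota> (\<lambda>x. f x + g x) = (\<lambda>a. \<iota> f a + \<iota> g a)) \<and>
     (\<forall>c. \<forall>f\<in>schwartz. \<iota> (\<lambda>x. c * f x) = (\<lambda>a. c * \<iota> f a)) \<and>
     (\<exists>C m. \<forall>f\<in>schwartz. N (\<iota> f) \<le> C * schwartz_norm m f)"

definition schwartz_dense ::
  "(fn \<Rightarrow> 'a \<Rightarrow> complex) \<Rightarrow> ('a \<Rightarrow> complex) set \<Rightarrow> (('a \<Rightarrow> complex) \<Rightarrow> real) \<Rightarrow> bool" where
  "schwartz_dense \<iota> V N \<longleftrightarrow> schwartz_embeds \<iota> V N \<and>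
     (\<forall>v\<in>V. \<forall>e>0. \<exists>f\<in>schwartz. N (\<lambda>a. v a - \<iota> f a) < e)"

text \<open>Since \<open>\<iota>\<close> has dense range in \<open>X\<close>, a continuous functional \<open>L\<close> on \<open>X\<close> is determined by the
  tempered distribution \<open>L \<circ> \<iota>\<close>; \<open>E\<close> is the dual of \<open>X\<close> through this identification.\<close>

definition is_dual_of ::
  "dist set \<Rightarrow> (dist \<Rightarrow> real) \<Rightarrow>
   (fn \<Rightarrow> 'a \<Rightarrow> complex) \<Rightarrow> ('a \<Rightarrow> complex) set \<Rightarrow> (('a \<Rightarrow> complex) \<Rightarrow> real) \<Rightarrow> bool" where
  "is_dual_of E N \<iota> X M \<longleftrightarrow>
     E = (\<lambda>L. on_schwartz (L \<circ> \<iota>)) ` dual_on X M \<and>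
     (\<exists>c>0. \<exists>C>0. \<forall>L\<in>dual_on X M.
        c * dual_norm_on X M L \<le> N (on_schwartz (L \<circ> \<iota>)) \<and>
        N (on_schwartz (L \<circ> \<iota>)) \<le> C * dual_norm_on X M L)"

text \<open>The space \<open>\<S>'\<close> carries the weak-* topology; for the continuity of \<open>E \<rightarrow> \<S>'\<close> and for
  the convergence of \<open>S\<^sub>j f\<close>, the strong topology gives the same notions.  The Banach space \<open>X\<close>
  of which \<open>E\<close> is the dual is separable, hence isometric to a space of bounded sequences,
  so that nothing is lost by letting it be carried by functions on an infinite set.\<close>

definition functional_space ::
  "(real \<Rightarrow> complex) \<Rightarrow> dist set \<Rightarrow> (dist \<Rightarrow> real) \<Rightarrow> bool" where
  "functional_space \<phi> E N \<longleftrightarrow> banach_on E N \<and>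
     schwartz_embeds dist_of E N \<and>
     E \<subseteq> tempered \<and> (\<forall>f\<in>schwartz. \<exists>C. \<forall>T\<in>E. norm (T f) \<le> C * N T) \<and>
     (schwartz_dense dist_of E N \<or>
      (\<exists>(\<iota> :: fn \<Rightarrow> dist) X M. banach_on X M \<and> schwartz_dense \<iota> X M \<and> is_dual_of E N \<iota> X M)) \<and>
     (\<forall>T\<in>E. \<forall>f\<in>schwartz. ((\<lambda>j. lp_S \<phi> j T f) \<longlongrightarrow> 0) at_bot)"

definition invariant_norm :: "dist set \<Rightarrow> (dist \<Rightarrow> real) \<Rightarrow> bool" where
  "invariant_norm E N \<longleftrightarrow>
     (\<forall>T\<in>E. \<forall>x0. \<forall>l>0. dist_rescale l x0 T \<in> E \<and> N (dist_rescale l x0 T) = N T)"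

definition good_space :: "(real \<Rightarrow> complex) \<Rightarrow> dist set \<Rightarrow> (dist \<Rightarrow> real) \<Rightarrow> bool" where
  "good_space \<phi> E N \<longleftrightarrow> functional_space \<phi> E N \<and>
     (\<exists>N'. equivalent_norm_on E N N' \<and> invariant_norm E N' \<and>
       (\<exists>\<eta> :: int \<Rightarrow> real. (\<forall>n. 0 \<le> \<eta> n) \<and> \<eta> summable_on UNIV \<and>
         (\<forall>T\<in>E. \<forall>U\<in>E. \<forall>k l. dist_support (dist_fourier T) \<subseteq> \<Gamma>_annulus k \<and>
            dist_support (dist_fourier U) \<subseteq> \<Gamma>_annulus l \<longrightarrow>
            (\<forall>j. lp_\<Delta> \<phi> j (dist_mult T U) \<in> E \<and>
               N' (lp_\<Delta> \<phi> j (dist_mult T U))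
                 \<le> \<eta> (max (k - j) (l - j)) * 2 powi (k + l - j) * N' T * N' U))))"

section \<open>Lorentz spaces\<close>

definition decreasing_rearrangement :: "fn \<Rightarrow> real \<Rightarrow> ennreal" where
  "decreasing_rearrangement f t =
     Inf (ennreal ` {s. 0 \<le> s \<and> emeasure lebesgue {x. norm (f x) > s} \<le> ennreal t})"

text \<open>Used for \<open>a > 0\<close> only.\<close>

definition ennpowr :: "ennreal \<Rightarrow> real \<Rightarrow> ennreal" where
  "ennpowr x a = (if x = \<infinity> then \<infinity> else ennreal (enn2real x powr a))"

definition lorentz_quasinorm :: "real \<Rightarrow> ennreal \<Rightarrow> fn \<Rightarrow> ennreal" where
  "lorentz_quasinorm p q f =
     (if q = \<infinity> then SUP t\<in>{0<..}. ennreal (t powr (1 / p)) * decreasing_rearrangement f t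
      else ennpowr (ennreal (enn2real q / p) *
        (\<integral>\<^sup>+ t\<in>{0<..}. ennpowr (ennreal (t powr (1 / p)) * decreasing_rearrangement f t) (enn2real q)
            * ennreal (1 / t) \<partial>lborel)) (1 / enn2real q))"

definition lorentz_functions :: "real \<Rightarrow> ennreal \<Rightarrow> fn set" where
  "lorentz_functions p q = {f \<in> borel_measurable lebesgue. lorentz_quasinorm p q f < \<infinity>}"

text \<open>Passing to distributions identifies functions that agree almost everywhere.\<close>

definition lorentz_space :: "real \<Rightarrow> ennreal \<Rightarrow> dist set" where
  "lorentz_space p q = dist_of ` lorentz_functions p q"

definition lorentz_norm :: "real \<Rightarrow> ennreal \<Rightarrow> (dist \<Rightarrow> real) \<Rightarrow> bool" where
  "lorentz_norm p q N \<longleftrightarrow> banach_on (lorentz_space p q) N \<and>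
     (\<exists>c>0. \<exists>C>0. \<forall>f\<in>lorentz_functions p q.
        ennreal c * lorentz_quasinorm p q f \<le> ennreal (N (dist_of f)) \<and>
        ennreal (N (dist_of f)) \<le> ennreal C * lorentz_quasinorm p q f)"

end

theory Submission
  imports Defs
begin

text \<open>The norm on \<open>L\<^bsup>(p,q)\<^esup>\<close> is the real interpolation norm built from Peetre's functional
  \<open>K(t, f; L\<^sup>1, L\<^sup>\<infinity>)\<close>; it is equivalent to the quasinorm for \<open>p > 1\<close> and invariant under
  \<open>f \<mapsto> \<lambda> f(\<lambda>\<cdot> - x\<^sub>0)\<close> for \<open>p = 3\<close>.  Littlewood--Paley operators are convolutions with
  dilates of one Schwartz function, which act boundedly on the \<open>K\<close>-functional.  An element with
  spectrum in \<open>\<Gamma>\<^sub>k\<close> is reproduced by such a convolution, so Bernstein's inequality bounds it in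
  \<open>L\<^sup>\<infinity>\<close> by \<open>2\<^sup>k\<close> times its norm.  This gives the product estimate with a factor
  \<open>2\<^bsup>min(k,l)\<^esup> = 2\<^bsup>k+l-j\<^esup> 2\<^bsup>-max(k-j,l-j)\<^esup>\<close>, while \<open>\<Delta>\<^sub>j(fg)\<close> vanishes when \<open>max(k,l)\<close> is much
  smaller than \<open>j\<close>.  For \<open>q = \<infinity>\<close> Schwartz functions are not dense, and weak \<open>L\<^sup>3\<close> is identified
  with the dual of \<open>L\<^bsup>(3/2,1)\<^esup>\<close>: a functional restricts to a weighted \<open>L\<^sup>2\<close> space, where it is
  represented by a function, and testing it on sets where this function is large gives the weak
  type bound.\<close>

section \<open>Schwartz functions\<close>

text \<open>The inversion constant is never evaluated: with \<open>c0\<close> the integral of the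
  kernel \<open>ker 1\<close>, mollification gives \<open>fourier (inv_fourier f) = c0 f\<close>,
  and only \<open>c0 \<noteq> 0\<close> enters, which an L^2 identity provides. Spectra are supports
  of distributions and are tested on compactly supported functions, while the inverse transform of a
  Schwartz function need not have compact support. Cutoffs of growing radius bridge the gap: once
  the radius exceeds the spectrum the pairing no longer depends on it, and its limit is a
  mollification limit. The weight \<open>decay\<close> fixes the common setting. Lorentz functions
  lie in the weighted L^1 space \<open>moderate\<close>, where pairing with Schwartz functions,
  convolution, and uniqueness of the density of a distribution are available. The inverse weight
  defines the L^2 space of the duality argument: its elements lie in L^1 and L^2, hence in
  L^(3/2,1), so a functional has a density there, on which size estimates can then be made. The
  completeness proof is carried out once for abstract function norms, since both the Lorentz norm
  and the weighted L^2 norm need it.\<close>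

primrec diff_class :: "fn set \<Rightarrow> nat \<Rightarrow> fn \<Rightarrow> bool" where
  "diff_class W 0 f \<longleftrightarrow> f \<in> W \<and> (\<forall>x. f differentiable at x)"
| "diff_class W (Suc n) f \<longleftrightarrow>
     f \<in> W \<and> (\<forall>x. f differentiable at x) \<and> (\<forall>i. diff_class W n (partial i f))"

lemma partials_snoc: "partials (is @ [i]) f = partials is (partial i f)"
  by (induction "is") auto

text \<open>In \<open>partials\<close> the head of the list is the outermost derivative, while
  \<open>diff_class\<close> takes the innermost one off first; \<open>partials_snoc\<close>
  reconciles the two. The recursive form is the one in which product, chain and Fourier rules become
  inductions with the function left arbitrary.\<close>

lemma diff_class_iff:
  "diff_class W n f \<longleftrightarrow>
     (\<forall>is. length is \<le> n \<longrightarrow> partials is f \<in> W \<and> (\<forall>x. partials is f differentiable at x))"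
proof (induction n arbitrary: f)
  case 0
  then show ?case by auto
next
  case (Suc n)
  show ?case (is "?L \<longleftrightarrow> ?R")
  proof
    assume L: ?L
    show ?R
    proof (intro allI impI)
      fix "is" :: "3 list" assume len: "length is \<le> Suc n"
      show "partials is f \<in> W \<and> (\<forall>x. partials is f differentiable at x)"
      proof (cases "is" rule: rev_cases)
        case Nil then show ?thesis using L by simp
      next
        case (snoc js i)
        with len have "length js \<le> n" by simp
        moreover have "diff_class W n (partial i f)" using L by simp
        ultimately show ?thesis using Suc.IH[of "partial i f"] snoc by (simp add: partials_snoc)
      qed
    qed
  next
    assume R: ?R
    have "f \<in> W \<and> (\<forall>x. f differentiable at x)" using R[rule_format, of "[]"] by simp
    moreover have "diff_class W n (partial i f)" for i
      unfolding Suc.IH using R by (metis length_append_singleton not_less_eq_eq partials_snoc)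
    ultimately show ?L by simp
  qed
qed

lemma diff_class_SucD: "diff_class W (Suc n) f \<Longrightarrow> diff_class W n f"
  unfolding diff_class_iff by auto

lemma diff_class_mono: "diff_class V n f \<Longrightarrow> V \<subseteq> W \<Longrightarrow> diff_class W n f"
  unfolding diff_class_iff by blast

lemma diff_classD: "diff_class W n f \<Longrightarrow> f \<in> W" "diff_class W n f \<Longrightarrow> f differentiable at x"
  by (cases n; auto)+

definition rapid :: "fn set" where
  "rapid = {f. \<forall>m. \<exists>C. \<forall>x. (1 + norm x) ^ m * norm (f x) \<le> C}"

definition poly_bounded :: "fn set" where
  "poly_bounded = {f. \<exists>m C. \<forall>x. norm (f x) \<le> C * (1 + norm x) ^ m}"

text \<open>The multipliers of the Schwartz space. Coordinates, characters and Fourier transforms of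
  rapidly decreasing functions belong here without being Schwartz in general.\<close>

definition slow :: "fn set" where
  "slow = {f. \<forall>n. diff_class poly_bounded n f}"

lemma schwartz_iff: "f \<in> schwartz \<longleftrightarrow> (\<forall>n. diff_class rapid n f)"
  unfolding schwartz_def smooth_def diff_class_iff rapid_def by (auto; meson order_refl)

lemma partial_eq: "(f has_derivative D) (at x) \<Longrightarrow> partial i f x = D (axis i 1)"
  unfolding partial_def using frechet_derivative_at by metis

lemma partial_add:
  assumes "\<And>x. f differentiable at x" "\<And>x. g differentiable at x"
  shows "partial i (\<lambda>x. f x + g x) = (\<lambda>x. partial i f x + partial i g x)"
proof
  fix x
  have "((\<lambda>x. f x + g x) has_derivative
      (\<lambda>h. frechet_derivative f (at x) h + frechet_derivative g (at x) h)) (at x)"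
    using assms by (intro has_derivative_add) (auto simp: frechet_derivative_works[symmetric])
  from partial_eq[OF this] show "partial i (\<lambda>x. f x + g x) x = partial i f x + partial i g x"
    by (simp add: partial_def)
qed

lemma partial_mult:
  assumes "\<And>x. f differentiable at x" "\<And>x. g differentiable at x"
  shows "partial i (\<lambda>x. f x * g x) = (\<lambda>x. f x * partial i g x + partial i f x * g x)"
proof
  fix x
  have "((\<lambda>x. f x * g x) has_derivative
      (\<lambda>h. f x * frechet_derivative g (at x) h + frechet_derivative f (at x) h * g x)) (at x)"
    using assms by (intro has_derivative_mult) (auto simp: frechet_derivative_works[symmetric])
  from partial_eq[OF this] show "partial i (\<lambda>x. f x * g x) x = f x * partial i g x + partial i f x * g x"
    by (simp add: partial_def)
qed

lemma partial_cmult: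
  assumes "\<And>x. f differentiable at x"
  shows "partial i (\<lambda>x. c * f x) = (\<lambda>x. c * partial i f x)"
proof
  fix x
  have "((\<lambda>x. c * f x) has_derivative (\<lambda>h. c * frechet_derivative f (at x) h)) (at x)"
    using assms by (intro has_derivative_mult_right) (auto simp: frechet_derivative_works[symmetric])
  from partial_eq[OF this] show "partial i (\<lambda>x. c * f x) x = c * partial i f x"
    by (simp add: partial_def)
qed

lemma partial_cnj:
  assumes "\<And>x. f differentiable at x"
  shows "partial i (\<lambda>x. cnj (f x)) = (\<lambda>x. cnj (partial i f x))"
proof
  fix x
  have "((\<lambda>x. cnj (f x)) has_derivative (\<lambda>h. cnj (frechet_derivative f (at x) h))) (at x)"
    using assms by (intro has_derivative_cnj) (auto simp: frechet_derivative_works[symmetric])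
  from partial_eq[OF this] show "partial i (\<lambda>x. cnj (f x)) x = cnj (partial i f x)"
    by (simp add: partial_def)
qed

lemma affine_has_derivative:
  assumes "\<And>x. f differentiable at x"
  shows "((\<lambda>x. f (a *\<^sub>R x + b)) has_derivative (\<lambda>h. frechet_derivative f (at (a *\<^sub>R x + b)) (a *\<^sub>R h))) (at x)"
proof -
  have 1: "((\<lambda>x. a *\<^sub>R x + b) has_derivative (\<lambda>h. a *\<^sub>R h)) (at x)"
    by (auto intro!: derivative_eq_intros)
  have 2: "(f has_derivative frechet_derivative f (at (a *\<^sub>R x + b))) (at (a *\<^sub>R x + b))"
    using assms frechet_derivative_works by blast
  show ?thesis by (rule has_derivative_compose[OF 1 2])
qed

lemma affine_differentiable:
  "(\<And>x. f differentiable at x) \<Longrightarrow> (\<lambda>x. f (a *\<^sub>R x + b)) differentiable at x" for f :: fn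
  using affine_has_derivative differentiableI by blast

lemma cnj_differentiable:
  assumes "f differentiable at x" shows "(\<lambda>x. cnj (f x)) differentiable at x"
  using assms has_derivative_cnj unfolding differentiable_def by blast

lemma partial_affine:
  assumes "\<And>x. f differentiable at x"
  shows "partial i (\<lambda>x. f (a *\<^sub>R x + b)) = (\<lambda>x. of_real a * partial i f (a *\<^sub>R x + b))"
proof
  fix x
  have "linear (frechet_derivative f (at (a *\<^sub>R x + b)))"
    using assms by (simp add: linear_frechet_derivative)
  then have "frechet_derivative f (at (a *\<^sub>R x + b)) (a *\<^sub>R axis i 1) = a *\<^sub>R partial i f (a *\<^sub>R x + b)"
    unfolding partial_def by (rule linear_scale)
  then show "partial i (\<lambda>x. f (a *\<^sub>R x + b)) x = of_real a * partial i f (a *\<^sub>R x + b)"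
    using partial_eq[OF affine_has_derivative[OF assms, of a b x]]
    by (metis scaleR_conv_of_real)
qed

lemma diff_class_add:
  assumes W: "\<And>f g. f \<in> W \<Longrightarrow> g \<in> W \<Longrightarrow> (\<lambda>x. f x + g x) \<in> W"
  shows "diff_class W n f \<Longrightarrow> diff_class W n g \<Longrightarrow> diff_class W n (\<lambda>x. f x + g x)"
proof (induction n arbitrary: f g)
  case 0
  then show ?case using W by simp
next
  case (Suc n)
  then show ?case using W by (simp add: partial_add)
qed

lemma diff_class_cmult:
  assumes W: "\<And>f c. f \<in> W \<Longrightarrow> (\<lambda>x. c * f x) \<in> W"
  shows "diff_class W n f \<Longrightarrow> diff_class W n (\<lambda>x. c * f x)"
proof (induction n arbitrary: f)
  case 0
  then show ?case using W by simp
next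
  case (Suc n)
  then show ?case using W by (simp add: partial_cmult)
qed

text \<open>Leibniz' rule and induction on the order. Three separate classes let one induction give
  \<open>schwartz_mult_slow\<close> as well as \<open>slow_mult\<close>.\<close>

lemma diff_class_mult:
  assumes U: "\<And>f g. f \<in> U \<Longrightarrow> g \<in> U \<Longrightarrow> (\<lambda>x. f x + g x) \<in> U"
    and VW: "\<And>f g. f \<in> V \<Longrightarrow> g \<in> W \<Longrightarrow> (\<lambda>x. f x * g x) \<in> U"
  shows "diff_class V n f \<Longrightarrow> diff_class W n g \<Longrightarrow> diff_class U n (\<lambda>x. f x * g x)"
proof (induction n arbitrary: f g)
  case 0
  then show ?case using VW by simp
next
  case (Suc n)
  have "diff_class V n f" "diff_class W n g" using Suc.prems diff_class_SucD by blast+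
  then have "diff_class U n (\<lambda>x. f x * partial i g x + partial i f x * g x)" for i
    using Suc.prems by (intro diff_class_add U Suc.IH) auto
  then show ?case using VW Suc.prems by (simp add: partial_mult)
qed

lemma diff_class_cnj:
  assumes W: "\<And>f. f \<in> W \<Longrightarrow> (\<lambda>x. cnj (f x)) \<in> W"
  shows "diff_class W n f \<Longrightarrow> diff_class W n (\<lambda>x. cnj (f x))"
proof (induction n arbitrary: f)
  case 0
  then show ?case using W by (auto intro: cnj_differentiable)
next
  case (Suc n)
  then show ?case using W by (auto simp: partial_cnj intro: cnj_differentiable)
qed

lemma diff_class_affine:
  assumes W: "\<And>f. f \<in> W \<Longrightarrow> (\<lambda>x. f (a *\<^sub>R x + b)) \<in> W" "\<And>f c. f \<in> W \<Longrightarrow> (\<lambda>x. c * f x) \<in> W"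
  shows "diff_class W n f \<Longrightarrow> diff_class W n (\<lambda>x. f (a *\<^sub>R x + b))"
proof (induction n arbitrary: f)
  case 0
  then show ?case using W(1) by (auto intro: affine_differentiable)
next
  case (Suc n)
  then have "diff_class W n (\<lambda>x. of_real a * partial i f (a *\<^sub>R x + b))" for i
    using diff_class_cmult[OF W(2), of n "\<lambda>x. partial i f (a *\<^sub>R x + b)" "of_real a"] by simp
  then show ?case using Suc W(1) by (auto simp: partial_affine intro: affine_differentiable)
qed

lemma diff_class_const: "(\<And>c. (\<lambda>_. c) \<in> W) \<Longrightarrow> diff_class W n (\<lambda>_. c)"
proof (induction n arbitrary: c)
  case 0
  then show ?case by simp
next
  case (Suc n)
  have "partial i (\<lambda>_. c) = (\<lambda>_. 0)" for i by (auto simp: partial_def)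
  then show ?case using Suc by simp
qed

lemma one_plus_norm_pos [simp]: "0 < 1 + norm x" "0 \<le> 1 + norm x" "1 + norm x \<noteq> 0"
  by (auto simp: add_pos_nonneg add_nonneg_eq_0_iff)

lemma rapid_add: "f \<in> rapid \<Longrightarrow> g \<in> rapid \<Longrightarrow> (\<lambda>x. f x + g x) \<in> rapid"
  unfolding rapid_def
proof safe
  fix m assume "\<forall>m. \<exists>C. \<forall>x. (1 + norm x) ^ m * cmod (f x) \<le> C" "\<forall>m. \<exists>C. \<forall>x. (1 + norm x) ^ m * cmod (g x) \<le> C"
  then obtain C D where C: "\<And>x. (1 + norm x) ^ m * cmod (f x) \<le> C" "\<And>x. (1 + norm x) ^ m * cmod (g x) \<le> D"
    by metis
  have "(1 + norm x) ^ m * cmod (f x + g x) \<le> C + D" for x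
    using C[of x] mult_left_mono[OF norm_triangle_ineq[of "f x" "g x"], of "(1 + norm x) ^ m"]
    by (simp add: distrib_left)
  then show "\<exists>C. \<forall>x. (1 + norm x) ^ m * cmod (f x + g x) \<le> C" by blast
qed

lemma rapid_mult: "f \<in> poly_bounded \<Longrightarrow> g \<in> rapid \<Longrightarrow> (\<lambda>x. f x * g x) \<in> rapid"
  unfolding rapid_def poly_bounded_def
proof safe
  fix m m' C assume f: "\<forall>x. cmod (f x) \<le> C * (1 + norm x) ^ m'" and "\<forall>m. \<exists>C. \<forall>x. (1 + norm x) ^ m * cmod (g x) \<le> C"
  then obtain D where D: "\<And>x. (1 + norm x) ^ (m' + m) * cmod (g x) \<le> D" by metis
  have "0 \<le> C" using order_trans[OF norm_ge_zero f[rule_format, of 0]] by simp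
  have "(1 + norm x) ^ m * cmod (f x * g x) \<le> C * D" for x
  proof -
    have "(1 + norm x) ^ m * cmod (f x * g x) \<le> (1 + norm x) ^ m * ((C * (1 + norm x) ^ m') * cmod (g x))"
      unfolding norm_mult by (intro mult_left_mono mult_right_mono f[rule_format]) auto
    also have "\<dots> = C * ((1 + norm x) ^ (m' + m) * cmod (g x))"
      by (simp add: power_add mult_ac)
    also have "\<dots> \<le> C * D" using D \<open>0 \<le> C\<close> by (intro mult_left_mono)
    finally show ?thesis .
  qed
  then show "\<exists>C. \<forall>x. (1 + norm x) ^ m * cmod (f x * g x) \<le> C" by blast
qed

lemma rapid_subset_poly_bounded: "rapid \<subseteq> poly_bounded"
proof
  fix f assume "f \<in> rapid"
  then obtain C where "\<And>x. (1 + norm x) ^ 0 * norm (f x) \<le> C" unfolding rapid_def by blast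
  then have "\<forall>x. norm (f x) \<le> C * (1 + norm x) ^ 0" by simp
  then show "f \<in> poly_bounded" unfolding poly_bounded_def by blast
qed

lemma poly_bounded_const: "(\<lambda>_. c) \<in> poly_bounded"
  unfolding poly_bounded_def by (auto intro!: exI[of _ 0] exI[of _ "norm c"])

lemma rapid_cmult: "f \<in> rapid \<Longrightarrow> (\<lambda>x. c * f x) \<in> rapid"
  using rapid_mult[OF poly_bounded_const] .

lemma poly_bounded_add: "f \<in> poly_bounded \<Longrightarrow> g \<in> poly_bounded \<Longrightarrow> (\<lambda>x. f x + g x) \<in> poly_bounded"
  unfolding poly_bounded_def
proof safe
  fix m C m' C' assume f: "\<forall>x. cmod (f x) \<le> C * (1 + norm x) ^ m" and g: "\<forall>x. cmod (g x) \<le> C' * (1 + norm x) ^ m'"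
  have C: "0 \<le> C" using order_trans[OF norm_ge_zero f[rule_format, of 0]] by simp
  have C': "0 \<le> C'" using order_trans[OF norm_ge_zero g[rule_format, of 0]] by simp
  have "norm (f x + g x) \<le> (C + C') * (1 + norm x) ^ (m + m')" for x
  proof -
    have "norm (f x + g x) \<le> C * (1 + norm x) ^ m + C' * (1 + norm x) ^ m'"
      using f g norm_triangle_ineq[of "f x" "g x"] by (meson add_mono order_trans)
    also have "\<dots> \<le> C * (1 + norm x) ^ (m + m') + C' * (1 + norm x) ^ (m + m')"
      using C C' by (intro add_mono mult_left_mono power_increasing) auto
    finally show ?thesis by (simp add: distrib_right)
  qed
  then show "\<exists>m C. \<forall>x. cmod (f x + g x) \<le> C * (1 + norm x) ^ m" by blast
qed

lemma poly_bounded_mult: "f \<in> poly_bounded \<Longrightarrow> g \<in> poly_bounded \<Longrightarrow> (\<lambda>x. f x * g x) \<in> poly_bounded"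
  unfolding poly_bounded_def
proof safe
  fix m C m' C' assume f: "\<forall>x. cmod (f x) \<le> C * (1 + norm x) ^ m" and g: "\<forall>x. cmod (g x) \<le> C' * (1 + norm x) ^ m'"
  have "norm (f x * g x) \<le> (C * C') * (1 + norm x) ^ (m + m')" for x
  proof -
    have "norm (f x * g x) \<le> (C * (1 + norm x) ^ m) * (C' * (1 + norm x) ^ m')"
      unfolding norm_mult using f g by (intro mult_mono order_trans[OF norm_ge_zero f[rule_format]]) auto
    then show ?thesis by (simp add: power_add mult_ac)
  qed
  then show "\<exists>m C. \<forall>x. cmod (f x * g x) \<le> C * (1 + norm x) ^ m" by blast
qed

lemma rapid_affine:
  assumes "a \<noteq> 0" "f \<in> rapid"
  shows "(\<lambda>x. f (a *\<^sub>R x + b)) \<in> rapid"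
  unfolding rapid_def
proof safe
  fix m obtain C where C: "\<And>x. (1 + norm x) ^ m * cmod (f x) \<le> C" using assms(2) unfolding rapid_def by blast
  \<comment> \<open>Solving y = ax + b for x gives 1 + |x| <= B (1 + |y|) with this
    constant.\<close>
  define B where "B = (1 + inverse \<bar>a\<bar>) * (1 + norm b)"
  have "(1 + norm x) ^ m * cmod (f (a *\<^sub>R x + b)) \<le> B ^ m * C" for x
  proof -
    let ?y = "a *\<^sub>R x + b"
    have "x = inverse a *\<^sub>R (?y - b)" using assms(1) by simp
    then have "norm x = inverse \<bar>a\<bar> * norm (?y - b)" by (metis norm_scaleR abs_inverse)
    also have "\<dots> \<le> inverse \<bar>a\<bar> * (norm ?y + norm b)"
      by (intro mult_left_mono norm_triangle_ineq4) auto
    finally have x: "norm x \<le> inverse \<bar>a\<bar> * (norm ?y + norm b)" .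
    have "1 + norm x \<le> (1 + inverse \<bar>a\<bar>) * ((1 + norm b) * (1 + norm ?y))"
    proof -
      have "1 + norm x \<le> 1 * 1 + inverse \<bar>a\<bar> * (norm ?y + norm b)" using x by simp
      also have "\<dots> \<le> 1 * ((1 + norm b) * (1 + norm ?y)) + inverse \<bar>a\<bar> * ((1 + norm b) * (1 + norm ?y))"
        by (intro add_mono mult_left_mono) (auto simp: algebra_simps)
      finally show ?thesis by (simp only: distrib_right)
    qed
    then have "1 + norm x \<le> B * (1 + norm ?y)" by (simp add: B_def mult_ac)
    then have "(1 + norm x) ^ m \<le> (B * (1 + norm ?y)) ^ m" by (intro power_mono) auto
    then have "(1 + norm x) ^ m * cmod (f ?y) \<le> (B * (1 + norm ?y)) ^ m * cmod (f ?y)"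
      by (intro mult_right_mono) auto
    also have "\<dots> = B ^ m * ((1 + norm ?y) ^ m * cmod (f ?y))" by (simp add: power_mult_distrib)
    also have "\<dots> \<le> B ^ m * C" using C by (intro mult_left_mono zero_le_power) (auto simp: B_def)
    finally show ?thesis .
  qed
  then show "\<exists>C. \<forall>x. (1 + norm x) ^ m * cmod (f (a *\<^sub>R x + b)) \<le> C" by blast
qed

lemma schwartz_add: "f \<in> schwartz \<Longrightarrow> g \<in> schwartz \<Longrightarrow> (\<lambda>x. f x + g x) \<in> schwartz"
  unfolding schwartz_iff using diff_class_add[OF rapid_add] by blast

lemma schwartz_mult_slow: "f \<in> slow \<Longrightarrow> g \<in> schwartz \<Longrightarrow> (\<lambda>x. f x * g x) \<in> schwartz"
  unfolding schwartz_iff slow_def using diff_class_mult[OF rapid_add rapid_mult] by blast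

lemma slow_mult: "f \<in> slow \<Longrightarrow> g \<in> slow \<Longrightarrow> (\<lambda>x. f x * g x) \<in> slow"
  unfolding slow_def using diff_class_mult[OF poly_bounded_add poly_bounded_mult] by blast

lemma schwartz_subset_slow: "schwartz \<subseteq> slow"
  unfolding schwartz_iff slow_def subset_iff using diff_class_mono[OF _ rapid_subset_poly_bounded] by blast

lemma slow_const: "(\<lambda>_. c) \<in> slow"
  unfolding slow_def using diff_class_const[OF poly_bounded_const] by blast

lemma schwartz_mult: "f \<in> schwartz \<Longrightarrow> g \<in> schwartz \<Longrightarrow> (\<lambda>x. f x * g x) \<in> schwartz"
  using schwartz_mult_slow schwartz_subset_slow by blast

lemma schwartz_cmult: "f \<in> schwartz \<Longrightarrow> (\<lambda>x. c * f x) \<in> schwartz"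
  using schwartz_mult_slow[OF slow_const] .

lemma schwartz_diff: "f \<in> schwartz \<Longrightarrow> g \<in> schwartz \<Longrightarrow> (\<lambda>x. f x - g x) \<in> schwartz"
  using schwartz_add[OF _ schwartz_cmult[of g "-1"]] by simp

lemma schwartz_cnj: "f \<in> schwartz \<Longrightarrow> (\<lambda>x. cnj (f x)) \<in> schwartz"
  unfolding schwartz_iff using diff_class_cnj[of rapid] by (auto simp: rapid_def)

lemma schwartz_affine: "a \<noteq> 0 \<Longrightarrow> f \<in> schwartz \<Longrightarrow> (\<lambda>x. f (a *\<^sub>R x + b)) \<in> schwartz"
  unfolding schwartz_iff using diff_class_affine[OF rapid_affine rapid_cmult] by blast

lemma schwartz_partial: "f \<in> schwartz \<Longrightarrow> partial i f \<in> schwartz"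
  unfolding schwartz_iff by (metis diff_class.simps(2))

lemma schwartz_rapid: "f \<in> schwartz \<Longrightarrow> f \<in> rapid"
  unfolding schwartz_iff using diff_classD(1) by blast

lemma schwartz_differentiable: "f \<in> schwartz \<Longrightarrow> f differentiable at x"
  unfolding schwartz_iff using diff_classD(2) by blast

lemma schwartz_continuous: "f \<in> schwartz \<Longrightarrow> continuous_on A f"
  by (meson continuous_at_imp_continuous_on differentiable_imp_continuous_within schwartz_differentiable)

lemma schwartz_borel: "f \<in> schwartz \<Longrightarrow> f \<in> borel_measurable borel"
  using borel_measurable_continuous_onI schwartz_continuous by blast

section \<open>Coordinates, characters and radial cutoffs\<close>

lemma slow_coordinate: "(\<lambda>x. complex_of_real (x $ i)) \<in> slow"
proof -
  have *: "((\<lambda>x. complex_of_real (x $ i)) has_derivative (\<lambda>h. complex_of_real (h $ i))) (at x)" for x :: R3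
    by (intro has_derivative_of_real bounded_linear.has_derivative[OF bounded_linear_vec_nth] has_derivative_ident)
  have p: "partial j (\<lambda>x. complex_of_real (x $ i)) = (\<lambda>x. complex_of_real (axis j 1 $ i))" for j
    by (rule ext, subst partial_eq[OF *]) simp
  have "norm (complex_of_real (x $ i)) \<le> 1 * (1 + norm x) ^ 1" for x :: R3
    using component_le_norm_cart[of x i] by simp
  then have "(\<lambda>x. complex_of_real (x $ i)) \<in> poly_bounded" unfolding poly_bounded_def by blast
  then have "diff_class poly_bounded n (\<lambda>x. complex_of_real (x $ i))" for n
    using * diff_class_const[OF poly_bounded_const] by (cases n) (auto simp: p intro: differentiableI)
  then show ?thesis by (simp add: slow_def)
qed

lemma exp_inner_has_derivative:
  "((\<lambda>x::R3. exp (- \<i> * of_real (x \<bullet> \<xi>))) has_derivative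
     (\<lambda>h. - \<i> * of_real (h \<bullet> \<xi>) * exp (- \<i> * of_real (x \<bullet> \<xi>)))) (at x)"
proof -
  have 1: "((\<lambda>x::R3. - \<i> * of_real (x \<bullet> \<xi>)) has_derivative (\<lambda>h. - \<i> * of_real (h \<bullet> \<xi>))) (at x)"
    by (auto intro!: derivative_eq_intros)
  have 2: "(exp has_derivative (*) (exp (- \<i> * of_real (x \<bullet> \<xi>)))) (at (- \<i> * of_real (x \<bullet> \<xi>)))"
    using DERIV_exp by (simp add: has_field_derivative_def)
  show ?thesis using has_derivative_compose[OF 1 2] by (simp add: mult.commute)
qed

lemma slow_exp: "(\<lambda>x. exp (- \<i> * of_real (x \<bullet> \<xi>))) \<in> slow"
proof -
  let ?e = "\<lambda>x::R3. exp (- \<i> * of_real (x \<bullet> \<xi>))"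
  note * = exp_inner_has_derivative[of \<xi>]
  have p: "partial j ?e = (\<lambda>x. (- \<i> * of_real (\<xi> $ j)) * ?e x)" for j
    by (rule ext, subst partial_eq[OF *]) (simp add: inner_axis')
  have "norm (?e x) \<le> 1 * (1 + norm x) ^ 0" for x by simp
  then have "?e \<in> poly_bounded" unfolding poly_bounded_def by blast
  then have "diff_class poly_bounded n ?e" for n
  proof (induction n)
    case 0
    then show ?case using * by (auto intro: differentiableI)
  next
    case (Suc n)
    have "diff_class poly_bounded n (\<lambda>x. (- \<i> * of_real (\<xi> $ j)) * ?e x)" for j
      using Suc by (intro diff_class_cmult poly_bounded_mult poly_bounded_const) auto
    then show ?case using * Suc unfolding diff_class.simps p by (auto intro: differentiableI)
  qed
  then show ?thesis by (simp add: slow_def)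
qed

text \<open>Since t lies inside the half line, the one-sided derivative is two-sided and can be
  compared with that of the zero function. By induction all derivatives of a cutoff profile vanish
  beyond 1.\<close>

lemma vector_derivative_within_half_line_zero:
  fixes f :: "real \<Rightarrow> complex"
  assumes "(f has_vector_derivative d) (at t within {0..})" "\<And>s. 1 < s \<Longrightarrow> f s = 0" "1 < t"
  shows "d = 0"
proof -
  have "(f has_vector_derivative d) (at t)"
    using assms(1,3) at_within_interior[of t "{0..}"] by (simp add: interior_real_atLeast)
  moreover have "(f has_vector_derivative 0) (at t)"
    by (rule has_vector_derivative_transform_within_open[of "\<lambda>_. 0" _ _ "{1<..}"]) (use assms in auto)
  ultimately show ?thesis by (rule vector_derivative_unique_at)
qed

text \<open>A derivative of the radial function with profile \<open>D k\<close> is a linear factor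
  times the radial function with profile \<open>D (Suc k)\<close>, so the induction runs over all
  profiles at once.\<close>

lemma schwartz_radial:
  assumes h: "smooth_half_line h" and h0: "\<And>t. 1 < t \<Longrightarrow> h t = 0" and a: "0 < a"
  shows "(\<lambda>\<xi>. h (a * (norm \<xi>)\<^sup>2)) \<in> schwartz"
proof -
  obtain D where D0: "D 0 = h"
    and D: "\<And>n t. 0 \<le> t \<Longrightarrow> (D n has_vector_derivative D (Suc n) t) (at t within {0..})"
    using h unfolding smooth_half_line_def by blast
  let ?R = "\<lambda>k x::R3. D k (a * (norm x)\<^sup>2)"
  have van: "D k t = 0" if "1 < t" for k t
    using that
  proof (induction k arbitrary: t)
    case 0
    then show ?case using D0 h0 by simp
  next
    case (Suc k)
    then show ?case using vector_derivative_within_half_line_zero[OF D] by (meson le_less order_less_trans zero_less_one)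
  qed
  have der: "(?R k has_derivative (\<lambda>v. (a * (2 * (x \<bullet> v))) *\<^sub>R ?R (Suc k) x)) (at x)" for k x
  proof -
    have 1: "((\<lambda>x. a * (norm x)\<^sup>2) has_derivative (\<lambda>v. a * (2 * (x \<bullet> v)))) (at x)"
      unfolding power2_norm_eq_inner by (auto intro!: derivative_eq_intros simp: inner_commute)
    have "(D k has_derivative (\<lambda>s. s *\<^sub>R D (Suc k) (a * (norm x)\<^sup>2))) (at (a * (norm x)\<^sup>2) within {0..})"
      using D[of "a * (norm x)\<^sup>2" k] a by (simp add: has_vector_derivative_def)
    \<comment> \<open>As a|x|^2 takes values in the half line, the one-sided derivative of the
      profile is enough, even at the origin.\<close>
    then have 2: "(D k has_derivative (\<lambda>s. s *\<^sub>R D (Suc k) (a * (norm x)\<^sup>2)))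
        (at (a * (norm x)\<^sup>2) within (\<lambda>x. a * (norm x)\<^sup>2) ` UNIV)"
      by (rule has_derivative_subset) (use a in auto)
    show ?thesis
      using has_derivative_in_compose[OF 1 2] by simp
  qed
  have p: "partial i (?R k) = (\<lambda>x. (of_real (2 * a) * of_real (x $ i)) * ?R (Suc k) x)" for i k
    by (rule ext, subst partial_eq[OF der]) (simp add: inner_axis scaleR_conv_of_real mult_ac)
  have rap: "?R k \<in> rapid" for k
    unfolding rapid_def
  proof safe
    fix m
    have "continuous_on {0..} (D k)"
      using D by (intro continuous_on_vector_derivative) auto
    then have "continuous_on {0..1} (D k)" by (rule continuous_on_subset) auto
    then have "bounded (D k ` {0..1})" by (intro compact_imp_bounded compact_continuous_image) auto
    then obtain B where "\<forall>y\<in>D k ` {0..1}. norm y \<le> B" unfolding bounded_iff by blast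
    then have B: "\<And>t. t \<in> {0..1} \<Longrightarrow> norm (D k t) \<le> B" by blast
    then have B0: "0 \<le> B" using norm_ge_zero order_trans by (metis atLeastAtMost_iff order_refl zero_le_one)
    define r where "r = sqrt (1 / a)"
    have "(1 + norm x) ^ m * cmod (?R k x) \<le> (1 + r) ^ m * B" for x
    proof (cases "a * (norm x)\<^sup>2 \<le> 1")
      case True
      then have "(norm x)\<^sup>2 \<le> 1 / a" using a by (simp add: field_simps)
      then have "norm x \<le> r" unfolding r_def by (rule real_le_rsqrt)
      moreover have "0 \<le> r" using a by (simp add: r_def)
      ultimately show ?thesis using True a by (intro mult_mono power_mono B) auto
    next
      case False
      then show ?thesis using van a B0 by (auto simp: r_def)
    qed
    then show "\<exists>C. \<forall>x. (1 + norm x) ^ m * cmod (?R k x) \<le> C" by blast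
  qed
  have "diff_class rapid n (?R k)" for n k
  proof (induction n arbitrary: k)
    case 0
    then show ?case using rap der by (auto intro: differentiableI)
  next
    case (Suc n)
    have sl: "(\<lambda>x. of_real (2 * a) * complex_of_real (x $ i)) \<in> slow" for i
      by (rule slow_mult[OF slow_const slow_coordinate])
    have "diff_class rapid n (\<lambda>x. (of_real (2 * a) * of_real (x $ i)) * ?R (Suc k) x)" for i
      by (rule diff_class_mult[OF rapid_add rapid_mult _ Suc]) (use sl[of i] in \<open>auto simp: slow_def\<close>)
    then show ?case using rap differentiableI[OF der] unfolding diff_class.simps p by blast
  qed
  from this[of _ 0] show ?thesis by (simp add: schwartz_iff D0)
qed

section \<open>Decay and integrability\<close>

text \<open>The exponent exceeds the dimension 3 by 2, so that summation over unit shells leaves the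
  convergent series of 1/n^2. In this form the weight also satisfies the shift inequality
  \<open>decay_mult_le\<close>.\<close>

definition decay :: "R3 \<Rightarrow> real" where
  "decay x = 1 / (1 + norm x) ^ 5"

lemma decay_pos [simp]: "0 < decay x" "0 \<le> decay x"
  by (auto simp: decay_def)

lemma decay_le_1: "decay x \<le> 1"
  by (simp add: decay_def one_le_power)

lemma continuous_decay: "continuous_on A decay"
  unfolding decay_def by (intro continuous_intros) auto

lemma borel_measurable_decay [measurable]: "decay \<in> borel_measurable borel"
  using continuous_decay by (rule borel_measurable_continuous_onI)

text \<open>From 1 + |x| <= (1 + |y|)(1 + |x - y|). It trades one factor of decay for a shift, which
  makes Fubini's theorem applicable to convolutions of functions that are integrable only against
  the weight.\<close>

lemma decay_mult_le: "decay y * decay (x - y) \<le> decay x"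
proof -
  have "1 + norm x \<le> (1 + norm y) * (1 + norm (x - y))"
    using norm_triangle_sub[of x y] mult_nonneg_nonneg[OF norm_ge_zero[of y] norm_ge_zero[of "x - y"]]
    by (simp only: distrib_left distrib_right mult_1_left mult_1_right)
  then have "(1 + norm x) ^ 5 \<le> ((1 + norm y) * (1 + norm (x - y))) ^ 5" by (intro power_mono) auto
  then show ?thesis
    unfolding decay_def by (simp add: power_mult_distrib[symmetric] frac_le)
qed

text \<open>On the n-th shell the weight is at most (1 + n)^(-5), and the ball of radius n + 1 has
  volume proportional to (n + 1)^3.\<close>

lemma integrable_decay: "integrable lborel decay"
proof (rule integrableI_nonneg)
  define v where "v = unit_ball_vol (real DIM(R3))"
  have "ennreal (decay x) \<le> (\<Sum>n. ennreal (1 / (1 + real n) ^ 5) * indicator (ball 0 (real n + 1)) x)" for x :: R3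
  proof -
    define n where "n = nat \<lfloor>norm x\<rfloor>"
    have "real n = of_int \<lfloor>norm x\<rfloor>" by (simp add: n_def)
    then have n: "real n \<le> norm x" "norm x < real n + 1" by linarith+
    define g :: "nat \<Rightarrow> ennreal" where "g k = ennreal (1 / (1 + real k) ^ 5) * indicator (ball 0 (real k + 1)) x" for k
    have "ennreal (decay x) \<le> g n"
      using n unfolding decay_def g_def by (auto intro!: ennreal_leI frac_le power_mono)
    also have "\<dots> \<le> (\<Sum>n. g n)"
      using sum_le_suminf[of g "{n}"] by simp
    finally show ?thesis by (simp add: g_def)
  qed
  then have "(\<integral>\<^sup>+x. decay x \<partial>lborel) \<le> (\<integral>\<^sup>+x. (\<Sum>n. ennreal (1 / (1 + real n) ^ 5) * indicator (ball 0 (real n + 1)) x) \<partial>(lborel :: R3 measure))"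
    by (intro nn_integral_mono) auto
  also have "\<dots> = (\<Sum>n. ennreal (1 / (1 + real n) ^ 5) * emeasure lborel (ball (0::R3) (real n + 1)))"
    by (subst nn_integral_suminf)
      (auto simp: nn_integral_cmult_indicator intro!: borel_measurable_times_ennreal borel_measurable_indicator)
  also have "\<dots> = (\<Sum>n. ennreal (v / (1 + real n) ^ 2))"
  proof (intro suminf_cong)
    fix n
    have "1 / (1 + real n) ^ 5 * (v * (real n + 1) ^ 3) = v / (1 + real n) ^ 2"
      by (simp add: divide_simps add.commute)
    then show "ennreal (1 / (1 + real n) ^ 5) * emeasure lborel (ball (0::R3) (real n + 1)) = ennreal (v / (1 + real n) ^ 2)"
      by (simp add: emeasure_ball v_def ennreal_mult[symmetric] unit_ball_vol_nonneg)
  qed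
  also have "\<dots> < \<infinity>"
  proof -
    have "summable (\<lambda>n. v * (inverse (real (Suc n) ^ 2)))"
      using inverse_power_summable[of 2, where 'a=real]
      by (intro summable_mult summable_Suc_iff[THEN iffD2, of "\<lambda>n. inverse (real n ^ 2)"]) simp
    then have s: "summable (\<lambda>n. v / (1 + real n) ^ 2)" by (simp add: divide_inverse add.commute)
    have "(\<Sum>n. ennreal (v / (1 + real n) ^ 2)) = ennreal (\<Sum>n. v / (1 + real n) ^ 2)"
      by (intro suminf_ennreal2 s) (simp add: v_def)
    then show ?thesis by simp
  qed
  finally show "(\<integral>\<^sup>+x. decay x \<partial>lborel) < \<infinity>" .
qed auto

lemma integrable_decay_bound:
  fixes f :: "R3 \<Rightarrow> 'b :: {banach, second_countable_topology}"
  assumes [measurable]: "f \<in> borel_measurable borel" and "\<And>x. norm (f x) \<le> C * decay x"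
  shows "integrable lborel f"
  by (rule Bochner_Integration.integrable_bound[of _ "\<lambda>x. C * decay x"])
     (use assms integrable_decay in \<open>auto intro!: AE_I2 order_trans[OF assms(2)]\<close>)

lemma rapid_decay:
  assumes "f \<in> rapid"
  obtains C where "0 \<le> C" "\<And>x. norm (f x) \<le> C * decay x ^ n"
proof -
  obtain C where C: "\<And>x. (1 + norm x) ^ (5 * n) * norm (f x) \<le> C" using assms unfolding rapid_def by blast
  have "0 \<le> C" using C[of 0] order_trans[OF norm_ge_zero] by simp
  moreover have "norm (f x) \<le> C * decay x ^ n" for x
  proof -
    have "decay x ^ n = 1 / (1 + norm x) ^ (5 * n)" by (simp add: decay_def power_divide power_mult)
    then show ?thesis using C[of x] by (simp add: pos_le_divide_eq mult.commute[of "norm (f x)"])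
  qed
  ultimately show ?thesis using that by blast
qed

lemma rapid_decay1:
  assumes "f \<in> rapid"
  obtains C where "0 \<le> C" "\<And>x. norm (f x) \<le> C * decay x"
  using rapid_decay[OF assms, where n=1] by auto

lemma rapid_integrable:
  assumes "f \<in> rapid" "f \<in> borel_measurable borel"
  shows "integrable lborel f"
  using rapid_decay1[OF assms(1)] integrable_decay_bound[OF assms(2)] by metis

lemma norm_integral_le:
  fixes f :: "'a \<Rightarrow> 'b :: {banach, second_countable_topology}"
  assumes "integrable M f" "integrable M g" "\<And>x. norm (f x) \<le> g x"
  shows "norm (integral\<^sup>L M f) \<le> integral\<^sup>L M g"
  using assms by (intro integral_norm_bound[THEN order_trans] integral_mono) auto

lemma schwartz_integrable: "f \<in> schwartz \<Longrightarrow> integrable lborel f"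
  by (intro rapid_integrable schwartz_rapid schwartz_borel)

text \<open>Only finitely many index lists have length at most m, so the set under the real supremum
  is bounded; otherwise \<open>SUP\<close> would carry no information.\<close>

lemma schwartz_norm_bound:
  assumes f: "f \<in> schwartz" and "length is \<le> m"
  shows "(1 + norm x) ^ m * norm (partials is f x) \<le> schwartz_norm m f"
proof -
  obtain C where C: "\<And>js x. (1 + norm x) ^ m * norm (partials js f x) \<le> C js"
    using f unfolding schwartz_def by (auto; metis)
  have fin: "finite {js :: 3 list. length js \<le> m}" using finite_lists_length_le[of "UNIV :: 3 set" m] by simp
  have "bdd_above ((\<lambda>(js, x). (1 + norm x) ^ m * norm (partials js f x)) ` ({js. length js \<le> m} \<times> UNIV))"
  proof (rule bdd_aboveI)
    fix y assume "y \<in> (\<lambda>(js, x). (1 + norm x) ^ m * norm (partials js f x)) ` ({js. length js \<le> m} \<times> UNIV)"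
    then obtain js x where js: "length js \<le> m" "y = (1 + norm x) ^ m * norm (partials js f x)" by auto
    then have "y \<le> C js" using C by simp
    also have "C js \<le> Max (C ` {js. length js \<le> m})" using fin js by (intro Max_ge) auto
    finally show "y \<le> Max (C ` {js. length js \<le> m})" .
  qed
  then show ?thesis
    unfolding schwartz_norm_def using assms(2) by (intro cSUP_upper2[where x="(is, x)"]) auto
qed

lemma schwartz_norm_nonneg: "f \<in> schwartz \<Longrightarrow> 0 \<le> schwartz_norm m f"
  using schwartz_norm_bound[of f "[]" m 0] order_trans[OF norm_ge_zero[of "f 0"]] by simp

lemma schwartz_norm_decay:
  assumes "f \<in> schwartz"
  shows "norm (f x) \<le> schwartz_norm 5 f * decay x"
  using schwartz_norm_bound[OF assms, of "[]" 5 x] by (simp add: decay_def pos_le_divide_eq mult.commute)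

section \<open>The Fourier transform of Schwartz functions\<close>

lemma rapid_coordinate_mult: "f \<in> rapid \<Longrightarrow> (\<lambda>x. - \<i> * of_real (x $ i) * f x) \<in> rapid"
  by (rule rapid_mult[OF _ ])
     (use slow_mult[OF slow_const slow_coordinate, of "- \<i>" i] in
       \<open>auto simp: slow_def dest: diff_classD(1)\<close>)

lemma schwartz_coordinate_mult: "f \<in> schwartz \<Longrightarrow> (\<lambda>x. - \<i> * of_real (x $ i) * f x) \<in> schwartz"
  by (rule schwartz_mult_slow[OF slow_mult[OF slow_const slow_coordinate]])

lemma fourier_lborel:
  "f \<in> borel_measurable borel \<Longrightarrow> fourier f \<xi> = (LINT x|lborel. exp (- \<i> * of_real (x \<bullet> \<xi>)) * f x)"
  unfolding fourier_def by (intro integral_completion) measurable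

lemma inv_fourier_eq: "inv_fourier f x = of_real (1 / (2 * pi) ^ 3) * fourier f (- x)"
  unfolding inv_fourier_def fourier_def by (simp add: inner_commute)

lemma norm_exp_ii_le: "norm (exp (- \<i> * of_real t) - 1 - (- \<i> * of_real t)) \<le> t\<^sup>2"
proof -
  have "norm (exp (- \<i> * of_real t) - (\<Sum>k\<le>1. (- \<i> * of_real t) ^ k / fact k)) \<le>
      exp \<bar>Re (- \<i> * of_real t)\<bar> * (norm (- \<i> * of_real t) ^ Suc 1) / fact 1"
    by (rule Taylor_exp)
  then show ?thesis by (simp add: norm_mult power2_eq_square algebra_simps)
qed

lemma has_derivative_quadratic:
  fixes f :: "'a::real_normed_vector \<Rightarrow> 'b::real_normed_vector"
  assumes "bounded_linear L" "\<And>y. norm (f y - f x - L (y - x)) \<le> C * (norm (y - x))\<^sup>2"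
  shows "(f has_derivative L) (at x)"
proof (rule has_derivativeI_sandwich[where e=1 and H="\<lambda>y. C * norm (y - x)"])
  show "((\<lambda>y. C * norm (y - x)) \<longlongrightarrow> 0) (at x)"
    by (rule tendsto_eq_intros refl)+ simp
next
  fix y assume "y \<noteq> x"
  then show "norm (f y - f x - L (y - x)) / norm (y - x) \<le> C * norm (y - x)"
    using assms(2)[of y] by (simp add: power2_eq_square divide_le_eq mult.assoc)
qed (use assms in auto)

text \<open>By the second-order remainder of the exponential the error is at most |h|^2 times the
  integral of |x|^2 |f(x)|. This explicit error replaces a passage to the limit under the
  integral.\<close>

lemma fourier_has_derivative:
  assumes f: "f \<in> rapid" and [measurable]: "f \<in> borel_measurable borel"
  shows "(fourier f has_derivative
     (\<lambda>h. LINT x|lborel. - \<i> * of_real (x \<bullet> h) * (exp (- \<i> * of_real (x \<bullet> \<xi>)) * f x))) (at \<xi>)"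
proof -
  let ?e = "\<lambda>\<xi> x::R3. exp (- \<i> * of_real (x \<bullet> \<xi>))"
  \<comment> \<open>One factor of \<open>decay\<close> absorbs |x| or |x|^2; the other one remains
    as the integrable majorant.\<close>
  obtain C where C: "0 \<le> C" "\<And>x. norm (f x) \<le> C * decay x ^ 2" using rapid_decay[OF f] by metis
  have n: "norm x * decay x \<le> 1" "(norm x)\<^sup>2 * decay x \<le> 1" for x :: R3
  proof -
    have "norm x \<le> (1 + norm x) ^ 5" using self_le_power[of "1 + norm x" 5] by simp
    then show "norm x * decay x \<le> 1" by (simp add: decay_def)
    have "(norm x)\<^sup>2 \<le> (1 + norm x) ^ 2" by (intro power_mono) auto
    also have "\<dots> \<le> (1 + norm x) ^ 5" by (intro power_increasing) auto
    finally show "(norm x)\<^sup>2 * decay x \<le> 1" by (simp add: decay_def)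
  qed
  have f1: "norm x * norm (f x) \<le> C * decay x" for x
  proof -
    have "norm x * norm (f x) \<le> norm x * (C * decay x ^ 2)" using C by (intro mult_left_mono) auto
    also have "\<dots> = C * decay x * (norm x * decay x)" by (simp add: power2_eq_square)
    also have "\<dots> \<le> C * decay x * 1" using C n by (intro mult_left_mono) auto
    finally show ?thesis by simp
  qed
  have f2: "(norm x)\<^sup>2 * norm (f x) \<le> C * decay x" for x
  proof -
    have "(norm x)\<^sup>2 * norm (f x) \<le> (norm x)\<^sup>2 * (C * decay x ^ 2)" using C by (intro mult_left_mono) auto
    also have "\<dots> = C * decay x * ((norm x)\<^sup>2 * decay x)" by (simp add: power2_eq_square)
    also have "\<dots> \<le> C * decay x * 1" using C n by (intro mult_left_mono) auto
    finally show ?thesis by simp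
  qed
  have i0: "integrable lborel (\<lambda>x. ?e \<xi> x * f x)" for \<xi>
    by (rule Bochner_Integration.integrable_bound[OF rapid_integrable[OF f]]) (auto simp: norm_mult)
  have b1: "norm (- \<i> * of_real (x \<bullet> h) * (?e \<xi> x * f x)) \<le> norm h * C * decay x" for x h
  proof -
    have "norm (- \<i> * of_real (x \<bullet> h) * (?e \<xi> x * f x)) = \<bar>x \<bullet> h\<bar> * norm (f x)" by (simp add: norm_mult)
    also have "\<dots> \<le> norm x * norm h * norm (f x)" by (intro mult_right_mono Cauchy_Schwarz_ineq2) auto
    also have "\<dots> = norm h * (norm x * norm (f x))" by simp
    also have "\<dots> \<le> norm h * (C * decay x)" by (intro mult_left_mono f1) auto
    finally show ?thesis by (simp add: mult.assoc)
  qed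
  have i1: "integrable lborel (\<lambda>x. - \<i> * of_real (x \<bullet> h) * (?e \<xi> x * f x))" for h
    by (rule integrable_decay_bound[OF _ b1]) measurable
  let ?L = "\<lambda>h. LINT x|lborel. - \<i> * of_real (x \<bullet> h) * (?e \<xi> x * f x)"
  have bl: "bounded_linear ?L"
  proof (rule bounded_linear_intro[where K="C * (LINT x|lborel. decay x)"])
    show "?L (h + k) = ?L h + ?L k" for h k
      by (subst Bochner_Integration.integral_add[OF i1 i1, symmetric]) (simp add: inner_add_right ring_distribs)
    show "?L (r *\<^sub>R h) = r *\<^sub>R ?L h" for r h
    proof -
      have "- \<i> * of_real (x \<bullet> (r *\<^sub>R h)) * (?e \<xi> x * f x) = r *\<^sub>R (- \<i> * of_real (x \<bullet> h) * (?e \<xi> x * f x))" for x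
        unfolding inner_scaleR_right of_real_mult scaleR_conv_of_real[where 'a=complex] by (simp only: mult_ac)
      then show ?thesis by (simp only: integral_scaleR_right)
    qed
    show "norm (?L h) \<le> norm h * (C * (LINT x|lborel. decay x))" for h
    proof -
      have "norm (?L h) \<le> (LINT x|lborel. norm h * C * decay x)"
        by (rule norm_integral_le[OF i1 _ b1]) (intro integrable_mult_right integrable_decay)
      then show ?thesis by (simp add: mult.assoc)
    qed
  qed
  show ?thesis
  proof (rule has_derivative_quadratic[OF bl, where C="C * (LINT x|lborel. decay x)"])
    fix \<zeta>
    define h where "h = \<zeta> - \<xi>"
    have "fourier f \<zeta> - fourier f \<xi> - ?L (\<zeta> - \<xi>) =
      (LINT x|lborel. ?e \<zeta> x * f x - ?e \<xi> x * f x - (- \<i> * of_real (x \<bullet> h) * (?e \<xi> x * f x)))"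
      unfolding h_def[symmetric] using i0 i1[of h] by (simp add: fourier_lborel)
    also have "norm \<dots> \<le> (LINT x|lborel. (norm h)\<^sup>2 * C * decay x)"
    proof (rule norm_integral_le)
      fix x
      have "?e \<zeta> x = ?e \<xi> x * ?e h x"
        by (simp add: h_def exp_add[symmetric] inner_diff_right algebra_simps)
      then have "?e \<zeta> x * f x - ?e \<xi> x * f x - (- \<i> * of_real (x \<bullet> h) * (?e \<xi> x * f x)) =
         ?e \<xi> x * f x * (?e h x - 1 - (- \<i> * of_real (x \<bullet> h)))"
        by (simp add: algebra_simps)
      then have "norm (?e \<zeta> x * f x - ?e \<xi> x * f x - (- \<i> * of_real (x \<bullet> h) * (?e \<xi> x * f x))) =
         norm (f x) * norm (?e h x - 1 - (- \<i> * of_real (x \<bullet> h)))" by (simp add: norm_mult)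
      also have "\<dots> \<le> norm (f x) * (x \<bullet> h)\<^sup>2" by (intro mult_left_mono norm_exp_ii_le) auto
      also have "\<dots> \<le> norm (f x) * (norm x * norm h)\<^sup>2"
        using Cauchy_Schwarz_ineq2[of x h] by (intro mult_left_mono power2_le_iff_abs_le[THEN iffD2]) auto
      also have "\<dots> = (norm h)\<^sup>2 * ((norm x)\<^sup>2 * norm (f x))" by (simp add: power_mult_distrib)
      also have "\<dots> \<le> (norm h)\<^sup>2 * (C * decay x)" by (intro mult_left_mono f2) auto
      finally show "norm (?e \<zeta> x * f x - ?e \<xi> x * f x - (- \<i> * of_real (x \<bullet> h) * (?e \<xi> x * f x)))
         \<le> (norm h)\<^sup>2 * C * decay x" by (simp add: mult.assoc)
    qed (use i0 i1[of h] integrable_decay in auto)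
    finally show "norm (fourier f \<zeta> - fourier f \<xi> - ?L (\<zeta> - \<xi>)) \<le> C * (LINT x|lborel. decay x) * (norm (\<zeta> - \<xi>))\<^sup>2"
      by (simp add: h_def mult_ac)
  qed
qed

lemma fourier_differentiable:
  "f \<in> rapid \<Longrightarrow> f \<in> borel_measurable borel \<Longrightarrow> fourier f differentiable at \<xi>"
  using fourier_has_derivative differentiableI by blast

lemma partial_fourier:
  assumes f: "f \<in> rapid" and [measurable]: "f \<in> borel_measurable borel"
  shows "partial i (fourier f) = fourier (\<lambda>x. - \<i> * of_real (x $ i) * f x)"
  by (rule ext, subst partial_eq[OF fourier_has_derivative[OF assms]])
     (simp add: fourier_lborel inner_axis mult_ac)

lemma norm_fourier_le:
  assumes [measurable]: "f \<in> borel_measurable borel"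
  shows "norm (fourier f \<xi>) \<le> (LINT x|lborel. norm (f x))"
  unfolding fourier_lborel[OF assms] by (rule order_trans[OF integral_norm_bound]) (simp add: norm_mult)

lemma fourier_slow:
  assumes "f \<in> rapid" "f \<in> borel_measurable borel"
  shows "fourier f \<in> slow"
proof -
  have pb: "fourier f \<in> poly_bounded" if "f \<in> borel_measurable borel" for f
  proof -
    have "\<forall>x. norm (fourier f x) \<le> (LINT x|lborel. norm (f x)) * (1 + norm x) ^ 0"
      using norm_fourier_le[OF that] by simp
    then show ?thesis unfolding poly_bounded_def by blast
  qed
  have "diff_class poly_bounded n (fourier f)" for n
    using assms
  proof (induction n arbitrary: f)
    case (0 f)
    then show ?case using pb fourier_differentiable by simp
  next
    case (Suc n f)
    have [measurable]: "f \<in> borel_measurable borel" by fact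
    have "diff_class poly_bounded n (partial i (fourier f))" for i
      unfolding partial_fourier[OF Suc(2,3)]
      by (rule Suc.IH[OF rapid_coordinate_mult[OF Suc(2)]]) measurable
    then show ?case using pb fourier_differentiable Suc by simp
  qed
  then show ?thesis by (simp add: slow_def)
qed

lemma integral_lborel_shift:
  fixes f :: "'a::euclidean_space \<Rightarrow> 'b :: {banach, second_countable_topology}"
  assumes [measurable]: "f \<in> borel_measurable borel"
  shows "(LINT x|lborel. f (x + a)) = (LINT x|lborel. f x)"
proof -
  have "(LINT x|lborel. f x) = (LINT x|distr lborel borel ((+) a). f x)" by (simp add: lborel_distr_plus)
  also have "\<dots> = (LINT x|lborel. f (x + a))" by (subst integral_distr) (auto simp: add.commute)
  finally show ?thesis by simp
qed

text \<open>Difference quotients have integral zero by translation invariance, and dominated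
  convergence passes to the derivative. This is the integration by parts behind
  \<open>fourier_partial\<close>.\<close>

lemma integral_partial:
  assumes g: "g \<in> schwartz"
  shows "(LINT x|lborel. partial i g x) = 0"
proof -
  define e :: R3 where "e = axis i 1"
  have ne: "norm e = 1" by (simp add: e_def)
  have [measurable]: "g \<in> borel_measurable borel" "partial i g \<in> borel_measurable borel"
    using g schwartz_partial schwartz_borel by auto
  obtain C where C: "0 \<le> C" "\<And>x. norm (partial i g x) \<le> C * decay x"
    using rapid_decay1[OF schwartz_rapid[OF schwartz_partial[OF g]]] by metis
  have dl: "((\<lambda>t. g (x + t *\<^sub>R e)) has_vector_derivative partial i g (x + t *\<^sub>R e)) (at t within A)" for x t A
  proof -
    let ?D = "frechet_derivative g (at (x + t *\<^sub>R e))"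
    have D: "(g has_derivative ?D) (at (x + t *\<^sub>R e))"
      using schwartz_differentiable[OF g] by (simp add: frechet_derivative_works[symmetric])
    have "((\<lambda>t. g (x + t *\<^sub>R e)) has_derivative (\<lambda>s. ?D (s *\<^sub>R e))) (at t within A)"
      by (rule has_derivative_compose[where f="\<lambda>t. x + t *\<^sub>R e", OF _ D]) (auto intro!: derivative_eq_intros)
    moreover have "?D (s *\<^sub>R e) = s *\<^sub>R partial i g (x + t *\<^sub>R e)" for s
      using linear_scale[OF has_derivative_linear[OF D]] by (simp add: partial_def e_def)
    ultimately show ?thesis by (simp add: has_vector_derivative_def)
  qed
  \<comment> \<open>Mean value theorem; a shift by at most 1 changes 1 + |x| by a factor of at most
    2, which costs 2^5 in \<open>decay\<close>.\<close>
  have bd: "norm (g (x + h *\<^sub>R e) - g x) \<le> C * 2 ^ 5 * decay x * h" if h: "0 \<le> h" "h \<le> 1" for x h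
  proof -
    have "norm (g (x + h *\<^sub>R e) - g (x + 0 *\<^sub>R e)) \<le> (C * 2 ^ 5 * decay x) * norm (h - 0)"
    proof (rule differentiable_bound[of "{0..h}" _ "\<lambda>t s. s *\<^sub>R partial i g (x + t *\<^sub>R e)"])
      fix t assume t: "t \<in> {0..h}"
      show "((\<lambda>t. g (x + t *\<^sub>R e)) has_derivative (\<lambda>s. s *\<^sub>R partial i g (x + t *\<^sub>R e))) (at t within {0..h})"
        using dl by (simp add: has_vector_derivative_def)
      have "1 + norm x \<le> 2 * (1 + norm (x + t *\<^sub>R e))"
        using norm_triangle_ineq4[of "x + t *\<^sub>R e" "t *\<^sub>R e"] t h norm_ge_zero[of "x + t *\<^sub>R e"]
        by (simp add: ne del: norm_ge_zero)
      then have "(1 + norm x) ^ 5 \<le> (2 * (1 + norm (x + t *\<^sub>R e))) ^ 5" by (intro power_mono) auto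
      then have "(1 + norm x) ^ 5 \<le> 2 ^ 5 * (1 + norm (x + t *\<^sub>R e)) ^ 5"
        by (simp only: power_mult_distrib)
      then have d: "decay (x + t *\<^sub>R e) \<le> 2 ^ 5 * decay x"
        unfolding decay_def by (simp add: divide_simps mult_ac)
      have "onorm (\<lambda>s. s *\<^sub>R partial i g (x + t *\<^sub>R e)) \<le> norm (partial i g (x + t *\<^sub>R e))"
        by (rule onorm_le) (simp add: mult.commute)
      also have "\<dots> \<le> C * decay (x + t *\<^sub>R e)" by (rule C)
      also have "\<dots> \<le> C * (2 ^ 5 * decay x)" using d C(1) by (intro mult_left_mono)
      finally show "onorm (\<lambda>s. s *\<^sub>R partial i g (x + t *\<^sub>R e)) \<le> C * 2 ^ 5 * decay x" by (simp only: mult.assoc)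
    qed (use h in auto)
    then show ?thesis using h by simp
  qed
  let ?q = "\<lambda>n x. (g (x + (1 / real (Suc n)) *\<^sub>R e) - g x) / of_real (1 / real (Suc n))"
  have "(\<lambda>n. LINT x|lborel. ?q n x) \<longlonglongrightarrow> (LINT x|lborel. partial i g x)"
  proof (rule integral_dominated_convergence[where w="\<lambda>x. C * 2 ^ 5 * decay x"])
    show "AE x in lborel. (\<lambda>n. ?q n x) \<longlonglongrightarrow> partial i g x"
    proof (rule AE_I2)
      fix x
      have "((\<lambda>t. (g (x + t *\<^sub>R e) - g x) / of_real t) \<longlongrightarrow> partial i g x) (at 0)"
      proof -
        have "((\<lambda>t. norm ((g (x + t *\<^sub>R e) - g x) - t *\<^sub>R partial i g x) / \<bar>t\<bar>) \<longlongrightarrow> 0) (at 0)"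
          using dl[of x 0 UNIV] by (simp add: has_vector_derivative_def has_derivative_iff_norm)
        then have "((\<lambda>t. norm ((g (x + t *\<^sub>R e) - g x) / of_real t - partial i g x)) \<longlongrightarrow> 0) (at 0)"
        proof (rule Lim_transform_eventually)
          have "norm (u - t *\<^sub>R v) / \<bar>t\<bar> = norm (u / of_real t - v)" if "t \<noteq> 0" for t and u v :: complex
          proof -
            have "u / of_real t - v = (u - t *\<^sub>R v) / of_real t"
              using that by (simp add: field_simps scaleR_conv_of_real)
            then show ?thesis by (simp add: norm_divide)
          qed
          then show "\<forall>\<^sub>F t in at 0. norm ((g (x + t *\<^sub>R e) - g x) - t *\<^sub>R partial i g x) / \<bar>t\<bar> =
              norm ((g (x + t *\<^sub>R e) - g x) / of_real t - partial i g x)"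
            by (simp add: eventually_at_filter)
        qed
        then show ?thesis by (simp add: LIM_zero_iff tendsto_norm_zero_iff)
      qed
      moreover have "filterlim (\<lambda>n. 1 / real (Suc n)) (at 0) sequentially"
        unfolding filterlim_at using LIMSEQ_inverse_real_of_nat by (auto simp: divide_inverse)
      ultimately show "(\<lambda>n. ?q n x) \<longlonglongrightarrow> partial i g x" by (rule filterlim_compose)
    qed
    show "AE x in lborel. norm (?q n x) \<le> C * 2 ^ 5 * decay x" for n
    proof (rule AE_I2)
      fix x
      have "norm (g (x + (1 / real (Suc n)) *\<^sub>R e) - g x) \<le> C * 2 ^ 5 * decay x * (1 / real (Suc n))"
        by (rule bd) auto
      then show "norm (?q n x) \<le> C * 2 ^ 5 * decay x"
        unfolding norm_divide norm_of_real by (simp add: field_simps del: of_nat_Suc)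
    qed
  qed (use integrable_decay in auto)
  moreover have "(LINT x|lborel. ?q n x) = 0" for n
  proof -
    have "integrable lborel (\<lambda>x. g (x + a))" for a
      using schwartz_integrable[OF schwartz_affine[of 1 g a]] g by simp
    then have "(LINT x|lborel. g (x + (1 / real (Suc n)) *\<^sub>R e) - g x) =
        (LINT x|lborel. g (x + (1 / real (Suc n)) *\<^sub>R e)) - (LINT x|lborel. g x)"
      using schwartz_integrable[OF g] by (intro Bochner_Integration.integral_diff)
    also have "\<dots> = 0" using integral_lborel_shift[OF \<open>g \<in> borel_measurable borel\<close>] by simp
    finally show ?thesis unfolding integral_divide_zero by simp
  qed
  ultimately have "(\<lambda>n. 0) \<longlonglongrightarrow> (LINT x|lborel. partial i g x)" by (simp only:)
  then show ?thesis by (simp add: LIMSEQ_const_iff)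
qed

lemma fourier_partial:
  assumes f: "f \<in> schwartz"
  shows "of_real (\<xi> $ i) * fourier f \<xi> = - \<i> * fourier (partial i f) \<xi>"
proof -
  let ?e = "\<lambda>x::R3. exp (- \<i> * of_real (x \<bullet> \<xi>))"
  have m: "f \<in> borel_measurable borel" "partial i f \<in> borel_measurable borel"
    using f schwartz_partial schwartz_borel by auto
  note d = exp_inner_has_derivative[of \<xi>]
  have p: "partial i ?e = (\<lambda>x. (- \<i> * of_real (\<xi> $ i)) * ?e x)"
    by (rule ext, subst partial_eq[OF d]) (simp add: inner_axis')
  have ef: "(\<lambda>x. ?e x * f x) \<in> schwartz" "(\<lambda>x. ?e x * partial i f x) \<in> schwartz"
    by (intro schwartz_mult_slow[OF slow_exp] f schwartz_partial)+
  have "partial i (\<lambda>x. ?e x * f x) = (\<lambda>x. ?e x * partial i f x + partial i ?e x * f x)"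
    by (rule partial_mult) (use d schwartz_differentiable[OF f] in \<open>auto intro: differentiableI\<close>)
  then have "0 = (LINT x|lborel. ?e x * partial i f x + (- \<i> * of_real (\<xi> $ i)) * (?e x * f x))"
    using integral_partial[OF ef(1), of i] unfolding p by (simp only: mult.assoc)
  also have "\<dots> = fourier (partial i f) \<xi> + (- \<i> * of_real (\<xi> $ i)) * fourier f \<xi>"
    unfolding fourier_lborel[OF m(1)] fourier_lborel[OF m(2)]
    using schwartz_integrable[OF ef(1)] schwartz_integrable[OF ef(2)] by simp
  finally have "\<i> * of_real (\<xi> $ i) * fourier f \<xi> = fourier (partial i f) \<xi>" by (simp add: algebra_simps)
  then have "\<i> * (\<i> * of_real (\<xi> $ i) * fourier f \<xi>) = \<i> * fourier (partial i f) \<xi>" by simp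
  then show ?thesis by (simp add: algebra_simps) (metis minus_equation_iff)
qed

text \<open>Each further factor |\<xi>| is bounded by the sum of the coordinates, and each
  coordinate turns into a derivative of f. The induction on the power must therefore leave f
  arbitrary.\<close>

lemma fourier_rapid: "f \<in> schwartz \<Longrightarrow> fourier f \<in> rapid"
proof -
  have "\<exists>C. \<forall>x. (1 + norm x) ^ m * cmod (fourier f x) \<le> C" if "f \<in> schwartz" for m f
    using that
  proof (induction m arbitrary: f)
    case 0
    then show ?case using norm_fourier_le[OF schwartz_borel] by auto
  next
    case (Suc m)
    obtain C where C: "\<And>x. (1 + norm x) ^ m * cmod (fourier f x) \<le> C" using Suc by blast
    have "\<forall>i. \<exists>C. \<forall>x. (1 + norm x) ^ m * cmod (fourier (partial i f) x) \<le> C"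
      using Suc.IH[OF schwartz_partial[OF Suc.prems]] by blast
    then obtain D where D: "\<And>i x. (1 + norm x) ^ m * cmod (fourier (partial i f) x) \<le> D i" by metis
    have "(1 + norm x) ^ Suc m * cmod (fourier f x) \<le> C + (\<Sum>i\<in>UNIV. D i)" for x
    proof -
      have "norm x * cmod (fourier f x) \<le> (\<Sum>i\<in>UNIV. \<bar>x $ i\<bar>) * cmod (fourier f x)"
        by (intro mult_right_mono norm_le_l1_cart) auto
      also have "\<dots> = (\<Sum>i\<in>UNIV. norm (of_real (x $ i) * fourier f x))"
        by (simp add: sum_distrib_right norm_mult)
      also have "\<dots> = (\<Sum>i\<in>UNIV. norm (fourier (partial i f) x))"
        by (simp only: fourier_partial[OF Suc.prems]) (simp add: norm_mult)
      finally have "(1 + norm x) ^ m * (norm x * cmod (fourier f x)) \<le>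
          (1 + norm x) ^ m * (\<Sum>i\<in>UNIV. norm (fourier (partial i f) x))"
        by (intro mult_left_mono) auto
      also have "\<dots> \<le> (\<Sum>i\<in>UNIV. D i)" unfolding sum_distrib_left by (intro sum_mono D)
      finally show ?thesis using C[of x] by (simp add: algebra_simps)
    qed
    then show ?case by blast
  qed
  then show "f \<in> schwartz \<Longrightarrow> fourier f \<in> rapid" by (simp add: rapid_def)
qed

lemma fourier_schwartz:
  assumes "f \<in> schwartz"
  shows "fourier f \<in> schwartz"
proof -
  have "diff_class rapid n (fourier f)" for n
    using assms
  proof (induction n arbitrary: f)
    case (0 f)
    then show ?case using fourier_rapid fourier_differentiable[OF schwartz_rapid schwartz_borel] by simp
  next
    case (Suc n f)
    have "diff_class rapid n (partial i (fourier f))" for i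
      using Suc schwartz_coordinate_mult[of f i]
      by (simp add: partial_fourier[OF schwartz_rapid schwartz_borel])
    then show ?case using Suc.prems fourier_rapid fourier_differentiable[OF schwartz_rapid schwartz_borel] by simp
  qed
  then show ?thesis by (simp add: schwartz_iff)
qed

lemma inv_fourier_schwartz: "f \<in> schwartz \<Longrightarrow> inv_fourier f \<in> schwartz"
proof -
  assume f: "f \<in> schwartz"
  have "inv_fourier f = (\<lambda>x. of_real (1 / (2 * pi) ^ 3) * fourier f ((-1) *\<^sub>R x + 0))"
    by (rule ext) (simp add: inv_fourier_eq)
  moreover have "\<dots> \<in> schwartz"
    by (intro schwartz_cmult schwartz_affine fourier_schwartz f) simp
  ultimately show ?thesis by simp
qed

section \<open>Weighted \<open>L\<^sup>q\<close> norms\<close>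

lemma ennpowr_ennreal: "0 \<le> r \<Longrightarrow> ennpowr (ennreal r) a = ennreal (r powr a)"
  by (simp add: ennpowr_def)

lemma ennpowr_top [simp]: "ennpowr top a = top"
  by (simp add: ennpowr_def)

lemma ennpowr_0 [simp]: "ennpowr 0 a = 0"
  by (simp add: ennpowr_def)

lemma ennpowr_1 [simp]: "ennpowr x 1 = x"
  by (cases x) (auto simp: ennpowr_def)

lemma ennpowr_eq_top_iff [simp]: "ennpowr x a = top \<longleftrightarrow> x = top"
  by (simp add: ennpowr_def)

lemma ennpowr_eq_0_iff [simp]: "ennpowr x a = 0 \<longleftrightarrow> x = 0"
  by (cases x) (auto simp: ennpowr_ennreal ennreal_eq_0_iff)

lemma ennreal_diff_eq_0: "a \<le> ennreal b \<Longrightarrow> a - ennreal b = 0"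
  by (metis ennreal_minus_mono ennreal_diff_self ennreal_neq_top le_zero_eq order_refl)

lemma ennreal_le_diff_add: "a \<le> (a - b) + b" for a b :: ennreal
  by (cases "b \<le> a") (auto simp: diff_add_cancel_ennreal not_le intro: add_increasing)

lemma ennpowr_mono:
  assumes "0 \<le> a" "x \<le> y"
  shows "ennpowr x a \<le> ennpowr y a"
proof (cases "y = top")
  case False
  then have "x \<noteq> top" using assms(2) by (auto simp: top_unique)
  with False show ?thesis using assms
    by (auto simp: ennpowr_def intro!: ennreal_leI powr_mono2 enn2real_mono simp: less_top)
qed simp

lemma ennpowr_mult:
  assumes "0 < a"
  shows "ennpowr (x * y) a = ennpowr x a * ennpowr y a"
proof (cases x; cases y)
  fix r s :: real assume "0 \<le> r" "x = ennreal r" "0 \<le> s" "y = ennreal s"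
  then show ?thesis by (simp add: ennreal_mult[symmetric] ennpowr_ennreal powr_mult)
next
  fix r :: real assume r: "0 \<le> r" "x = ennreal r" "y = top"
  then show ?thesis by (cases "r = 0") (auto simp: ennpowr_ennreal ennreal_mult_top ennreal_eq_0_iff)
next
  fix r :: real assume r: "0 \<le> r" "y = ennreal r" "x = top"
  then show ?thesis by (cases "r = 0") (auto simp: ennpowr_ennreal ennreal_top_mult ennreal_eq_0_iff)
qed simp

lemma ennpowr_ennpowr: "ennpowr (ennpowr x a) b = ennpowr x (a * b)"
  by (cases x) (auto simp: ennpowr_ennreal powr_powr)

lemma ennpowr_le_iff:
  assumes "0 < a"
  shows "ennpowr x (1 / a) \<le> y \<longleftrightarrow> x \<le> ennpowr y a"
proof
  assume "ennpowr x (1 / a) \<le> y"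
  then have "ennpowr (ennpowr x (1 / a)) a \<le> ennpowr y a" using assms by (intro ennpowr_mono) auto
  then show "x \<le> ennpowr y a" using assms by (simp add: ennpowr_ennpowr)
next
  assume "x \<le> ennpowr y a"
  then have "ennpowr x (1 / a) \<le> ennpowr (ennpowr y a) (1 / a)" using assms by (intro ennpowr_mono) auto
  then show "ennpowr x (1 / a) \<le> y" using assms by (simp add: ennpowr_ennpowr)
qed

text \<open>A power with positive exponent is an order isomorphism of the extended half line whose
  inverse is the reciprocal power.\<close>

lemma ennpowr_SUP:
  assumes "0 < a"
  shows "ennpowr (SUP i\<in>I. f i) a = (SUP i\<in>I. ennpowr (f i) a)"
proof (rule antisym)
  have "f i \<le> ennpowr (SUP i\<in>I. ennpowr (f i) a) (1 / a)" if "i \<in> I" for i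
  proof -
    have "f i = ennpowr (ennpowr (f i) a) (1 / a)" using assms by (simp add: ennpowr_ennpowr)
    also have "\<dots> \<le> ennpowr (SUP i\<in>I. ennpowr (f i) a) (1 / a)"
      using assms that by (intro ennpowr_mono SUP_upper) auto
    finally show ?thesis .
  qed
  then have "(SUP i\<in>I. f i) \<le> ennpowr (SUP i\<in>I. ennpowr (f i) a) (1 / a)" by (rule SUP_least)
  then have "ennpowr (SUP i\<in>I. f i) a \<le> ennpowr (ennpowr (SUP i\<in>I. ennpowr (f i) a) (1 / a)) a"
    using assms by (intro ennpowr_mono) auto
  then show "ennpowr (SUP i\<in>I. f i) a \<le> (SUP i\<in>I. ennpowr (f i) a)"
    using assms by (simp add: ennpowr_ennpowr)
  show "(SUP i\<in>I. ennpowr (f i) a) \<le> ennpowr (SUP i\<in>I. f i) a"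
    using assms by (intro SUP_least ennpowr_mono SUP_upper) auto
qed

lemma borel_measurable_ennpowr [measurable (raw)]:
  assumes [measurable]: "h \<in> borel_measurable M"
  shows "(\<lambda>x. ennpowr (h x) a) \<in> borel_measurable M"
  unfolding ennpowr_def by measurable

lemma ennpowr_tendsto_0:
  assumes "0 < a" "(X \<longlongrightarrow> 0) F"
  shows "((\<lambda>n. ennpowr (X n) a) \<longlongrightarrow> 0) F"
proof (rule order_tendstoI)
  fix e :: ennreal assume "0 < e"
  then obtain d where d: "0 < d" "d < e" using dense by blast
  then have dt: "d < top" using order_less_le_trans top_greatest by blast
  have "0 < ennpowr d (1 / a)" using d by (simp add: zero_less_iff_neq_zero)
  with order_tendstoD(2)[OF assms(2)] have "\<forall>\<^sub>F n in F. X n < ennpowr d (1 / a)" by blast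
  then show "\<forall>\<^sub>F n in F. ennpowr (X n) a < e"
  proof eventually_elim
    case (elim n)
    then have "ennpowr (X n) a \<le> ennpowr (ennpowr d (1 / a)) a" using assms by (intro ennpowr_mono) auto
    then show ?case using assms d by (simp add: ennpowr_ennpowr)
  qed
qed auto

section \<open>Minkowski's inequality, finite and countable\<close>

definition lq_norm :: "'a measure \<Rightarrow> real \<Rightarrow> ('a \<Rightarrow> ennreal) \<Rightarrow> ennreal" where
  "lq_norm M q h = ennpowr (\<integral>\<^sup>+t. ennpowr (h t) q \<partial>M) (1 / q)"

lemma lq_norm_le_iff: "0 < q \<Longrightarrow> lq_norm M q h \<le> c \<longleftrightarrow> (\<integral>\<^sup>+t. ennpowr (h t) q \<partial>M) \<le> ennpowr c q"
  unfolding lq_norm_def by (rule ennpowr_le_iff)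

lemma lq_norm_mono: "1 \<le> q \<Longrightarrow> AE t in M. h t \<le> k t \<Longrightarrow> lq_norm M q h \<le> lq_norm M q k"
  unfolding lq_norm_def by (intro ennpowr_mono nn_integral_mono_AE) (auto elim!: eventually_mono intro: ennpowr_mono)

lemma lq_norm_cmult:
  assumes "1 \<le> q" and [measurable]: "h \<in> borel_measurable M"
  shows "lq_norm M q (\<lambda>t. c * h t) = c * lq_norm M q h"
proof -
  have "lq_norm M q (\<lambda>t. c * h t) = ennpowr (ennpowr c q * (\<integral>\<^sup>+t. ennpowr (h t) q \<partial>M)) (1 / q)"
    unfolding lq_norm_def using assms by (simp add: ennpowr_mult nn_integral_cmult)
  then show ?thesis using assms by (simp add: lq_norm_def ennpowr_mult ennpowr_ennpowr)
qed

text \<open>Convexity of the power at the combination of a/\<alpha> and b/\<beta> with weights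
  \<alpha>/(\<alpha>+\<beta>) and \<beta>/(\<alpha>+\<beta>). Integrating it with \<alpha>, \<beta>
  just above the two norms yields Minkowski's inequality directly.\<close>

lemma powr_add_le:
  fixes a b \<alpha> \<beta> q :: real
  assumes "0 \<le> a" "0 \<le> b" "0 < \<alpha>" "0 < \<beta>" "1 \<le> q"
  shows "(a + b) powr q \<le> (\<alpha> + \<beta>) powr (q - 1) * (\<alpha> powr (1 - q) * a powr q + \<beta> powr (1 - q) * b powr q)"
proof -
  have one: "x powr q \<le> (\<alpha> + \<beta>) powr (q - 1) * (\<gamma> powr (1 - q) * x powr q)"
    if "0 \<le> x" "0 < \<gamma>" "\<gamma> \<le> \<alpha> + \<beta>" for x \<gamma>
  proof -
    have "1 \<le> ((\<alpha> + \<beta>) / \<gamma>) powr (q - 1)"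
      using that assms by (intro ge_one_powr_ge_zero) (auto simp: divide_simps)
    also have "\<dots> = (\<alpha> + \<beta>) powr (q - 1) * \<gamma> powr (1 - q)"
      using that assms by (simp add: powr_divide powr_diff field_simps)
    finally have "1 \<le> (\<alpha> + \<beta>) powr (q - 1) * \<gamma> powr (1 - q)" .
    from mult_right_mono[OF this, of "x powr q"] show ?thesis by (simp add: mult.assoc)
  qed
  show ?thesis
  proof (cases "a = 0 \<or> b = 0")
    case True
    then show ?thesis using one[of b \<beta>] one[of a \<alpha>] assms by auto
  next
    case False
    then have ab: "0 < a" "0 < b" using assms by auto
    define u where "u = \<alpha> / (\<alpha> + \<beta>)"
    have u: "0 \<le> u" "0 \<le> 1 - u" "1 - u = \<beta> / (\<alpha> + \<beta>)" using assms by (auto simp: u_def field_simps)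
    have "(u * (a / \<alpha>) + (1 - u) * (b / \<beta>)) powr q \<le> u * (a / \<alpha>) powr q + (1 - u) * (b / \<beta>) powr q"
      using convex_onD[OF powr_convex[OF \<open>1 \<le> q\<close>], of "1 - u" "a / \<alpha>" "b / \<beta>"] ab assms u(1,2)
      by simp
    moreover have "u * (a / \<alpha>) + (1 - u) * (b / \<beta>) = (a + b) / (\<alpha> + \<beta>)"
      unfolding u(3) using assms by (simp add: u_def divide_simps)
    ultimately have "((a + b) / (\<alpha> + \<beta>)) powr q \<le> u * (a / \<alpha>) powr q + (1 - u) * (b / \<beta>) powr q"
      by simp
    then have "(a + b) powr q \<le> (\<alpha> + \<beta>) powr q * (u * (a / \<alpha>) powr q + (1 - u) * (b / \<beta>) powr q)"
      using ab assms by (simp add: powr_divide divide_le_eq mult.commute)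
    also have "\<dots> = (\<alpha> + \<beta>) powr (q - 1) * (\<alpha> powr (1 - q) * a powr q + \<beta> powr (1 - q) * b powr q)"
    proof -
      have "(\<alpha> + \<beta>) powr q * (\<gamma> / (\<alpha> + \<beta>) * (x / \<gamma>) powr q) = (\<alpha> + \<beta>) powr (q - 1) * (\<gamma> powr (1 - q) * x powr q)"
        if "0 < \<gamma>" "0 < x" for \<gamma> x
        using that assms by (simp add: powr_divide powr_diff)
      then show ?thesis unfolding u(3) unfolding u_def using ab assms by (simp add: distrib_left)
    qed
    finally show ?thesis .
  qed
qed

lemma ennpowr_add_le:
  assumes "0 < \<alpha>" "0 < \<beta>" "1 \<le> q"
  shows "ennpowr (x + y) q \<le> ennreal ((\<alpha> + \<beta>) powr (q - 1)) *
    (ennreal (\<alpha> powr (1 - q)) * ennpowr x q + ennreal (\<beta> powr (1 - q)) * ennpowr y q)"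
proof (cases "x = top \<or> y = top")
  case True
  then show ?thesis using assms by (auto simp: ennreal_mult_eq_top_iff ennreal_mult_top ennreal_top_mult)
next
  case False
  then obtain a b where ab: "0 \<le> a" "x = ennreal a" "0 \<le> b" "y = ennreal b"
    by (metis ennreal_cases)
  have "ennpowr (x + y) q = ennreal ((a + b) powr q)"
    using ab by (simp add: ennreal_plus[symmetric] ennpowr_ennreal del: ennreal_plus)
  also have "\<dots> \<le> ennreal ((\<alpha> + \<beta>) powr (q - 1) * (\<alpha> powr (1 - q) * a powr q + \<beta> powr (1 - q) * b powr q))"
    using ab assms by (intro ennreal_leI powr_add_le)
  also have "\<dots> = ennreal ((\<alpha> + \<beta>) powr (q - 1)) *
    (ennreal (\<alpha> powr (1 - q)) * ennpowr x q + ennreal (\<beta> powr (1 - q)) * ennpowr y q)"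
    using ab by (simp add: ennreal_mult ennpowr_ennreal)
  finally show ?thesis .
qed

lemma lq_norm_add:
  assumes "1 \<le> q" and [measurable]: "h \<in> borel_measurable M" "k \<in> borel_measurable M"
  shows "lq_norm M q (\<lambda>t. h t + k t) \<le> lq_norm M q h + lq_norm M q k"
proof (rule ennreal_le_epsilon)
  fix e :: real assume fin: "lq_norm M q h + lq_norm M q k < top" and e: "0 < e"
  \<comment> \<open>The summand e/2 keeps both weights positive when a norm is zero.\<close>
  define \<alpha> \<beta> where "\<alpha> = enn2real (lq_norm M q h) + e / 2" and "\<beta> = enn2real (lq_norm M q k) + e / 2"
  have pos: "0 < \<alpha>" "0 < \<beta>" using e by (auto simp: \<alpha>_def \<beta>_def add_nonneg_pos)
  have "lq_norm M q h \<le> ennreal \<alpha>" "lq_norm M q k \<le> ennreal \<beta>"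
    using fin e by (auto simp: \<alpha>_def \<beta>_def ennreal_plus[symmetric] simp del: ennreal_plus
       intro!: enn2real_le less_imp_le simp: ennreal_less_iff)
      (auto simp: less_top enn2real_le ennreal_enn2real_if ennreal_plus intro: order_trans[OF _ add_increasing2])
  then have i: "(\<integral>\<^sup>+t. ennpowr (h t) q \<partial>M) \<le> ennreal (\<alpha> powr q)" "(\<integral>\<^sup>+t. ennpowr (k t) q \<partial>M) \<le> ennreal (\<beta> powr q)"
    using assms(1) pos by (auto simp: lq_norm_le_iff ennpowr_ennreal)
  have "(\<integral>\<^sup>+t. ennpowr (h t + k t) q \<partial>M) \<le> (\<integral>\<^sup>+t. ennreal ((\<alpha> + \<beta>) powr (q - 1)) *
    (ennreal (\<alpha> powr (1 - q)) * ennpowr (h t) q + ennreal (\<beta> powr (1 - q)) * ennpowr (k t) q) \<partial>M)"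
    using pos assms(1) by (intro nn_integral_mono ennpowr_add_le)
  also have "\<dots> = ennreal ((\<alpha> + \<beta>) powr (q - 1)) *
    (ennreal (\<alpha> powr (1 - q)) * (\<integral>\<^sup>+t. ennpowr (h t) q \<partial>M) + ennreal (\<beta> powr (1 - q)) * (\<integral>\<^sup>+t. ennpowr (k t) q \<partial>M))"
    by (simp add: nn_integral_cmult nn_integral_add)
  also have "\<dots> \<le> ennreal ((\<alpha> + \<beta>) powr (q - 1)) *
    (ennreal (\<alpha> powr (1 - q)) * ennreal (\<alpha> powr q) + ennreal (\<beta> powr (1 - q)) * ennreal (\<beta> powr q))"
    by (intro mult_left_mono add_mono i) auto
  also have "\<dots> = ennreal ((\<alpha> + \<beta>) powr (q - 1) * (\<alpha> powr (1 - q) * \<alpha> powr q + \<beta> powr (1 - q) * \<beta> powr q))"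
    by (simp add: ennreal_mult)
  also have "(\<alpha> + \<beta>) powr (q - 1) * (\<alpha> powr (1 - q) * \<alpha> powr q + \<beta> powr (1 - q) * \<beta> powr q) = (\<alpha> + \<beta>) powr q"
  proof -
    have "\<alpha> powr (1 - q) * \<alpha> powr q = \<alpha>" "\<beta> powr (1 - q) * \<beta> powr q = \<beta>"
      using pos by (simp_all add: powr_add[symmetric])
    then show ?thesis using pos by (simp add: powr_diff)
  qed
  finally have "(\<integral>\<^sup>+t. ennpowr (h t + k t) q \<partial>M) \<le> ennpowr (ennreal (\<alpha> + \<beta>)) q"
    using pos by (simp add: ennpowr_ennreal del: ennreal_plus)
  then have "lq_norm M q (\<lambda>t. h t + k t) \<le> ennreal (\<alpha> + \<beta>)"
    using assms(1) by (simp add: lq_norm_le_iff)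
  also have "ennreal (\<alpha> + \<beta>) = lq_norm M q h + lq_norm M q k + ennreal e"
  proof -
    have "\<alpha> + \<beta> = enn2real (lq_norm M q h) + enn2real (lq_norm M q k) + e" by (simp add: \<alpha>_def \<beta>_def)
    then show ?thesis using fin e by simp
  qed
  finally show "lq_norm M q (\<lambda>t. h t + k t) \<le> lq_norm M q h + lq_norm M q k + ennreal e" .
qed

text \<open>Finite sums come from Minkowski's inequality, the limit from monotone convergence of the
  q-th powers.\<close>

lemma lq_norm_suminf:
  assumes q: "1 \<le> q" and [measurable]: "\<And>n. h n \<in> borel_measurable M"
  shows "lq_norm M q (\<lambda>t. \<Sum>n. h n t) \<le> (\<Sum>n. lq_norm M q (h n))" (is "_ \<le> ?C")
proof -
  have fin: "lq_norm M q (\<lambda>t. \<Sum>i<n. h i t) \<le> (\<Sum>i<n. lq_norm M q (h i))" for n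
  proof (induction n)
    case 0
    then show ?case by (simp add: lq_norm_def)
  next
    case (Suc n)
    have "lq_norm M q (\<lambda>t. (\<Sum>i<n. h i t) + h n t) \<le> lq_norm M q (\<lambda>t. \<Sum>i<n. h i t) + lq_norm M q (h n)"
      by (rule lq_norm_add[OF q]) measurable
    also have "\<dots> \<le> (\<Sum>i<n. lq_norm M q (h i)) + lq_norm M q (h n)" by (intro add_right_mono Suc)
    finally show ?case by simp
  qed
  have inc: "incseq (\<lambda>n. \<Sum>i<n. h i t)" for t
    by (auto simp: incseq_Suc_iff intro: add_increasing2)
  have "(\<integral>\<^sup>+t. ennpowr (\<Sum>n. h n t) q \<partial>M) = (\<integral>\<^sup>+t. (SUP n. ennpowr (\<Sum>i<n. h i t) q) \<partial>M)"
    using q by (simp add: suminf_eq_SUP ennpowr_SUP)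
  also have "\<dots> = (SUP n. \<integral>\<^sup>+t. ennpowr (\<Sum>i<n. h i t) q \<partial>M)"
    using inc q by (intro nn_integral_monotone_convergence_SUP)
      (auto simp: incseq_def le_fun_def intro!: ennpowr_mono)
  also have "\<dots> \<le> ennpowr ?C q"
  proof (rule SUP_least)
    fix n
    have "lq_norm M q (\<lambda>t. \<Sum>i<n. h i t) \<le> ?C"
      using fin[of n] sum_le_suminf[of "\<lambda>n. lq_norm M q (h n)" "{..<n}"] by (auto intro: order_trans)
    then show "(\<integral>\<^sup>+t. ennpowr (\<Sum>i<n. h i t) q \<partial>M) \<le> ennpowr ?C q"
      using q by (simp add: lq_norm_le_iff)
  qed
  finally show ?thesis using q by (simp add: lq_norm_le_iff)
qed

section \<open>The dilation-invariant measure dt/t on the half line\<close>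

definition log_measure :: "real measure" where
  "log_measure = density lborel (\<lambda>t. indicator {0<..} t * ennreal (1 / t))"

lemma sets_log_measure [measurable_cong]: "sets log_measure = sets borel"
  by (simp add: log_measure_def)

lemma nn_integral_log_measure:
  fixes h :: "real \<Rightarrow> ennreal"
  assumes "h \<in> borel_measurable borel"
  shows "(\<integral>\<^sup>+t. h t \<partial>log_measure) = (\<integral>\<^sup>+t\<in>{0<..}. h t * ennreal (1 / t) \<partial>lborel)"
  unfolding log_measure_def using assms by (simp add: nn_integral_density mult_ac)

lemma AE_log_measure: "(\<And>t :: real. 0 < t \<Longrightarrow> P t) \<Longrightarrow> AE t in log_measure. P t"
  unfolding log_measure_def by (subst AE_density) (auto split: split_indicator)

lemma nn_integral_log_dilate:
  assumes [measurable]: "h \<in> borel_measurable borel" and l: "0 < l"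
  shows "(\<integral>\<^sup>+t. h (l * t) \<partial>log_measure) = (\<integral>\<^sup>+t. h t \<partial>log_measure)"
proof -
  have "(\<integral>\<^sup>+t. h t \<partial>log_measure) = (\<integral>\<^sup>+t. h t * ennreal (1 / t) * indicator {0<..} t \<partial>lborel)"
    by (rule nn_integral_log_measure) measurable
  also have "\<dots> = ennreal l * (\<integral>\<^sup>+t. h (l * t) * ennreal (1 / (l * t)) * indicator {0<..} (l * t) \<partial>lborel)"
    by (subst nn_integral_real_affine[where c=l and t=0]) (use l in auto)
  also have "\<dots> = (\<integral>\<^sup>+t. ennreal l * (h (l * t) * ennreal (1 / (l * t)) * indicator {0<..} (l * t)) \<partial>lborel)"
    by (rule nn_integral_cmult[symmetric]) measurable
  also have "\<dots> = (\<integral>\<^sup>+t. h (l * t) * ennreal (1 / t) * indicator {0<..} t \<partial>lborel)"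
  proof (rule nn_integral_cong)
    fix t
    show "ennreal l * (h (l * t) * ennreal (1 / (l * t)) * indicator {0<..} (l * t)) = h (l * t) * ennreal (1 / t) * indicator {0<..} t"
    proof (cases "0 < t")
      case True
      then have "ennreal (1 / t) = ennreal l * ennreal (1 / (l * t))"
        using l by (simp add: ennreal_mult[symmetric])
      then show ?thesis using True l by (simp add: mult_ac)
    next
      case False
      then show ?thesis using l by (simp add: zero_less_mult_iff)
    qed
  qed
  also have "\<dots> = (\<integral>\<^sup>+t. h (l * t) \<partial>log_measure)"
    by (rule nn_integral_log_measure[symmetric]) measurable
  finally show ?thesis by simp
qed

text \<open>For q = \<infinity> this is a true supremum over t > 0, as in the Lorentz quasinorm, and
  not an essential one.\<close>

definition log_norm :: "ennreal \<Rightarrow> (real \<Rightarrow> ennreal) \<Rightarrow> ennreal" where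
  "log_norm q h = (if q = \<infinity> then SUP t\<in>{0<..}. h t else lq_norm log_measure (enn2real q) h)"

lemma enn2real_ge_1: "1 \<le> q \<Longrightarrow> q \<noteq> \<infinity> \<Longrightarrow> 1 \<le> enn2real q"
  by (metis enn2real_1 enn2real_mono infinity_ennreal_def top.not_eq_extremum)

lemma log_norm_mono:
  assumes "1 \<le> q" "\<And>t. 0 < t \<Longrightarrow> h t \<le> k t"
  shows "log_norm q h \<le> log_norm q k"
  using assms unfolding log_norm_def
  by (auto intro!: SUP_mono lq_norm_mono enn2real_ge_1 AE_log_measure)

lemma log_norm_cmult:
  assumes "1 \<le> q" "h \<in> borel_measurable borel"
  shows "log_norm q (\<lambda>t. c * h t) = c * log_norm q h"
  using assms unfolding log_norm_def
  by (auto simp: SUP_mult_left_ennreal intro!: lq_norm_cmult enn2real_ge_1 cong: measurable_cong_sets)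

lemma log_norm_suminf:
  assumes q: "1 \<le> q" and [measurable]: "\<And>n. h n \<in> borel_measurable borel"
  shows "log_norm q (\<lambda>t. \<Sum>n. h n t) \<le> (\<Sum>n. log_norm q (h n))"
proof (cases "q = \<infinity>")
  case True
  have "(\<Sum>n. h n t) \<le> (\<Sum>n. SUP t\<in>{0<..}. h n t)" if "0 < t" for t
    using that by (intro suminf_le SUP_upper) auto
  then show ?thesis using True by (auto simp: log_norm_def intro!: SUP_least)
next
  case False
  then show ?thesis using q by (simp add: log_norm_def lq_norm_suminf enn2real_ge_1)
qed

lemma log_norm_dilate:
  fixes h :: "real \<Rightarrow> ennreal"
  assumes [measurable]: "h \<in> borel_measurable borel" and l: "0 < l"
  shows "log_norm q (\<lambda>t. h (l * t)) = log_norm q h"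
proof (cases "q = \<infinity>")
  case True
  have "(\<lambda>t. l * t) ` {0<..} = {0<..}"
  proof
    show "{0<..} \<subseteq> (\<lambda>t. l * t) ` {0<..}"
    proof
      fix t :: real assume "t \<in> {0<..}"
      then have "t = l * (t / l)" "t / l \<in> {0<..}" using l by auto
      then show "t \<in> (\<lambda>t. l * t) ` {0<..}" by blast
    qed
  qed (use l in auto)
  then have "(SUP t\<in>{0<..}. h (l * t)) = (SUP t\<in>{0<..}. h t)"
    by (metis image_image)
  then show ?thesis using True by (simp add: log_norm_def)
next
  case False
  have "(\<integral>\<^sup>+t. ennpowr (h (l * t)) (enn2real q) \<partial>log_measure) = (\<integral>\<^sup>+t. ennpowr (h t) (enn2real q) \<partial>log_measure)"
    by (rule nn_integral_log_dilate[OF _ l]) measurable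
  then show ?thesis using False by (simp add: log_norm_def lq_norm_def)
qed

text \<open>The interval [a, 2a] has dt/t-measure at least 1/2, since 1/t >= 1/(2a) there, and
  (1/2)^(1/q) >= 1/2. Hence the factor 2, uniform in q.\<close>

lemma log_norm_ge:
  assumes q: "1 \<le> q" and a: "0 < a" and c: "\<And>t. a \<le> t \<Longrightarrow> t \<le> 2 * a \<Longrightarrow> c \<le> h t"
  shows "c \<le> 2 * log_norm q h"
proof (cases "q = \<infinity>")
  case True
  have "c \<le> h a" using c a by auto
  also have "\<dots> \<le> (SUP t\<in>{0<..}. h t)" using a by (intro SUP_upper) auto
  also have "\<dots> \<le> 2 * (SUP t\<in>{0<..}. h t)" using mult_right_mono[of 1 2 "SUP t\<in>{0<..}. h t"] by simp
  finally show ?thesis using True by (simp add: log_norm_def)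
next
  case False
  define r where "r = enn2real q"
  have r: "1 \<le> r" using enn2real_ge_1 q False by (simp add: r_def)
  have ind: "ennpowr (indicator {a..2*a} t) r = indicator {a..2*a} t" for t
    using r by (auto simp: ennpowr_def split: split_indicator)
  have "ennreal (1 / 2) = ennreal (1 / (2 * a)) * emeasure lborel {a..2*a}"
    using a by (simp add: ennreal_mult[symmetric])
  also have "\<dots> = (\<integral>\<^sup>+t. ennreal (1 / (2 * a)) * indicator {a..2*a} t \<partial>lborel)"
    by (simp add: nn_integral_cmult_indicator)
  also have "\<dots> \<le> (\<integral>\<^sup>+t\<in>{0<..}. indicator {a..2*a} t * ennreal (1 / t) \<partial>lborel)"
    using a by (intro nn_integral_mono) (auto split: split_indicator intro!: ennreal_leI divide_left_mono)
  also have "\<dots> = (\<integral>\<^sup>+t. ennpowr (indicator {a..2*a} t) r \<partial>log_measure)"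
    unfolding ind by (rule nn_integral_log_measure[symmetric]) measurable
  finally have half: "ennreal (1 / 2) \<le> (\<integral>\<^sup>+t. ennpowr (indicator {a..2*a} t) r \<partial>log_measure)" .
  have "ennreal (1 / 2) \<le> ennreal ((1 / 2) powr (1 / r))"
    using r powr_mono'[of "1 / r" 1 "1 / 2 :: real"] by (intro ennreal_leI) simp
  also have "\<dots> = ennpowr (ennreal (1 / 2)) (1 / r)" by (rule ennpowr_ennreal[symmetric]) simp
  also have "\<dots> \<le> lq_norm log_measure r (indicator {a..2*a})"
    unfolding lq_norm_def using r by (intro ennpowr_mono half) auto
  finally have half': "ennreal (1 / 2) \<le> lq_norm log_measure r (indicator {a..2*a})" .
  have "c = 2 * (c * ennreal (1 / 2))"
  proof -
    have "2 * (c * ennreal (1 / 2)) = c * (ennreal 2 * ennreal (1 / 2))" by (simp add: mult_ac)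
    also have "ennreal 2 * ennreal (1 / 2) = 1" by (subst ennreal_mult[symmetric]) auto
    finally show ?thesis by simp
  qed
  also have "\<dots> \<le> 2 * (c * lq_norm log_measure r (indicator {a..2*a}))"
    by (intro mult_left_mono half') auto
  also have "c * lq_norm log_measure r (indicator {a..2*a}) = lq_norm log_measure r (\<lambda>t. c * indicator {a..2*a} t)"
    by (rule lq_norm_cmult[symmetric, OF r]) measurable
  also have "\<dots> \<le> lq_norm log_measure r h"
    by (intro lq_norm_mono r AE_log_measure) (use c in \<open>auto split: split_indicator\<close>)
  finally show ?thesis using False by (simp add: log_norm_def r_def mult_left_mono)
qed

text \<open>For values at most 1 the q-th power is below the function itself, so a single integral
  covers every finite q.\<close>

lemma log_norm_finite:
  assumes q: "1 \<le> q" and h: "\<And>t. 0 < t \<Longrightarrow> h t \<le> 1" and i: "(\<integral>\<^sup>+t. h t \<partial>log_measure) < \<infinity>"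
  shows "log_norm q h < \<infinity>"
proof (cases "q = \<infinity>")
  case True
  have "(SUP t\<in>{0<..}. h t) \<le> 1" using h by (intro SUP_least) auto
  then show ?thesis using True by (simp add: log_norm_def order_le_less_trans[of _ 1])
next
  case False
  define r where "r = enn2real q"
  have r: "1 \<le> r" using enn2real_ge_1 q False by (simp add: r_def)
  have "ennpowr x r \<le> x" if "x \<le> 1" for x
  proof -
    have "x \<noteq> top" using that by (auto simp: top_unique)
    then obtain s where s: "0 \<le> s" "x = ennreal s" by (metis ennreal_cases)
    then have "s powr r \<le> s powr 1" using that r by (intro powr_mono') auto
    then show ?thesis using s by (simp add: ennpowr_ennreal)
  qed
  then have "(\<integral>\<^sup>+t. ennpowr (h t) r \<partial>log_measure) \<le> (\<integral>\<^sup>+t. h t \<partial>log_measure)"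
    by (intro nn_integral_mono_AE AE_log_measure) (use h in auto)
  then have "(\<integral>\<^sup>+t. ennpowr (h t) r \<partial>log_measure) < top" using i by auto
  then show ?thesis using False by (simp add: log_norm_def lq_norm_def r_def less_top[symmetric])
qed

lemma borel_measurable_mono_ennreal:
  fixes f :: "real \<Rightarrow> ennreal"
  assumes "mono f"
  shows "f \<in> borel_measurable borel"
proof (rule borel_measurableI_greater)
  fix y
  have "is_interval {x. y < f x}"
    unfolding is_interval_1 using assms by (auto simp: mono_def intro: order_less_le_trans)
  then show "{x \<in> space borel. y < f x} \<in> sets borel" using real_interval_borel_measurable by simp
qed

lemma borel_measurable_antimono_ennreal:
  fixes f :: "real \<Rightarrow> ennreal"
  assumes "antimono f"
  shows "f \<in> borel_measurable borel"
proof (rule borel_measurableI_greater)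
  fix y
  have "is_interval {x. y < f x}"
    unfolding is_interval_1 using assms by (auto simp: antimono_def intro: order_less_le_trans)
  then show "{x \<in> space borel. y < f x} \<in> sets borel" using real_interval_borel_measurable by simp
qed

text \<open>The integrand is bounded by t^(\<beta>-\<theta>-1) on (0, 1] and by t^(-\<theta>-1)
  beyond, and both are integrable.\<close>

lemma nn_integral_log_powr_min:
  assumes "0 < \<theta>" "\<theta> < \<beta>"
  shows "(\<integral>\<^sup>+t. ennreal (t powr (- \<theta>) * min 1 (t powr \<beta>)) \<partial>log_measure) < \<infinity>"
proof -
  have "(\<integral>\<^sup>+t. ennreal (t powr (- \<theta>) * min 1 (t powr \<beta>)) \<partial>log_measure) =
     (\<integral>\<^sup>+t\<in>{0<..}. ennreal (t powr (- \<theta>) * min 1 (t powr \<beta>)) * ennreal (1 / t) \<partial>lborel)"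
    by (rule nn_integral_log_measure) measurable
  also have "\<dots> \<le> (\<integral>\<^sup>+t. ennreal (t powr (\<beta> - \<theta> - 1)) * indicator {0..1} t +
      ennreal (t powr (- \<theta> - 1)) * indicator {1..} t \<partial>lborel)"
  proof (intro nn_integral_mono)
    fix t :: real
    show "ennreal (t powr (- \<theta>) * min 1 (t powr \<beta>)) * ennreal (1 / t) * indicator {0<..} t
      \<le> ennreal (t powr (\<beta> - \<theta> - 1)) * indicator {0..1} t + ennreal (t powr (- \<theta> - 1)) * indicator {1..} t"
    proof (cases "0 < t")
      case True
      show ?thesis
      proof (cases "t \<le> 1")
        case t1: True
        have "t powr (- \<theta>) * min 1 (t powr \<beta>) * (1 / t) \<le> t powr (- \<theta>) * t powr \<beta> * (1 / t)"
          using True by (intro mult_right_mono mult_left_mono) auto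
        also have "\<dots> = t powr (\<beta> - \<theta> - 1)" using True by (simp add: powr_diff powr_minus powr_add field_simps)
        finally have "ennreal (t powr (- \<theta>) * min 1 (t powr \<beta>)) * ennreal (1 / t) \<le> ennreal (t powr (\<beta> - \<theta> - 1))"
          using True by (simp add: ennreal_mult[symmetric])
        then show ?thesis using True t1 by (simp add: add_increasing2)
      next
        case t1: False
        have "t powr (- \<theta>) * min 1 (t powr \<beta>) * (1 / t) \<le> t powr (- \<theta>) * 1 * (1 / t)"
          using True by (intro mult_right_mono mult_left_mono) auto
        also have "\<dots> = t powr (- \<theta> - 1)" using True by (simp add: powr_diff powr_minus powr_add field_simps)
        finally have "ennreal (t powr (- \<theta>) * min 1 (t powr \<beta>)) * ennreal (1 / t) \<le> ennreal (t powr (- \<theta> - 1))"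
          using True by (simp add: ennreal_mult[symmetric])
        then show ?thesis using True t1 by (simp add: add_increasing2)
      qed
    qed simp
  qed
  also have "\<dots> = (\<integral>\<^sup>+t. ennreal (t powr (\<beta> - \<theta> - 1)) * indicator {0..1} t \<partial>lborel) +
      (\<integral>\<^sup>+t. ennreal (t powr (- \<theta> - 1)) * indicator {1..} t \<partial>lborel)"
    by (rule nn_integral_add) measurable
  also have "\<dots> < \<infinity>"
    using assms nn_integral_has_integral_lebesgue'[OF _ has_integral_powr_from_0[of "\<beta> - \<theta> - 1" 1]]
      nn_integral_has_integral_lebesgue'[OF _ has_integral_powr_to_inf[of "- \<theta> - 1" 1]]
    by simp
  finally show ?thesis .
qed

section \<open>The \<open>K\<close>-functional\<close>

text \<open>For \<open>g = \<bar>f\<bar>\<close> this is Peetre's functional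
  \<open>inf {\<parallel>f\<^sub>0\<parallel>\<^sub>1 + t \<parallel>f\<^sub>1\<parallel>\<^sub>\<infinity> | f = f\<^sub>0 + f\<^sub>1}\<close>, since truncation at height \<open>s\<close> is the
  optimal splitting with \<open>\<parallel>f\<^sub>1\<parallel>\<^sub>\<infinity> \<le> s\<close>.  Unlike the rearrangement it is subadditive in \<open>g\<close>.\<close>

definition kfun :: "real \<Rightarrow> (R3 \<Rightarrow> ennreal) \<Rightarrow> ennreal" where
  "kfun t g = (INF s\<in>{0..}. (\<integral>\<^sup>+x. (g x - ennreal s) \<partial>lborel) + ennreal (t * s))"

lemma kfun_le: "0 \<le> s \<Longrightarrow> kfun t g \<le> (\<integral>\<^sup>+x. (g x - ennreal s) \<partial>lborel) + ennreal (t * s)"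
  unfolding kfun_def by (intro INF_lower) auto

lemma kfun_greatest: "(\<And>s. 0 \<le> s \<Longrightarrow> c \<le> (\<integral>\<^sup>+x. (g x - ennreal s) \<partial>lborel) + ennreal (t * s)) \<Longrightarrow> c \<le> kfun t g"
  unfolding kfun_def by (intro INF_greatest) auto

lemma kfun_lessD: "kfun t g < c \<Longrightarrow> \<exists>s\<ge>0. (\<integral>\<^sup>+x. (g x - ennreal s) \<partial>lborel) + ennreal (t * s) < c"
  unfolding kfun_def by (auto simp: INF_less_iff)

lemma kfun_mono_left: "t \<le> t' \<Longrightarrow> kfun t g \<le> kfun t' g"
  by (rule kfun_greatest, rule order_trans[OF kfun_le])
    (auto intro!: add_left_mono ennreal_leI mult_right_mono)

lemma kfun_borel [measurable]: "(\<lambda>t. kfun t g) \<in> borel_measurable borel"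
  by (rule borel_measurable_mono_ennreal) (auto simp: mono_def kfun_mono_left)

lemma kfun_mono:
  assumes "AE x in lborel. g x \<le> h x"
  shows "kfun t g \<le> kfun t h"
  by (rule kfun_greatest, rule order_trans[OF kfun_le], assumption)
    (use assms in \<open>auto intro!: add_right_mono nn_integral_mono_AE elim!: eventually_mono intro: ennreal_minus_mono\<close>)

lemma kfun_le_integral: "kfun t g \<le> (\<integral>\<^sup>+x. g x \<partial>lborel)"
  using kfun_le[of 0 t g] by simp

lemma kfun_le_bound:
  assumes "0 \<le> A" "\<And>x. g x \<le> ennreal A"
  shows "kfun t g \<le> ennreal (t * A)"
proof -
  have "(\<integral>\<^sup>+x. (g x - ennreal A) \<partial>lborel) = (\<integral>\<^sup>+x. 0 \<partial>(lborel :: R3 measure))"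
    by (intro nn_integral_cong ennreal_diff_eq_0 assms(2))
  then show ?thesis using kfun_le[OF assms(1), of t g] by simp
qed

lemma suminf_ennreal_half: "(\<Sum>n. ennreal (c / 2 ^ Suc n)) = ennreal c" if "0 \<le> c"
proof -
  have "(\<lambda>n. c * (1 / 2) ^ Suc n) sums (c * 1)" by (intro sums_mult power_half_series)
  moreover have "(\<lambda>n. c * (1 / 2) ^ Suc n) = (\<lambda>n. c / 2 ^ Suc n)" by (simp add: fun_eq_iff power_divide)
  ultimately have "(\<lambda>n. c / 2 ^ Suc n) sums c" by (simp only: mult_1_right)
  then show ?thesis using that by (intro suminf_ennreal_eq) auto
qed

text \<open>Truncate the n-th summand at a level \<open>s n\<close> that is optimal up to e/2^(n+1),
  and the series at the sum of the levels: the excess of the series is at most the sum of the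
  excesses.\<close>

lemma kfun_suminf:
  assumes [measurable]: "\<And>n. g n \<in> borel_measurable borel" and t: "0 < t"
  shows "kfun t (\<lambda>x. \<Sum>n. g n x) \<le> (\<Sum>n. kfun t (g n))"
proof (rule ennreal_le_epsilon)
  fix e :: real assume fin: "(\<Sum>n. kfun t (g n)) < top" and e: "0 < e"
  have "\<exists>s\<ge>0. (\<integral>\<^sup>+x. (g n x - ennreal s) \<partial>lborel) + ennreal (t * s) < kfun t (g n) + ennreal (e / 2 ^ Suc n)" for n
  proof (rule kfun_lessD)
    have "kfun t (g n) < top" using ennreal_suminf_lessD[OF fin] .
    then show "kfun t (g n) < kfun t (g n) + ennreal (e / 2 ^ Suc n)"
      using e ennreal_add_left_cancel_less[of "kfun t (g n)" 0 "ennreal (e / 2 ^ Suc n)"] by simp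
  qed
  then obtain s where s: "\<And>n. 0 \<le> s n"
    and le: "\<And>n. (\<integral>\<^sup>+x. (g n x - ennreal (s n)) \<partial>lborel) + ennreal (t * s n) \<le> kfun t (g n) + ennreal (e / 2 ^ Suc n)"
    by (metis less_imp_le)
  have S: "(\<Sum>n. (\<integral>\<^sup>+x. (g n x - ennreal (s n)) \<partial>lborel) + ennreal (t * s n)) \<le> (\<Sum>n. kfun t (g n)) + ennreal e"
    using suminf_le[of _ "\<lambda>n. kfun t (g n) + ennreal (e / 2 ^ Suc n)", OF le] e
    by (simp add: suminf_add[symmetric] suminf_ennreal_half del: power_Suc suminf_ennreal)
  \<comment> \<open>The levels are summable because t > 0 and the total of the K-functionals is
    finite.\<close>
  have "(\<Sum>n. ennreal (t * s n)) \<le> (\<Sum>n. (\<integral>\<^sup>+x. (g n x - ennreal (s n)) \<partial>lborel) + ennreal (t * s n))"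
    by (intro suminf_le) auto
  also note S
  finally have "(\<Sum>n. ennreal (t * s n)) \<noteq> top" using fin by (auto simp: top_unique)
  then have "summable (\<lambda>n. t * s n)" using s t by (intro summable_suminf_not_top) auto
  then have sums: "summable s" using t summable_mult_D by fastforce
  have st: "(\<Sum>n. ennreal (t * s n)) = ennreal (t * suminf s)"
    using sums s t by (subst suminf_ennreal2) (auto simp: suminf_mult)
  have ss: "(\<Sum>n. ennreal (s n)) = ennreal (suminf s)"
    using sums s by (intro suminf_ennreal2) auto
  have "(\<Sum>n. g n x) - ennreal (suminf s) \<le> (\<Sum>n. g n x - ennreal (s n))" for x
  proof -
    have "(\<Sum>n. g n x) \<le> (\<Sum>n. (g n x - ennreal (s n)) + ennreal (s n))" by (intro suminf_le ennreal_le_diff_add) auto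
    also have "\<dots> = (\<Sum>n. g n x - ennreal (s n)) + ennreal (suminf s)"
      by (subst suminf_add[symmetric]) (auto simp: ss)
    finally have "(\<Sum>n. g n x) - ennreal (suminf s) \<le> (\<Sum>n. g n x - ennreal (s n)) + ennreal (suminf s) - ennreal (suminf s)"
      by (intro ennreal_minus_mono) auto
    then show ?thesis by simp
  qed
  then have "(\<integral>\<^sup>+x. ((\<Sum>n. g n x) - ennreal (suminf s)) \<partial>lborel) \<le> (\<integral>\<^sup>+x. (\<Sum>n. g n x - ennreal (s n)) \<partial>lborel)"
    by (intro nn_integral_mono)
  also have "\<dots> = (\<Sum>n. \<integral>\<^sup>+x. (g n x - ennreal (s n)) \<partial>lborel)"
    by (rule nn_integral_suminf) measurable
  finally have "(\<integral>\<^sup>+x. ((\<Sum>n. g n x) - ennreal (suminf s)) \<partial>lborel) + ennreal (t * suminf s) \<le>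
      (\<Sum>n. \<integral>\<^sup>+x. (g n x - ennreal (s n)) \<partial>lborel) + (\<Sum>n. ennreal (t * s n))"
    unfolding st by (rule add_right_mono)
  also have "\<dots> = (\<Sum>n. (\<integral>\<^sup>+x. (g n x - ennreal (s n)) \<partial>lborel) + ennreal (t * s n))"
    by (rule suminf_add) auto
  also note S
  finally show "kfun t (\<lambda>x. \<Sum>n. g n x) \<le> (\<Sum>n. kfun t (g n)) + ennreal e"
    using order_trans[OF kfun_le[of "suminf s" t "\<lambda>x. \<Sum>n. g n x"]] suminf_nonneg[OF sums s] by blast
qed

lemma ennreal_mult_diff: "ennreal c * (a - b) = ennreal c * a - ennreal c * b" if "0 \<le> c" "b \<noteq> top"
proof (cases a)
  case (real r)
  moreover obtain s where "0 \<le> s" "b = ennreal s" using \<open>b \<noteq> top\<close> by (cases b) auto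
  moreover have "ennreal c * ennreal (r - s) = ennreal (c * r - c * s)"
    using that by (simp add: ennreal_mult'[symmetric] right_diff_distrib)
  moreover have "ennreal c * ennreal r = ennreal (c * r)" "ennreal c * ennreal s = ennreal (c * s)"
    using that by (simp_all add: ennreal_mult'[symmetric])
  ultimately show ?thesis using that by (simp add: ennreal_minus)
next
  case top
  then show ?thesis using that by (cases "c = 0") (auto simp: ennreal_mult_top)
qed

lemma kfun_cmult_le:
  assumes [measurable]: "g \<in> borel_measurable borel" and c: "0 < c"
  shows "kfun t (\<lambda>x. ennreal c * g x) \<le> ennreal c * kfun t g"
proof -
  have "ennreal (1 / c) * kfun t (\<lambda>x. ennreal c * g x) \<le> kfun t g"
  proof (rule kfun_greatest)
    fix s :: real assume s: "0 \<le> s"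
    have "kfun t (\<lambda>x. ennreal c * g x) \<le> (\<integral>\<^sup>+x. (ennreal c * g x - ennreal (c * s)) \<partial>lborel) + ennreal (t * (c * s))"
      using c s by (intro kfun_le) auto
    also have "(\<integral>\<^sup>+x. (ennreal c * g x - ennreal (c * s)) \<partial>lborel) = (\<integral>\<^sup>+x. ennreal c * (g x - ennreal s) \<partial>lborel)"
      using c s by (intro nn_integral_cong) (simp add: ennreal_mult_diff ennreal_mult)
    also have "\<dots> = ennreal c * (\<integral>\<^sup>+x. (g x - ennreal s) \<partial>lborel)" by (rule nn_integral_cmult) measurable
    also have "ennreal (t * (c * s)) = ennreal c * ennreal (t * s)"
      using c by (simp add: ennreal_mult'[symmetric] mult_ac)
    finally have "ennreal (1 / c) * kfun t (\<lambda>x. ennreal c * g x) \<le>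
        ennreal (1 / c) * (ennreal c * ((\<integral>\<^sup>+x. (g x - ennreal s) \<partial>lborel) + ennreal (t * s)))"
      by (intro mult_left_mono) (auto simp: distrib_left)
    also have "\<dots> = (\<integral>\<^sup>+x. (g x - ennreal s) \<partial>lborel) + ennreal (t * s)"
      using c by (simp add: mult.assoc[symmetric] ennreal_mult[symmetric])
    finally show "ennreal (1 / c) * kfun t (\<lambda>x. ennreal c * g x) \<le> (\<integral>\<^sup>+x. (g x - ennreal s) \<partial>lborel) + ennreal (t * s)" .
  qed
  then have "ennreal c * (ennreal (1 / c) * kfun t (\<lambda>x. ennreal c * g x)) \<le> ennreal c * kfun t g"
    by (intro mult_left_mono) auto
  then show ?thesis using c by (simp add: mult.assoc[symmetric] ennreal_mult[symmetric])
qed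

lemma kfun_cmult:
  assumes [measurable]: "g \<in> borel_measurable borel" and c: "0 \<le> c"
  shows "kfun t (\<lambda>x. ennreal c * g x) = ennreal c * kfun t g"
proof (cases "c = 0")
  case True
  then show ?thesis using kfun_le_integral[of t "\<lambda>x. 0"] by simp
next
  case False
  then have c: "0 < c" using c by simp
  have "kfun t g = kfun t (\<lambda>x. ennreal (1 / c) * (ennreal c * g x))"
    using c by (simp add: mult.assoc[symmetric] ennreal_mult[symmetric])
  also have "\<dots> \<le> ennreal (1 / c) * kfun t (\<lambda>x. ennreal c * g x)"
    using c by (intro kfun_cmult_le) auto
  finally have "ennreal c * kfun t g \<le> ennreal c * (ennreal (1 / c) * kfun t (\<lambda>x. ennreal c * g x))"
    by (intro mult_left_mono) auto
  then have "ennreal c * kfun t g \<le> kfun t (\<lambda>x. ennreal c * g x)"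
    using c by (simp add: mult.assoc[symmetric] ennreal_mult[symmetric])
  then show ?thesis using kfun_cmult_le[OF assms(1) c] by (intro antisym)
qed

text \<open>At each level s, the excess of g over s is paired with the bound A of h, and the part of
  g below s with the mass A t. Indicators of sets, kernels and \<open>decay\<close> are the
  functions h to which this is applied.\<close>

lemma kfun_pairing:
  assumes [measurable]: "g \<in> borel_measurable borel" "h \<in> borel_measurable borel"
    and A: "0 \<le> A" "\<And>x. h x \<le> ennreal A" and t: "0 \<le> t" "(\<integral>\<^sup>+x. h x \<partial>lborel) \<le> ennreal (A * t)"
  shows "(\<integral>\<^sup>+x. g x * h x \<partial>lborel) \<le> ennreal A * kfun t g"
proof (cases "A = 0")
  case True
  then have "h x = 0" for x using A(2)[of x] by simp
  then show ?thesis by simp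
next
  case False
  then have A0: "0 < A" using A by simp
  have "ennreal (1 / A) * (\<integral>\<^sup>+x. g x * h x \<partial>lborel) \<le> kfun t g"
  proof (rule kfun_greatest)
    fix s :: real assume s: "0 \<le> s"
    have "(\<integral>\<^sup>+x. g x * h x \<partial>lborel) \<le> (\<integral>\<^sup>+x. ennreal A * (g x - ennreal s) + ennreal s * h x \<partial>lborel)"
    proof (rule nn_integral_mono)
      fix x
      have "g x * h x \<le> ((g x - ennreal s) + ennreal s) * h x" by (intro mult_right_mono ennreal_le_diff_add) auto
      also have "\<dots> = h x * (g x - ennreal s) + ennreal s * h x" by (simp only: distrib_right) (simp only: mult.commute)
      also have "\<dots> \<le> ennreal A * (g x - ennreal s) + ennreal s * h x"
        by (intro add_right_mono mult_right_mono A) auto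
      finally show "g x * h x \<le> ennreal A * (g x - ennreal s) + ennreal s * h x" .
    qed
    also have "\<dots> = ennreal A * (\<integral>\<^sup>+x. (g x - ennreal s) \<partial>lborel) + ennreal s * (\<integral>\<^sup>+x. h x \<partial>lborel)"
      by (simp add: nn_integral_add nn_integral_cmult)
    also have "\<dots> \<le> ennreal A * (\<integral>\<^sup>+x. (g x - ennreal s) \<partial>lborel) + ennreal s * ennreal (A * t)"
      by (intro add_left_mono mult_left_mono t) auto
    also have "ennreal s * ennreal (A * t) = ennreal A * ennreal (t * s)"
      using A t s by (simp add: ennreal_mult[symmetric] mult_ac)
    finally have "ennreal (1 / A) * (\<integral>\<^sup>+x. g x * h x \<partial>lborel) \<le>
        ennreal (1 / A) * (ennreal A * ((\<integral>\<^sup>+x. (g x - ennreal s) \<partial>lborel) + ennreal (t * s)))"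
      by (intro mult_left_mono) (auto simp: distrib_left)
    also have "\<dots> = (\<integral>\<^sup>+x. (g x - ennreal s) \<partial>lborel) + ennreal (t * s)"
      using A0 by (simp add: mult.assoc[symmetric] ennreal_mult[symmetric])
    finally show "ennreal (1 / A) * (\<integral>\<^sup>+x. g x * h x \<partial>lborel) \<le> (\<integral>\<^sup>+x. (g x - ennreal s) \<partial>lborel) + ennreal (t * s)" .
  qed
  then have "ennreal A * (ennreal (1 / A) * (\<integral>\<^sup>+x. g x * h x \<partial>lborel)) \<le> ennreal A * kfun t g"
    by (intro mult_left_mono) auto
  then show ?thesis using A0 by (simp add: mult.assoc[symmetric] ennreal_mult[symmetric])
qed

lemma nn_integral_affine:
  assumes [measurable]: "g \<in> borel_measurable borel" and l: "0 < l"
  shows "(\<integral>\<^sup>+x. g (l *\<^sub>R x + a) \<partial>lborel) = ennreal (1 / l ^ 3) * (\<integral>\<^sup>+x. g x \<partial>(lborel :: R3 measure))"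
proof -
  have "(\<integral>\<^sup>+x. g x \<partial>(lborel :: R3 measure)) = ennreal (l ^ 3) * (\<integral>\<^sup>+x. g (l *\<^sub>R x + a) \<partial>lborel)"
    by (subst lborel_affine[of l a]) (use l in \<open>auto simp: nn_integral_density nn_integral_distr nn_integral_cmult add.commute power3_eq_cube mult_ac\<close>)
  then show ?thesis using l by (simp add: mult.assoc[symmetric] ennreal_mult[symmetric])
qed

text \<open>A dilation multiplies integrals by l^(-3) and leaves heights alone, so the relative
  price t of a level is rescaled by l^3.\<close>

lemma kfun_affine:
  assumes [measurable]: "g \<in> borel_measurable borel" and l: "0 < l"
  shows "kfun t (\<lambda>x. g (l *\<^sub>R x + a)) = ennreal (1 / l ^ 3) * kfun (l ^ 3 * t) g"
proof -
  have *: "(\<integral>\<^sup>+x. (g (l *\<^sub>R x + a) - ennreal s) \<partial>lborel) + ennreal (t * s) =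
     ennreal (1 / l ^ 3) * ((\<integral>\<^sup>+x. (g x - ennreal s) \<partial>lborel) + ennreal (l ^ 3 * t * s))" for s
  proof -
    have "(\<integral>\<^sup>+x. (g (l *\<^sub>R x + a) - ennreal s) \<partial>lborel) = ennreal (1 / l ^ 3) * (\<integral>\<^sup>+x. (g x - ennreal s) \<partial>lborel)"
      by (rule nn_integral_affine[OF _ l]) measurable
    then show ?thesis using l by (simp add: distrib_left ennreal_mult'[symmetric])
  qed
  have inv: "ennreal (l ^ 3) * (ennreal (1 / l ^ 3) * x) = x" "ennreal (1 / l ^ 3) * (ennreal (l ^ 3) * x) = x" for x
    using l by (simp_all add: mult.assoc[symmetric] ennreal_mult[symmetric])
  show ?thesis
  proof (rule antisym)
    have "ennreal (l ^ 3) * kfun t (\<lambda>x. g (l *\<^sub>R x + a)) \<le> kfun (l ^ 3 * t) g"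
    proof (rule kfun_greatest)
      fix s :: real assume "0 \<le> s"
      from mult_left_mono[OF kfun_le[OF this, of t "\<lambda>x. g (l *\<^sub>R x + a)"], of "ennreal (l ^ 3)"]
      show "ennreal (l ^ 3) * kfun t (\<lambda>x. g (l *\<^sub>R x + a)) \<le> (\<integral>\<^sup>+x. (g x - ennreal s) \<partial>lborel) + ennreal (l ^ 3 * t * s)"
        by (simp only: * inv) simp
    qed
    from mult_left_mono[OF this, of "ennreal (1 / l ^ 3)"]
    show "kfun t (\<lambda>x. g (l *\<^sub>R x + a)) \<le> ennreal (1 / l ^ 3) * kfun (l ^ 3 * t) g"
      by (simp only: inv) simp
  next
    show "ennreal (1 / l ^ 3) * kfun (l ^ 3 * t) g \<le> kfun t (\<lambda>x. g (l *\<^sub>R x + a))"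
      by (rule kfun_greatest) (auto simp only: * intro!: mult_left_mono kfun_le zero_le)
  qed
qed

section \<open>Decreasing rearrangements and Lorentz norms\<close>

lemma rearrangement_le:
  "0 \<le> s \<Longrightarrow> emeasure lebesgue {x. norm (f x) > s} \<le> ennreal t \<Longrightarrow> decreasing_rearrangement f t \<le> ennreal s"
  unfolding decreasing_rearrangement_def by (intro Inf_lower) auto

lemma rearrangement_antimono: "antimono (decreasing_rearrangement f)"
  unfolding decreasing_rearrangement_def antimono_def
  by (auto intro!: Inf_superset_mono image_mono ennreal_leI intro: order_trans)

lemma rearrangement_borel [measurable]: "decreasing_rearrangement f \<in> borel_measurable borel"
  by (rule borel_measurable_antimono_ennreal[OF rearrangement_antimono])

lemma rearrangement_lessD:
  "decreasing_rearrangement f t < c \<Longrightarrow> \<exists>s\<ge>0. ennreal s < c \<and> emeasure lebesgue {x. norm (f x) > s} \<le> ennreal t"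
  unfolding decreasing_rearrangement_def by (auto simp: Inf_less_iff)

lemma sets_norm_gt: "f \<in> borel_measurable lebesgue \<Longrightarrow> {x. norm (f x) > s} \<in> sets lebesgue" for f :: fn
proof -
  assume [measurable]: "f \<in> borel_measurable lebesgue"
  have "{x \<in> space lebesgue. norm (f x) > s} \<in> sets lebesgue" by measurable
  then show ?thesis by simp
qed

text \<open>The infimum in the rearrangement is attained: {|f| > a} is the increasing union of the
  sets {|f| > a + 1/(n+1)}, whose measures are all at most t.\<close>

lemma emeasure_rearrangement:
  assumes f: "f \<in> borel_measurable lebesgue" and fin: "decreasing_rearrangement f t < top"
  shows "emeasure lebesgue {x. norm (f x) > enn2real (decreasing_rearrangement f t)} \<le> ennreal t"
proof -
  define a where "a = enn2real (decreasing_rearrangement f t)"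
  let ?A = "\<lambda>n. {x. norm (f x) > a + 1 / real (Suc n)}"
  have "{x. norm (f x) > a} = (\<Union>n. ?A n)"
  proof safe
    fix x assume "a < norm (f x)"
    then obtain n where "1 / real (Suc n) < norm (f x) - a" using nat_approx_posE[of "norm (f x) - a"] by auto
    then show "x \<in> (\<Union>n. ?A n)" by (intro UN_I[of n]) auto
  next
    fix x n assume "a + 1 / real (Suc n) < norm (f x)"
    then show "a < norm (f x)" by (smt (verit) divide_nonneg_nonneg of_nat_0_le_iff)
  qed
  also have "emeasure lebesgue \<dots> = (SUP n. emeasure lebesgue (?A n))"
  proof (rule SUP_emeasure_incseq[symmetric])
    show "range ?A \<subseteq> sets lebesgue" using sets_norm_gt[OF f] by auto
    have "1 / real (Suc n) \<le> 1 / real (Suc m)" if "m \<le> n" for m n using that by (simp add: frac_le)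
    then show "incseq ?A" unfolding incseq_def by (auto intro: le_less_trans[OF add_left_mono])
  qed
  also have "\<dots> \<le> ennreal t"
  proof (rule SUP_least)
    fix n
    have "decreasing_rearrangement f t = ennreal a" using fin by (simp add: a_def)
    also have "\<dots> < ennreal (a + 1 / real (Suc n))" by (intro ennreal_lessI) (auto simp: a_def add_nonneg_pos)
    finally obtain s where s: "0 \<le> s" "ennreal s < ennreal (a + 1 / real (Suc n))" "emeasure lebesgue {x. norm (f x) > s} \<le> ennreal t"
      using rearrangement_lessD by blast
    then have "s < a + 1 / real (Suc n)" by (simp add: ennreal_less_iff)
    then have "emeasure lebesgue (?A n) \<le> emeasure lebesgue {x. norm (f x) > s}"
      by (intro emeasure_mono sets_norm_gt f) auto
    then show "emeasure lebesgue (?A n) \<le> ennreal t" using s by auto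
  qed
  finally show ?thesis by (simp add: a_def)
qed

abbreviation absf :: "fn \<Rightarrow> R3 \<Rightarrow> ennreal" where
  "absf f \<equiv> \<lambda>x. ennreal (norm (f x))"

text \<open>If r lies below the rearrangement at t, the set where |f| > r has measure at least t, so
  by Chebyshev the excess over a level s < r has integral at least (r - s) t.\<close>

lemma rearrangement_le_kfun:
  assumes f: "f \<in> borel_measurable lebesgue" and t: "0 < t"
  shows "ennreal t * decreasing_rearrangement f t \<le> kfun t (absf f)"
proof (rule kfun_greatest)
  fix s :: real assume s: "0 \<le> s"
  let ?C = "(\<integral>\<^sup>+x. (absf f x - ennreal s) \<partial>lborel) + ennreal (t * s)"
  note [measurable] = f
  have "decreasing_rearrangement f t \<le> ennreal (1 / t) * ?C"
  proof (rule dense_le)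
    fix x assume x: "x < decreasing_rearrangement f t"
    then have "x < top" using top_greatest order_less_le_trans by blast
    then obtain r where r: "0 \<le> r" "x = ennreal r" by (cases x) auto
    have "ennreal (t * r) \<le> ?C"
    proof (cases "r \<le> s")
      case True
      then have "ennreal (t * r) \<le> ennreal (t * s)" using t by (intro ennreal_leI) auto
      then show ?thesis by (simp add: add_increasing)
    next
      case False
      have "ennreal t \<le> emeasure lebesgue {x. norm (f x) > r}"
        using rearrangement_le[OF r(1), of f t] x r by (metis linorder_le_cases not_le)
      then have "ennreal (r - s) * ennreal t \<le> ennreal (r - s) * emeasure lebesgue {x. norm (f x) > r}"
        by (intro mult_left_mono) auto
      also have "\<dots> = (\<integral>\<^sup>+x. ennreal (r - s) * indicator {x. norm (f x) > r} x \<partial>lebesgue)"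
        by (rule nn_integral_cmult_indicator[symmetric]) (rule sets_norm_gt[OF f])
      also have "\<dots> \<le> (\<integral>\<^sup>+x. (absf f x - ennreal s) \<partial>lebesgue)"
        using s by (intro nn_integral_mono) (auto split: split_indicator simp: ennreal_minus intro!: ennreal_leI)
      also have "\<dots> = (\<integral>\<^sup>+x. (absf f x - ennreal s) \<partial>lborel)" by (rule nn_integral_completion)
      finally have "ennreal ((r - s) * t) + ennreal (t * s) \<le> ?C"
        using False t by (intro add_right_mono) (simp add: ennreal_mult)
      moreover have "ennreal ((r - s) * t) + ennreal (t * s) = ennreal (t * r)"
        using False t s by (subst ennreal_plus[symmetric]) (auto simp: algebra_simps)
      ultimately show ?thesis by simp
    qed
    then have "ennreal (1 / t) * ennreal (t * r) \<le> ennreal (1 / t) * ?C" by (intro mult_left_mono) auto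
    then show "x \<le> ennreal (1 / t) * ?C" using t r by (simp add: ennreal_mult[symmetric])
  qed
  then have "ennreal t * decreasing_rearrangement f t \<le> ennreal t * (ennreal (1 / t) * ?C)" by (intro mult_left_mono) auto
  then show "ennreal t * decreasing_rearrangement f t \<le> ?C"
    using t by (simp add: mult.assoc[symmetric] ennreal_mult[symmetric])
qed

text \<open>This bound replaces Hardy's inequality: the norm of the right-hand side is a geometric
  series of dilates of the rearrangement.\<close>

lemma kfun_le_rearrangement:
  assumes f: "f \<in> borel_measurable lebesgue" and t: "0 < t"
  shows "kfun t (absf f) \<le> (\<Sum>k. ennreal (2 * t * (1 / 2) ^ k) * decreasing_rearrangement f ((1 / 2) ^ k * t))"
proof (cases "\<exists>k. decreasing_rearrangement f ((1 / 2) ^ k * t) = top")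
  case True
  then obtain k where k: "decreasing_rearrangement f ((1 / 2) ^ k * t) = top" by blast
  define h where "h k = ennreal (2 * t * (1 / 2) ^ k) * decreasing_rearrangement f ((1 / 2) ^ k * t)" for k
  have "h k = top" using t k by (simp add: h_def ennreal_mult_top)
  then have "(\<Sum>k. h k) = top" using sum_le_suminf[of h "{k}"] by (simp add: top_unique)
  then show ?thesis by (simp add: h_def)
next
  case False
  note [measurable] = f sets_norm_gt[OF f]
  define a where "a k = enn2real (decreasing_rearrangement f ((1 / 2) ^ k * t))" for k
  have ea: "decreasing_rearrangement f ((1 / 2) ^ k * t) = ennreal (a k)" and a0: "0 \<le> a k" for k
    using False by (auto simp: a_def less_top)
  have em: "emeasure lebesgue {x. norm (f x) > a k} \<le> ennreal ((1 / 2) ^ k * t)" for k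
    unfolding a_def using False by (intro emeasure_rearrangement f) (auto simp: less_top)
  have amono: "a k \<le> a (Suc k)" for k
  proof -
    have "(1 / 2) ^ Suc k * t \<le> (1 / 2) ^ k * t" using t by simp
    then have "ennreal (a k) \<le> ennreal (a (Suc k))"
      unfolding ea[symmetric] using rearrangement_antimono by (simp add: antimono_def)
    then show ?thesis using a0 by (simp add: ennreal_le_iff)
  qed
  \<comment> \<open>A point above all levels lies in sets of measure at most 2^(-k) t for every
    k.\<close>
  have null: "AE x in lebesgue. \<exists>k. norm (f x) \<le> a k"
  proof -
    let ?N = "\<Inter>k. {x. norm (f x) > a k}"
    have N: "?N \<in> sets lebesgue" by measurable
    have "emeasure lebesgue ?N \<le> ennreal ((1 / 2) ^ k * t)" for k
      by (rule order_trans[OF emeasure_mono em[of k]]) auto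
    moreover have "(\<lambda>k. ennreal ((1 / 2) ^ k * t)) \<longlonglongrightarrow> ennreal (0 * t)"
      by (intro tendsto_ennrealI tendsto_mult_right LIMSEQ_realpow_zero) auto
    ultimately have "emeasure lebesgue ?N \<le> ennreal (0 * t)"
      by (intro LIMSEQ_le_const) auto
    then have "?N \<in> null_sets lebesgue" using N by (auto intro: null_setsI)
    then show ?thesis by (rule AE_I') (auto simp: not_le)
  qed
  have "kfun t (absf f) \<le> (\<integral>\<^sup>+x. (absf f x - ennreal (a 0)) \<partial>lebesgue) + ennreal (t * a 0)"
    unfolding nn_integral_completion using a0 by (rule kfun_le)
  \<comment> \<open>Take the least k with |f(x)| <= a k: for k = 0 there is no excess, and for k = j
    + 1 the j-th term alone dominates |f(x)|.\<close>
  also have "(\<integral>\<^sup>+x. (absf f x - ennreal (a 0)) \<partial>lebesgue) \<le>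
      (\<integral>\<^sup>+x. (\<Sum>k. ennreal (a (Suc k)) * indicator {x. norm (f x) > a k} x) \<partial>lebesgue)"
  proof (rule nn_integral_mono_AE)
    show "AE x in lebesgue. absf f x - ennreal (a 0) \<le> (\<Sum>k. ennreal (a (Suc k)) * indicator {x. norm (f x) > a k} x)"
      using null
    proof eventually_elim
      case (elim x)
      define k where "k = (LEAST k. norm (f x) \<le> a k)"
      have k: "norm (f x) \<le> a k" unfolding k_def using elim by (rule LeastI_ex)
      show ?case
      proof (cases k)
        case 0
        then show ?thesis using k by (simp add: ennreal_diff_eq_0 ennreal_leI)
      next
        case (Suc j)
        define h where "h k = ennreal (a (Suc k)) * indicator {x. norm (f x) > a k} x" for k
        have "\<not> norm (f x) \<le> a j" using not_less_Least[of j "\<lambda>k. norm (f x) \<le> a k"] Suc k_def by auto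
        then have "absf f x \<le> h j" using k Suc by (simp add: h_def ennreal_leI)
        also have "\<dots> \<le> (\<Sum>k. h k)" using sum_le_suminf[of h "{j}"] by simp
        finally have "absf f x \<le> (\<Sum>k. h k)" .
        with diff_le_self_ennreal[of "absf f x" "ennreal (a 0)"] show ?thesis unfolding h_def by (rule order_trans)
      qed
    qed
  qed
  also have "\<dots> = (\<Sum>k. ennreal (a (Suc k)) * emeasure lebesgue {x. norm (f x) > a k})"
    by (subst nn_integral_suminf) (auto simp: nn_integral_cmult_indicator)
  also have "\<dots> \<le> (\<Sum>k. ennreal (2 * t * (1 / 2) ^ Suc k) * ennreal (a (Suc k)))"
  proof (intro suminf_le)
    fix k
    have "ennreal (a (Suc k)) * emeasure lebesgue {x. norm (f x) > a k} \<le> ennreal (a (Suc k)) * ennreal ((1 / 2) ^ k * t)"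
      by (intro mult_left_mono em) auto
    then show "ennreal (a (Suc k)) * emeasure lebesgue {x. norm (f x) > a k} \<le> ennreal (2 * t * (1 / 2) ^ Suc k) * ennreal (a (Suc k))"
      by (simp add: mult_ac)
  qed auto
  also have "ennreal (t * a 0) \<le> ennreal (2 * t * (1 / 2) ^ 0) * ennreal (a 0)"
    using t a0 by (simp add: ennreal_mult[symmetric] ennreal_leI)
  finally have "kfun t (absf f) \<le> (\<Sum>k. ennreal (2 * t * (1 / 2) ^ Suc k) * ennreal (a (Suc k))) + ennreal (2 * t * (1 / 2) ^ 0) * ennreal (a 0)"
    by (simp add: add_mono)
  also have "\<dots> = (\<Sum>k. ennreal (2 * t * (1 / 2) ^ k) * ennreal (a k))"
    using suminf_offset[of "\<lambda>k. ennreal (2 * t * (1 / 2) ^ k) * ennreal (a k)" 1] by (simp add: add.commute)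
  finally show ?thesis by (simp add: ea)
qed

text \<open>The K-method norm with parameter \<theta> = 1 - 1/p: the weight t^(-\<theta>) is t^(1/p
  - 1).\<close>

definition lnorm :: "real \<Rightarrow> ennreal \<Rightarrow> (R3 \<Rightarrow> ennreal) \<Rightarrow> ennreal" where
  "lnorm p q g = log_norm q (\<lambda>t. ennreal (t powr (1 / p - 1)) * kfun t g)"

lemma lnorm_mono: "1 \<le> q \<Longrightarrow> AE x in lborel. g x \<le> h x \<Longrightarrow> lnorm p q g \<le> lnorm p q h"
  unfolding lnorm_def by (intro log_norm_mono mult_left_mono kfun_mono) auto

lemma lnorm_cmult:
  assumes "1 \<le> q" "0 \<le> c" "g \<in> borel_measurable borel"
  shows "lnorm p q (\<lambda>x. ennreal c * g x) = ennreal c * lnorm p q g"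
proof -
  have "lnorm p q (\<lambda>x. ennreal c * g x) = log_norm q (\<lambda>t. ennreal c * (ennreal (t powr (1 / p - 1)) * kfun t g))"
    unfolding lnorm_def using assms by (simp add: kfun_cmult mult_ac)
  then show ?thesis unfolding lnorm_def using assms by (simp add: log_norm_cmult)
qed

lemma lnorm_suminf:
  assumes q: "1 \<le> q" and g: "\<And>n. g n \<in> borel_measurable borel"
  shows "lnorm p q (\<lambda>x. \<Sum>n. g n x) \<le> (\<Sum>n. lnorm p q (g n))"
proof -
  have "lnorm p q (\<lambda>x. \<Sum>n. g n x) \<le> log_norm q (\<lambda>t. \<Sum>n. ennreal (t powr (1 / p - 1)) * kfun t (g n))"
    unfolding lnorm_def
  proof (rule log_norm_mono[OF q])
    fix t :: real assume "0 < t"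
    then have "ennreal (t powr (1 / p - 1)) * kfun t (\<lambda>x. \<Sum>n. g n x) \<le> ennreal (t powr (1 / p - 1)) * (\<Sum>n. kfun t (g n))"
      by (intro mult_left_mono kfun_suminf g) auto
    then show "ennreal (t powr (1 / p - 1)) * kfun t (\<lambda>x. \<Sum>n. g n x) \<le> (\<Sum>n. ennreal (t powr (1 / p - 1)) * kfun t (g n))"
      by simp
  qed
  also have "\<dots> \<le> (\<Sum>n. lnorm p q (g n))" unfolding lnorm_def by (intro log_norm_suminf q) measurable
  finally show ?thesis .
qed

text \<open>On [t, 2t] the K-functional is at least its value at t and the weight at least its value
  at 2t. The constant 4 is the 2 of \<open>log_norm_ge\<close> times the bound 2 for 2^(1 -
  1/p).\<close>

lemma kfun_le_lnorm:
  assumes p: "1 < p" and q: "1 \<le> q" and t: "0 < t"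
  shows "kfun t g \<le> ennreal (4 * t powr (1 - 1 / p)) * lnorm p q g"
proof -
  have "ennreal ((2 * t) powr (1 / p - 1)) * kfun t g \<le> 2 * lnorm p q g"
    unfolding lnorm_def
  proof (rule log_norm_ge[OF q t])
    fix s assume s: "t \<le> s" "s \<le> 2 * t"
    have "(2 * t) powr (1 / p - 1) \<le> s powr (1 / p - 1)"
      using p s t by (intro powr_mono2') (auto simp: field_simps)
    then show "ennreal ((2 * t) powr (1 / p - 1)) * kfun t g \<le> ennreal (s powr (1 / p - 1)) * kfun s g"
      using s by (intro mult_mono kfun_mono_left ennreal_leI) auto
  qed
  then have "ennreal ((2 * t) powr (1 - 1 / p)) * (ennreal ((2 * t) powr (1 / p - 1)) * kfun t g) \<le>
      ennreal ((2 * t) powr (1 - 1 / p)) * (2 * lnorm p q g)"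
    by (intro mult_left_mono) auto
  moreover have "ennreal ((2 * t) powr (1 - 1 / p)) * (ennreal ((2 * t) powr (1 / p - 1)) * kfun t g) = kfun t g"
    using t by (simp add: mult.assoc[symmetric] ennreal_mult[symmetric] powr_add[symmetric])
  moreover have "ennreal ((2 * t) powr (1 - 1 / p)) * (2 * lnorm p q g) \<le> ennreal (4 * t powr (1 - 1 / p)) * lnorm p q g"
  proof -
    have "2 powr (1 - 1 / p) \<le> 2 powr 1" using p by (intro powr_mono) auto
    then have "(2 * t) powr (1 - 1 / p) * 2 \<le> 4 * t powr (1 - 1 / p)"
      using t mult_right_mono[of "2 powr (1 - 1 / p)" 2 "2 * t powr (1 - 1 / p)"] by (simp add: powr_mult mult_ac)
    then have "ennreal ((2 * t) powr (1 - 1 / p) * 2) * lnorm p q g \<le> ennreal (4 * t powr (1 - 1 / p)) * lnorm p q g"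
      by (intro mult_right_mono ennreal_leI) auto
    then show ?thesis by (simp add: ennreal_mult mult.assoc)
  qed
  ultimately show ?thesis by simp
qed

text \<open>The norm of the indicator of a set of measure 1, whose K-functional is min 1 t.\<close>

definition lnorm_const :: "real \<Rightarrow> ennreal \<Rightarrow> ennreal" where
  "lnorm_const p q = log_norm q (\<lambda>t. ennreal (t powr (1 / p - 1) * min 1 t))"

lemma lnorm_const_finite:
  assumes p: "1 < p" and q: "1 \<le> q"
  shows "lnorm_const p q < top"
  unfolding lnorm_const_def infinity_ennreal_def[symmetric]
proof (rule log_norm_finite[OF q])
  fix t :: real assume t: "0 < t"
  have "t powr (1 / p - 1) * min 1 t \<le> 1"
  proof (cases "t \<le> 1")
    case True
    then have "t powr (1 / p - 1) * min 1 t = t powr (1 / p)" using t by (simp add: powr_diff)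
    also have "\<dots> \<le> 1 powr (1 / p)" using p t True by (intro powr_mono2) auto
    finally show ?thesis by simp
  next
    case False
    then have "t powr (1 / p - 1) \<le> t powr 0" using p by (intro powr_mono) (auto simp: field_simps)
    then show ?thesis using False by simp
  qed
  then show "ennreal (t powr (1 / p - 1) * min 1 t) \<le> 1" by simp
next
  have "(\<integral>\<^sup>+t. ennreal (t powr (1 / p - 1) * min 1 t) \<partial>log_measure) =
    (\<integral>\<^sup>+t. ennreal (t powr (- (1 - 1 / p)) * min 1 (t powr 1)) \<partial>log_measure)"
    by (intro nn_integral_cong_AE AE_log_measure) simp
  also have "\<dots> < \<infinity>" using p by (intro nn_integral_log_powr_min) (auto simp: field_simps)
  finally show "(\<integral>\<^sup>+t. ennreal (t powr (1 / p - 1) * min 1 t) \<partial>log_measure) < \<infinity>" .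
qed

text \<open>The two trivial splittings bound the K-functional by A T min(1, t/T), and the factor T
  is removed by dilation invariance of dt/t.\<close>

lemma lnorm_le:
  assumes p: "1 < p" and q: "1 \<le> q" and A: "0 \<le> A" "\<And>x. g x \<le> ennreal A"
    and T: "0 < T" "(\<integral>\<^sup>+x. g x \<partial>lborel) \<le> ennreal (A * T)"
  shows "lnorm p q g \<le> ennreal (A * T powr (1 / p)) * lnorm_const p q"
proof -
  let ?h = "\<lambda>t. ennreal (t powr (1 / p - 1) * min 1 t)"
  have "lnorm p q g \<le> log_norm q (\<lambda>t. ennreal (A * T powr (1 / p)) * ?h ((1 / T) * t))"
    unfolding lnorm_def
  proof (rule log_norm_mono[OF q])
    fix t :: real assume t: "0 < t"
    have "kfun t g \<le> ennreal (A * T)" using order_trans[OF kfun_le_integral T(2)] .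
    moreover have "kfun t g \<le> ennreal (t * A)" by (rule kfun_le_bound[OF A])
    ultimately have "kfun t g \<le> ennreal (A * T * min 1 ((1 / T) * t))"
      using T A by (auto simp: min_def mult_ac)
    then have "ennreal (t powr (1 / p - 1)) * kfun t g \<le> ennreal (t powr (1 / p - 1)) * ennreal (A * T * min 1 ((1 / T) * t))"
      by (intro mult_left_mono) auto
    also have "\<dots> = ennreal (t powr (1 / p - 1) * (A * T * min 1 ((1 / T) * t)))"
      using A T t by (simp add: ennreal_mult')
    also have "t powr (1 / p - 1) * (A * T * min 1 ((1 / T) * t)) =
        A * T powr (1 / p) * (((1 / T) * t) powr (1 / p - 1) * min 1 ((1 / T) * t))"
    proof -
      have "t powr (1 / p - 1) * T = T powr (1 / p) * ((1 / T) * t) powr (1 / p - 1)"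
        using t T by (simp add: powr_divide powr_diff)
      then show ?thesis by (simp add: mult_ac)
    qed
    also have "ennreal \<dots> = ennreal (A * T powr (1 / p)) * ?h ((1 / T) * t)"
      using A T t by (intro ennreal_mult) auto
    finally show "ennreal (t powr (1 / p - 1)) * kfun t g \<le> ennreal (A * T powr (1 / p)) * ?h ((1 / T) * t)" .
  qed
  also have "\<dots> = ennreal (A * T powr (1 / p)) * log_norm q (\<lambda>t. ?h ((1 / T) * t))"
    by (intro log_norm_cmult q) measurable
  also have "log_norm q (\<lambda>t. ?h ((1 / T) * t)) = lnorm_const p q"
    unfolding lnorm_const_def by (rule log_norm_dilate) (use T in auto)
  finally show ?thesis .
qed

text \<open>Amplitude and volume contribute l * l^(-3) = l^(-2), which is exactly how the weight
  t^(1/3 - 1) changes under the substitution of l^3 t for t.\<close>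

lemma lnorm_scale_invariant:
  assumes q: "1 \<le> q" and [measurable]: "g \<in> borel_measurable borel" and l: "0 < l"
  shows "lnorm 3 q (\<lambda>x. ennreal l * g (l *\<^sub>R x + a)) = lnorm 3 q g"
proof -
  have "ennreal (t powr (1 / 3 - 1)) * kfun t (\<lambda>x. ennreal l * g (l *\<^sub>R x + a)) =
      ennreal ((l ^ 3 * t) powr (1 / 3 - 1)) * kfun (l ^ 3 * t) g" if t: "0 < t" for t
  proof -
    have "kfun t (\<lambda>x. ennreal l * g (l *\<^sub>R x + a)) = ennreal l * kfun t (\<lambda>x. g (l *\<^sub>R x + a))"
      using l by (intro kfun_cmult) auto
    also have "\<dots> = ennreal l * (ennreal (1 / l ^ 3) * kfun (l ^ 3 * t) g)"
      by (simp add: kfun_affine l)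
    also have "\<dots> = ennreal (1 / l ^ 2) * kfun (l ^ 3 * t) g"
      using l by (simp add: mult.assoc[symmetric] ennreal_mult[symmetric] power2_eq_square power3_eq_cube)
    finally have "ennreal (t powr (1 / 3 - 1)) * kfun t (\<lambda>x. ennreal l * g (l *\<^sub>R x + a)) =
        ennreal (t powr (1 / 3 - 1) * (1 / l ^ 2)) * kfun (l ^ 3 * t) g"
      using ennreal_mult[of "t powr (1 / 3 - 1)" "1 / l ^ 2"] by (simp add: mult.assoc)
    also have "t powr (1 / 3 - 1) * (1 / l ^ 2) = (l ^ 3 * t) powr (1 / 3 - 1)"
    proof -
      have "(l ^ 3) powr (1 / 3 - 1) = (l powr 3) powr (1 / 3 - 1)" using l by simp
      also have "\<dots> = l powr (- 2)" by (simp add: powr_powr)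
      also have "\<dots> = 1 / l ^ 2" using l by (simp add: powr_minus_divide)
      finally have "(l ^ 3) powr (1 / 3 - 1) = 1 / l ^ 2" .
      then show ?thesis using t l by (simp only: powr_mult mult.commute)
    qed
    finally show ?thesis .
  qed
  then have "lnorm 3 q (\<lambda>x. ennreal l * g (l *\<^sub>R x + a)) = log_norm q (\<lambda>t. ennreal ((l ^ 3 * t) powr (1 / 3 - 1)) * kfun (l ^ 3 * t) g)"
    unfolding lnorm_def by (intro antisym log_norm_mono q) auto
  also have "\<dots> = lnorm 3 q g"
    unfolding lnorm_def by (rule log_norm_dilate) (use l in auto)
  finally show ?thesis .
qed

text \<open>A finite norm makes the K-functional grow more slowly than t. For large t some level of
  finite cost therefore lies below the given s, and the excess over s is smaller still.\<close>

lemma lnorm_truncation_finite: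
  assumes p: "1 < p" and q: "1 \<le> q" and fin: "lnorm p q g < top" and s: "0 < s"
  shows "(\<integral>\<^sup>+x. (g x - ennreal s) \<partial>lborel) < top"
proof -
  define L where "L = enn2real (lnorm p q g)"
  \<comment> \<open>Then t^(1/p) exceeds 4L/s, so the bound 4 t^(1 - 1/p) L of
    \<open>kfun_le_lnorm\<close> is below t s.\<close>
  define t where "t = (4 * L / s + 1) powr p"
  have L: "0 \<le> L" "lnorm p q g = ennreal L" using fin by (auto simp: L_def)
  have b: "0 < 4 * L / s + 1" using L s by (simp add: add_nonneg_pos)
  have t: "0 < t" using b by (simp add: t_def)
  have "t powr (1 / p) = 4 * L / s + 1" using p b by (simp add: t_def powr_powr)
  then have "4 * L < s * t powr (1 / p)" using s by (simp add: field_simps)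
  then have "4 * L * t powr (1 - 1 / p) < s * t powr (1 / p) * t powr (1 - 1 / p)"
    using t by (intro mult_strict_right_mono) auto
  also have "\<dots> = t * s" using t by (simp add: powr_add[symmetric])
  finally have "4 * t powr (1 - 1 / p) * L < t * s" by (simp add: mult_ac)
  then have "ennreal (4 * t powr (1 - 1 / p)) * lnorm p q g < ennreal (t * s)"
    using L t s by (simp add: ennreal_mult[symmetric] ennreal_less_iff)
  then have "kfun t g < ennreal (t * s)" using kfun_le_lnorm[OF p q t] by (rule order_le_less_trans[rotated])
  then obtain r where r: "0 \<le> r" "(\<integral>\<^sup>+x. (g x - ennreal r) \<partial>lborel) + ennreal (t * r) < ennreal (t * s)"
    using kfun_lessD by blast
  have "ennreal (t * r) \<le> (\<integral>\<^sup>+x. (g x - ennreal r) \<partial>lborel) + ennreal (t * r)" by (rule add_increasing) auto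
  also note r(2)
  finally have "ennreal (t * r) < ennreal (t * s)" .
  then have "r < s" using t r by (simp add: ennreal_less_iff)
  then have "(\<integral>\<^sup>+x. (g x - ennreal s) \<partial>lborel) \<le> (\<integral>\<^sup>+x. (g x - ennreal r) \<partial>lborel)"
    by (intro nn_integral_mono ennreal_mono_minus ennreal_leI) auto
  also have "\<dots> \<le> (\<integral>\<^sup>+x. (g x - ennreal r) \<partial>lborel) + ennreal (t * r)" by simp
  also have "\<dots> < top" using r(2) by (metis ennreal_less_top order.strict_trans)
  finally show ?thesis .
qed

text \<open>Dominated convergence is used twice: in x at a fixed positive level, where the excess of
  g is an integrable majorant, and in t with the K-functional of g as majorant. The integral in t is
  where q < \<infinity> enters.\<close>

lemma lnorm_dominated_convergence:
  assumes p: "1 < p" and q: "1 \<le> q" "q \<noteq> \<infinity>"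
    and [measurable]: "\<And>n. f n \<in> borel_measurable borel" "g \<in> borel_measurable borel"
    and le: "\<And>n. AE x in lborel. f n x \<le> g x" and fin: "lnorm p q g < top"
    and lim: "AE x in lborel. (\<lambda>n. f n x) \<longlonglongrightarrow> 0"
  shows "(\<lambda>n. lnorm p q (f n)) \<longlonglongrightarrow> 0"
proof -
  define r where "r = enn2real q"
  have r: "1 \<le> r" using q enn2real_ge_1 by (simp add: r_def)
  have k: "(\<lambda>n. kfun t (f n)) \<longlonglongrightarrow> 0" if t: "0 < t" for t
  proof (rule order_tendstoI)
    fix e :: ennreal assume "0 < e"
    then obtain e1 where e1: "0 < e1" "e1 < e" using dense by blast
    then have "e1 < top" using order_less_le_trans top_greatest by blast
    then obtain d where d: "e1 = ennreal d" "0 \<le> d" by (cases e1) auto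
    then have d0: "0 < d" using e1 by (cases "d = 0") auto
    define s where "s = d / (2 * t)"
    have s: "0 < s" using d0 t by (simp add: s_def)
    have "(\<lambda>n. \<integral>\<^sup>+x. (f n x - ennreal s) \<partial>lborel) \<longlonglongrightarrow> (\<integral>\<^sup>+x. 0 \<partial>(lborel :: R3 measure))"
    proof (rule nn_integral_dominated_convergence[where w="\<lambda>x. g x - ennreal s"])
      show "AE x in lborel. f n x - ennreal s \<le> g x - ennreal s" for n
        using le[of n] by eventually_elim (auto intro: ennreal_minus_mono)
      show "(\<integral>\<^sup>+x. (g x - ennreal s) \<partial>lborel) < \<infinity>" using lnorm_truncation_finite[OF p q(1) fin s] by simp
      show "AE x in lborel. (\<lambda>n. f n x - ennreal s) \<longlonglongrightarrow> 0"
        using lim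
      proof eventually_elim
        case (elim x)
        show ?case by (rule tendsto_sandwich[OF _ _ tendsto_const elim]) auto
      qed
    qed auto
    then have "(\<lambda>n. \<integral>\<^sup>+x. (f n x - ennreal s) \<partial>lborel) \<longlonglongrightarrow> 0" by simp
    moreover have "0 < ennreal (d / 2)" using d0 by simp
    ultimately have "\<forall>\<^sub>F n in sequentially. (\<integral>\<^sup>+x. (f n x - ennreal s) \<partial>lborel) < ennreal (d / 2)"
      by (rule order_tendstoD)
    then show "\<forall>\<^sub>F n in sequentially. kfun t (f n) < e"
    proof eventually_elim
      case (elim n)
      have "kfun t (f n) \<le> (\<integral>\<^sup>+x. (f n x - ennreal s) \<partial>lborel) + ennreal (t * s)"
        using s by (intro kfun_le) auto
      also have "\<dots> \<le> ennreal (d / 2) + ennreal (d / 2)"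
        using elim t by (intro add_mono) (auto simp: s_def less_imp_le)
      also have "\<dots> = ennreal d" using d0 by (subst ennreal_plus[symmetric]) auto
      finally show ?case using e1 d by (simp add: order_le_less_trans)
    qed
  qed auto
  let ?H = "\<lambda>f t. ennpowr (ennreal (t powr (1 / p - 1)) * kfun t f) r"
  have "(\<lambda>n. \<integral>\<^sup>+t. ?H (f n) t \<partial>log_measure) \<longlonglongrightarrow> (\<integral>\<^sup>+t. 0 \<partial>log_measure)"
  proof (rule nn_integral_dominated_convergence[where w="?H g"])
    show "AE t in log_measure. ?H (f n) t \<le> ?H g t" for n
      using r le by (intro AE_log_measure ennpowr_mono mult_left_mono kfun_mono) auto
    have "lq_norm log_measure r (\<lambda>t. ennreal (t powr (1 / p - 1)) * kfun t g) < top"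
      using fin q by (simp add: lnorm_def log_norm_def r_def)
    then show "(\<integral>\<^sup>+t. ?H g t \<partial>log_measure) < \<infinity>"
      by (simp add: lq_norm_def less_top[symmetric])
    show "AE t in log_measure. (\<lambda>n. ?H (f n) t) \<longlonglongrightarrow> 0"
    proof (rule AE_log_measure)
      fix t :: real assume "0 < t"
      have "(\<lambda>n. ennreal (t powr (1 / p - 1)) * kfun t (f n)) \<longlonglongrightarrow> ennreal (t powr (1 / p - 1)) * 0"
        by (intro tendsto_mult_ennreal tendsto_const k \<open>0 < t\<close>) auto
      then show "(\<lambda>n. ?H (f n) t) \<longlonglongrightarrow> 0" using r by (intro ennpowr_tendsto_0) auto
    qed
  qed (measurable; simp)+
  then have "(\<lambda>n. ennpowr (\<integral>\<^sup>+t. ?H (f n) t \<partial>log_measure) (1 / r)) \<longlonglongrightarrow> 0"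
    using r by (intro ennpowr_tendsto_0) auto
  then show ?thesis using q by (simp add: lnorm_def log_norm_def lq_norm_def r_def)
qed

section \<open>Equivalence with the Lorentz quasinorm\<close>

definition quasinorm_const :: "real \<Rightarrow> ennreal \<Rightarrow> ennreal" where
  "quasinorm_const p q = (if q = \<infinity> then 1 else ennpowr (ennreal (enn2real q / p)) (1 / enn2real q))"

lemma lorentz_quasinorm_eq:
  assumes p: "1 < p" and q: "1 \<le> q"
  shows "lorentz_quasinorm p q f = quasinorm_const p q * log_norm q (\<lambda>t. ennreal (t powr (1 / p)) * decreasing_rearrangement f t)"
proof (cases "q = \<infinity>")
  case False
  have "(\<integral>\<^sup>+ t\<in>{0<..}. ennpowr (ennreal (t powr (1 / p)) * decreasing_rearrangement f t) (enn2real q)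
            * ennreal (1 / t) \<partial>lborel) =
     (\<integral>\<^sup>+ t. ennpowr (ennreal (t powr (1 / p)) * decreasing_rearrangement f t) (enn2real q) \<partial>log_measure)"
    by (rule nn_integral_log_measure[symmetric]) measurable
  then show ?thesis using False enn2real_ge_1[OF q False]
    by (simp add: lorentz_quasinorm_def quasinorm_const_def log_norm_def lq_norm_def ennpowr_mult)
qed (simp add: lorentz_quasinorm_def quasinorm_const_def log_norm_def)

lemma quasinorm_const_pos:
  assumes "1 < p" "1 \<le> q" shows "\<exists>\<kappa>>0. quasinorm_const p q = ennreal \<kappa>"
proof (cases "q = \<infinity>")
  case True
  then show ?thesis by (intro exI[of _ 1]) (simp add: quasinorm_const_def)
next
  case False
  then show ?thesis using enn2real_ge_1[OF assms(2) False] assms(1)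
    by (intro exI[of _ "(enn2real q / p) powr (1 / enn2real q)"]) (simp add: quasinorm_const_def ennpowr_ennreal)
qed

lemma lorentz_quasinorm_equiv:
  assumes p: "1 < p" and q: "1 \<le> q"
  shows "\<exists>c>0. \<exists>C>0. \<forall>f\<in>borel_measurable lebesgue.
    ennreal c * lorentz_quasinorm p q f \<le> lnorm p q (absf f) \<and> lnorm p q (absf f) \<le> ennreal C * lorentz_quasinorm p q f"
proof -
  obtain \<kappa> where \<kappa>: "0 < \<kappa>" "quasinorm_const p q = ennreal \<kappa>" using quasinorm_const_pos[OF p q] by blast
  \<comment> \<open>The k-th dilate in \<open>kfun_le_rearrangement\<close> contributes 2 * 2^(-k) *
    2^(k/p) = 2 \<rho>^k. The series converges since p > 1, with sum \<open>D\<close>.\<close>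
  define \<rho> where "\<rho> = (2::real) powr (1 / p - 1)"
  have \<rho>: "0 < \<rho>" "\<rho> < 1"
  proof -
    have "(2::real) powr (1 / p - 1) < 2 powr 0" using p by (intro powr_less_mono) (auto simp: field_simps)
    then show "0 < \<rho>" "\<rho> < 1" by (auto simp: \<rho>_def)
  qed
  define D where "D = 2 / (1 - \<rho>)"
  have D: "0 < D" using \<rho> by (simp add: D_def)
  let ?W = "\<lambda>f t. ennreal (t powr (1 / p)) * decreasing_rearrangement f t"
  have low: "log_norm q (?W f) \<le> lnorm p q (absf f)" if f: "f \<in> borel_measurable lebesgue" for f
    unfolding lnorm_def
  proof (rule log_norm_mono[OF q])
    fix t :: real assume t: "0 < t"
    have "?W f t = ennreal (t powr (1 / p - 1)) * (ennreal t * decreasing_rearrangement f t)"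
      using t by (simp add: mult.assoc[symmetric] ennreal_mult[symmetric] powr_diff)
    also have "\<dots> \<le> ennreal (t powr (1 / p - 1)) * kfun t (absf f)"
      by (intro mult_left_mono rearrangement_le_kfun f t) auto
    finally show "?W f t \<le> ennreal (t powr (1 / p - 1)) * kfun t (absf f)" .
  qed
  have up: "lnorm p q (absf f) \<le> ennreal D * log_norm q (?W f)" if f: "f \<in> borel_measurable lebesgue" for f
  proof -
    have "lnorm p q (absf f) \<le> log_norm q (\<lambda>t. \<Sum>k. ennreal (2 * \<rho> ^ k) * ?W f ((1 / 2) ^ k * t))"
      unfolding lnorm_def
    proof (rule log_norm_mono[OF q])
      fix t :: real assume t: "0 < t"
      have "ennreal (t powr (1 / p - 1)) * kfun t (absf f) \<le>
         ennreal (t powr (1 / p - 1)) * (\<Sum>k. ennreal (2 * t * (1 / 2) ^ k) * decreasing_rearrangement f ((1 / 2) ^ k * t))"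
        by (intro mult_left_mono kfun_le_rearrangement f t) auto
      also have "\<dots> = (\<Sum>k. ennreal (t powr (1 / p - 1)) * (ennreal (2 * t * (1 / 2) ^ k) * decreasing_rearrangement f ((1 / 2) ^ k * t)))"
        by simp
      also have "\<dots> = (\<Sum>k. ennreal (2 * \<rho> ^ k) * ?W f ((1 / 2) ^ k * t))"
      proof (intro suminf_cong)
        fix k
        have "\<rho> * (1 / 2) powr (1 / p) = 1 / 2"
          by (simp add: \<rho>_def powr_diff powr_divide)
        moreover have "((1 / 2 :: real) ^ k) powr (1 / p) = ((1 / 2) powr (1 / p)) ^ k"
          by (simp add: powr_realpow[symmetric] powr_powr mult.commute)
        ultimately have "\<rho> ^ k * ((1 / 2) ^ k) powr (1 / p) = (1 / 2) ^ k"
          by (metis power_mult_distrib)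
        moreover have "2 * \<rho> ^ k * ((1 / 2) ^ k * t) powr (1 / p) = 2 * t powr (1 / p) * (\<rho> ^ k * ((1 / 2) ^ k) powr (1 / p))"
          using t by (simp add: powr_mult)
        moreover have "t powr (1 / p - 1) * (2 * t * (1 / 2) ^ k) = 2 * t powr (1 / p) * (1 / 2) ^ k"
          using t by (simp add: powr_diff)
        ultimately have "t powr (1 / p - 1) * (2 * t * (1 / 2) ^ k) = 2 * \<rho> ^ k * ((1 / 2) ^ k * t) powr (1 / p)"
          by simp
        then have "ennreal (t powr (1 / p - 1)) * ennreal (2 * t * (1 / 2) ^ k) = ennreal (2 * \<rho> ^ k) * ennreal (((1 / 2) ^ k * t) powr (1 / p))"
          using t \<rho> by (simp only: ennreal_mult'[symmetric] ennreal_mult[symmetric] powr_ge_zero)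
            (simp add: ennreal_mult[symmetric])?
        then show "ennreal (t powr (1 / p - 1)) * (ennreal (2 * t * (1 / 2) ^ k) * decreasing_rearrangement f ((1 / 2) ^ k * t)) =
          ennreal (2 * \<rho> ^ k) * ?W f ((1 / 2) ^ k * t)"
          by (simp only: mult.assoc[symmetric])
      qed
      finally show "ennreal (t powr (1 / p - 1)) * kfun t (absf f) \<le> (\<Sum>k. ennreal (2 * \<rho> ^ k) * ?W f ((1 / 2) ^ k * t))" .
    qed
    also have "\<dots> \<le> (\<Sum>k. log_norm q (\<lambda>t. ennreal (2 * \<rho> ^ k) * ?W f ((1 / 2) ^ k * t)))"
      by (intro log_norm_suminf q) measurable
    also have "\<dots> = (\<Sum>k. ennreal (2 * \<rho> ^ k) * log_norm q (?W f))"
    proof (intro suminf_cong)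
      fix k
      have "log_norm q (\<lambda>t. ?W f ((1 / 2) ^ k * t)) = log_norm q (?W f)"
        by (rule log_norm_dilate) auto
      moreover have "log_norm q (\<lambda>t. ennreal (2 * \<rho> ^ k) * ?W f ((1 / 2) ^ k * t)) = ennreal (2 * \<rho> ^ k) * log_norm q (\<lambda>t. ?W f ((1 / 2) ^ k * t))"
        by (intro log_norm_cmult q) measurable
      ultimately show "log_norm q (\<lambda>t. ennreal (2 * \<rho> ^ k) * ?W f ((1 / 2) ^ k * t)) = ennreal (2 * \<rho> ^ k) * log_norm q (?W f)"
        by simp
    qed
    also have "\<dots> = (\<Sum>k. ennreal (2 * \<rho> ^ k)) * log_norm q (?W f)" by simp
    also have "(\<Sum>k. ennreal (2 * \<rho> ^ k)) = ennreal D"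
      using \<rho> sums_mult[OF geometric_sums[of \<rho>], of 2] by (intro suminf_ennreal_eq) (auto simp: D_def)
    finally show ?thesis .
  qed
  show ?thesis
  proof (intro exI conjI ballI)
    show "0 < 1 / \<kappa>" "0 < D / \<kappa>" using \<kappa> D by auto
    fix f :: fn assume f: "f \<in> borel_measurable lebesgue"
    have Q: "lorentz_quasinorm p q f = ennreal \<kappa> * log_norm q (?W f)" using lorentz_quasinorm_eq[OF p q] \<kappa> by simp
    show "ennreal (1 / \<kappa>) * lorentz_quasinorm p q f \<le> lnorm p q (absf f)"
      using low[OF f] \<kappa> by (simp add: Q mult.assoc[symmetric] ennreal_mult[symmetric])
    show "lnorm p q (absf f) \<le> ennreal (D / \<kappa>) * lorentz_quasinorm p q f"
      using up[OF f] \<kappa> D by (simp add: Q mult.assoc[symmetric] ennreal_mult[symmetric])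
  qed
qed


section \<open>Function norms and the Riesz--Fischer theorem\<close>



lemma decay_neq_0 [simp]: "decay x \<noteq> 0"
  using decay_pos(1)[of x] by linarith

text \<open>Shared by \<open>lnorm\<close> and the weighted L^2 norm. The last axiom embeds the
  space in weighted L^1; finiteness almost everywhere, definiteness and integrability against
  \<open>decay\<close> are drawn from it.\<close>

locale function_norm =
  fixes \<rho> :: "(R3 \<Rightarrow> ennreal) \<Rightarrow> ennreal" and B :: real
  assumes mono: "\<And>g h. g \<in> borel_measurable borel \<Longrightarrow> h \<in> borel_measurable borel \<Longrightarrow>
      AE x in lborel. g x \<le> h x \<Longrightarrow> \<rho> g \<le> \<rho> h"
    and suminf: "\<And>g. (\<And>n::nat. g n \<in> borel_measurable borel) \<Longrightarrow> \<rho> (\<lambda>x. \<Sum>n. g n x) \<le> (\<Sum>n. \<rho> (g n))"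
    and cmult: "\<And>c g. 0 \<le> c \<Longrightarrow> g \<in> borel_measurable borel \<Longrightarrow> \<rho> (\<lambda>x. ennreal c * g x) = ennreal c * \<rho> g"
    and decay_bound: "\<And>g. g \<in> borel_measurable borel \<Longrightarrow>
      (\<integral>\<^sup>+x. g x * ennreal (decay x) \<partial>lborel) \<le> ennreal B * \<rho> g"
begin

lemma zero: "\<rho> (\<lambda>x. 0) = 0"
  using cmult[of 0 "\<lambda>x. 0"] by simp



lemma add:
  assumes [measurable]: "g \<in> borel_measurable borel" "h \<in> borel_measurable borel"
  shows "\<rho> (\<lambda>x. g x + h x) \<le> \<rho> g + \<rho> h"
proof -
  define F where "F n = (if n = (0::nat) then g else if n = 1 then h else (\<lambda>x. 0))" for n
  have "(\<Sum>n. F n x) = (\<Sum>n\<in>{0,1}. F n x)" for x by (rule suminf_finite) (auto simp: F_def)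
  then have 1: "(\<lambda>x. \<Sum>n. F n x) = (\<lambda>x. g x + h x)" by (auto simp: F_def)
  have 2: "(\<Sum>n. \<rho> (F n)) = (\<Sum>n\<in>{0,1}. \<rho> (F n))" by (rule suminf_finite) (auto simp: F_def zero)
  have "\<rho> (\<lambda>x. \<Sum>n. F n x) \<le> (\<Sum>n. \<rho> (F n))" by (rule suminf) (auto simp: F_def)
  then show ?thesis unfolding 1 2 by (simp add: F_def)
qed

lemma norm_add:
  assumes [measurable]: "f \<in> borel_measurable borel" "g \<in> borel_measurable borel"
  shows "\<rho> (absf (\<lambda>x. f x + g x)) \<le> \<rho> (absf f) + \<rho> (absf g)"
proof -
  have "\<rho> (absf (\<lambda>x. f x + g x)) \<le> \<rho> (\<lambda>x. absf f x + absf g x)"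
    by (intro mono) (auto intro!: AE_I2 simp: ennreal_plus[symmetric] norm_triangle_ineq simp del: ennreal_plus)
  also have "\<dots> \<le> \<rho> (absf f) + \<rho> (absf g)" by (rule add) measurable
  finally show ?thesis .
qed

lemma norm_cmult:
  "f \<in> borel_measurable borel \<Longrightarrow> \<rho> (absf (\<lambda>x. c * f x)) = ennreal (norm c) * \<rho> (absf f)"
  using cmult[of "norm c" "absf f"] by (simp add: norm_mult ennreal_mult)

lemma norm_diff:
  assumes [measurable]: "f \<in> borel_measurable borel" "g \<in> borel_measurable borel"
  shows "\<rho> (absf (\<lambda>x. f x - g x)) \<le> \<rho> (absf f) + \<rho> (absf g)"
  using norm_add[OF assms(1), of "\<lambda>x. - 1 * g x"] norm_cmult[OF assms(2), of "- 1"] by simp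

lemma AE_finite:
  assumes [measurable]: "g \<in> borel_measurable borel" and fin: "\<rho> g < top"
  shows "AE x in lborel. g x < top"
proof -
  have "(\<integral>\<^sup>+x. g x * ennreal (decay x) \<partial>lborel) < top"
    using order_le_less_trans[OF decay_bound[OF assms(1)]] fin by (simp add: ennreal_mult_less_top)
  then have "AE x in lborel. g x * ennreal (decay x) \<noteq> \<infinity>"
    by (intro nn_integral_noteq_infinite) auto
  then show ?thesis by eventually_elim (auto simp: ennreal_mult_eq_top_iff less_top)
qed

lemma AE_zero:
  assumes [measurable]: "g \<in> borel_measurable borel" and z: "\<rho> g = 0"
  shows "AE x in lborel. g x = 0"
proof -
  have "(\<integral>\<^sup>+x. g x * ennreal (decay x) \<partial>lborel) = 0" using decay_bound[OF assms(1)] z by simp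
  then have "AE x in lborel. g x * ennreal (decay x) = 0" by (subst (asm) nn_integral_0_iff_AE) auto
  then show ?thesis by eventually_elim auto
qed

lemma integrable_decay_mult:
  assumes [measurable]: "u \<in> borel_measurable borel" and fin: "\<rho> (absf u) < top"
  shows "integrable lborel (\<lambda>x. u x * of_real (decay x))"
proof (rule integrableI_bounded)
  have "(\<integral>\<^sup>+x. ennreal (norm (u x * of_real (decay x))) \<partial>lborel) = (\<integral>\<^sup>+x. absf u x * ennreal (decay x) \<partial>lborel)"
    by (intro nn_integral_cong) (simp add: norm_mult ennreal_mult)
  also have "\<dots> < \<infinity>"
    using order_le_less_trans[OF decay_bound[of "absf u"]] fin by (simp add: ennreal_mult_less_top)
  finally show "(\<integral>\<^sup>+x. ennreal (norm (u x * of_real (decay x))) \<partial>lborel) < \<infinity>" .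
qed auto

text \<open>A rapidly convergent subsequence has telescoping differences whose absolute values are
  summable almost everywhere. Countable subadditivity bounds the tails and takes the place of a
  Fatou property.\<close>

theorem riesz_fischer:
  assumes F [measurable]: "\<And>n. F n \<in> borel_measurable borel" and fin: "\<And>n. \<rho> (absf (F n)) < top"
    and cauchy: "\<And>e::real. 0 < e \<Longrightarrow> \<exists>M. \<forall>m\<ge>M. \<forall>n\<ge>M. \<rho> (absf (\<lambda>x. F m x - F n x)) < ennreal e"
  obtains f where "f \<in> borel_measurable borel" "\<rho> (absf f) < top"
    "(\<lambda>n. \<rho> (absf (\<lambda>x. F n x - f x))) \<longlonglongrightarrow> 0"
proof -
  have "\<exists>M. \<forall>k. \<forall>m\<ge>M k. \<forall>n\<ge>M k. \<rho> (absf (\<lambda>x. F m x - F n x)) < ennreal (1 / 2 ^ Suc k)"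
    by (intro choice allI cauchy) auto
  then obtain M where M: "\<And>k m n. M k \<le> m \<Longrightarrow> M k \<le> n \<Longrightarrow> \<rho> (absf (\<lambda>x. F m x - F n x)) < ennreal (1 / 2 ^ Suc k)"
    by metis
  \<comment> \<open>Partial sums of \<open>M\<close> make both \<open>r k\<close> and
    \<open>r (Suc k)\<close> at least \<open>M k\<close>.\<close>
  define r where "r k = (\<Sum>i\<le>k. M i)" for k
  have r: "M k \<le> r k" "M k \<le> r (Suc k)" for k
    unfolding r_def using member_le_sum[of k "{..k}" M] member_le_sum[of k "{..Suc k}" M] by simp_all
  define d where "d k x = F (r (Suc k)) x - F (r k) x" for k x
  have [measurable]: "d k \<in> borel_measurable borel" for k unfolding d_def by measurable
  have d_le: "\<rho> (absf (d k)) \<le> ennreal (1 / 2 ^ Suc k)" for k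
    using M[OF r(2) r(1), of k] by (simp add: d_def[abs_def])
  \<comment> \<open>Where the subsequence diverges \<open>lim\<close> has an arbitrary value;
    \<open>ae\<close> shows that such points form a null set.\<close>
  define f where "f x = lim (\<lambda>k. F (r k) x)" for x
  have [measurable]: "f \<in> borel_measurable borel" unfolding f_def by measurable
  \<comment> \<open>The j-th tail of the telescoping series, which dominates |F (r j) - f| wherever
    \<open>G 0\<close> is finite.\<close>
  define G where "G j x = (\<Sum>k. absf (d (k + j)) x)" for j x
  have [measurable]: "G j \<in> borel_measurable borel" for j unfolding G_def by measurable
  have G: "\<rho> (G j) \<le> ennreal (1 / 2 ^ j)" for j
  proof -
    have "\<rho> (G j) \<le> (\<Sum>k. \<rho> (absf (d (k + j))))" unfolding G_def by (rule suminf) measurable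
    also have "\<dots> \<le> (\<Sum>k. ennreal ((1 / 2 ^ j) / 2 ^ Suc k))"
      using d_le[of "_ + j"] by (intro suminf_le) (auto simp: power_add mult_ac)
    also have "\<dots> = ennreal (1 / 2 ^ j)" by (rule suminf_ennreal_half) simp
    finally show ?thesis .
  qed
  have tel: "F (r n) x = F (r j) x + (\<Sum>k<n - j. d (k + j) x)" if "j \<le> n" for n j x
    using that
  proof (induction n rule: dec_induct)
    case base
    then show ?case by simp
  next
    case (step n)
    then have "Suc n - j = Suc (n - j)" "n - j + j = n" by auto
    then show ?case using step by (simp add: d_def)
  qed
  have pw: "absf (\<lambda>x. F (r j) x - f x) x \<le> G j x" if G0: "G 0 x < top" for x j
  proof -
    have "(\<Sum>k. absf (d k) x) \<noteq> top" using G0 by (simp add: G_def)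
    then have sn: "summable (\<lambda>k. norm (d k x))" by (intro summable_suminf_not_top) auto
    then have sd: "summable (\<lambda>k. d k x)" by (rule summable_norm_cancel)
    then have "(\<lambda>n. F (r 0) x + (\<Sum>k<n. d k x)) \<longlonglongrightarrow> F (r 0) x + (\<Sum>k. d k x)"
      by (intro tendsto_intros summable_LIMSEQ)
    moreover have "(\<lambda>n. F (r 0) x + (\<Sum>k<n. d k x)) = (\<lambda>n. F (r n) x)"      by (rule ext, subst tel[OF le0]) (simp only: minus_nat.diff_0 add_0_right)
    ultimately have lm: "(\<lambda>n. F (r n) x) \<longlonglongrightarrow> F (r 0) x + (\<Sum>k. d k x)" by (simp only:)
    then have fl: "(\<lambda>n. F (r n) x) \<longlonglongrightarrow> f x" unfolding f_def limI[OF lm] .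
    have snj: "summable (\<lambda>k. norm (d (k + j) x))" using sn by (rule summable_ignore_initial_segment)
    have "norm (F (r j) x - f x) \<le> (\<Sum>k. norm (d (k + j) x))"
    proof (rule Lim_norm_ubound[of sequentially])
      show "(\<lambda>n. F (r j) x - F (r n) x) \<longlonglongrightarrow> F (r j) x - f x" by (intro tendsto_intros fl)
      show "\<forall>\<^sub>F n in sequentially. norm (F (r j) x - F (r n) x) \<le> (\<Sum>k. norm (d (k + j) x))"
        using eventually_ge_at_top[of j]
      proof eventually_elim
        case (elim n)
        have "norm (F (r j) x - F (r n) x) = norm (\<Sum>k<n - j. d (k + j) x)" using tel[OF elim, of x] by simp
        also have "\<dots> \<le> (\<Sum>k<n - j. norm (d (k + j) x))" by (rule norm_sum)
        also have "\<dots> \<le> (\<Sum>k. norm (d (k + j) x))" by (intro sum_le_suminf snj) auto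
        finally show ?case .
      qed
    qed auto
    then have "absf (\<lambda>x. F (r j) x - f x) x \<le> ennreal (\<Sum>k. norm (d (k + j) x))" by (rule ennreal_leI)
    also have "\<dots> = G j x" unfolding G_def by (rule suminf_ennreal2[symmetric]) (auto intro: snj)
    finally show ?thesis .
  qed
  have ae: "AE x in lborel. G 0 x < top"
    by (rule AE_finite) (use order_le_less_trans[OF G[of 0]] in auto)
  have sub: "\<rho> (absf (\<lambda>x. F (r j) x - f x)) \<le> ennreal (1 / 2 ^ j)" for j
    by (rule order_trans[OF mono G]) (use ae pw in \<open>auto elim!: eventually_mono\<close>)
  have lim: "(\<lambda>n. \<rho> (absf (\<lambda>x. F n x - f x))) \<longlonglongrightarrow> 0"
  proof (rule order_tendstoI)
    fix e :: ennreal assume "0 < e"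
    then obtain e1 where e1: "0 < e1" "e1 < e" using dense by blast
    then have "e1 < top" using order_less_le_trans top_greatest by blast
    then obtain c where c: "e1 = ennreal c" "0 \<le> c" by (cases e1) auto
    then have c0: "0 < c" using e1 by (cases "c = 0") auto
    obtain j where "(1 / 2 :: real) ^ j < c / 2" using real_arch_pow_inv[of "c / 2" "1 / 2"] c0 by auto
    then have j: "1 / 2 ^ j < c / 2" by (simp add: power_divide)
    have "\<rho> (absf (\<lambda>x. F n x - f x)) < e" if n: "M j \<le> n" for n
    proof -
      have "\<rho> (absf (\<lambda>x. F n x - f x)) = \<rho> (absf (\<lambda>x. (F n x - F (r j) x) + (F (r j) x - f x)))" by simp
      also have "\<dots> \<le> \<rho> (absf (\<lambda>x. F n x - F (r j) x)) + \<rho> (absf (\<lambda>x. F (r j) x - f x))"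
        by (rule norm_add) measurable
      also have "\<dots> \<le> ennreal (1 / 2 ^ Suc j) + ennreal (1 / 2 ^ j)"
        by (intro add_mono sub less_imp_le[OF M[OF n r(1)]])
      also have "\<dots> \<le> ennreal (c / 2) + ennreal (c / 2)"
      proof -
        have "(1::real) / 2 ^ Suc j \<le> 1 / 2 ^ j" by (simp add: field_simps)
        then show ?thesis using j by (intro add_mono ennreal_leI) linarith+
      qed
      also have "\<dots> = e1" using c by (subst ennreal_plus[symmetric]) auto
      finally show ?thesis using e1 by simp
    qed
    then show "\<forall>\<^sub>F n in sequentially. \<rho> (absf (\<lambda>x. F n x - f x)) < e"
      unfolding eventually_sequentially by blast
  qed auto
  have "\<rho> (absf f) = \<rho> (absf (\<lambda>x. F (r 0) x - (F (r 0) x - f x)))" by simp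
  also have "\<dots> \<le> \<rho> (absf (F (r 0))) + \<rho> (absf (\<lambda>x. F (r 0) x - f x))" by (rule norm_diff) measurable
  also have "\<dots> < top" using fin sub[of 0] order_le_less_trans[OF sub[of 0]] by simp
  finally show ?thesis using that lim \<open>f \<in> borel_measurable borel\<close> by blast
qed

end

text \<open>At t = 1, \<open>kfun_pairing\<close> asks for one constant above both the maximum 1 of
  \<open>decay\<close> and its integral.\<close>

definition decay_mass :: real where
  "decay_mass = max 1 (LINT x|lborel. decay x)"

lemma nn_integral_decay: "(\<integral>\<^sup>+x. ennreal (decay x) \<partial>lborel) = ennreal (LINT x|lborel. decay x)"
  by (intro nn_integral_eq_integral integrable_decay) auto

lemma function_norm_lnorm:
  assumes p: "1 < p" and q: "1 \<le> q"
  shows "function_norm (lnorm p q) (decay_mass * 4)"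
proof
  fix g :: "R3 \<Rightarrow> ennreal" assume [measurable]: "g \<in> borel_measurable borel"
  have "(\<integral>\<^sup>+x. g x * ennreal (decay x) \<partial>lborel) \<le> ennreal decay_mass * kfun 1 g"
    by (rule kfun_pairing)
      (auto simp: decay_mass_def nn_integral_decay intro!: ennreal_leI order_trans[OF decay_le_1])
  also have "\<dots> \<le> ennreal decay_mass * (ennreal 4 * lnorm p q g)"
    using kfun_le_lnorm[OF p q, of 1 g] by (intro mult_left_mono) auto
  finally show "(\<integral>\<^sup>+x. g x * ennreal (decay x) \<partial>lborel) \<le> ennreal (decay_mass * 4) * lnorm p q g"
    by (subst ennreal_mult) (auto simp: decay_mass_def mult.assoc)
qed (use assms in \<open>auto intro: lnorm_mono lnorm_suminf lnorm_cmult\<close>)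

section \<open>Convolutions\<close>

definition conv :: "fn \<Rightarrow> fn \<Rightarrow> fn" where
  "conv u k x = (LINT y|lborel. u y * k (x - y))"

text \<open>The functions that serve as densities of distributions: the class contains the Lorentz
  functions, and its pairing with Schwartz functions converges absolutely.\<close>

definition moderate :: "fn set" where
  "moderate = {u. u \<in> borel_measurable borel \<and> integrable lborel (\<lambda>x. u x * of_real (decay x))}"

lemma conv_borel [measurable]:
  assumes [measurable]: "u \<in> borel_measurable borel" "k \<in> borel_measurable borel"
  shows "conv u k \<in> borel_measurable borel"
  unfolding conv_def[abs_def] by measurable

lemma moderate_borel: "u \<in> moderate \<Longrightarrow> u \<in> borel_measurable borel"
  by (simp add: moderate_def)

lemma moderate_mult_integrable:
  assumes u: "u \<in> moderate" and [measurable]: "k \<in> borel_measurable borel" and k: "\<And>x. norm (k x) \<le> C * decay x"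
  shows "integrable lborel (\<lambda>x. u x * k x)"
proof -
  have [measurable]: "u \<in> borel_measurable borel" using u by (rule moderate_borel)
  have i: "integrable lborel (\<lambda>x. of_real C * (u x * of_real (decay x)))"
    using u by (simp add: moderate_def)
  have "0 \<le> C * decay 0" using k[of 0] norm_ge_zero order_trans by blast
  then have C: "0 \<le> C" using mult_neg_pos[of C "decay 0"] by fastforce
  have "norm (u x * k x) \<le> norm (of_real C * (u x * of_real (decay x)))" for x
    using mult_left_mono[OF k[of x], of "norm (u x)"] C by (simp add: norm_mult mult_ac)
  then show ?thesis
    by (intro Bochner_Integration.integrable_bound[OF i] AE_I2) auto
qed

lemma moderate_mult_schwartz: "u \<in> moderate \<Longrightarrow> f \<in> schwartz \<Longrightarrow> integrable lborel (\<lambda>x. u x * f x)"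
  using rapid_decay1[OF schwartz_rapid] moderate_mult_integrable[OF _ schwartz_borel] by metis

lemma moderate_add: "u \<in> moderate \<Longrightarrow> v \<in> moderate \<Longrightarrow> (\<lambda>x. u x + v x) \<in> moderate"
  by (auto simp: moderate_def distrib_right)

lemma moderate_cmult: "u \<in> moderate \<Longrightarrow> (\<lambda>x. c * u x) \<in> moderate"
  by (auto simp: moderate_def mult.assoc)

section \<open>Distributions given by functions, and Fubini for convolutions\<close>

lemma dist_of_eq:
  assumes "u \<in> borel_measurable borel" "f \<in> schwartz"
  shows "dist_of u f = (LINT x|lborel. u x * f x)"
  unfolding dist_of_def on_schwartz_def using assms schwartz_borel[OF assms(2)]
  by (simp add: integral_completion)

lemma dist_of_eq_0: "f \<notin> schwartz \<Longrightarrow> dist_of u f = 0"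
  by (simp add: dist_of_def on_schwartz_def)

lemma dist_of_cong_AE:
  assumes "u \<in> borel_measurable lebesgue" "v \<in> borel_measurable lebesgue" "AE x in lebesgue. u x = v x"
  shows "dist_of u = dist_of v"
proof -
  have "(LINT x|lebesgue. u x * f x) = (LINT x|lebesgue. v x * f x)" if "f \<in> schwartz" for f
  proof (rule integral_cong_AE)
    have "f \<in> borel_measurable lebesgue" using schwartz_borel[OF that] by (simp add: measurable_completion)
    then show "(\<lambda>x. u x * f x) \<in> borel_measurable lebesgue" "(\<lambda>x. v x * f x) \<in> borel_measurable lebesgue"
      using assms by auto
    show "AE x in lebesgue. u x * f x = v x * f x" using assms(3) by eventually_elim simp
  qed
  then show ?thesis by (auto simp: dist_of_def on_schwartz_def fun_eq_iff)
qed

lemma dist_of_add: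
  assumes "u \<in> moderate" "v \<in> moderate"
  shows "dist_of (\<lambda>x. u x + v x) = (\<lambda>f. dist_of u f + dist_of v f)"
proof
  fix f show "dist_of (\<lambda>x. u x + v x) f = dist_of u f + dist_of v f"
  proof (cases "f \<in> schwartz")
    case True
    then show ?thesis using assms moderate_mult_schwartz
      by (simp add: dist_of_eq moderate_borel moderate_add distrib_right)
  qed (simp add: dist_of_eq_0)
qed

lemma dist_of_cmult:
  assumes "u \<in> moderate"
  shows "dist_of (\<lambda>x. c * u x) = (\<lambda>f. c * dist_of u f)"
proof
  fix f show "dist_of (\<lambda>x. c * u x) f = c * dist_of u f"
  proof (cases "f \<in> schwartz")
    case True
    then show ?thesis using assms by (simp add: dist_of_eq moderate_borel moderate_cmult mult.assoc)
  qed (simp add: dist_of_eq_0)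
qed

lemma dist_of_diff:
  assumes "u \<in> moderate" "v \<in> moderate"
  shows "dist_of (\<lambda>x. u x - v x) = (\<lambda>f. dist_of u f - dist_of v f)"
  using dist_of_add[OF assms(1) moderate_cmult[OF assms(2), of "-1"]] dist_of_cmult[OF assms(2), of "-1"]
  by simp

lemma integrable_tensor:
  fixes f g :: "R3 \<Rightarrow> 'a::{real_normed_algebra, banach, second_countable_topology}"
  assumes f: "integrable lborel f" and g: "integrable lborel g"
  shows "integrable (lborel \<Otimes>\<^sub>M lborel) (\<lambda>(x, y). f x * g y)"
proof (rule lborel_pair.Fubini_integrable)
  have [measurable]: "f \<in> borel_measurable borel" "g \<in> borel_measurable borel" using f g by auto
  show "(\<lambda>(x, y). f x * g y) \<in> borel_measurable (lborel \<Otimes>\<^sub>M lborel)" by measurable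
  show "integrable lborel (\<lambda>x. LINT y|lborel. norm (case (x, y) of (x, y) \<Rightarrow> f x * g y))"
  proof (rule Bochner_Integration.integrable_bound)
    show "integrable lborel (\<lambda>x. norm (f x) * (LINT y|lborel. norm (g y)))" using f by auto
    show "AE x in lborel. norm (LINT y|lborel. norm (case (x, y) of (x, y) \<Rightarrow> f x * g y)) \<le> norm (norm (f x) * (LINT y|lborel. norm (g y)))"
    proof (rule AE_I2)
      fix x
      have "norm (LINT y|lborel. norm (f x * g y)) \<le> (LINT y|lborel. norm (f x) * norm (g y))"
        by (rule norm_integral_le) (use g in \<open>auto simp: norm_mult_ineq intro!: integrable_norm\<close>)
      then show "norm (LINT y|lborel. norm (case (x, y) of (x, y) \<Rightarrow> f x * g y)) \<le> norm (norm (f x) * (LINT y|lborel. norm (g y)))"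
        by simp
    qed
  qed measurable
  show "AE x in lborel. integrable lborel (\<lambda>y. case (x, y) of (x, y) \<Rightarrow> f x * g y)"
    using g by auto
qed

text \<open>Two of the three decay factors bound the kernel uniformly in the second variable:
  \<open>decay y * decay (x - y) \<le> decay x\<close>.\<close>

lemma integrable_conv_kernel:
  assumes u: "u \<in> moderate" and [measurable]: "f \<in> borel_measurable borel" "k \<in> borel_measurable borel"
    and f: "0 \<le> C" "\<And>x. norm (f x) \<le> C * decay x ^ 2" and k: "0 \<le> D" "\<And>x. norm (k x) \<le> D * decay x"
  shows "integrable (lborel \<Otimes>\<^sub>M lborel) (\<lambda>(x, y). u x * f y * k (y - x))"
proof (rule Bochner_Integration.integrable_bound)
  have [measurable]: "u \<in> borel_measurable borel" using u by (rule moderate_borel)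
  have "integrable lborel (\<lambda>y. complex_of_real (C * D * decay y))"
    using integrable_decay by (intro integrable_of_real) simp
  then show "integrable (lborel \<Otimes>\<^sub>M lborel) (\<lambda>(x, y). (u x * of_real (decay x)) * complex_of_real (C * D * decay y))"
    using u by (intro integrable_tensor) (auto simp: moderate_def)
  show "(\<lambda>(x, y). u x * f y * k (y - x)) \<in> borel_measurable (lborel \<Otimes>\<^sub>M lborel)" by measurable
  have "norm (u x * f y * k (y - x)) \<le> norm ((u x * of_real (decay x)) * complex_of_real (C * D * decay y))" for x y
  proof -
    have "norm (f y) * norm (k (y - x)) \<le> (C * decay y ^ 2) * (D * decay (y - x))"
      using f k by (intro mult_mono) auto
    also have "\<dots> = C * D * decay y * (decay y * decay (x - y))"
      by (simp add: power2_eq_square decay_def norm_minus_commute)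
    also have "\<dots> \<le> C * D * decay y * decay x"
      using f k by (intro mult_left_mono decay_mult_le) auto
    finally have "norm (u x) * (norm (f y) * norm (k (y - x))) \<le> norm (u x) * (C * D * decay y * decay x)"
      by (intro mult_left_mono) auto
    then show ?thesis using f k by (simp add: norm_mult abs_mult mult_ac)
  qed
  then show "AE x in lborel \<Otimes>\<^sub>M lborel. norm (case x of (x, y) \<Rightarrow> u x * f y * k (y - x)) \<le>
      norm (case x of (x, y) \<Rightarrow> (u x * of_real (decay x)) * complex_of_real (C * D * decay y))"
    by (intro AE_I2) (simp add: case_prod_unfold)
qed

text \<open>Fubini's theorem; evenness of k makes the convolution kernel equal to its
  transpose.\<close>

lemma conv_adjoint:
  assumes u: "u \<in> moderate" and [measurable]: "f \<in> borel_measurable borel" "k \<in> borel_measurable borel"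
    and f: "0 \<le> C" "\<And>x. norm (f x) \<le> C * decay x ^ 2" and k: "0 \<le> D" "\<And>x. norm (k x) \<le> D * decay x"
    and ev: "\<And>x. k (- x) = k x"
  shows "(LINT x|lborel. u x * conv f k x) = (LINT x|lborel. conv u k x * f x)"
    and "integrable lborel (\<lambda>x. conv u k x * f x)"
proof -
  have i: "integrable (lborel \<Otimes>\<^sub>M lborel) (case_prod (\<lambda>x y. u x * f y * k (y - x)))"
    using integrable_conv_kernel[OF u _ _ f k] by simp
  have "k (x - y) = k (y - x)" for x y using ev[of "y - x"] by simp
  then have "u x * conv f k x = (LINT y|lborel. u x * f y * k (y - x))" for x
    unfolding conv_def by (subst integral_mult_right_zero[symmetric]) (simp add: mult.assoc)
  moreover have "conv u k y * f y = (LINT x|lborel. u x * f y * k (y - x))" for y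
    unfolding conv_def by (subst integral_mult_left_zero[symmetric]) (simp add: mult_ac)
  ultimately show "(LINT x|lborel. u x * conv f k x) = (LINT x|lborel. conv u k x * f x)"
      "integrable lborel (\<lambda>x. conv u k x * f x)"
    using lborel_pair.Fubini_integral[OF i] lborel_pair.integrable_snd[OF i] by simp_all
qed

lemma norm_integral_le_nn:
  fixes f :: "'a \<Rightarrow> 'b::{banach, second_countable_topology}"
  shows "ennreal (norm (integral\<^sup>L M f)) \<le> (\<integral>\<^sup>+x. ennreal (norm (f x)) \<partial>M)"
  by (cases "integrable M f") (auto simp: integral_norm_bound_ennreal not_integrable_integral_eq)

lemma nn_integral_shift:
  fixes g :: "R3 \<Rightarrow> ennreal"
  assumes [measurable]: "g \<in> borel_measurable borel"
  shows "(\<integral>\<^sup>+x. g (x - a) \<partial>lborel) = (\<integral>\<^sup>+x. g x \<partial>lborel)"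
  using nn_integral_affine[OF assms, of 1 "- a"] by simp

lemma nn_integral_reflect:
  fixes g :: "R3 \<Rightarrow> ennreal"
  assumes [measurable]: "g \<in> borel_measurable borel"
  shows "(\<integral>\<^sup>+x. g (a - x) \<partial>lborel) = (\<integral>\<^sup>+x. g x \<partial>lborel)"
proof -
  have "(\<integral>\<^sup>+x. g x \<partial>lborel) = (\<integral>\<^sup>+x. g (a - x) \<partial>lborel)"
    by (subst lborel_affine[of "- 1" a]) (auto simp: nn_integral_density nn_integral_distr)
  then show ?thesis by simp
qed

lemma kfun_mult_greatest:
  assumes "0 \<le> b" "\<And>s. 0 \<le> s \<Longrightarrow> c \<le> ennreal b * ((\<integral>\<^sup>+x. (g x - ennreal s) \<partial>lborel) + ennreal (t * s))"
  shows "c \<le> ennreal b * kfun t g"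
proof (cases "b = 0")
  case True
  then show ?thesis using assms(2)[of 0] by simp
next
  case False
  then have b: "0 < b" using assms by simp
  have "ennreal (1 / b) * c \<le> kfun t g"
  proof (rule kfun_greatest)
    fix s :: real assume "0 \<le> s"
    from mult_left_mono[OF assms(2)[OF this], of "ennreal (1 / b)"]
    show "ennreal (1 / b) * c \<le> (\<integral>\<^sup>+x. (g x - ennreal s) \<partial>lborel) + ennreal (t * s)"
      using b by (simp add: mult.assoc[symmetric] ennreal_mult[symmetric])
  qed
  from mult_left_mono[OF this, of "ennreal b"] show ?thesis
    using b by (simp add: mult.assoc[symmetric] ennreal_mult[symmetric])
qed

text \<open>Split u at level s. The part below s convolves to something of size at most b s, and the
  excess to something whose integral is at most b times its own; so level b s is a good one for the
  convolution.\<close>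

lemma kfun_conv:
  assumes [measurable]: "u \<in> borel_measurable borel" "k \<in> borel_measurable borel"
    and b: "0 \<le> b" "(\<integral>\<^sup>+x. absf k x \<partial>lborel) \<le> ennreal b"
  shows "kfun t (absf (conv u k)) \<le> ennreal b * kfun t (absf u)"
proof (rule kfun_mult_greatest[OF b(1)])
  fix s :: real assume s: "0 \<le> s"
  let ?v = "\<lambda>y. absf u y - ennreal s"
  have pw: "absf (conv u k) x - ennreal (b * s) \<le> (\<integral>\<^sup>+y. ?v y * absf k (x - y) \<partial>lborel)" for x
  proof -
    have "absf (conv u k) x \<le> (\<integral>\<^sup>+y. ennreal (norm (u y * k (x - y))) \<partial>lborel)"
      unfolding conv_def by (rule norm_integral_le_nn)
    also have "\<dots> \<le> (\<integral>\<^sup>+y. ?v y * absf k (x - y) + ennreal s * absf k (x - y) \<partial>lborel)"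
    proof (rule nn_integral_mono)
      fix y
      have "ennreal (norm (u y * k (x - y))) = absf u y * absf k (x - y)" by (simp add: norm_mult ennreal_mult)
      also have "\<dots> \<le> (?v y + ennreal s) * absf k (x - y)" by (intro mult_right_mono ennreal_le_diff_add) auto
      finally show "ennreal (norm (u y * k (x - y))) \<le> ?v y * absf k (x - y) + ennreal s * absf k (x - y)"
        by (simp only: distrib_right)
    qed
    also have "\<dots> = (\<integral>\<^sup>+y. ?v y * absf k (x - y) \<partial>lborel) + ennreal s * (\<integral>\<^sup>+y. absf k (x - y) \<partial>lborel)"
      by (simp add: nn_integral_add nn_integral_cmult)
    also have "(\<integral>\<^sup>+y. absf k (x - y) \<partial>lborel) = (\<integral>\<^sup>+y. absf k y \<partial>lborel)"
      by (rule nn_integral_reflect) measurable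
    also have "(\<integral>\<^sup>+y. ?v y * absf k (x - y) \<partial>lborel) + ennreal s * (\<integral>\<^sup>+y. absf k y \<partial>lborel) \<le>
        (\<integral>\<^sup>+y. ?v y * absf k (x - y) \<partial>lborel) + ennreal s * ennreal b"
      by (intro add_left_mono mult_left_mono b) auto
    also have "ennreal s * ennreal b = ennreal (b * s)" using b s by (simp add: ennreal_mult mult.commute)
    finally have "absf (conv u k) x - ennreal (b * s) \<le>
        (\<integral>\<^sup>+y. ?v y * absf k (x - y) \<partial>lborel) + ennreal (b * s) - ennreal (b * s)"
      by (intro ennreal_minus_mono) auto
    then show ?thesis by simp
  qed
  have "(\<integral>\<^sup>+x. (absf (conv u k) x - ennreal (b * s)) \<partial>lborel) \<le> (\<integral>\<^sup>+x. (\<integral>\<^sup>+y. ?v y * absf k (x - y) \<partial>lborel) \<partial>lborel)"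
    by (intro nn_integral_mono pw)
  also have "\<dots> = (\<integral>\<^sup>+y. (\<integral>\<^sup>+x. ?v y * absf k (x - y) \<partial>lborel) \<partial>lborel)"
    by (rule lborel_pair.Fubini') measurable
  also have "\<dots> = (\<integral>\<^sup>+y. ?v y * (\<integral>\<^sup>+x. absf k x \<partial>lborel) \<partial>lborel)"
    using nn_integral_shift[of "absf k"] by (simp add: nn_integral_cmult)
  also have "\<dots> = (\<integral>\<^sup>+y. ?v y \<partial>lborel) * (\<integral>\<^sup>+x. absf k x \<partial>lborel)"
    by (rule nn_integral_multc) measurable
  also have "\<dots> \<le> (\<integral>\<^sup>+y. ?v y \<partial>lborel) * ennreal b" by (intro mult_left_mono b) auto
  finally have i: "(\<integral>\<^sup>+x. (absf (conv u k) x - ennreal (b * s)) \<partial>lborel) \<le> (\<integral>\<^sup>+y. ?v y \<partial>lborel) * ennreal b" .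
  have "kfun t (absf (conv u k)) \<le> (\<integral>\<^sup>+x. (absf (conv u k) x - ennreal (b * s)) \<partial>lborel) + ennreal (t * (b * s))"
    using b s by (intro kfun_le) auto
  also have "\<dots> \<le> (\<integral>\<^sup>+y. ?v y \<partial>lborel) * ennreal b + ennreal b * ennreal (t * s)"
    using b i by (intro add_mono) (auto simp: ennreal_mult'[symmetric] mult_ac)
  finally show "kfun t (absf (conv u k)) \<le> ennreal b * ((\<integral>\<^sup>+x. (absf u x - ennreal s) \<partial>lborel) + ennreal (t * s))"
    by (simp add: distrib_left mult.commute)
qed

lemma lnorm_conv:
  assumes q: "1 \<le> q" and [measurable]: "u \<in> borel_measurable borel" "k \<in> borel_measurable borel"
    and b: "0 \<le> b" "(\<integral>\<^sup>+x. absf k x \<partial>lborel) \<le> ennreal b"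
  shows "lnorm p q (absf (conv u k)) \<le> ennreal b * lnorm p q (absf u)"
proof -
  have "lnorm p q (absf (conv u k)) \<le> log_norm q (\<lambda>t. ennreal b * (ennreal (t powr (1 / p - 1)) * kfun t (absf u)))"
    unfolding lnorm_def
    by (rule log_norm_mono[OF q], subst mult.left_commute) (intro mult_left_mono kfun_conv b, auto)
  then show ?thesis unfolding lnorm_def by (subst (asm) log_norm_cmult[OF q]) auto
qed

lemma lnorm_mult_bounded:
  assumes q: "1 \<le> q" and [measurable]: "u \<in> borel_measurable borel" and A: "0 \<le> A" "\<And>x. norm (v x) \<le> A"
  shows "lnorm p q (absf (\<lambda>x. v x * u x)) \<le> ennreal A * lnorm p q (absf u)"
proof -
  have "lnorm p q (absf (\<lambda>x. v x * u x)) \<le> lnorm p q (\<lambda>x. ennreal A * absf u x)"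
    using A by (intro lnorm_mono q AE_I2) (auto simp: norm_mult ennreal_mult[symmetric] intro!: ennreal_leI mult_right_mono)
  then show ?thesis by (simp add: lnorm_cmult q A)
qed

text \<open>The value of a convolution at a point is a pairing of u with a reflected translate of k,
  which has the same bound and mass as k.\<close>

lemma conv_bound:
  assumes [measurable]: "u \<in> borel_measurable borel" "k \<in> borel_measurable borel"
    and A: "0 \<le> A" "\<And>x. norm (k x) \<le> A" and t: "0 \<le> t" "(\<integral>\<^sup>+x. absf k x \<partial>lborel) \<le> ennreal (A * t)"
  shows "absf (conv u k) x \<le> ennreal A * kfun t (absf u)"
proof -
  have "absf (conv u k) x \<le> (\<integral>\<^sup>+y. ennreal (norm (u y * k (x - y))) \<partial>lborel)"
    unfolding conv_def by (rule norm_integral_le_nn)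
  also have "\<dots> = (\<integral>\<^sup>+y. absf u y * absf k (x - y) \<partial>lborel)" by (simp add: norm_mult ennreal_mult)
  also have "\<dots> \<le> ennreal A * kfun t (absf u)"
    by (rule kfun_pairing) (use A t in \<open>auto intro: ennreal_leI simp: nn_integral_reflect[of "absf k"]\<close>)
  finally show ?thesis .
qed

section \<open>Fourier multipliers as convolutions\<close>

lemma inv_fourier_lborel:
  assumes [measurable]: "f \<in> borel_measurable borel"
  shows "inv_fourier f x = of_real (1 / (2 * pi) ^ 3) * (LINT \<xi>|lborel. exp (\<i> * of_real (x \<bullet> \<xi>)) * f \<xi>)"
proof -
  have "(\<lambda>\<xi>. exp (\<i> * of_real (x \<bullet> \<xi>)) * f \<xi>) \<in> borel_measurable lborel" by measurable
  then show ?thesis unfolding inv_fourier_def by (simp only: integral_completion)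
qed

lemma integral_reflect_lborel:
  fixes f :: "R3 \<Rightarrow> complex"
  assumes [measurable]: "f \<in> borel_measurable borel"
  shows "(LINT x|lborel. f (- x)) = (LINT x|lborel. f x)"
proof -
  have "(LINT x|lborel. f x) = (LINT x|lborel. f (- x))"
    by (subst lborel_affine[of "- 1" 0]) (simp_all add: density_1 integral_distr)
  then show ?thesis by simp
qed

lemma inv_fourier_even:
  assumes [measurable]: "m \<in> borel_measurable borel" and ev: "\<And>x. m (- x) = m x"
  shows "inv_fourier m (- x) = inv_fourier m x"
proof -
  have "(LINT \<xi>|lborel. exp (\<i> * of_real (- x \<bullet> \<xi>)) * m \<xi>) = (LINT \<xi>|lborel. exp (\<i> * of_real (- x \<bullet> - \<xi>)) * m (- \<xi>))"
    by (rule integral_reflect_lborel[symmetric]) measurable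
  then show ?thesis by (simp add: inv_fourier_lborel ev)
qed

text \<open>Pure Fubini: \<open>inv_fourier f\<close> is written out as an integral, so the identity
  may be used in the proof of the inversion formula itself. Evenness of m turns y - x into x -
  y.\<close>

lemma fourier_mult_inv_fourier:
  assumes m: "integrable lborel m" and f: "integrable lborel f" and ev: "\<And>x. m (- x) = m x"
  shows "fourier (\<lambda>\<xi>. m \<xi> * inv_fourier f \<xi>) x = conv f (inv_fourier m) x"
proof -
  have [measurable]: "m \<in> borel_measurable borel" "f \<in> borel_measurable borel" using m f by auto
  have "inv_fourier f = (\<lambda>x. of_real (1 / (2 * pi) ^ 3) * (LINT \<xi>|lborel. exp (\<i> * of_real (x \<bullet> \<xi>)) * f \<xi>))"
    by (intro ext inv_fourier_lborel) measurable
  then have [measurable]: "inv_fourier f \<in> borel_measurable borel" by (simp only:) measurable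
  define \<kappa> where "\<kappa> = complex_of_real (1 / (2 * pi) ^ 3)"
  let ?F = "\<lambda>\<xi> y. \<kappa> * (exp (\<i> * of_real ((y - x) \<bullet> \<xi>)) * (m \<xi> * f y))"
  have i: "integrable (lborel \<Otimes>\<^sub>M lborel) (case_prod ?F)"
  proof (rule Bochner_Integration.integrable_bound)
    show "integrable (lborel \<Otimes>\<^sub>M lborel) (\<lambda>(\<xi>, y). (\<kappa> * m \<xi>) * f y)"
      using m f by (intro integrable_tensor) auto
    show "case_prod ?F \<in> borel_measurable (lborel \<Otimes>\<^sub>M lborel)" by measurable
    show "AE z in lborel \<Otimes>\<^sub>M lborel. norm (case_prod ?F z) \<le> norm (case z of (\<xi>, y) \<Rightarrow> (\<kappa> * m \<xi>) * f y)"
      by (intro AE_I2) (auto simp: norm_mult)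
  qed
  have "fourier (\<lambda>\<xi>. m \<xi> * inv_fourier f \<xi>) x = (LINT \<xi>|lborel. exp (- \<i> * of_real (x \<bullet> \<xi>)) * (m \<xi> * inv_fourier f \<xi>))"
    by (subst fourier_lborel) (auto simp: inner_commute)
  also have "\<dots> = (LINT \<xi>|lborel. (LINT y|lborel. ?F \<xi> y))"
  proof (rule Bochner_Integration.integral_cong)
    fix \<xi>
    have "exp (- \<i> * of_real (x \<bullet> \<xi>)) * (m \<xi> * inv_fourier f \<xi>) =
        (LINT y|lborel. (\<kappa> * exp (- \<i> * of_real (x \<bullet> \<xi>)) * m \<xi>) * (exp (\<i> * of_real (\<xi> \<bullet> y)) * f y))"
      by (subst integral_mult_right_zero) (simp add: inv_fourier_lborel \<kappa>_def mult_ac)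
    also have "\<dots> = (LINT y|lborel. ?F \<xi> y)"
    proof (rule Bochner_Integration.integral_cong)
      fix y
      have "exp (- \<i> * of_real (x \<bullet> \<xi>)) * exp (\<i> * of_real (\<xi> \<bullet> y)) = exp (\<i> * of_real ((y - x) \<bullet> \<xi>))"
        by (simp add: exp_add[symmetric] inner_diff_left inner_commute algebra_simps)
      then show "(\<kappa> * exp (- \<i> * of_real (x \<bullet> \<xi>)) * m \<xi>) * (exp (\<i> * of_real (\<xi> \<bullet> y)) * f y) = ?F \<xi> y"
        by (metis (no_types, lifting) mult.assoc mult.left_commute)
    qed simp
    finally show "exp (- \<i> * of_real (x \<bullet> \<xi>)) * (m \<xi> * inv_fourier f \<xi>) = (LINT y|lborel. ?F \<xi> y)" .
  qed simp
  also have "\<dots> = (LINT y|lborel. (LINT \<xi>|lborel. ?F \<xi> y))"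
    by (rule lborel_pair.Fubini_integral[OF i, symmetric])
  also have "\<dots> = (LINT y|lborel. f y * inv_fourier m (x - y))"
  proof (rule Bochner_Integration.integral_cong)
    fix y
    have "(LINT \<xi>|lborel. ?F \<xi> y) = (LINT \<xi>|lborel. (\<kappa> * f y) * (exp (\<i> * of_real ((y - x) \<bullet> \<xi>)) * m \<xi>))"
      by (intro Bochner_Integration.integral_cong) (simp_all add: mult_ac)
    also have "\<dots> = f y * inv_fourier m (y - x)"
      by (subst integral_mult_right_zero) (simp add: inv_fourier_lborel \<kappa>_def mult_ac)
    also have "inv_fourier m (y - x) = inv_fourier m (x - y)"
      using inv_fourier_even[of m "x - y"] ev by simp
    finally show "(LINT \<xi>|lborel. ?F \<xi> y) = f y * inv_fourier m (x - y)" .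
  qed simp
  finally show ?thesis by (simp add: conv_def)
qed

text \<open>The multiplier acts on the test function, where \<open>fourier_mult_inv_fourier\<close>
  makes it a convolution; \<open>conv_adjoint\<close> moves that convolution back to u.\<close>

lemma fourier_multiplier_dist_of:
  assumes u: "u \<in> moderate" and m: "m \<in> schwartz" and ev: "\<And>x. m (- x) = m x"
  shows "fourier_multiplier m (dist_of u) = dist_of (conv u (inv_fourier m))"
proof
  fix f
  show "fourier_multiplier m (dist_of u) f = dist_of (conv u (inv_fourier m)) f"
  proof (cases "f \<in> schwartz")
    case False
    then show ?thesis by (simp add: fourier_multiplier_def dist_inv_fourier_def on_schwartz_def dist_of_eq_0)
  next
    case True
    note [measurable] = moderate_borel[OF u] schwartz_borel[OF True] schwartz_borel[OF inv_fourier_schwartz[OF m]]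
    have s: "(\<lambda>\<xi>. m \<xi> * inv_fourier f \<xi>) \<in> schwartz" by (intro schwartz_mult m inv_fourier_schwartz True)
    obtain C where C: "0 \<le> C" "\<And>x. norm (f x) \<le> C * decay x ^ 2" using rapid_decay[OF schwartz_rapid[OF True]] by metis
    obtain D where D: "0 \<le> D" "\<And>x. norm (inv_fourier m x) \<le> D * decay x"
      using rapid_decay1[OF schwartz_rapid[OF inv_fourier_schwartz[OF m]]] by metis
    have "fourier_multiplier m (dist_of u) f = dist_of u (fourier (\<lambda>\<xi>. m \<xi> * inv_fourier f \<xi>))"
      using True s inv_fourier_schwartz[OF True]
      by (simp add: fourier_multiplier_def dist_inv_fourier_def dist_smult_def dist_fourier_def on_schwartz_def)
    also have "\<dots> = (LINT x|lborel. u x * fourier (\<lambda>\<xi>. m \<xi> * inv_fourier f \<xi>) x)"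
      by (rule dist_of_eq) (auto intro: fourier_schwartz s)
    also have "\<dots> = (LINT x|lborel. u x * conv f (inv_fourier m) x)"
      using fourier_mult_inv_fourier[OF schwartz_integrable[OF m] schwartz_integrable[OF True] ev] by simp
    also have "\<dots> = (LINT x|lborel. conv u (inv_fourier m) x * f x)"
      by (rule conv_adjoint[OF u _ _ C D]) (auto intro!: inv_fourier_even schwartz_borel m ev)
    also have "\<dots> = dist_of (conv u (inv_fourier m)) f"
      by (rule dist_of_eq[symmetric]) (auto intro: True)
    finally show ?thesis .
  qed
qed

lemma fourier_multiplication_formula:
  assumes a: "integrable lborel a" and b: "integrable lborel b"
  shows "(LINT x|lborel. a x * fourier b x) = (LINT x|lborel. fourier a x * b x)"
proof -
  have [measurable]: "a \<in> borel_measurable borel" "b \<in> borel_measurable borel" using a b by auto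
  let ?F = "\<lambda>x y::R3. exp (- \<i> * of_real (x \<bullet> y)) * (a x * b y)"
  have i: "integrable (lborel \<Otimes>\<^sub>M lborel) (case_prod ?F)"
  proof (rule Bochner_Integration.integrable_bound)
    show "integrable (lborel \<Otimes>\<^sub>M lborel) (\<lambda>(x, y). a x * b y)" by (rule integrable_tensor[OF a b])
    show "AE z in lborel \<Otimes>\<^sub>M lborel. norm (case_prod ?F z) \<le> norm (case z of (x, y) \<Rightarrow> a x * b y)"
      by (intro AE_I2) (auto simp: norm_mult)
  qed measurable
  have "(LINT x|lborel. a x * fourier b x) = (LINT x|lborel. (LINT y|lborel. ?F x y))"
    by (intro Bochner_Integration.integral_cong refl)
      (simp add: fourier_lborel mult.left_commute[of "exp _"] inner_commute del: minus_mult_left)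
  also have "\<dots> = (LINT y|lborel. (LINT x|lborel. ?F x y))"
    by (rule lborel_pair.Fubini_integral[OF i, symmetric])
  also have "\<dots> = (LINT x|lborel. fourier a x * b x)"
    by (intro Bochner_Integration.integral_cong refl)
      (simp add: fourier_lborel mult.assoc[symmetric] del: minus_mult_left)
  finally show ?thesis .
qed

text \<open>The set where g does not vanish is open, and a nonempty open set is not
  negligible.\<close>

lemma continuous_AE_zero:
  fixes g :: fn
  assumes c: "continuous_on UNIV g" and z: "AE x in lborel. g x = 0"
  shows "g x = 0"
proof (rule ccontr)
  assume "g x \<noteq> 0"
  have "open {x. g x \<noteq> 0}" using c by (intro open_Collect_neq continuous_intros)
  moreover have "{x. g x \<noteq> 0} \<noteq> {}" using \<open>g x \<noteq> 0\<close> by blast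
  ultimately have "\<not> negligible {x. g x \<noteq> 0}" by (rule open_not_negligible)
  moreover have "{x. g x \<noteq> 0} \<in> null_sets lborel"
    by (subst AE_iff_null_sets) (use \<open>open _\<close> z in auto)
  then have "{x. g x \<noteq> 0} \<in> null_sets lebesgue" by (rule null_sets_completionI)
  ultimately show False by (simp add: negligible_iff_null_sets)
qed

lemma integral_affine_lborel:
  fixes f :: "R3 \<Rightarrow> complex"
  assumes [measurable]: "f \<in> borel_measurable borel" and l: "0 < l"
  shows "(LINT x|lborel. f (l *\<^sub>R x + a)) = of_real (1 / l ^ 3) * (LINT x|lborel. f x)"
proof -
  have "(LINT x|lborel. f x) = of_real (l ^ 3) * (LINT x|lborel. f (l *\<^sub>R x + a))"
    by (subst lborel_affine[of l a])
      (use l in \<open>auto simp: integral_density integral_distr add.commute[of a] power3_eq_cube scaleR_conv_of_real[where 'a=complex]\<close>)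
  then show ?thesis using l by simp
qed

section \<open>The cutoff and its kernels\<close>

locale cutoff =
  fixes \<phi> :: "real \<Rightarrow> complex"
  assumes cutoff: "lp_cutoff \<phi>"
begin

lemma phi_one: "0 \<le> t \<Longrightarrow> t \<le> 1 / 4 \<Longrightarrow> \<phi> t = 1"
  using cutoff by (simp add: lp_cutoff_def)

lemma phi_zero: "1 < t \<Longrightarrow> \<phi> t = 0"
proof (rule ccontr)
  assume "1 < t" "\<phi> t \<noteq> 0"
  then have "t \<in> closure {t. 0 \<le> t \<and> \<phi> t \<noteq> 0}" using closure_subset by force
  then show False using cutoff \<open>1 < t\<close> by (auto simp: lp_cutoff_def)
qed

text \<open>For r = 2^j this is the multiplier of the operator S_j. Arbitrary radii are kept for
  mollification (r to infinity), partitions of a support, and the reproducing kernels.\<close>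

definition cut :: "real \<Rightarrow> fn" where
  "cut r \<xi> = \<phi> (1 / r\<^sup>2 * (norm \<xi>)\<^sup>2)"

lemma cut_schwartz: "0 < r \<Longrightarrow> cut r \<in> schwartz"
  unfolding cut_def[abs_def] using cutoff phi_zero
  by (intro schwartz_radial) (auto simp: lp_cutoff_def)

lemma cut_minus: "cut r (- x) = cut r x"
  by (simp add: cut_def)

lemma cut_one: "0 < r \<Longrightarrow> norm \<xi> \<le> r / 2 \<Longrightarrow> cut r \<xi> = 1"
  unfolding cut_def using power_mono[of "norm \<xi>" "r / 2" 2]
  by (intro phi_one) (auto simp: field_simps power2_eq_square)

lemma cut_zero: "0 < r \<Longrightarrow> r < norm \<xi> \<Longrightarrow> cut r \<xi> = 0"
  unfolding cut_def using power_strict_mono[of r "norm \<xi>" 2]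
  by (intro phi_zero) (auto simp: field_simps)

lemma cut_scale: "0 < r \<Longrightarrow> cut r \<xi> = cut 1 ((1 / r) *\<^sub>R \<xi>)"
  by (simp add: cut_def power_mult_distrib power_divide)

definition ker :: "real \<Rightarrow> fn" where
  "ker r = inv_fourier (cut r)"

lemma ker_schwartz: "0 < r \<Longrightarrow> ker r \<in> schwartz"
  unfolding ker_def by (intro inv_fourier_schwartz cut_schwartz)

lemma ker_minus: "0 < r \<Longrightarrow> ker r (- x) = ker r x"
  unfolding ker_def by (intro inv_fourier_even schwartz_borel cut_schwartz cut_minus)

lemma ker_scale:
  assumes r: "0 < r"
  shows "ker r x = of_real (r ^ 3) * ker 1 (r *\<^sub>R x)"
proof -
  have [measurable]: "cut 1 \<in> borel_measurable borel" by (intro schwartz_borel cut_schwartz) simp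
  have [measurable]: "cut r \<in> borel_measurable borel" by (intro schwartz_borel cut_schwartz r)
  let ?g = "\<lambda>\<xi>. exp (\<i> * of_real ((r *\<^sub>R x) \<bullet> \<xi>)) * cut 1 \<xi>"
  have "(LINT \<xi>|lborel. exp (\<i> * of_real (x \<bullet> \<xi>)) * cut r \<xi>) = (LINT \<xi>|lborel. ?g ((1 / r) *\<^sub>R \<xi> + 0))"
    using r by (simp add: cut_scale[OF r])
  also have "\<dots> = of_real (1 / (1 / r) ^ 3) * (LINT \<xi>|lborel. ?g \<xi>)"
    by (rule integral_affine_lborel) (use r in auto)
  also have "1 / (1 / r) ^ 3 = r ^ 3" using r by (simp add: power_divide)
  finally show ?thesis by (simp add: ker_def inv_fourier_lborel)
qed

text \<open>Two powers of \<open>decay\<close>, because \<open>mollify_integrand_bound\<close>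
  spends one on a shift and keeps one for integration.\<close>

definition A0 :: real where
  "A0 = (SOME C. 0 \<le> C \<and> (\<forall>x. norm (ker 1 x) \<le> C * decay x ^ 2))"

lemma A0: "0 \<le> A0" "norm (ker 1 x) \<le> A0 * decay x ^ 2"
proof -
  obtain C where C: "0 \<le> C" "\<And>x. norm (ker 1 x) \<le> C * decay x ^ 2"
    using rapid_decay[OF schwartz_rapid[OF ker_schwartz[of 1]], where n=2] by auto
  have "0 \<le> A0 \<and> (\<forall>x. norm (ker 1 x) \<le> A0 * decay x ^ 2)"
    unfolding A0_def by (rule someI[of _ C]) (use C in blast)
  then show "0 \<le> A0" "norm (ker 1 x) \<le> A0 * decay x ^ 2" by blast+
qed

text \<open>The constant in the inversion formula. Its value is 1 for the chosen normalisation, but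
  the proof carries it along and uses only that it is nonzero.\<close>

definition c0 :: complex where
  "c0 = (LINT x|lborel. ker 1 x)"

text \<open>A common bound for the L^1 norm and the supremum of the kernel at scale 1; by scaling it
  controls the kernels at every scale.\<close>

definition K1 :: real where
  "K1 = max (LINT x|lborel. norm (ker 1 x)) A0"

lemma K1: "0 \<le> K1" using A0 by (simp add: K1_def)

lemma ker_bound: "0 < r \<Longrightarrow> norm (ker r x) \<le> K1 * r ^ 3"
proof -
  assume r: "0 < r"
  have "norm (ker 1 y) \<le> A0" for y
    using A0(2)[of y] A0(1) decay_le_1[of y] mult_left_mono[OF power_le_one[of "decay y" 2] A0(1)] by simp
  also have "A0 \<le> K1" by (simp add: K1_def)
  finally show ?thesis using r by (simp add: ker_scale[OF r] norm_mult norm_power mult.commute)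
qed

lemma ker_L1: "0 < r \<Longrightarrow> (\<integral>\<^sup>+x. absf (ker r) x \<partial>lborel) \<le> ennreal K1"
proof -
  assume r: "0 < r"
  have [measurable]: "ker 1 \<in> borel_measurable borel" by (intro schwartz_borel ker_schwartz) simp
  have "(\<integral>\<^sup>+x. absf (ker r) x \<partial>lborel) = (\<integral>\<^sup>+x. ennreal (r ^ 3) * absf (ker 1) (r *\<^sub>R x + 0) \<partial>lborel)"
    using r by (simp add: ker_scale[OF r] norm_mult norm_power ennreal_mult)
  also have "\<dots> = ennreal (r ^ 3) * (\<integral>\<^sup>+x. absf (ker 1) (r *\<^sub>R x + 0) \<partial>lborel)"
    by (rule nn_integral_cmult) measurable
  also have "(\<integral>\<^sup>+x. absf (ker 1) (r *\<^sub>R x + 0) \<partial>lborel) = ennreal (1 / r ^ 3) * (\<integral>\<^sup>+x. absf (ker 1) x \<partial>lborel)"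
    by (rule nn_integral_affine) (use r in auto)
  also have "ennreal (r ^ 3) * (ennreal (1 / r ^ 3) * (\<integral>\<^sup>+x. absf (ker 1) x \<partial>lborel)) = (\<integral>\<^sup>+x. absf (ker 1) x \<partial>lborel)"
    using r by (simp add: mult.assoc[symmetric] ennreal_mult[symmetric])
  also have "\<dots> = ennreal (LINT x|lborel. norm (ker 1 x))"
    using ker_schwartz[of 1] by (intro nn_integral_eq_integral integrable_norm schwartz_integrable) auto
  also have "\<dots> \<le> ennreal K1" by (intro ennreal_leI) (simp add: K1_def)
  finally show ?thesis .
qed

text \<open>The substitution y = x + z/r, with the evenness of the kernel, moves the scale into the
  argument of f, ready for dominated convergence as r grows.\<close>

lemma conv_ker_eq:
  assumes [measurable]: "f \<in> borel_measurable borel" and r: "0 < r"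
  shows "conv f (ker r) x = (LINT z|lborel. f (x + (1 / r) *\<^sub>R z) * ker 1 z)"
proof -
  have [measurable]: "ker 1 \<in> borel_measurable borel" by (intro schwartz_borel ker_schwartz) simp
  have [measurable]: "ker r \<in> borel_measurable borel" by (intro schwartz_borel ker_schwartz r)
  have "(LINT z|lborel. f (x + (1 / r) *\<^sub>R z) * ker 1 z) = (LINT z|lborel. f ((1 / r) *\<^sub>R z + x) * ker 1 (r *\<^sub>R (x - ((1 / r) *\<^sub>R z + x))))"
    using ker_minus[of 1] r by (simp add: add.commute)
  also have "\<dots> = of_real (1 / (1 / r) ^ 3) * (LINT y|lborel. f y * ker 1 (r *\<^sub>R (x - y)))"
    using integral_affine_lborel[of "\<lambda>y. f y * ker 1 (r *\<^sub>R (x - y))" "1 / r" x] r by simp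
  also have "1 / (1 / r) ^ 3 = r ^ 3" using r by (simp add: power_divide)
  also have "of_real (r ^ 3) * (LINT y|lborel. f y * ker 1 (r *\<^sub>R (x - y))) = (LINT y|lborel. of_real (r ^ 3) * (f y * ker 1 (r *\<^sub>R (x - y))))"
    by simp
  also have "\<dots> = conv f (ker r) x"
    unfolding conv_def by (intro Bochner_Integration.integral_cong refl) (simp only: ker_scale[OF r] mult.left_commute)
  finally show ?thesis by simp
qed

lemma decay_antimono: "norm x \<le> norm y \<Longrightarrow> decay y \<le> decay x"
  unfolding decay_def by (intro frac_le power_mono) auto

text \<open>For r >= 1 the shift z/r is no longer than z, so one factor \<open>decay z\<close> turns
  decay at x + z/r into decay at x. The other factor is left for the integration over z.\<close>

lemma mollify_integrand_bound:
  assumes C: "0 \<le> C" "\<And>x. norm (f x) \<le> C * decay x" and r: "1 \<le> r"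
  shows "norm (f (x + (1 / r) *\<^sub>R z) * ker 1 z) \<le> C * A0 * decay x * decay z"
proof -
  have "norm ((1 / r) *\<^sub>R z) \<le> norm z" using r mult_left_mono[OF r, of "norm z"] by (simp add: divide_le_eq)
  then have "decay z \<le> decay ((1 / r) *\<^sub>R z)" by (rule decay_antimono)
  moreover have "decay ((1 / r) *\<^sub>R z) = decay (x - (x + (1 / r) *\<^sub>R z))" by (simp add: decay_def)
  ultimately have "decay (x + (1 / r) *\<^sub>R z) * decay z \<le> decay (x + (1 / r) *\<^sub>R z) * decay (x - (x + (1 / r) *\<^sub>R z))"
    by (intro mult_left_mono) auto
  then have d: "decay (x + (1 / r) *\<^sub>R z) * decay z \<le> decay x" using decay_mult_le order_trans by blast
  have "norm (f (x + (1 / r) *\<^sub>R z) * ker 1 z) \<le> (C * decay (x + (1 / r) *\<^sub>R z)) * (A0 * decay z ^ 2)"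
    unfolding norm_mult using C A0 by (intro mult_mono) auto
  also have "\<dots> = C * A0 * decay z * (decay (x + (1 / r) *\<^sub>R z) * decay z)" by (simp add: power2_eq_square)
  also have "\<dots> \<le> C * A0 * decay z * decay x" using C A0 d by (intro mult_left_mono) auto
  finally show ?thesis by (simp add: mult_ac)
qed

definition A1 :: real where "A1 = A0 * (LINT x|lborel. decay x)"

lemma A1: "0 \<le> A1" using A0 by (simp add: A1_def)

lemma mollify_bound:
  assumes [measurable]: "f \<in> borel_measurable borel" and C: "0 \<le> C" "\<And>x. norm (f x) \<le> C * decay x" and r: "1 \<le> r"
  shows "norm (conv f (ker r) x) \<le> C * A1 * decay x"
proof -
  have [measurable]: "ker 1 \<in> borel_measurable borel" by (intro schwartz_borel ker_schwartz) simp
  have b: "norm (f (x + (1 / r) *\<^sub>R z) * ker 1 z) \<le> (C * A0 * decay x) * decay z" for z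
    using mollify_integrand_bound[OF C r] .
  have "norm (conv f (ker r) x) \<le> (LINT z|lborel. (C * A0 * decay x) * decay z)"
    unfolding conv_ker_eq[OF assms(1) order_less_le_trans[OF zero_less_one r]]
    by (intro norm_integral_le b integrable_decay_bound[OF _ b] integrable_mult_right integrable_decay) measurable
  then show ?thesis by (simp add: A1_def mult_ac)
qed

lemma mollify_tendsto:
  assumes f: "continuous_on UNIV f" and C: "0 \<le> C" "\<And>x. norm (f x) \<le> C * decay x"
  shows "(\<lambda>n. conv f (ker (real (Suc n))) x) \<longlonglongrightarrow> c0 * f x"
proof -
  have [measurable]: "f \<in> borel_measurable borel" using f by (rule borel_measurable_continuous_onI)
  have [measurable]: "ker 1 \<in> borel_measurable borel" by (intro schwartz_borel ker_schwartz) simp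
  have "(\<lambda>n. LINT z|lborel. f (x + (1 / real (Suc n)) *\<^sub>R z) * ker 1 z) \<longlonglongrightarrow> (LINT z|lborel. f x * ker 1 z)"
  proof (rule integral_dominated_convergence[where w="\<lambda>z. (C * A0 * decay x) * decay z"])
    show "AE z in lborel. (\<lambda>n. f (x + (1 / real (Suc n)) *\<^sub>R z) * ker 1 z) \<longlonglongrightarrow> f x * ker 1 z"
    proof (rule AE_I2)
      fix z :: R3
      have "(\<lambda>n. 1 / real (Suc n)) \<longlonglongrightarrow> 0" using LIMSEQ_inverse_real_of_nat by (simp add: divide_inverse)
      then have "(\<lambda>n. x + (1 / real (Suc n)) *\<^sub>R z) \<longlonglongrightarrow> x + 0 *\<^sub>R z" by (intro tendsto_intros)
      then have L: "(\<lambda>n. x + (1 / real (Suc n)) *\<^sub>R z) \<longlonglongrightarrow> x" by (simp only: scaleR_zero_left add_0_right)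
      have "isCont f x" using f by (simp add: continuous_on_eq_continuous_at)
      from isCont_tendsto_compose[OF this L] have "(\<lambda>n. f (x + (1 / real (Suc n)) *\<^sub>R z)) \<longlonglongrightarrow> f x" .
      then show "(\<lambda>n. f (x + (1 / real (Suc n)) *\<^sub>R z) * ker 1 z) \<longlonglongrightarrow> f x * ker 1 z" by (intro tendsto_intros)
    qed
    show "AE z in lborel. norm (f (x + (1 / real (Suc n)) *\<^sub>R z) * ker 1 z) \<le> (C * A0 * decay x) * decay z" for n
      by (intro AE_I2 mollify_integrand_bound[OF C]) simp
  qed (use integrable_decay in auto)
  moreover have "(LINT z|lborel. f x * ker 1 z) = c0 * f x" by (simp add: c0_def)
  moreover have "conv f (ker (real (Suc n))) x = (LINT z|lborel. f (x + (1 / real (Suc n)) *\<^sub>R z) * ker 1 z)" for n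
    by (rule conv_ker_eq) auto
  ultimately show ?thesis by (simp only:)
qed

lemma cut_bounded: "\<exists>B\<ge>0. \<forall>r>0. \<forall>\<xi>. norm (cut r \<xi>) \<le> B"
proof -
  obtain B where "0 \<le> B" "\<And>x. norm (cut 1 x) \<le> B * decay x"
    using rapid_decay1[OF schwartz_rapid[OF cut_schwartz[of 1]]] by auto
  moreover have "B * decay x \<le> B" for x using decay_le_1[of x] \<open>0 \<le> B\<close> by (simp add: mult_left_le)
  ultimately show ?thesis by (metis cut_scale order_trans)
qed

lemma cut_tendsto: "(\<lambda>n. cut (real (Suc n)) \<xi>) \<longlonglongrightarrow> 1"
proof -
  obtain N where N: "2 * norm \<xi> \<le> real N" using real_arch_simple by blast
  have "\<forall>\<^sub>F n in sequentially. cut (real (Suc n)) \<xi> = 1"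
    using eventually_ge_at_top[of N] by eventually_elim (use N in \<open>auto intro!: cut_one\<close>)
  then show ?thesis by (rule tendsto_eventually)
qed

text \<open>The convolutions of f with \<open>ker n\<close> are computed in two ways: as
  mollifications they tend to c0 f, and as transforms of cut-off inverse transforms they tend to the
  transform of \<open>inv_fourier f\<close>.\<close>

lemma fourier_inv_fourier:
  assumes f: "f \<in> schwartz"
  shows "fourier (inv_fourier f) x = c0 * f x"
proof -
  note [measurable] = schwartz_borel[OF inv_fourier_schwartz[OF f]]
  have [measurable]: "cut (real (Suc n)) \<in> borel_measurable borel" for n by (intro schwartz_borel cut_schwartz) simp
  obtain B where B: "0 \<le> B" "\<And>r \<xi>. 0 < r \<Longrightarrow> norm (cut r \<xi>) \<le> B" using cut_bounded by metis
  obtain C where C: "0 \<le> C" "\<And>x. norm (f x) \<le> C * decay x" using rapid_decay1[OF schwartz_rapid[OF f]] by metis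
  have "(\<lambda>n. LINT \<xi>|lborel. exp (- \<i> * of_real (\<xi> \<bullet> x)) * (cut (real (Suc n)) \<xi> * inv_fourier f \<xi>))
      \<longlonglongrightarrow> (LINT \<xi>|lborel. exp (- \<i> * of_real (\<xi> \<bullet> x)) * inv_fourier f \<xi>)"
  proof (rule integral_dominated_convergence[where w="\<lambda>\<xi>. B * norm (inv_fourier f \<xi>)"])
    show "integrable lborel (\<lambda>\<xi>. B * norm (inv_fourier f \<xi>))"
      using schwartz_integrable[OF inv_fourier_schwartz[OF f]] by auto
    show "AE \<xi> in lborel. (\<lambda>n. exp (- \<i> * of_real (\<xi> \<bullet> x)) * (cut (real (Suc n)) \<xi> * inv_fourier f \<xi>))
      \<longlonglongrightarrow> exp (- \<i> * of_real (\<xi> \<bullet> x)) * inv_fourier f \<xi>"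
    proof (rule AE_I2)
      fix \<xi>
      have "(\<lambda>n. exp (- \<i> * of_real (\<xi> \<bullet> x)) * (cut (real (Suc n)) \<xi> * inv_fourier f \<xi>))
          \<longlonglongrightarrow> exp (- \<i> * of_real (\<xi> \<bullet> x)) * (1 * inv_fourier f \<xi>)"
        by (intro tendsto_intros cut_tendsto)
      then show "(\<lambda>n. exp (- \<i> * of_real (\<xi> \<bullet> x)) * (cut (real (Suc n)) \<xi> * inv_fourier f \<xi>))
          \<longlonglongrightarrow> exp (- \<i> * of_real (\<xi> \<bullet> x)) * inv_fourier f \<xi>" by simp
    qed
    show "AE \<xi> in lborel. norm (exp (- \<i> * of_real (\<xi> \<bullet> x)) * (cut (real (Suc n)) \<xi> * inv_fourier f \<xi>)) \<le> B * norm (inv_fourier f \<xi>)" for n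
      using B(2)[of "real (Suc n)"] by (intro AE_I2) (auto simp: norm_mult intro!: mult_right_mono)
  qed measurable
  moreover have "(LINT \<xi>|lborel. exp (- \<i> * of_real (\<xi> \<bullet> x)) * (cut (real (Suc n)) \<xi> * inv_fourier f \<xi>)) = conv f (ker (real (Suc n))) x" for n
  proof -
    have "conv f (ker (real (Suc n))) x = fourier (\<lambda>\<xi>. cut (real (Suc n)) \<xi> * inv_fourier f \<xi>) x"
      unfolding ker_def
      by (intro fourier_mult_inv_fourier[symmetric] schwartz_integrable cut_schwartz cut_minus f) simp
    also have "\<dots> = (LINT \<xi>|lborel. exp (- \<i> * of_real (\<xi> \<bullet> x)) * (cut (real (Suc n)) \<xi> * inv_fourier f \<xi>))"
      by (rule fourier_lborel) measurable
    finally show ?thesis by simp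
  qed
  ultimately have "(\<lambda>n. conv f (ker (real (Suc n))) x) \<longlonglongrightarrow> fourier (inv_fourier f) x"
    by (simp add: fourier_lborel del: of_nat_Suc)
  then show ?thesis using mollify_tendsto[OF schwartz_continuous[OF f] C] LIMSEQ_unique by blast
qed

text \<open>If c0 = 0, then \<open>fourier\<close> kills g = \<open>inv_fourier f\<close> for every
  Schwartz f. The multiplication formula then makes the integral of |g|^2 zero, so every inverse
  transform vanishes; at the origin this contradicts the positivity of the integral of |cut
  1|^2.\<close>

lemma c0_nonzero: "c0 \<noteq> 0"
proof
  assume c: "c0 = 0"
  have z: "inv_fourier f x = 0" if f: "f \<in> schwartz" for f x
  proof -
    define g where "g = inv_fourier f"
    have gs: "g \<in> schwartz" unfolding g_def by (rule inv_fourier_schwartz[OF f])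
    note [measurable] = schwartz_borel[OF f] schwartz_borel[OF gs]
    have cnj: "cnj (g x) = of_real (1 / (2 * pi) ^ 3) * fourier (\<lambda>x. cnj (f x)) x" for x
    proof -
      have "cnj (LINT \<xi>|lborel. exp (\<i> * of_real (x \<bullet> \<xi>)) * f \<xi>) = (LINT \<xi>|lborel. cnj (exp (\<i> * of_real (x \<bullet> \<xi>)) * f \<xi>))"
        by (rule Bochner_Integration.integral_cnj[symmetric])
      then show ?thesis
        unfolding g_def using schwartz_borel[OF schwartz_cnj[OF f]]
        by (simp add: inv_fourier_lborel fourier_lborel exp_cnj inner_commute)
    qed
    have "(LINT x|lborel. g x * fourier (\<lambda>x. cnj (f x)) x) = (LINT x|lborel. fourier g x * cnj (f x))"
      by (intro fourier_multiplication_formula schwartz_integrable gs schwartz_cnj f)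
    also have "\<dots> = 0" using fourier_inv_fourier[OF f] c by (simp add: g_def)
    finally have "(LINT x|lborel. g x * fourier (\<lambda>x. cnj (f x)) x) = 0" .
    moreover have "complex_of_real (LINT x|lborel. (norm (g x))\<^sup>2) = (LINT x|lborel. of_real (1 / (2 * pi) ^ 3) * (g x * fourier (\<lambda>x. cnj (f x)) x))"
      unfolding integral_complex_of_real[symmetric]
      by (intro Bochner_Integration.integral_cong refl) (simp add: complex_norm_square cnj mult_ac del: of_real_power)
    ultimately have "complex_of_real (LINT x|lborel. (norm (g x))\<^sup>2) = 0" by (simp only: integral_mult_right_zero mult_zero_right)
    then have "(LINT x|lborel. (norm (g x))\<^sup>2) = 0" by simp
    moreover have "integrable lborel (\<lambda>x. (norm (g x))\<^sup>2)"
      using integrable_norm[OF schwartz_integrable[OF schwartz_mult[OF gs gs]]] by (simp add: norm_mult power2_eq_square)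
    ultimately have "AE x in lborel. (norm (g x))\<^sup>2 = 0" by (subst (asm) integral_nonneg_eq_0_iff_AE) auto
    then have "AE x in lborel. g x = 0" by eventually_elim simp
    then show ?thesis using continuous_AE_zero[OF schwartz_continuous[OF gs]] by (simp add: g_def)
  qed
  define h where "h x = cut 1 x * cnj (cut 1 x)" for x
  have hs: "h \<in> schwartz" unfolding h_def[abs_def] by (intro schwartz_mult schwartz_cnj cut_schwartz) auto
  have heq: "h x = complex_of_real ((norm (cut 1 x))\<^sup>2)" for x unfolding h_def by (rule complex_norm_square[symmetric])
  have "(LINT x|lborel. h x) = 0" using z[OF hs, of 0] by (simp add: inv_fourier_lborel[OF schwartz_borel[OF hs]])
  then have "(LINT x|lborel. (norm (cut 1 x))\<^sup>2) = 0" unfolding heq integral_complex_of_real by simp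
  moreover have "integrable lborel (\<lambda>x. (norm (cut 1 x))\<^sup>2)"
    using integrable_norm[OF schwartz_integrable[OF hs]] by (simp add: h_def norm_mult power2_eq_square)
  ultimately have "AE x in lborel. (norm (cut 1 x))\<^sup>2 = 0" by (subst (asm) integral_nonneg_eq_0_iff_AE) auto
  then have "AE x in lborel. cut 1 x = 0" by eventually_elim simp
  then have "cut 1 0 = 0"
    by (rule continuous_AE_zero[rotated]) (intro schwartz_continuous cut_schwartz zero_less_one)
  then show False using cut_one[of 1 0] by simp
qed

lemma inv_fourier_fourier:
  assumes f: "f \<in> schwartz"
  shows "inv_fourier (fourier f) x = c0 * f x"
proof -
  note [measurable] = schwartz_borel[OF fourier_schwartz[OF f]]
  have "fourier (inv_fourier f) x = (LINT \<xi>|lborel. exp (- \<i> * of_real (\<xi> \<bullet> x)) * inv_fourier f \<xi>)"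
    by (rule fourier_lborel[OF schwartz_borel[OF inv_fourier_schwartz[OF f]]])
  also have "\<dots> = (LINT \<xi>|lborel. of_real (1 / (2 * pi) ^ 3) * (exp (\<i> * of_real (x \<bullet> - \<xi>)) * fourier f (- \<xi>)))"
    by (simp only: inv_fourier_eq) (simp add: inner_commute mult.left_commute)
  also have "\<dots> = of_real (1 / (2 * pi) ^ 3) * (LINT \<xi>|lborel. exp (\<i> * of_real (x \<bullet> - \<xi>)) * fourier f (- \<xi>))"
    by (rule integral_mult_right_zero)
  also have "(LINT \<xi>|lborel. exp (\<i> * of_real (x \<bullet> - \<xi>)) * fourier f (- \<xi>)) = (LINT \<xi>|lborel. exp (\<i> * of_real (x \<bullet> \<xi>)) * fourier f \<xi>)"
    by (rule integral_reflect_lborel) measurable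
  finally show ?thesis using fourier_inv_fourier[OF f] by (simp add: inv_fourier_lborel)
qed

end

section \<open>Mollification\<close>

lemma compact_support_rapid:
  assumes "\<And>x. norm (g x) \<le> M" "\<And>x. R < norm x \<Longrightarrow> g x = 0" "0 \<le> R"
  shows "g \<in> rapid"
  unfolding rapid_def
proof safe
  fix m
  have "0 \<le> M" using assms(1) norm_ge_zero order_trans by blast
  have "(1 + norm x) ^ m * norm (g x) \<le> (1 + R) ^ m * M" for x
  proof (cases "R < norm x")
    case True
    then show ?thesis using assms \<open>0 \<le> M\<close> by simp
  next
    case False
    then show ?thesis using assms by (intro mult_mono power_mono) auto
  qed
  then show "\<exists>C. \<forall>x. (1 + norm x) ^ m * cmod (g x) \<le> C" by blast
qed

text \<open>Lebesgue measurability already provides continuous functions converging almost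
  everywhere; what is added is a uniform bound and a common bounded support.\<close>

lemma continuous_approximation:
  fixes v :: fn
  assumes v: "v \<in> borel_measurable borel" and M: "0 < M" "\<And>x. norm (v x) \<le> M" and N: "\<And>x. N < norm x \<Longrightarrow> v x = 0"
  obtains g where "\<And>n::nat. continuous_on UNIV (g n)" "\<And>n x. norm (g n x) \<le> M"
    "\<And>n x. N + 1 < norm x \<Longrightarrow> g n x = 0" "AE x in lborel. (\<lambda>n. g n x) \<longlonglongrightarrow> v x"
proof -
  have "v \<in> borel_measurable lebesgue" using v by (intro measurable_completion) simp
  then have "v \<in> borel_measurable (lebesgue_on UNIV)" by (simp add: lebesgue_on_UNIV_eq)
  then have "v measurable_on UNIV" by (subst measurable_on_iff_borel_measurable) auto
  then obtain Z G where Z: "negligible Z" and G: "\<And>n. continuous_on UNIV (G n)"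
    and lim: "\<And>x. x \<notin> Z \<Longrightarrow> (\<lambda>n. G n x) \<longlonglongrightarrow> v x"
    unfolding measurable_on_def by auto
  \<comment> \<open>The last factor leaves values of modulus at most M alone and scales larger ones
    back to modulus M. The first factor is 1 for |x| <= N and 0 beyond N + 1.\<close>
  define g where "g n x = of_real (max 0 (min 1 (N + 1 - norm x))) * (G n x * of_real (M / max M (norm (G n x))))" for n x
  have mx: "0 < max M t" "max M t \<noteq> 0" for t using M(1) by (auto simp: less_max_iff_disj)
  show ?thesis
  proof
    fix n
    show "continuous_on UNIV (g n)" unfolding g_def[abs_def]
      by (intro continuous_intros continuous_on_max continuous_on_min G) (simp add: mx)
    fix x
    have "norm (G n x) * (M / max M (norm (G n x))) \<le> M"
      using mx[of "norm (G n x)"] M(1) by (simp add: divide_le_eq mult.commute mult_left_mono)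
    moreover have "max 0 (min 1 (N + 1 - norm x)) \<le> 1" by auto
    ultimately have "max 0 (min 1 (N + 1 - norm x)) * (norm (G n x) * (M / max M (norm (G n x)))) \<le> 1 * M"
      using mx[of "norm (G n x)"] M(1) by (intro mult_mono) auto
    then show "norm (g n x) \<le> M" using mx[of "norm (G n x)"] M(1) by (simp add: g_def norm_mult norm_divide)
    show "g n x = 0" if "N + 1 < norm x" using that by (simp add: g_def)
  next
    have "Z \<in> null_sets lebesgue" using Z by (simp add: negligible_iff_null_sets)
    then have "AE x in lebesgue. x \<notin> Z" by (rule AE_not_in)
    then have "AE x in lborel. x \<notin> Z" by (simp add: AE_completion_iff)
    then show "AE x in lborel. (\<lambda>n. g n x) \<longlonglongrightarrow> v x"
    proof eventually_elim
      case (elim x)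
      have "(\<lambda>n. g n x) \<longlonglongrightarrow> of_real (max 0 (min 1 (N + 1 - norm x))) * (v x * of_real (M / max M (norm (v x))))"
        unfolding g_def by (intro tendsto_intros tendsto_max lim elim mx)
      moreover have "M / max M (norm (v x)) = 1" using M(1) M(2)[of x] by (simp add: max_def)
      moreover have "of_real (max 0 (min 1 (N + 1 - norm x))) * v x = v x" using N[of x] by (cases "N < norm x") auto
      ultimately show ?case by simp
    qed
  qed
qed

lemma moderate_tendsto:
  assumes u: "u \<in> moderate" and [measurable]: "\<And>n. f n \<in> borel_measurable borel" "g \<in> borel_measurable borel"
    and b: "\<And>n x. norm (f n x) \<le> C * decay x" and lim: "AE x in lborel. (\<lambda>n. f n x) \<longlonglongrightarrow> g x"
  shows "(\<lambda>n. LINT x|lborel. u x * f n x) \<longlonglongrightarrow> (LINT x|lborel. u x * g x)"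
proof (rule integral_dominated_convergence[where w="\<lambda>x. C * norm (u x * of_real (decay x))"])
  have [measurable]: "u \<in> borel_measurable borel" using u by (rule moderate_borel)
  show "(\<lambda>x. u x * g x) \<in> borel_measurable lborel" "\<And>n. (\<lambda>x. u x * f n x) \<in> borel_measurable lborel" by measurable
  show "integrable lborel (\<lambda>x. C * norm (u x * of_real (decay x)))"
    using u by (auto simp: moderate_def intro!: integrable_mult_right integrable_norm)
  show "AE x in lborel. (\<lambda>n. u x * f n x) \<longlonglongrightarrow> u x * g x"
    using lim by eventually_elim (intro tendsto_intros)
  show "AE x in lborel. norm (u x * f n x) \<le> C * norm (u x * of_real (decay x))" for n
  proof (rule AE_I2)
    fix x
    show "norm (u x * f n x) \<le> C * norm (u x * of_real (decay x))"
      using mult_left_mono[OF b[of n x], of "norm (u x)"] by (simp add: norm_mult mult_ac)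
  qed
qed

context cutoff
begin

text \<open>On the Fourier side this is the slow function \<open>inv_fourier g\<close> times a
  Schwartz cutoff, so the smoothness comes from the cutoff even when g has none.\<close>

lemma conv_ker_schwartz:
  assumes g: "g \<in> rapid" "g \<in> borel_measurable borel" and r: "0 < r"
  shows "conv g (ker r) \<in> schwartz"
proof -
  have "(\<lambda>\<eta>. of_real (1 / (2 * pi) ^ 3) * (fourier g \<eta> * cut r \<eta>)) \<in> schwartz" (is "?h \<in> _")
    by (intro schwartz_cmult schwartz_mult_slow fourier_slow g cut_schwartz r)
  then have "(\<lambda>\<xi>. ?h ((- 1) *\<^sub>R \<xi> + 0)) \<in> schwartz" by (intro schwartz_affine) auto
  moreover have "(\<lambda>\<xi>. ?h ((- 1) *\<^sub>R \<xi> + 0)) = (\<lambda>\<xi>. cut r \<xi> * inv_fourier g \<xi>)"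
    by (rule ext) (simp add: inv_fourier_eq cut_minus)
  ultimately have "fourier (\<lambda>\<xi>. cut r \<xi> * inv_fourier g \<xi>) \<in> schwartz" by (metis fourier_schwartz)
  moreover have "fourier (\<lambda>\<xi>. cut r \<xi> * inv_fourier g \<xi>) = conv g (ker r)"
    unfolding ker_def by (intro ext fourier_mult_inv_fourier schwartz_integrable cut_schwartz r rapid_integrable g cut_minus)
  ultimately show ?thesis by simp
qed

lemma mollify_pairing:
  assumes u: "u \<in> moderate" and f: "continuous_on UNIV f" and C: "0 \<le> C" "\<And>x. norm (f x) \<le> C * decay x"
  shows "(\<lambda>n. LINT x|lborel. u x * conv f (ker (real (Suc n))) x) \<longlonglongrightarrow> c0 * (LINT x|lborel. u x * f x)"
proof -
  have [measurable]: "f \<in> borel_measurable borel" using f by (rule borel_measurable_continuous_onI)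
  have [measurable]: "ker (real (Suc n)) \<in> borel_measurable borel" for n by (intro schwartz_borel ker_schwartz) simp
  have "(\<lambda>n. LINT x|lborel. u x * conv f (ker (real (Suc n))) x) \<longlonglongrightarrow> (LINT x|lborel. u x * (c0 * f x))"
  proof (rule moderate_tendsto[OF u])
    show "norm (conv f (ker (real (Suc n))) x) \<le> C * A1 * decay x" for n x by (rule mollify_bound[OF _ C]) auto
    show "AE x in lborel. (\<lambda>n. conv f (ker (real (Suc n))) x) \<longlonglongrightarrow> c0 * f x"
      by (intro AE_I2 mollify_tendsto[OF f C])
  qed measurable
  then show ?thesis by (simp add: mult.left_commute del: of_nat_Suc)
qed

text \<open>The class of test functions is enlarged step by step: mollification reaches continuous
  rapidly decreasing functions, almost everywhere approximation reaches bounded measurable functions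
  of bounded support, and among these is the conjugate phase of u on a ball.\<close>

lemma du_bois_reymond:
  assumes u: "u \<in> moderate" and z: "\<And>f. f \<in> schwartz \<Longrightarrow> (LINT x|lborel. u x * f x) = 0"
  shows "AE x in lborel. u x = 0"
proof -
  have [measurable]: "u \<in> borel_measurable borel" using u by (rule moderate_borel)
  have c: "(LINT x|lborel. u x * g x) = 0" if g: "continuous_on UNIV g" "g \<in> rapid" for g
  proof -
    have gb: "g \<in> borel_measurable borel" using g(1) by (rule borel_measurable_continuous_onI)
    obtain C where C: "0 \<le> C" "\<And>x. norm (g x) \<le> C * decay x" using rapid_decay1[OF g(2)] by metis
    have "(\<lambda>n. LINT x|lborel. u x * conv g (ker (real (Suc n))) x) = (\<lambda>n. 0)"
      by (intro ext z conv_ker_schwartz g gb) simp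
    then have "c0 * (LINT x|lborel. u x * g x) = 0"
      using mollify_pairing[OF u g(1) C] by (simp only: LIMSEQ_const_iff)
    then show ?thesis using c0_nonzero by simp
  qed
  have bd: "(LINT x|lborel. u x * v x) = 0"
    if vb [measurable]: "v \<in> borel_measurable borel" and v: "\<And>x. norm (v x) \<le> 1" "\<And>x. N < norm x \<Longrightarrow> v x = 0" and N: "0 \<le> N" for v N
  proof -
    obtain g where g: "\<And>n::nat. continuous_on UNIV (g n)" "\<And>n x. norm (g n x) \<le> 1"
      "\<And>n x. N + 1 < norm x \<Longrightarrow> g n x = 0" "AE x in lborel. (\<lambda>n. g n x) \<longlonglongrightarrow> v x"
      using continuous_approximation[OF vb zero_less_one v] by blast
    have [measurable]: "g n \<in> borel_measurable borel" for n using g(1) by (rule borel_measurable_continuous_onI)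
    have "(\<lambda>n. LINT x|lborel. u x * g n x) \<longlonglongrightarrow> (LINT x|lborel. u x * v x)"
    proof (rule moderate_tendsto[OF u _ _ _ g(4)])
      fix n x
      \<comment> \<open>On the ball of radius N + 1 that contains the supports, \<open>decay\<close>
        is at least the inverse of this constant.\<close>
      show "norm (g n x) \<le> (1 + (N + 1)) ^ 5 * decay x"
      proof (cases "N + 1 < norm x")
        case True
        then show ?thesis using g(3) N by simp
      next
        case False
        then have "(1 + norm x) ^ 5 \<le> (1 + (N + 1)) ^ 5" by (intro power_mono) auto
        then have "1 \<le> (1 + (N + 1)) ^ 5 * decay x" by (simp add: decay_def)
        then show ?thesis using g(2) order_trans by blast
      qed
    qed auto
    moreover have "(LINT x|lborel. u x * g n x) = 0" for n
      by (intro c g(1) compact_support_rapid[of _ 1 "N + 1"]) (use g N in auto)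
    ultimately show ?thesis by (simp add: LIMSEQ_const_iff)
  qed
  have "AE x in lborel. norm x \<le> real n \<longrightarrow> u x = 0" for n
  proof -
    define v where "v x = (if norm x \<le> real n then cnj (sgn (u x)) else 0)" for x
    have [measurable]: "(\<lambda>x. sgn (u x)) \<in> borel_measurable borel" unfolding sgn_div_norm by measurable
    have [measurable]: "(\<lambda>x. cnj (sgn (u x))) \<in> borel_measurable borel"
      by (rule borel_measurable_continuous_on[of cnj]) (auto intro: continuous_intros)
    have [measurable]: "v \<in> borel_measurable borel" unfolding v_def by measurable
    have v: "norm (v x) \<le> 1" for x by (simp add: v_def norm_sgn)
    have "u x * v x = complex_of_real (norm (u x) * indicator (cball 0 (real n)) x)" for x
    proof -
      have "u x * cnj (sgn (u x)) = of_real (norm (u x))"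
        by (cases "u x = 0") (simp_all add: sgn_div_norm scaleR_conv_of_real complex_norm_square[symmetric] power2_eq_square field_simps)
      then show ?thesis by (auto simp: v_def split: split_indicator)
    qed
    moreover have "(LINT x|lborel. u x * v x) = 0" by (rule bd[of v "real n"]) (use v in \<open>auto simp: v_def\<close>)
    ultimately have "complex_of_real (LINT x|lborel. norm (u x) * indicator (cball 0 (real n)) x) = 0"
      by (simp only: integral_complex_of_real)
    then have z: "(LINT x|lborel. norm (u x) * indicator (cball 0 (real n)) x) = 0" by simp
    have [measurable]: "cball (0::R3) (real n) \<in> sets borel" by simp
    have "integrable lborel (\<lambda>x. u x * of_real (indicator (cball 0 (real n)) x))"
    proof (rule moderate_mult_integrable[OF u])
      fix x :: R3
      show "norm (complex_of_real (indicator (cball 0 (real n)) x)) \<le> (1 + real n) ^ 5 * decay x"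
      proof (cases "norm x \<le> real n")
        case True
        then have "(1 + norm x) ^ 5 \<le> (1 + real n) ^ 5" by (intro power_mono) auto
        then show ?thesis using True by (simp add: decay_def)
      qed simp
    qed measurable
    then have "integrable lborel (\<lambda>x. norm (u x * of_real (indicator (cball 0 (real n)) x)))" by (rule integrable_norm)
    then have "integrable lborel (\<lambda>x. norm (u x) * indicator (cball 0 (real n)) x)" by (simp add: norm_mult)
    then have "AE x in lborel. norm (u x) * indicator (cball 0 (real n)) x = 0"
      using z by (subst (asm) integral_nonneg_eq_0_iff_AE) auto
    then show ?thesis by eventually_elim (auto split: split_indicator_asm)
  qed
  then have "AE x in lborel. \<forall>n. norm x \<le> real n \<longrightarrow> u x = 0" unfolding AE_all_countable by blast
  then show ?thesis by eventually_elim (use real_arch_simple in blast)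
qed

lemma dist_of_inj:
  assumes u: "u \<in> moderate" "v \<in> moderate" and e: "dist_of u = dist_of v"
  shows "AE x in lborel. u x = v x"
proof -
  have "AE x in lborel. u x - v x = 0"
  proof (rule du_bois_reymond)
    show m: "(\<lambda>x. u x - v x) \<in> moderate" using moderate_add[OF u(1) moderate_cmult[OF u(2), of "-1"]] by simp
    fix f :: fn assume f: "f \<in> schwartz"
    have "dist_of (\<lambda>x. u x - v x) f = 0" using dist_of_diff[OF u] e by simp
    then show "(LINT x|lborel. (u x - v x) * f x) = 0" using dist_of_eq[OF moderate_borel[OF m] f] by simp
  qed
  then show ?thesis by eventually_elim simp
qed

section \<open>Density of the Schwartz space\<close>

lemma lnorm_decay_finite:
  assumes p: "1 < p" and q: "1 \<le> q" and C: "0 \<le> C"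
  shows "lnorm p q (\<lambda>x. ennreal (C * decay x)) < top"
proof -
  have "(\<integral>\<^sup>+x. ennreal (C * decay x) \<partial>lborel) = ennreal C * ennreal (LINT x|lborel. decay x)"
    unfolding nn_integral_decay[symmetric] using C by (subst nn_integral_cmult[symmetric]) (auto simp: ennreal_mult)
  also have "\<dots> \<le> ennreal (C * decay_mass)"
    using C by (subst ennreal_mult[symmetric]) (auto simp: decay_mass_def intro!: ennreal_leI mult_left_mono)
  finally have "lnorm p q (\<lambda>x. ennreal (C * decay x)) \<le> ennreal (C * decay_mass powr (1 / p)) * lnorm_const p q"
    using C decay_le_1 by (intro lnorm_le p q C) (auto simp: decay_mass_def intro!: ennreal_leI mult_left_le)
  also have "\<dots> < top" using lnorm_const_finite[OF p q] by (simp add: ennreal_mult_less_top)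
  finally show ?thesis .
qed

lemma lnorm_tendsto:
  assumes p: "1 < p" and q: "1 \<le> q" "q \<noteq> \<infinity>"
    and [measurable]: "u \<in> borel_measurable borel" "\<And>n. f n \<in> borel_measurable borel" "g \<in> borel_measurable borel"
    and le: "\<And>n x. norm (u x - f n x) \<le> g x" and fin: "lnorm p q (\<lambda>x. ennreal (g x)) < top"
    and lim: "AE x in lborel. (\<lambda>n. f n x) \<longlonglongrightarrow> u x" and e: "0 < e"
  shows "\<exists>n. lnorm p q (absf (\<lambda>x. u x - f n x)) < e"
proof -
  have "(\<lambda>n. lnorm p q (absf (\<lambda>x. u x - f n x))) \<longlonglongrightarrow> 0"
  proof (rule lnorm_dominated_convergence[OF p q _ _ _ fin])
    show "AE x in lborel. (\<lambda>n. absf (\<lambda>x. u x - f n x) x) \<longlonglongrightarrow> 0"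
      using lim
    proof eventually_elim
      case (elim x)
      have "(\<lambda>n. u x - f n x) \<longlonglongrightarrow> u x - u x" by (intro tendsto_intros elim)
      then have "(\<lambda>n. norm (u x - f n x)) \<longlonglongrightarrow> 0" by (simp add: tendsto_norm_zero)
      then have "(\<lambda>n. ennreal (norm (u x - f n x))) \<longlonglongrightarrow> ennreal 0" by (rule tendsto_ennrealI)
      then show ?case by simp
    qed
    show "AE x in lborel. absf (\<lambda>x. u x - f n x) x \<le> ennreal (g x)" for n
      using le by (intro AE_I2 ennreal_leI)
  qed measurable
  then have "\<forall>\<^sub>F n in sequentially. lnorm p q (absf (\<lambda>x. u x - f n x)) < e" using e by (rule order_tendstoD)
  then show ?thesis by (auto simp: eventually_sequentially)
qed

text \<open>Three approximations with error e/3 each: truncation of height and support, continuous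
  functions, and mollification divided by c0. Each converges almost everywhere under a majorant of
  finite norm.\<close>

lemma schwartz_lnorm_dense:
  assumes p: "1 < p" and q: "1 \<le> q" "q \<noteq> \<infinity>"
    and u: "u \<in> borel_measurable borel" "lnorm p q (absf u) < top" and e: "0 < e"
  shows "\<exists>f\<in>schwartz. lnorm p q (absf (\<lambda>x. u x - f x)) < ennreal e"
proof -
  interpret F: function_norm "lnorm p q" "decay_mass * 4" by (rule function_norm_lnorm[OF p q(1)])
  note [measurable] = u(1)
  define d where "d = ennreal (e / 3)"
  have d: "0 < d" using e by (simp add: d_def)
  define v where "v n x = (if norm x \<le> real n \<and> norm (u x) \<le> real n then u x else 0)" for n x
  have [measurable]: "v n \<in> borel_measurable borel" for n unfolding v_def by measurable
  have "\<exists>n. lnorm p q (absf (\<lambda>x. u x - v n x)) < d"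
  proof (rule lnorm_tendsto[OF p q, where g="\<lambda>x. norm (u x)"])
    show "AE x in lborel. (\<lambda>n. v n x) \<longlonglongrightarrow> u x"
    proof (rule AE_I2)
      fix x obtain N where N: "max (norm x) (norm (u x)) \<le> real N" using real_arch_simple by blast
      have "\<forall>\<^sub>F n in sequentially. v n x = u x"
        using eventually_ge_at_top[of N] by eventually_elim (use N in \<open>auto simp: v_def\<close>)
      then show "(\<lambda>n. v n x) \<longlonglongrightarrow> u x" by (rule tendsto_eventually)
    qed
  qed (use u d in \<open>auto simp: v_def\<close>)
  then obtain N where N: "lnorm p q (absf (\<lambda>x. u x - v N x)) < d" by blast
  define M where "M = real N + 1"
  have M: "0 < M" "\<And>x. norm (v N x) \<le> M" "\<And>x. M < norm x \<Longrightarrow> v N x = 0" by (auto simp: v_def M_def)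
  obtain g where g: "\<And>n::nat. continuous_on UNIV (g n)" "\<And>n x. norm (g n x) \<le> M"
      "\<And>n x. M + 1 < norm x \<Longrightarrow> g n x = 0" "AE x in lborel. (\<lambda>n. g n x) \<longlonglongrightarrow> v N x"
    using continuous_approximation[OF \<open>\<And>n. v n \<in> borel_measurable borel\<close> M] by blast
  have [measurable]: "g n \<in> borel_measurable borel" for n using g(1) by (rule borel_measurable_continuous_onI)
  have "\<exists>n. lnorm p q (absf (\<lambda>x. v N x - g n x)) < d"
  proof (rule lnorm_tendsto[OF p q, where g="\<lambda>x. (2 * M * (1 + (M + 1)) ^ 5) * decay x"])
    show "lnorm p q (\<lambda>x. ennreal ((2 * M * (1 + (M + 1)) ^ 5) * decay x)) < top"
      using M by (intro lnorm_decay_finite p q) auto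
    fix n x
    show "norm (v N x - g n x) \<le> (2 * M * (1 + (M + 1)) ^ 5) * decay x"
    proof (cases "M + 1 < norm x")
      case True
      then show ?thesis using M g(3) by simp
    next
      case False
      then have "(1 + norm x) ^ 5 \<le> (1 + (M + 1)) ^ 5" by (intro power_mono) auto
      then have 1: "1 \<le> (1 + (M + 1)) ^ 5 * decay x" by (simp add: decay_def)
      have "norm (v N x - g n x) \<le> 2 * M" using norm_triangle_ineq4[of "v N x" "g n x"] M(2)[of x] g(2)[of n x] by linarith
      also have "\<dots> \<le> 2 * M * ((1 + (M + 1)) ^ 5 * decay x)" using M(1) 1 by simp
      finally show ?thesis by (simp only: mult.assoc)
    qed
  qed (use d g in auto)
  then obtain n where n: "lnorm p q (absf (\<lambda>x. v N x - g n x)) < d" by blast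
  have gr: "g n \<in> rapid" by (rule compact_support_rapid[of _ M "M + 1"]) (use g M in auto)
  obtain C where C: "0 \<le> C" "\<And>x. norm (g n x) \<le> C * decay x" using rapid_decay1[OF gr] by metis
  define h where "h k x = (1 / c0) * conv (g n) (ker (real (Suc k))) x" for k x
  have hs: "h k \<in> schwartz" for k unfolding h_def[abs_def] by (intro schwartz_cmult conv_ker_schwartz gr) auto
  have [measurable]: "h k \<in> borel_measurable borel" for k using hs by (rule schwartz_borel)
  have "\<exists>k. lnorm p q (absf (\<lambda>x. g n x - h k x)) < d"
  proof (rule lnorm_tendsto[OF p q, where g="\<lambda>x. (C + C * A1 / norm c0) * decay x"])
    show "lnorm p q (\<lambda>x. ennreal ((C + C * A1 / norm c0) * decay x)) < top"
      using C A1 by (intro lnorm_decay_finite p q) auto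
    fix k x
    have "norm (h k x) \<le> (1 / norm c0) * (C * A1 * decay x)"
      unfolding h_def norm_mult norm_divide norm_one by (intro mult_left_mono mollify_bound C) auto
    then show "norm (g n x - h k x) \<le> (C + C * A1 / norm c0) * decay x"
      using norm_triangle_ineq4[of "g n x" "h k x"] C(2)[of x] by (simp add: distrib_right)
  next
    show "AE x in lborel. (\<lambda>k. h k x) \<longlonglongrightarrow> g n x"
    proof (rule AE_I2)
      fix x
      have "(\<lambda>k. h k x) \<longlonglongrightarrow> (1 / c0) * (c0 * g n x)"
        unfolding h_def by (intro tendsto_intros mollify_tendsto[OF g(1) C])
      then show "(\<lambda>k. h k x) \<longlonglongrightarrow> g n x" using c0_nonzero by simp
    qed
  qed (use d in auto)
  then obtain k where k: "lnorm p q (absf (\<lambda>x. g n x - h k x)) < d" by blast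
  have "lnorm p q (absf (\<lambda>x. u x - h k x)) = lnorm p q (absf (\<lambda>x. (u x - v N x) + ((v N x - g n x) + (g n x - h k x))))"
    by simp
  also have "\<dots> \<le> lnorm p q (absf (\<lambda>x. u x - v N x)) + lnorm p q (absf (\<lambda>x. (v N x - g n x) + (g n x - h k x)))"
    by (rule F.norm_add) measurable
  also have "\<dots> \<le> lnorm p q (absf (\<lambda>x. u x - v N x)) + (lnorm p q (absf (\<lambda>x. v N x - g n x)) + lnorm p q (absf (\<lambda>x. g n x - h k x)))"
    by (intro add_left_mono F.norm_add) measurable
  also have "\<dots> < d + (d + d)" using N n k by (intro add_strict_mono)
  also have "d + (d + d) = ennreal e" using e by (simp add: d_def ennreal_plus[symmetric] del: ennreal_plus)
  finally show ?thesis using hs by blast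
qed

section \<open>Spectral localisation\<close>

text \<open>The support is defined by local vanishing, so a covering argument is needed. Instead of
  a partition of unity, g is multiplied by factors 1 - \<theta>: each leaves the value of D
  unchanged, because D vanishes on the part that is removed, and finitely many of them annihilate
  g.\<close>

lemma dist_vanishes_off_support:
  assumes add: "\<And>f g. f \<in> schwartz \<Longrightarrow> g \<in> schwartz \<Longrightarrow> D (\<lambda>x. f x + g x) = D f + D g"
    and g: "g \<in> schwartz" "compact (closure {x. g x \<noteq> 0})" "closure {x. g x \<noteq> 0} \<inter> dist_support D = {}"
  shows "D g = 0"
proof -
  define K where "K = closure {x. g x \<noteq> 0}"
  have "\<forall>x\<in>K. \<exists>r. 0 < r \<and> (\<exists>U. open U \<and> dist_vanishes_on D U \<and> cball x r \<subseteq> U)"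
  proof
    fix x assume "x \<in> K"
    have "x \<notin> dist_support D" using \<open>x \<in> K\<close> g(3) by (auto simp: K_def)
    then obtain U where U: "open U" "dist_vanishes_on D U" "x \<in> U" by (auto simp: dist_support_def)
    then obtain r where "0 < r" "cball x r \<subseteq> U" using open_contains_cball by blast
    then show "\<exists>r. 0 < r \<and> (\<exists>U. open U \<and> dist_vanishes_on D U \<and> cball x r \<subseteq> U)" using U by blast
  qed
  from bchoice[OF this] obtain r where r: "\<And>x. x \<in> K \<Longrightarrow> 0 < r x"
    and rU: "\<And>x. x \<in> K \<Longrightarrow> \<exists>U. open U \<and> dist_vanishes_on D U \<and> cball x (r x) \<subseteq> U"
    by blast
  \<comment> \<open>Half radii, because \<open>cut (r x)\<close> equals 1 only up to half its
    radius, while it is supported in the full ball.\<close>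
  have cov: "K \<subseteq> (\<Union>x\<in>K. ball x (r x / 2))" using r by auto
  have cK: "compact K" using g(2) by (simp add: K_def)
  obtain F where F: "F \<subseteq> K" "finite F" "K \<subseteq> (\<Union>x\<in>F. ball x (r x / 2))"
    by (rule compactE_image[OF cK _ cov]) auto
  define \<theta> where "\<theta> x y = cut (r x) (y - x)" for x y
  have \<theta>s: "\<theta> x \<in> schwartz" if "x \<in> K" for x
    using schwartz_affine[OF _ cut_schwartz[OF r[OF that]], of 1 "- x"] by (simp add: \<theta>_def[abs_def])
  have step: "D h = D (\<lambda>y. h y * (1 - \<theta> x y))" "(\<lambda>y. h y * (1 - \<theta> x y)) \<in> schwartz"
    if h: "h \<in> schwartz" and x: "x \<in> K" for h x
  proof -
    have h1: "(\<lambda>y. h y * \<theta> x y) \<in> schwartz" by (intro schwartz_mult h \<theta>s x)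
    have "(\<lambda>y. h y - h y * \<theta> x y) \<in> schwartz" by (intro schwartz_diff h h1)
    then show h2: "(\<lambda>y. h y * (1 - \<theta> x y)) \<in> schwartz" by (simp add: right_diff_distrib)
    have sub: "closure {y. h y * \<theta> x y \<noteq> 0} \<subseteq> cball x (r x)"
      by (rule closure_minimal) (use cut_zero[OF r[OF x]] in \<open>auto simp: \<theta>_def dist_norm norm_minus_commute not_less[symmetric]\<close>)
    then have "compact (closure {y. h y * \<theta> x y \<noteq> 0})"
      by (meson bounded_cball bounded_subset closed_closure compact_eq_bounded_closed)
    moreover obtain U where "dist_vanishes_on D U" "cball x (r x) \<subseteq> U" using rU[OF x] by blast
    ultimately have "D (\<lambda>y. h y * \<theta> x y) = 0"
      using h1 sub unfolding dist_vanishes_on_def by (meson subset_trans)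
    then show "D h = D (\<lambda>y. h y * (1 - \<theta> x y))" using add[OF h1 h2] by (simp add: algebra_simps)
  qed
  have "(\<lambda>y. g y * (\<Prod>x\<in>G. 1 - \<theta> x y)) \<in> schwartz \<and> D g = D (\<lambda>y. g y * (\<Prod>x\<in>G. 1 - \<theta> x y))"
    if "finite G" "G \<subseteq> K" for G
    using that
  proof (induction G rule: finite_induct)
    case empty
    then show ?case using g by simp
  next
    case (insert x G)
    then have IH: "(\<lambda>y. g y * (\<Prod>x\<in>G. 1 - \<theta> x y)) \<in> schwartz" "D g = D (\<lambda>y. g y * (\<Prod>x\<in>G. 1 - \<theta> x y))" and x: "x \<in> K"
      by auto
    have "(\<lambda>y. g y * (\<Prod>x\<in>insert x G. 1 - \<theta> x y)) = (\<lambda>y. g y * (\<Prod>x\<in>G. 1 - \<theta> x y) * (1 - \<theta> x y))"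
      using insert by (simp add: mult_ac)
    then show ?case using step[OF IH(1) x] IH(2) by simp
  qed
  from this[OF F(2,1)] have "D g = D (\<lambda>y. g y * (\<Prod>x\<in>F. 1 - \<theta> x y))" by simp
  also have "(\<lambda>y. g y * (\<Prod>x\<in>F. 1 - \<theta> x y)) = (\<lambda>y. 0)"
  proof
    fix y
    show "g y * (\<Prod>x\<in>F. 1 - \<theta> x y) = 0"
    proof (cases "g y = 0")
      case False
      then have "y \<in> K" using closure_subset[of "{x. g x \<noteq> 0}"] by (auto simp: K_def)
      then obtain x where x: "x \<in> F" "y \<in> ball x (r x / 2)" using F(3) by blast
      then have "\<theta> x y = 1" unfolding \<theta>_def using r F(1)
        by (intro cut_one) (auto simp: dist_norm norm_minus_commute less_imp_le)
      then show ?thesis using x F(2) by auto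
    qed simp
  qed
  also have "D (\<lambda>y. 0) = 0"
    using add[OF schwartz_cmult[OF g(1), of 0] schwartz_cmult[OF g(1), of 0]] by simp
  finally show ?thesis .
qed

text \<open>For t >= 4R the difference of the cutoffs of radius t and 4R lives in 2R <= |\<xi>| <=
  t, away from the spectrum, so both give the same pairing. Letting t grow yields c0 times the
  pairing with f. The factor 4 leaves the gap between R and 2R.\<close>

lemma spectral_reproducing:
  assumes u: "u \<in> moderate" and R: "0 < R" and s: "dist_support (dist_fourier (dist_of u)) \<subseteq> cball 0 R"
  shows "dist_of u = dist_of (\<lambda>x. (1 / c0) * conv u (ker (4 * R)) x)"
proof
  fix f
  note [measurable] = moderate_borel[OF u]
  have [measurable]: "ker (4 * R) \<in> borel_measurable borel" using R by (intro schwartz_borel ker_schwartz) simp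
  let ?D = "dist_fourier (dist_of u)"
  show "dist_of u f = dist_of (\<lambda>x. (1 / c0) * conv u (ker (4 * R)) x) f"
  proof (cases "f \<in> schwartz")
    case f: True
    obtain C where C: "0 \<le> C" "\<And>x. norm (f x) \<le> C * decay x" using rapid_decay1[OF schwartz_rapid[OF f]] by metis
    obtain C2 where C2: "0 \<le> C2" "\<And>x. norm (f x) \<le> C2 * decay x ^ 2" using rapid_decay[OF schwartz_rapid[OF f]] by metis
    have add: "?D (\<lambda>x. a x + b x) = ?D a + ?D b" if "a \<in> schwartz" "b \<in> schwartz" for a b
    proof -
      have "fourier (\<lambda>x. a x + b x) = (\<lambda>x. fourier a x + fourier b x)"
      proof
        fix x
        have i: "integrable lborel (\<lambda>y. exp (- \<i> * of_real (y \<bullet> x)) * c y)" if "c \<in> schwartz" for c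
          by (rule schwartz_integrable[OF schwartz_mult_slow[OF slow_exp that]])
        show "fourier (\<lambda>x. a x + b x) x = fourier a x + fourier b x"
          using i[OF that(1)] i[OF that(2)] schwartz_borel[OF schwartz_add[OF that]] schwartz_borel[OF that(1)] schwartz_borel[OF that(2)]
          by (simp add: fourier_lborel distrib_left)
      qed
      then show ?thesis
        using that schwartz_add fourier_schwartz moderate_mult_schwartz[OF u]
        by (simp add: dist_fourier_def on_schwartz_def dist_of_eq distrib_left)
    qed
    have F: "inv_fourier f \<in> schwartz" by (rule inv_fourier_schwartz[OF f])
    have cs: "(\<lambda>\<xi>. cut t \<xi> * inv_fourier f \<xi>) \<in> schwartz" if "0 < t" for t
      by (intro schwartz_mult cut_schwartz that F)
    have D: "?D (\<lambda>\<xi>. cut t \<xi> * inv_fourier f \<xi>) = (LINT x|lborel. u x * conv f (ker t) x)" if "0 < t" for t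
    proof -
      have "fourier (\<lambda>\<xi>. cut t \<xi> * inv_fourier f \<xi>) = conv f (ker t)"
        unfolding ker_def by (intro ext fourier_mult_inv_fourier schwartz_integrable cut_schwartz that f cut_minus)
      then show ?thesis using cs[OF that] fourier_schwartz[OF cs[OF that]]
        by (simp add: dist_fourier_def on_schwartz_def dist_of_eq)
    qed
    have eq: "(LINT x|lborel. u x * conv f (ker t) x) = (LINT x|lborel. u x * conv f (ker (4 * R)) x)" if t: "4 * R \<le> t" for t
    proof -
      have t0: "0 < t" using R t by simp
      let ?h = "\<lambda>\<xi>. cut t \<xi> * inv_fourier f \<xi> - cut (4 * R) \<xi> * inv_fourier f \<xi>"
      have hs: "?h \<in> schwartz" using R by (intro schwartz_diff cs t0) simp
      have "{x. ?h x \<noteq> 0} \<subseteq> {x. 2 * R \<le> norm x \<and> norm x \<le> t}"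
      proof (intro subsetI, rule ccontr)
        fix x assume x: "x \<in> {x. ?h x \<noteq> 0}" "x \<notin> {x. 2 * R \<le> norm x \<and> norm x \<le> t}"
        then consider "norm x < 2 * R" | "t < norm x" by auto
        then show False
        proof cases
          case 1
          then have "cut t x = 1" "cut (4 * R) x = 1" using R t by (auto intro!: cut_one)
          then show False using x by simp
        next
          case 2
          then have "cut t x = 0" "cut (4 * R) x = 0" using R t by (auto intro!: cut_zero)
          then show False using x by simp
        qed
      qed
      moreover have "closed {x::R3. 2 * R \<le> norm x \<and> norm x \<le> t}"
        by (intro closed_Collect_conj closed_Collect_le continuous_intros)
      ultimately have cl: "closure {x. ?h x \<noteq> 0} \<subseteq> {x. 2 * R \<le> norm x \<and> norm x \<le> t}" by (rule closure_minimal)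
      then have "bounded (closure {x. ?h x \<noteq> 0})" by (intro bounded_subset[OF bounded_cball[of 0 t]]) auto
      then have "compact (closure {x. ?h x \<noteq> 0})" by (simp add: compact_eq_bounded_closed)
      moreover have "closure {x. ?h x \<noteq> 0} \<inter> dist_support ?D = {}" using cl s R by fastforce
      ultimately have "?D ?h = 0" using dist_vanishes_off_support[of ?D ?h] add hs by blast
      moreover have "?D (\<lambda>\<xi>. ?h \<xi> + cut (4 * R) \<xi> * inv_fourier f \<xi>) = ?D ?h + ?D (\<lambda>\<xi>. cut (4 * R) \<xi> * inv_fourier f \<xi>)"
        using R by (intro add hs cs) simp
      ultimately show ?thesis using D[OF t0] D[of "4 * R"] R by simp
    qed
    have "(\<lambda>n. LINT x|lborel. u x * conv f (ker (real (Suc n))) x) \<longlonglongrightarrow> c0 * (LINT x|lborel. u x * f x)"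
      by (rule mollify_pairing[OF u schwartz_continuous[OF f] C])
    moreover have "\<forall>\<^sub>F n in sequentially. (LINT x|lborel. u x * conv f (ker (real (Suc n))) x) = (LINT x|lborel. u x * conv f (ker (4 * R)) x)"
    proof -
      obtain N where "4 * R \<le> real N" using real_arch_simple by blast
      then have "4 * R \<le> real (Suc n)" if "N \<le> n" for n using that by simp
      then show ?thesis using eq eventually_sequentially by blast
    qed
    ultimately have "(\<lambda>n. LINT x|lborel. u x * conv f (ker (4 * R)) x) \<longlonglongrightarrow> c0 * (LINT x|lborel. u x * f x)"
      by (rule Lim_transform_eventually)
    then have "(LINT x|lborel. u x * conv f (ker (4 * R)) x) = c0 * (LINT x|lborel. u x * f x)"
      by (simp add: LIMSEQ_const_iff)
    moreover obtain D where "0 \<le> D" "\<And>x. norm (ker (4 * R) x) \<le> D * decay x"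
      using rapid_decay1[OF schwartz_rapid[OF ker_schwartz[of "4 * R"]]] R by auto
    then have "(LINT x|lborel. u x * conv f (ker (4 * R)) x) = (LINT x|lborel. conv u (ker (4 * R)) x * f x)"
      using R by (intro conv_adjoint[OF u _ _ C2]) (auto intro: ker_minus schwartz_borel f)
    ultimately have "(LINT x|lborel. conv u (ker (4 * R)) x * f x) = c0 * (LINT x|lborel. u x * f x)" by simp
    moreover have "dist_of (\<lambda>x. (1 / c0) * conv u (ker (4 * R)) x) f = (1 / c0) * (LINT x|lborel. conv u (ker (4 * R)) x * f x)"
      by (subst dist_of_eq) (auto simp: f)
    ultimately show ?thesis using c0_nonzero by (simp add: dist_of_eq f)
  qed (simp add: dist_of_eq_0)
qed

lemma conv_ker_continuous:
  assumes u: "u \<in> moderate" and r: "0 < r"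
  shows "continuous_on UNIV (conv u (ker r))"
proof (rule continuous_on_sequentiallyI)
  fix X :: "nat \<Rightarrow> R3" and x assume X: "X \<longlonglongrightarrow> x"
  note [measurable] = moderate_borel[OF u]
  have [measurable]: "ker r \<in> borel_measurable borel" using r by (intro schwartz_borel ker_schwartz)
  obtain D where D: "0 \<le> D" "\<And>x. norm (ker r x) \<le> D * decay x"
    using rapid_decay1[OF schwartz_rapid[OF ker_schwartz[OF r]]] by metis
  obtain B where B: "\<And>n. norm (X n) \<le> B" using X convergent_imp_Bseq[of X] unfolding Bseq_def convergent_def by blast
  have B0: "0 \<le> B" using B norm_ge_zero order_trans by blast
  \<comment> \<open>A shift by at most B changes \<open>decay\<close> by at most a constant factor,
    which gives one majorant for the whole sequence.\<close>
  have b: "norm (ker r (X n - y)) \<le> D * (1 + B) ^ 5 * decay y" for n y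
  proof -
    have "decay (X n) * decay (y - X n) \<le> decay y" by (rule decay_mult_le)
    moreover have "1 / (1 + B) ^ 5 \<le> decay (X n)" unfolding decay_def using B[of n] by (intro frac_le power_mono) auto
    ultimately have "1 / (1 + B) ^ 5 * decay (y - X n) \<le> decay y"
      by (meson decay_pos(2) mult_right_mono order_trans)
    then have "decay (y - X n) \<le> (1 + B) ^ 5 * decay y" using B0 by (simp add: divide_le_eq mult.commute)
    moreover have "decay (y - X n) = decay (X n - y)" by (simp add: decay_def norm_minus_commute)
    ultimately have "D * decay (X n - y) \<le> D * ((1 + B) ^ 5 * decay y)" using D by (intro mult_left_mono) auto
    then show ?thesis using D(2)[of "X n - y"] by (simp add: mult.assoc)
  qed
  show "(\<lambda>n. conv u (ker r) (X n)) \<longlonglongrightarrow> conv u (ker r) x"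
    unfolding conv_def
  proof (rule moderate_tendsto[OF u _ _ b])
    have "isCont (ker r) (x - y)" for y
      using schwartz_continuous[OF ker_schwartz[OF r], of UNIV] by (simp add: continuous_on_eq_continuous_at)
    then show "AE y in lborel. (\<lambda>n. ker r (X n - y)) \<longlonglongrightarrow> ker r (x - y)"
      by (intro AE_I2 isCont_tendsto_compose[of _ "ker r"] tendsto_intros X)
  qed measurable
qed

text \<open>The kernel has supremum K1 r^3 and mass K1, so the pairing takes place at t = r^(-3).
  There the K-functional is at most 4 r^(-2) times the norm, and r^3 * r^(-2) = r.\<close>

lemma bernstein:
  assumes q: "1 \<le> q" and [measurable]: "u \<in> borel_measurable borel" and r: "0 < r"
  shows "absf (conv u (ker r)) x \<le> ennreal (4 * K1 * r) * lnorm 3 q (absf u)"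
proof -
  have [measurable]: "ker r \<in> borel_measurable borel" using r by (intro schwartz_borel ker_schwartz)
  have "absf (conv u (ker r)) x \<le> ennreal (K1 * r ^ 3) * kfun (1 / r ^ 3) (absf u)"
    by (rule conv_bound) (use r K1 ker_bound[OF r] ker_L1[OF r] in auto)
  also have "\<dots> \<le> ennreal (K1 * r ^ 3) * (ennreal (4 * (1 / r ^ 3) powr (1 - 1 / 3)) * lnorm 3 q (absf u))"
    using r by (intro mult_left_mono kfun_le_lnorm q) auto
  also have "\<dots> = ennreal (K1 * r ^ 3 * (4 * (1 / r ^ 3) powr (1 - 1 / 3))) * lnorm 3 q (absf u)"
    using K1 r by (simp add: ennreal_mult mult.assoc)
  also have "(1 / r ^ 3) powr (1 - 1 / 3) = 1 / r ^ 2"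
  proof -
    have "(1 / r ^ 3) powr (1 - 1 / 3) = (r powr (- 3)) powr (2 / 3)" using r by (simp add: powr_minus_divide)
    also have "\<dots> = r powr (- 2)" by (simp add: powr_powr)
    finally show ?thesis using r by (simp add: powr_minus_divide)
  qed
  also have "K1 * r ^ 3 * (4 * (1 / r ^ 2)) = 4 * K1 * r" using r by (simp add: power2_eq_square power3_eq_cube)
  finally show ?thesis .
qed

text \<open>The Fourier transform of the product is supported in the sum of the supports.\<close>

lemma product_multiplier_zero:
  assumes u: "u \<in> moderate" and v: "v \<in> moderate" and rs: "0 < r" "0 < s"
    and bd: "\<And>x. norm (conv u (ker r) x) \<le> B"
    and m: "m \<in> schwartz" and mz: "\<And>\<xi>. norm \<xi> \<le> r + s \<Longrightarrow> m \<xi> = 0" and f: "f \<in> schwartz"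
  shows "(LINT x|lborel. conv u (ker r) x * conv v (ker s) x * fourier (\<lambda>\<xi>. m \<xi> * inv_fourier f \<xi>) x) = 0"
proof -
  define W where "W \<xi> = m \<xi> * inv_fourier f \<xi>" for \<xi>
  define G where "G = fourier W"
  have Ws: "W \<in> schwartz" unfolding W_def[abs_def] by (intro schwartz_mult m inv_fourier_schwartz f)
  have Gs: "G \<in> schwartz" unfolding G_def by (rule fourier_schwartz[OF Ws])
  have GW: "inv_fourier G \<xi> = 0" if "norm \<xi> \<le> r + s" for \<xi>
    unfolding G_def inv_fourier_fourier[OF Ws] using mz[OF that] by (simp add: W_def)
  note [measurable] = moderate_borel[OF u] moderate_borel[OF v] schwartz_borel[OF Gs]
    schwartz_borel[OF ker_schwartz[OF rs(1)]] schwartz_borel[OF ker_schwartz[OF rs(2)]] schwartz_borel[OF cut_schwartz[OF rs(2)]]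
  obtain D where D: "0 \<le> D" "\<And>x. norm (G x) \<le> D * decay x ^ 2" using rapid_decay[OF schwartz_rapid[OF Gs]] by metis
  obtain E1 where E1: "0 \<le> E1" "\<And>x. norm (ker r x) \<le> E1 * decay x" using rapid_decay1[OF schwartz_rapid[OF ker_schwartz[OF rs(1)]]] by metis
  obtain E2 where E2: "0 \<le> E2" "\<And>x. norm (ker s x) \<le> E2 * decay x" using rapid_decay1[OF schwartz_rapid[OF ker_schwartz[OF rs(2)]]] by metis
  have B0: "0 \<le> B" using bd norm_ge_zero order_trans by blast
  \<comment> \<open>The convolution of v is opened up: for each fixed z, \<open>H z\<close> is the
    test function against which the first factor has to be integrated.\<close>
  define H where "H z x = ker s (x - z) * G x" for z x
  have [measurable]: "H z \<in> borel_measurable borel" for z unfolding H_def by measurable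
  have Hb: "norm (H z x) \<le> E2 * D * decay x ^ 2" for z x
  proof -
    have "norm (ker s (x - z)) \<le> E2" using E2 decay_le_1[of "x - z"] mult_left_mono[OF decay_le_1[of "x - z"], of E2] by (meson dual_order.trans mult_left_le)
    then show ?thesis unfolding H_def norm_mult using mult_mono[OF _ D(2)[of x] E2(1) norm_ge_zero] by (simp add: mult.assoc)
  qed
  have Hi: "integrable lborel (H z)" for z
  proof (rule integrable_decay_bound[where C="E2 * D"])
    fix x have "decay x ^ 2 \<le> decay x" using decay_le_1[of x] by (simp add: power2_eq_square mult_left_le)
    then show "norm (H z x) \<le> E2 * D * decay x" using Hb[of z x] E2 D mult_left_mono[of "decay x ^ 2" "decay x" "E2 * D"] by simp
  qed measurable
  define \<kappa> where "\<kappa> = complex_of_real (1 / (2 * pi) ^ 3)"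
  \<comment> \<open>The inverse transform of \<open>H z\<close> at \<xi> averages that of G over the
    points \<xi> + \<zeta> with |\<zeta>| <= s. For |\<xi>| <= r these lie in the ball of radius r +
    s, where it vanishes.\<close>
  have Hz: "inv_fourier (H z) \<xi> = 0" if \<xi>: "norm \<xi> \<le> r" for z \<xi>
  proof -
    let ?F = "\<lambda>x \<zeta>. \<kappa> * (exp (\<i> * of_real ((x - z) \<bullet> \<zeta>)) * exp (\<i> * of_real (\<xi> \<bullet> x)) * (G x * cut s \<zeta>))"
    have i: "integrable (lborel \<Otimes>\<^sub>M lborel) (case_prod ?F)"
    proof (rule Bochner_Integration.integrable_bound)
      show "integrable (lborel \<Otimes>\<^sub>M lborel) (\<lambda>(x, \<zeta>). (\<kappa> * G x) * cut s \<zeta>)"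
        using schwartz_integrable[OF Gs] schwartz_integrable[OF cut_schwartz[OF rs(2)]] by (intro integrable_tensor) auto
      show "AE w in lborel \<Otimes>\<^sub>M lborel. norm (case_prod ?F w) \<le> norm (case w of (x, \<zeta>) \<Rightarrow> (\<kappa> * G x) * cut s \<zeta>)"
        by (intro AE_I2) (auto simp: norm_mult)
    qed measurable
    have "(LINT x|lborel. exp (\<i> * of_real (\<xi> \<bullet> x)) * H z x) = (LINT x|lborel. (LINT \<zeta>|lborel. ?F x \<zeta>))"
    proof (rule Bochner_Integration.integral_cong)
      fix x
      have "(LINT \<zeta>|lborel. ?F x \<zeta>) = (LINT \<zeta>|lborel. (\<kappa> * exp (\<i> * of_real (\<xi> \<bullet> x)) * G x) * (exp (\<i> * of_real ((x - z) \<bullet> \<zeta>)) * cut s \<zeta>))"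
        by (intro Bochner_Integration.integral_cong) (simp_all add: mult_ac)
      also have "\<dots> = (\<kappa> * exp (\<i> * of_real (\<xi> \<bullet> x)) * G x) * (LINT \<zeta>|lborel. exp (\<i> * of_real ((x - z) \<bullet> \<zeta>)) * cut s \<zeta>)"
        by (rule integral_mult_right_zero)
      also have "\<dots> = exp (\<i> * of_real (\<xi> \<bullet> x)) * H z x"
        by (simp add: H_def ker_def inv_fourier_lborel \<kappa>_def mult_ac)
      finally show "exp (\<i> * of_real (\<xi> \<bullet> x)) * H z x = (LINT \<zeta>|lborel. ?F x \<zeta>)" by simp
    qed simp
    also have "\<dots> = (LINT \<zeta>|lborel. (LINT x|lborel. ?F x \<zeta>))"
      by (rule lborel_pair.Fubini_integral[OF i, symmetric])
    also have "\<dots> = (LINT \<zeta>|(lborel :: R3 measure). 0)"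
    proof (rule Bochner_Integration.integral_cong)
      fix \<zeta>
      have "(LINT x|lborel. ?F x \<zeta>) = (LINT x|lborel. (exp (- \<i> * of_real (z \<bullet> \<zeta>)) * cut s \<zeta>) * (\<kappa> * (exp (\<i> * of_real ((\<xi> + \<zeta>) \<bullet> x)) * G x)))"
      proof (rule Bochner_Integration.integral_cong)
        fix x
        have "exp (\<i> * of_real ((x - z) \<bullet> \<zeta>)) * exp (\<i> * of_real (\<xi> \<bullet> x)) = exp (- \<i> * of_real (z \<bullet> \<zeta>)) * exp (\<i> * of_real ((\<xi> + \<zeta>) \<bullet> x))"
          by (simp add: exp_add[symmetric] inner_diff_left inner_add_left inner_commute algebra_simps)
        then have "?F x \<zeta> = \<kappa> * (exp (- \<i> * of_real (z \<bullet> \<zeta>)) * exp (\<i> * of_real ((\<xi> + \<zeta>) \<bullet> x)) * (G x * cut s \<zeta>))"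
          by (simp only:)
        then show "?F x \<zeta> = (exp (- \<i> * of_real (z \<bullet> \<zeta>)) * cut s \<zeta>) * (\<kappa> * (exp (\<i> * of_real ((\<xi> + \<zeta>) \<bullet> x)) * G x))"
          by (simp only: mult_ac)
      qed simp
      also have "\<dots> = (exp (- \<i> * of_real (z \<bullet> \<zeta>)) * cut s \<zeta>) * inv_fourier G (\<xi> + \<zeta>)"
        by (simp only: integral_mult_right_zero inv_fourier_lborel[OF schwartz_borel[OF Gs]] \<kappa>_def)
      also have "\<dots> = 0"
      proof (cases "s < norm \<zeta>")
        case True
        then show ?thesis using cut_zero[OF rs(2)] by simp
      next
        case False
        then have "norm (\<xi> + \<zeta>) \<le> r + s" using \<xi> norm_triangle_ineq[of \<xi> \<zeta>] by linarith
        then show ?thesis using GW by simp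
      qed
      finally show "(LINT x|lborel. ?F x \<zeta>) = 0" .
    qed simp
    finally show ?thesis by (simp add: inv_fourier_lborel)
  qed
  have cH: "conv (H z) (ker r) y = 0" for z y
  proof -
    have "conv (H z) (ker r) y = fourier (\<lambda>\<xi>. cut r \<xi> * inv_fourier (H z) \<xi>) y"
      unfolding ker_def by (intro fourier_mult_inv_fourier[symmetric] schwartz_integrable cut_schwartz rs Hi cut_minus)
    also have "(\<lambda>\<xi>. cut r \<xi> * inv_fourier (H z) \<xi>) = (\<lambda>\<xi>. 0)"
      using Hz cut_zero[OF rs(1)] by (auto simp: fun_eq_iff) (metis not_less)
    finally show ?thesis by (simp add: fourier_def)
  qed
  \<comment> \<open>Adjointness moves the kernel \<open>ker r\<close> from u to \<open>H z\<close>,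
    and that convolution is zero by the previous step.\<close>
  have uH: "(LINT x|lborel. conv u (ker r) x * H z x) = 0" for z
  proof -
    have "(LINT x|lborel. u x * conv (H z) (ker r) x) = (LINT x|lborel. conv u (ker r) x * H z x)"
      by (rule conv_adjoint(1)[OF u _ _ _ Hb E1]) (use E2 D rs in \<open>auto intro: ker_minus\<close>)
    then show ?thesis by (simp add: cH)
  qed
  \<comment> \<open>With the bounded first factor absorbed, P plays the role of the test function
    for v; its convolution with \<open>ker s\<close> at z is the integral in
    \<open>uH\<close>.\<close>
  define P where "P x = conv u (ker r) x * G x" for x
  have [measurable]: "P \<in> borel_measurable borel" unfolding P_def by measurable
  have Pb: "norm (P x) \<le> B * D * decay x ^ 2" for x
    unfolding P_def norm_mult using mult_mono[OF bd[of x] D(2)[of x] B0 norm_ge_zero] by (simp add: mult.assoc)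
  have "conv P (ker s) z = (LINT x|lborel. conv u (ker r) x * H z x)" for z
    unfolding conv_def[of P] P_def H_def
    using ker_minus[OF rs(2), of "_ - z"] by (intro Bochner_Integration.integral_cong refl) (simp add: mult_ac)
  then have "(LINT x|lborel. v x * conv P (ker s) x) = 0" by (simp add: uH)
  moreover have "(LINT x|lborel. v x * conv P (ker s) x) = (LINT x|lborel. conv v (ker s) x * P x)"
    by (rule conv_adjoint(1)[OF v _ _ _ Pb E2]) (use B0 D rs in \<open>auto intro: ker_minus\<close>)
  ultimately show ?thesis by (simp add: P_def G_def W_def[abs_def] mult_ac)
qed

end

section \<open>Dilations and translations of distributions\<close>

lemma dist_rescale_dist_of:
  assumes u: "u \<in> moderate" and l: "0 < l"
  shows "dist_rescale l x0 (dist_of u) = dist_of (\<lambda>x. of_real l * u (l *\<^sub>R x - x0))"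
proof
  fix f
  note [measurable] = moderate_borel[OF u]
  show "dist_rescale l x0 (dist_of u) f = dist_of (\<lambda>x. of_real l * u (l *\<^sub>R x - x0)) f"
  proof (cases "f \<in> schwartz")
    case f: True
    note [measurable] = schwartz_borel[OF f]
    have eq: "(\<lambda>y. f ((1 / l) *\<^sub>R (y + x0))) = (\<lambda>y. f ((1 / l) *\<^sub>R y + (1 / l) *\<^sub>R x0))" by (simp add: scaleR_add_right)
    have fs: "(\<lambda>y. f ((1 / l) *\<^sub>R (y + x0))) \<in> schwartz" unfolding eq using l by (intro schwartz_affine f) simp
    have "dist_rescale l x0 (dist_of u) f = of_real (l / l ^ 3) * (LINT y|lborel. u y * f ((1 / l) *\<^sub>R (y + x0)))"
      using f fs by (simp add: dist_rescale_def on_schwartz_def dist_of_eq)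
    also have "\<dots> = of_real l * (of_real (1 / l ^ 3) * (LINT y|lborel. u y * f ((1 / l) *\<^sub>R (y + x0))))" by simp
    also have "of_real (1 / l ^ 3) * (LINT y|lborel. u y * f ((1 / l) *\<^sub>R (y + x0))) =
        (LINT x|lborel. u (l *\<^sub>R x + - x0) * f ((1 / l) *\<^sub>R (l *\<^sub>R x + - x0 + x0)))"
      by (rule integral_affine_lborel[symmetric]) (use l in auto)
    also have "of_real l * \<dots> = dist_of (\<lambda>x. of_real l * u (l *\<^sub>R x - x0)) f"
      using l by (subst dist_of_eq) (auto simp: f mult.assoc)
    finally show ?thesis .
  qed (simp add: dist_rescale_def on_schwartz_def dist_of_eq_0)
qed

section \<open>Lorentz spaces of distributions\<close>

text \<open>The Lorentz class consists of Lebesgue measurable functions, whereas the K-functional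
  and Fubini arguments are carried out for Borel functions; the passage costs only a null
  set.\<close>

lemma lebesgue_ex_borel:
  fixes f :: fn
  assumes f: "f \<in> borel_measurable lebesgue"
  obtains g where "g \<in> borel_measurable borel" "AE x in lborel. f x = g x"
proof -
  have "(\<lambda>x. Re (f x)) \<in> borel_measurable lebesgue" "(\<lambda>x. Im (f x)) \<in> borel_measurable lebesgue"
    using f by (simp_all add: borel_measurable_complex_iff)
  from completion_ex_borel_measurable_real[OF this(1)] completion_ex_borel_measurable_real[OF this(2)]
  obtain a b where [measurable]: "a \<in> borel_measurable lborel" "b \<in> borel_measurable lborel"
    and ab: "AE x in lborel. Re (f x) = a x" "AE x in lborel. Im (f x) = b x"
    by blast
  show ?thesis
  proof
    show "(\<lambda>x. of_real (a x) + \<i> * of_real (b x)) \<in> borel_measurable borel" by measurable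
    show "AE x in lborel. f x = of_real (a x) + \<i> * of_real (b x)"
      using ab by eventually_elim (auto simp: complex_eq_iff)
  qed
qed

text \<open>The exponent is left general because both L^(3,q) and the predual L^(3/2,1) of weak L^3
  are instances.\<close>

locale lorentz = cutoff \<phi> for \<phi> +
  fixes p :: real and q :: ennreal
  assumes p: "1 < p" and q: "1 \<le> q"
begin

sublocale F: function_norm "lnorm p q" "decay_mass * 4"
  by (rule function_norm_lnorm[OF p q])

definition lfun :: "fn set" where
  "lfun = {f. f \<in> borel_measurable borel \<and> lnorm p q (absf f) < top}"

lemma lfun_borel: "f \<in> lfun \<Longrightarrow> f \<in> borel_measurable borel"
  by (simp add: lfun_def)

lemma lfun_lebesgue: "f \<in> lfun \<Longrightarrow> f \<in> borel_measurable lebesgue"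
  by (auto simp: lfun_def intro: measurable_completion)

lemma lfun_finite: "f \<in> lfun \<Longrightarrow> lnorm p q (absf f) < top"
  by (simp add: lfun_def)

lemma lfun_moderate: "f \<in> lfun \<Longrightarrow> f \<in> moderate"
  using F.integrable_decay_mult by (simp add: lfun_def moderate_def)

lemma lfun_add: "f \<in> lfun \<Longrightarrow> g \<in> lfun \<Longrightarrow> (\<lambda>x. f x + g x) \<in> lfun"
  using order_le_less_trans[OF F.norm_add[of f g]] by (auto simp: lfun_def)

lemma lfun_cmult: "f \<in> lfun \<Longrightarrow> (\<lambda>x. c * f x) \<in> lfun"
  using F.norm_cmult[of f c] by (auto simp: lfun_def ennreal_mult_less_top)

lemma lfun_diff: "f \<in> lfun \<Longrightarrow> g \<in> lfun \<Longrightarrow> (\<lambda>x. f x - g x) \<in> lfun"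
  using lfun_add[OF _ lfun_cmult[of g "-1"]] by simp

lemma lfun_mono:
  assumes "f \<in> borel_measurable borel" "lnorm p q (absf f) \<le> ennreal c * lnorm p q (absf g)" "g \<in> lfun"
  shows "f \<in> lfun"
  using assms order_le_less_trans[OF assms(2)] by (auto simp: lfun_def ennreal_mult_less_top)

lemma lnorm_cong_AE:
  "AE x in lborel. f x = g x \<Longrightarrow> lnorm p q (absf f) = lnorm p q (absf g)"
  by (intro antisym lnorm_mono q) (auto elim!: eventually_mono)

lemma lfun_lorentz_functions:
  assumes f: "f \<in> lfun" shows "f \<in> lorentz_functions p q"
proof -
  obtain c where c: "0 < c" "\<And>f. f \<in> borel_measurable lebesgue \<Longrightarrow> ennreal c * lorentz_quasinorm p q f \<le> lnorm p q (absf f)"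
    using lorentz_quasinorm_equiv[OF p q] by blast
  have "ennreal c * lorentz_quasinorm p q f < top"
    using order_le_less_trans[OF c(2)[OF lfun_lebesgue[OF f]] lfun_finite[OF f]] .
  then show ?thesis using c(1) f lfun_lebesgue
    by (auto simp: lorentz_functions_def ennreal_mult_less_top)
qed

lemma lorentz_functions_lfun:
  assumes f: "f \<in> lorentz_functions p q"
  obtains g where "g \<in> lfun" "dist_of g = dist_of f" "lnorm p q (absf g) = lnorm p q (absf f)"
proof -
  have fm: "f \<in> borel_measurable lebesgue" using f by (simp add: lorentz_functions_def)
  then obtain g where g: "g \<in> borel_measurable borel" "AE x in lborel. f x = g x" by (rule lebesgue_ex_borel)
  obtain C where C: "0 < C" "\<And>f. f \<in> borel_measurable lebesgue \<Longrightarrow> lnorm p q (absf f) \<le> ennreal C * lorentz_quasinorm p q f"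
    using lorentz_quasinorm_equiv[OF p q] by blast
  have l: "lnorm p q (absf g) = lnorm p q (absf f)" using g(2) by (intro lnorm_cong_AE) (auto elim!: eventually_mono)
  have "lnorm p q (absf f) < top"
    using order_le_less_trans[OF C(2)[OF fm]] f by (auto simp: lorentz_functions_def ennreal_mult_less_top)
  then have gl: "g \<in> lfun" using g l by (simp add: lfun_def)
  have "AE x in lebesgue. g x = f x" using AE_completion[OF g(2)] by eventually_elim simp
  then have "dist_of g = dist_of f" by (intro dist_of_cong_AE lfun_lebesgue gl fm)
  then show ?thesis using that gl l by blast
qed

lemma lorentz_space_eq: "lorentz_space p q = dist_of ` lfun"
proof
  show "lorentz_space p q \<subseteq> dist_of ` lfun"
  proof
    fix T assume "T \<in> lorentz_space p q"
    then obtain f where "f \<in> lorentz_functions p q" "T = dist_of f" unfolding lorentz_space_def by blast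
    then show "T \<in> dist_of ` lfun" by (metis imageI lorentz_functions_lfun)
  qed
qed (auto simp: lorentz_space_def intro: lfun_lorentz_functions)

lemma dist_of_lfun_inj: "f \<in> lfun \<Longrightarrow> g \<in> lfun \<Longrightarrow> dist_of f = dist_of g \<Longrightarrow> AE x in lborel. f x = g x"
  by (intro dist_of_inj lfun_moderate)

text \<open>Computed on an arbitrary Borel density; by injectivity of \<open>dist_of\<close> up to
  null sets the choice does not matter, which is the content of \<open>ennreal_LN\<close>.\<close>

definition LN :: "dist \<Rightarrow> real" where
  "LN T = enn2real (lnorm p q (absf (SOME f. f \<in> lfun \<and> dist_of f = T)))"

lemma LN_nonneg [simp]: "0 \<le> LN T"
  by (simp add: LN_def)

lemma ennreal_LN:
  assumes f: "f \<in> lfun"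
  shows "ennreal (LN (dist_of f)) = lnorm p q (absf f)"
proof -
  define g where "g = (SOME g. g \<in> lfun \<and> dist_of g = dist_of f)"
  have "g \<in> lfun \<and> dist_of g = dist_of f" unfolding g_def by (rule someI[of _ f]) (use f in simp)
  then have g: "g \<in> lfun" "dist_of g = dist_of f" by auto
  have "ennreal (LN (dist_of f)) = lnorm p q (absf g)"
    unfolding LN_def g_def[symmetric] by (rule ennreal_enn2real) (rule lfun_finite[OF g(1)])
  also have "\<dots> = lnorm p q (absf f)" by (intro lnorm_cong_AE dist_of_lfun_inj g f)
  finally show ?thesis .
qed

lemma LN_leI: "f \<in> lfun \<Longrightarrow> 0 \<le> c \<Longrightarrow> lnorm p q (absf f) \<le> ennreal c \<Longrightarrow> LN (dist_of f) \<le> c"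
  by (simp add: ennreal_LN[symmetric])

lemma LN_lessI: "f \<in> lfun \<Longrightarrow> 0 < c \<Longrightarrow> lnorm p q (absf f) < ennreal c \<Longrightarrow> LN (dist_of f) < c"
  by (simp add: ennreal_LN[symmetric] ennreal_less_iff)

lemma dist_of_lfun_add: "f \<in> lfun \<Longrightarrow> g \<in> lfun \<Longrightarrow> (\<lambda>a. dist_of f a + dist_of g a) = dist_of (\<lambda>x. f x + g x)"
  by (simp add: dist_of_add lfun_moderate)

lemma dist_of_lfun_cmult: "f \<in> lfun \<Longrightarrow> (\<lambda>a. c * dist_of f a) = dist_of (\<lambda>x. c * f x)"
  by (simp add: dist_of_cmult lfun_moderate)

lemma dist_of_lfun_diff: "f \<in> lfun \<Longrightarrow> g \<in> lfun \<Longrightarrow> (\<lambda>a. dist_of f a - dist_of g a) = dist_of (\<lambda>x. f x - g x)"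
  by (simp add: dist_of_diff lfun_moderate)

lemma lfun_zero: "(\<lambda>x. 0) \<in> lfun"
  using F.zero by (simp add: lfun_def)

lemma dist_of_zero: "dist_of (\<lambda>x. 0) = (\<lambda>a. 0)"
  by (auto simp: dist_of_def on_schwartz_def)

lemma subspace_lorentz: "subspace_on (lorentz_space p q)"
proof -
  have "(\<lambda>_. 0) \<in> dist_of ` lfun" using imageI[OF lfun_zero, of dist_of] dist_of_zero by simp
  then show ?thesis unfolding subspace_on_def lorentz_space_eq
    by (auto simp: dist_of_lfun_add dist_of_lfun_cmult intro: lfun_add lfun_cmult)
qed

lemma norm_LN: "norm_on (lorentz_space p q) LN"
  unfolding norm_on_def lorentz_space_eq
proof (intro conjI ballI allI)
  fix T assume "T \<in> dist_of ` lfun"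
  then obtain f where f: "f \<in> lfun" "T = dist_of f" by blast
  show "LN T = 0 \<longleftrightarrow> T = (\<lambda>_. 0)"
  proof
    assume "LN T = 0"
    then have "lnorm p q (absf f) = 0" using ennreal_LN[OF f(1)] f by simp
    then have "AE x in lborel. absf f x = 0" using lfun_borel[OF f(1)] by (intro F.AE_zero) auto
    then have "AE x in lborel. f x = 0" by eventually_elim simp
    then have "AE x in lebesgue. f x = (\<lambda>x. 0) x" using AE_completion by fastforce
    then have "dist_of f = dist_of (\<lambda>x. 0)" by (intro dist_of_cong_AE lfun_lebesgue f lfun_zero) auto
    then show "T = (\<lambda>_. 0)" using f dist_of_zero by simp
  next
    assume "T = (\<lambda>_. 0)"
    then show "LN T = 0" using ennreal_LN[OF lfun_zero] dist_of_zero F.zero by simp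
  qed
next
  fix S T assume "S \<in> dist_of ` lfun" "T \<in> dist_of ` lfun"
  then obtain f g where f: "f \<in> lfun" "S = dist_of f" and g: "g \<in> lfun" "T = dist_of g" by blast
  have "lnorm p q (absf (\<lambda>x. f x + g x)) \<le> lnorm p q (absf f) + lnorm p q (absf g)"
    by (intro F.norm_add lfun_borel f g)
  also have "\<dots> = ennreal (LN S + LN T)" using f g by (simp add: ennreal_LN)
  finally show "LN (\<lambda>a. S a + T a) \<le> LN S + LN T"
    using f g by (simp add: dist_of_lfun_add LN_leI lfun_add)
next
  fix c T assume "T \<in> dist_of ` lfun"
  then obtain f where f: "f \<in> lfun" "T = dist_of f" by blast
  have "ennreal (LN (\<lambda>a. c * T a)) = ennreal (norm c * LN T)"
    using F.norm_cmult[OF lfun_borel[OF f(1)], of c] f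
    by (simp add: dist_of_lfun_cmult ennreal_LN lfun_cmult ennreal_mult)
  then show "LN (\<lambda>a. c * T a) = norm c * LN T" by simp
qed simp

lemma LN_tendsto_0:
  assumes "\<And>n. f n \<in> lfun" "(\<lambda>n. lnorm p q (absf (f n))) \<longlonglongrightarrow> 0"
  shows "(\<lambda>n. LN (dist_of (f n))) \<longlonglongrightarrow> 0"
proof (rule tendsto_ennrealD)
  show "(\<lambda>n. ennreal (LN (dist_of (f n)))) \<longlonglongrightarrow> ennreal 0" using assms by (simp add: ennreal_LN)
qed auto

lemma complete_LN: "complete_on (lorentz_space p q) LN"
  unfolding complete_on_def
proof (intro allI impI, elim conjE)
  fix T :: "nat \<Rightarrow> dist"
  assume T: "\<forall>n. T n \<in> lorentz_space p q" and C: "\<forall>e>0. \<exists>M. \<forall>m\<ge>M. \<forall>n\<ge>M. LN (\<lambda>a. T m a - T n a) < e"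
  have "\<forall>n. \<exists>f. f \<in> lfun \<and> T n = dist_of f" using T unfolding lorentz_space_eq by blast
  then obtain f where f: "\<And>n. f n \<in> lfun" "\<And>n. T n = dist_of (f n)" by metis
  have d: "(\<lambda>a. T m a - T n a) = dist_of (\<lambda>x. f m x - f n x)" for m n
    unfolding f(2) by (rule dist_of_lfun_diff[OF f(1) f(1)])
  obtain g where g: "g \<in> borel_measurable borel" "lnorm p q (absf g) < top" "(\<lambda>n. lnorm p q (absf (\<lambda>x. f n x - g x))) \<longlonglongrightarrow> 0"
  proof (rule F.riesz_fischer[of f])
    show "\<And>n. f n \<in> borel_measurable borel" "\<And>n. lnorm p q (absf (f n)) < top" using f by (auto simp: lfun_def)
    fix e :: real assume e: "0 < e"
    obtain M where M: "\<And>m n. M \<le> m \<Longrightarrow> M \<le> n \<Longrightarrow> LN (\<lambda>a. T m a - T n a) < e" using C e by blast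
    have "lnorm p q (absf (\<lambda>x. f m x - f n x)) < ennreal e" if "M \<le> m" "M \<le> n" for m n
      using M[OF that] e unfolding d by (simp add: ennreal_LN[symmetric] lfun_diff f ennreal_less_iff)
    then show "\<exists>M. \<forall>m\<ge>M. \<forall>n\<ge>M. lnorm p q (absf (\<lambda>x. f m x - f n x)) < ennreal e" by blast
  qed
  have gl: "g \<in> lfun" using g by (simp add: lfun_def)
  have "(\<lambda>n. LN (dist_of (\<lambda>x. f n x - g x))) \<longlonglongrightarrow> 0" by (intro LN_tendsto_0 g lfun_diff f gl)
  then have "(\<lambda>n. LN (\<lambda>a. T n a - dist_of g a)) \<longlonglongrightarrow> 0"
    unfolding f(2) using dist_of_lfun_diff[OF f(1) gl] by simp
  then show "\<exists>S\<in>lorentz_space p q. (\<lambda>n. LN (\<lambda>a. T n a - S a)) \<longlonglongrightarrow> 0"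
    unfolding lorentz_space_eq using gl by blast
qed

lemma banach_LN: "banach_on (lorentz_space p q) LN"
  by (simp add: banach_on_def subspace_lorentz norm_LN complete_LN)

lemma lorentz_norm_LN: "lorentz_norm p q LN"
proof -
  obtain c C where cC: "0 < c" "0 < C" "\<And>f. f \<in> borel_measurable lebesgue \<Longrightarrow>
      ennreal c * lorentz_quasinorm p q f \<le> lnorm p q (absf f) \<and> lnorm p q (absf f) \<le> ennreal C * lorentz_quasinorm p q f"
    using lorentz_quasinorm_equiv[OF p q] by blast
  have "ennreal (LN (dist_of f)) = lnorm p q (absf f)" if "f \<in> lorentz_functions p q" for f
    using lorentz_functions_lfun[OF that] ennreal_LN by metis
  then have "\<forall>f\<in>lorentz_functions p q. ennreal c * lorentz_quasinorm p q f \<le> ennreal (LN (dist_of f)) \<and>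
      ennreal (LN (dist_of f)) \<le> ennreal C * lorentz_quasinorm p q f"
    using cC(3) by (simp add: lorentz_functions_def)
  then show ?thesis unfolding lorentz_norm_def using banach_LN cC(1,2) by blast
qed

text \<open>Both norms are comparable to the same quasinorm. This transfers statements about
  \<open>LN\<close> to an arbitrary admissible norm.\<close>

lemma lorentz_norm_equiv:
  assumes N: "lorentz_norm p q N"
  shows "\<exists>a>0. \<exists>b>0. \<forall>T\<in>lorentz_space p q. a * LN T \<le> N T \<and> N T \<le> b * LN T"
proof -
  have "\<exists>c>0. \<exists>C>0. \<forall>f\<in>lorentz_functions p q.
        ennreal c * lorentz_quasinorm p q f \<le> ennreal (N (dist_of f)) \<and>
        ennreal (N (dist_of f)) \<le> ennreal C * lorentz_quasinorm p q f"
    using N unfolding lorentz_norm_def by blast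
  then obtain c C where c: "0 < c" "0 < C" and cC: "\<And>f. f \<in> lorentz_functions p q \<Longrightarrow>
        ennreal c * lorentz_quasinorm p q f \<le> ennreal (N (dist_of f)) \<and>
        ennreal (N (dist_of f)) \<le> ennreal C * lorentz_quasinorm p q f" by metis
  have "\<exists>c>0. \<exists>C>0. \<forall>f\<in>lorentz_functions p q.
        ennreal c * lorentz_quasinorm p q f \<le> ennreal (LN (dist_of f)) \<and>
        ennreal (LN (dist_of f)) \<le> ennreal C * lorentz_quasinorm p q f"
    using lorentz_norm_LN unfolding lorentz_norm_def by blast
  then obtain c' C' where c': "0 < c'" "0 < C'" and cC': "\<And>f. f \<in> lorentz_functions p q \<Longrightarrow>
        ennreal c' * lorentz_quasinorm p q f \<le> ennreal (LN (dist_of f)) \<and>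
        ennreal (LN (dist_of f)) \<le> ennreal C' * lorentz_quasinorm p q f" by metis
  have "(c / C') * LN T \<le> N T \<and> N T \<le> (C / c') * LN T" if T: "T \<in> lorentz_space p q" for T
  proof -
    obtain f where f: "f \<in> lorentz_functions p q" "T = dist_of f" using T unfolding lorentz_space_def by blast
    obtain Q where Q: "0 \<le> Q" "lorentz_quasinorm p q f = ennreal Q"
      using f(1) unfolding lorentz_functions_def by (cases "lorentz_quasinorm p q f") auto
    have N0: "0 \<le> N T" using N T by (simp add: lorentz_norm_def banach_on_def norm_on_def)
    have "c * Q \<le> N T" "N T \<le> C * Q" "c' * Q \<le> LN T" "LN T \<le> C' * Q"
      using cC[OF f(1)] cC'[OF f(1)] c c' N0 Q f(2) by (simp_all add: ennreal_mult[symmetric])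
    moreover from \<open>LN T \<le> C' * Q\<close> have "(c / C') * LN T \<le> c * Q"
      using c c' mult_left_mono[of "LN T" "C' * Q" "c / C'"] by simp
    moreover from \<open>c' * Q \<le> LN T\<close> have "C * Q \<le> (C / c') * LN T"
      using c c' mult_left_mono[of "c' * Q" "LN T" "C / c'"] by simp
    ultimately show ?thesis by linarith
  qed
  then show ?thesis using c c' by (intro exI[of _ "c / C'"] conjI exI[of _ "C / c'"]) auto
qed

lemma schwartz_lfun:
  assumes f: "f \<in> schwartz"
  shows "f \<in> lfun" "LN (dist_of f) \<le> decay_mass powr (1 / p) * enn2real (lnorm_const p q) * schwartz_norm 5 f"
proof -
  define S where "S = schwartz_norm 5 f"
  have S0: "0 \<le> S" unfolding S_def by (rule schwartz_norm_nonneg[OF f])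
  have b: "norm (f x) \<le> S * decay x" for x unfolding S_def by (rule schwartz_norm_decay[OF f])
  have "lnorm p q (absf f) \<le> ennreal (S * decay_mass powr (1 / p)) * lnorm_const p q"
  proof (rule lnorm_le[OF p q S0])
    show "absf f x \<le> ennreal S" for x
      using b[of x] decay_le_1[of x] S0 by (intro ennreal_leI) (meson mult_left_le order_trans)
    have "(\<integral>\<^sup>+x. absf f x \<partial>lborel) \<le> (\<integral>\<^sup>+x. ennreal S * ennreal (decay x) \<partial>lborel)"
      using b S0 by (intro nn_integral_mono) (simp add: ennreal_mult[symmetric])
    also have "\<dots> = ennreal S * ennreal (LINT x|lborel. decay x)"
      by (simp add: nn_integral_cmult nn_integral_decay)
    also have "\<dots> \<le> ennreal S * ennreal decay_mass" by (intro mult_left_mono ennreal_leI) (auto simp: decay_mass_def)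
    finally show "(\<integral>\<^sup>+x. absf f x \<partial>lborel) \<le> ennreal (S * decay_mass)" using S0 by (simp add: ennreal_mult decay_mass_def)
  qed (simp add: decay_mass_def)
  also have "\<dots> = ennreal (decay_mass powr (1 / p) * enn2real (lnorm_const p q) * S)"
  proof -
    have "lnorm_const p q = ennreal (enn2real (lnorm_const p q))" using lnorm_const_finite[OF p q] by simp
    then have "ennreal (S * decay_mass powr (1 / p)) * lnorm_const p q = ennreal (S * decay_mass powr (1 / p)) * ennreal (enn2real (lnorm_const p q))"
      by simp
    then show ?thesis using S0 by (simp add: ennreal_mult[symmetric] mult_ac)
  qed
  finally have le: "lnorm p q (absf f) \<le> ennreal (decay_mass powr (1 / p) * enn2real (lnorm_const p q) * S)" .
  then show fl: "f \<in> lfun" using schwartz_borel[OF f] order_le_less_trans[OF le] by (simp add: lfun_def)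
  show "LN (dist_of f) \<le> decay_mass powr (1 / p) * enn2real (lnorm_const p q) * schwartz_norm 5 f"
    using LN_leI[OF fl _ le] S0 by (simp add: S_def)
qed

lemma schwartz_inj: "inj_on dist_of schwartz"
proof (rule inj_onI)
  fix f g assume fg: "f \<in> schwartz" "g \<in> schwartz" "dist_of f = dist_of g"
  have "AE x in lborel. f x - g x = 0"
    using dist_of_lfun_inj[OF schwartz_lfun(1)[OF fg(1)] schwartz_lfun(1)[OF fg(2)] fg(3)] by eventually_elim simp
  then have "f x - g x = 0" for x by (rule continuous_AE_zero[rotated]) (intro continuous_on_diff schwartz_continuous fg)
  then show "f = g" by (simp add: fun_eq_iff)
qed

lemma schwartz_embeds_LN: "schwartz_embeds dist_of (lorentz_space p q) LN"
  unfolding schwartz_embeds_def lorentz_space_eq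
  using schwartz_inj schwartz_lfun
  by (auto simp: dist_of_lfun_add[symmetric] dist_of_lfun_cmult[symmetric] schwartz_lfun(1))

lemma schwartz_dense_LN:
  assumes "q \<noteq> \<infinity>"
  shows "schwartz_dense dist_of (lorentz_space p q) LN"
  unfolding schwartz_dense_def
proof (intro conjI ballI allI impI)
  fix v e assume "v \<in> lorentz_space p q" and e: "(0::real) < e"
  then obtain u where u: "u \<in> lfun" "v = dist_of u" unfolding lorentz_space_eq by blast
  obtain f where f: "f \<in> schwartz" "lnorm p q (absf (\<lambda>x. u x - f x)) < ennreal e"
    using schwartz_lnorm_dense[OF p q assms lfun_borel[OF u(1)] lfun_finite[OF u(1)] e] by blast
  have "LN (\<lambda>a. v a - dist_of f a) < e"
    unfolding u(2) dist_of_lfun_diff[OF u(1) schwartz_lfun(1)[OF f(1)]]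
    by (intro LN_lessI lfun_diff u schwartz_lfun(1) f e)
  then show "\<exists>f\<in>schwartz. LN (\<lambda>a. v a - dist_of f a) < e" using f by blast
qed (rule schwartz_embeds_LN)

lemma pairing_bound:
  assumes u: "u \<in> lfun" and f: "f \<in> schwartz"
  shows "norm (dist_of u f) \<le> (decay_mass * 4 * LN (dist_of u)) * schwartz_norm 5 f"
proof -
  note [measurable] = lfun_borel[OF u] schwartz_borel[OF f]
  define S where "S = schwartz_norm 5 f"
  have S0: "0 \<le> S" unfolding S_def by (rule schwartz_norm_nonneg[OF f])
  have "ennreal (norm (dist_of u f)) = ennreal (norm (LINT x|lborel. u x * f x))"
    using u f by (simp add: dist_of_eq lfun_borel)
  also have "\<dots> \<le> (\<integral>\<^sup>+x. ennreal (norm (u x * f x)) \<partial>lborel)" by (rule norm_integral_le_nn)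
  also have "\<dots> \<le> (\<integral>\<^sup>+x. ennreal S * (absf u x * ennreal (decay x)) \<partial>lborel)"
  proof (rule nn_integral_mono)
    fix x
    have "norm (u x * f x) \<le> norm (u x) * (S * decay x)"
      unfolding norm_mult S_def by (intro mult_left_mono schwartz_norm_decay f) auto
    then show "ennreal (norm (u x * f x)) \<le> ennreal S * (absf u x * ennreal (decay x))"
      using S0 by (simp add: ennreal_mult[symmetric] mult_ac)
  qed
  also have "\<dots> = ennreal S * (\<integral>\<^sup>+x. absf u x * ennreal (decay x) \<partial>lborel)" by (rule nn_integral_cmult) measurable
  also have "\<dots> \<le> ennreal S * (ennreal (decay_mass * 4) * lnorm p q (absf u))"
    by (intro mult_left_mono F.decay_bound) auto
  also have "\<dots> = ennreal ((decay_mass * 4 * LN (dist_of u)) * S)"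
  proof -
    have "0 \<le> decay_mass * 4" by (simp add: decay_mass_def)
    then show ?thesis unfolding ennreal_LN[OF u, symmetric] using S0 by (simp only: ennreal_mult[symmetric] LN_nonneg mult_nonneg_nonneg mult_ac)
  qed
  finally show ?thesis unfolding S_def using schwartz_norm_nonneg[OF f, of 5] by (simp add: decay_mass_def)
qed

lemma lorentz_tempered: "lorentz_space p q \<subseteq> tempered"
proof
  fix T assume "T \<in> lorentz_space p q"
  then obtain u where u: "u \<in> lfun" "T = dist_of u" unfolding lorentz_space_eq by blast
  have i: "integrable lborel (\<lambda>x. u x * f x)" if "f \<in> schwartz" for f
    using moderate_mult_schwartz[OF lfun_moderate[OF u(1)] that] .
  have "\<forall>f\<in>schwartz. norm (T f) \<le> (decay_mass * 4 * LN T) * schwartz_norm 5 f"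
    using pairing_bound[OF u(1)] u(2) by simp
  then show "T \<in> tempered"
    unfolding tempered_def using i u lfun_borel[OF u(1)]
    by (auto simp: dist_of_eq dist_of_eq_0 schwartz_add schwartz_cmult distrib_left mult.left_commute)
qed

end

section \<open>Littlewood--Paley estimates at the scale-invariant exponent 3\<close>

locale lorentz3 = lorentz \<phi> 3 q for \<phi> q
begin

lemma cut_powi: "\<phi> (4 powi (- j) * (norm \<xi>)\<^sup>2) = cut (2 powi j) \<xi>"
proof -
  have "(2 powi j :: real)\<^sup>2 = 4 powi j"
    using power_int_mult_distrib[of "2 powi 1" "2 powi 1" j] by (simp add: power2_eq_square power_int_mult_distrib[symmetric])
  then show ?thesis by (simp add: cut_def power_int_minus divide_inverse)
qed

lemma lp_S_eq:
  assumes u: "u \<in> moderate"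
  shows "lp_S \<phi> j (dist_of u) = dist_of (conv u (ker (2 powi j)))"
  unfolding lp_S_def cut_powi ker_def
  by (rule fourier_multiplier_dist_of[OF u]) (auto intro: cut_schwartz cut_minus)

lemma conv_ker_lfun:
  assumes u: "u \<in> lfun" and r: "0 < r"
  shows "lnorm 3 q (absf (conv u (ker r))) \<le> ennreal K1 * lnorm 3 q (absf u)" "conv u (ker r) \<in> lfun"
proof -
  note [measurable] = lfun_borel[OF u] schwartz_borel[OF ker_schwartz[OF r]]
  show le: "lnorm 3 q (absf (conv u (ker r))) \<le> ennreal K1 * lnorm 3 q (absf u)"
    by (rule lnorm_conv[OF q _ _ K1 ker_L1[OF r]]) measurable
  show "conv u (ker r) \<in> lfun" by (rule lfun_mono[OF _ le u]) measurable
qed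

lemma bernstein':
  assumes u: "u \<in> lfun" and r: "0 < r"
  shows "norm (conv u (ker r) x) \<le> 4 * K1 * r * LN (dist_of u)"
proof -
  have "ennreal (norm (conv u (ker r) x)) \<le> ennreal (4 * K1 * r) * ennreal (LN (dist_of u))"
    using bernstein[OF q lfun_borel[OF u] r] by (simp add: ennreal_LN u)
  then show ?thesis using K1 r by (simp add: ennreal_mult[symmetric])
qed

text \<open>Bernstein's inequality bounds the low-frequency part uniformly by a multiple of 2^j, and
  the test function is integrable.\<close>

lemma lp_S_tendsto:
  assumes T: "T \<in> lorentz_space 3 q" and f: "f \<in> schwartz"
  shows "((\<lambda>j. lp_S \<phi> j T f) \<longlongrightarrow> 0) at_bot"
proof -
  obtain u where u: "u \<in> lfun" "T = dist_of u" using T unfolding lorentz_space_eq by blast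
  note [measurable] = lfun_borel[OF u(1)] schwartz_borel[OF f]
  define D where "D = 4 * K1 * LN T * (LINT x|lborel. norm (f x))"
  have fi: "integrable lborel (\<lambda>x. norm (f x))" by (intro integrable_norm schwartz_integrable f)
  have D0: "0 \<le> D" using K1 by (simp add: D_def)
  have b: "norm (lp_S \<phi> j T f) \<le> D * 2 powi j" for j
  proof -
    have r: "0 < (2 powi j :: real)" by simp
    have [measurable]: "ker (2 powi j) \<in> borel_measurable borel" by (intro schwartz_borel ker_schwartz r)
    have pw: "norm (conv u (ker (2 powi j)) x * f x) \<le> (4 * K1 * 2 powi j * LN T) * norm (f x)" for x
      unfolding norm_mult u(2) by (intro mult_right_mono bernstein' u r) auto
    have "norm (LINT x|lborel. conv u (ker (2 powi j)) x * f x) \<le> (LINT x|lborel. (4 * K1 * 2 powi j * LN T) * norm (f x))"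
      by (intro norm_integral_le pw integrable_mult_right fi
          moderate_mult_schwartz[OF lfun_moderate[OF conv_ker_lfun(2)[OF u(1) r]] f])
    then show ?thesis
      unfolding u(2) lp_S_eq[OF lfun_moderate[OF u(1)]] by (subst dist_of_eq) (auto simp: f D_def u(2) mult_ac)
  qed
  show ?thesis
  proof (rule tendstoI)
    fix e :: real assume e: "0 < e"
    obtain n where n: "(1 / 2 :: real) ^ n < e / (D + 1)" using real_arch_pow_inv[of "e / (D + 1)" "1 / 2"] e D0 by auto
    have "dist (lp_S \<phi> j T f) 0 < e" if j: "j \<le> - int n" for j
    proof -
      have "(2 powi j :: real) \<le> 2 powi (- int n)" using j by (intro power_int_increasing) auto
      also have "\<dots> = (1 / 2) ^ n" by (simp add: power_int_minus power_one_over inverse_eq_divide)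
      finally have "D * 2 powi j \<le> (D + 1) * (1 / 2) ^ n" using D0 by (intro mult_mono) auto
      also have "\<dots> < e" using n D0 by (simp add: pos_less_divide_eq mult.commute)
      finally show ?thesis using b[of j] by simp
    qed
    then show "\<forall>\<^sub>F j in at_bot. dist (lp_S \<phi> j T f) 0 < e"
      unfolding eventually_at_bot_linorder by blast
  qed
qed

lemma invariant_LN: "invariant_norm (lorentz_space 3 q) LN"
  unfolding invariant_norm_def
proof (intro ballI allI impI)
  fix T x0 and l :: real assume "T \<in> lorentz_space 3 q" and l: "0 < l"
  then obtain u where u: "u \<in> lfun" "T = dist_of u" unfolding lorentz_space_eq by blast
  note [measurable] = lfun_borel[OF u(1)]
  let ?v = "\<lambda>x. of_real l * u (l *\<^sub>R x - x0)"
  have r: "dist_rescale l x0 T = dist_of ?v" unfolding u(2) by (rule dist_rescale_dist_of[OF lfun_moderate[OF u(1)] l])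
  have "lnorm 3 q (absf ?v) = lnorm 3 q (\<lambda>x. ennreal l * absf u (l *\<^sub>R x + - x0))"
    using l by (simp add: norm_mult ennreal_mult)
  also have "\<dots> = lnorm 3 q (absf u)" by (rule lnorm_scale_invariant[OF q _ l]) measurable
  finally have eq: "lnorm 3 q (absf ?v) = lnorm 3 q (absf u)" .
  then have v: "?v \<in> lfun" using lfun_finite[OF u(1)] by (simp add: lfun_def)
  have "ennreal (LN (dist_of ?v)) = ennreal (LN T)" unfolding u(2) ennreal_LN[OF v] ennreal_LN[OF u(1)] by (rule eq)
  then show "dist_rescale l x0 T \<in> lorentz_space 3 q \<and> LN (dist_rescale l x0 T) = LN T"
    unfolding r using v by (simp add: lorentz_space_eq)
qed

text \<open>Uniqueness is the issue: competitors of polynomial growth need not be in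
  \<open>moderate\<close>. Multiplication by a cutoff localises the comparison, and continuity
  removes the null set.\<close>

lemma fun_of_dist_eq:
  assumes u: "continuous_on UNIV u" "\<And>x. norm (u x) \<le> B"
  shows "fun_of_dist (dist_of u) = u"
  unfolding fun_of_dist_def
proof (rule the_equality)
  have "norm (u x) \<le> B * (1 + norm x) ^ 0" for x using u by simp
  then show "continuous_on UNIV u \<and> (\<exists>C m. \<forall>x. norm (u x) \<le> C * (1 + norm x) ^ m) \<and> dist_of u = dist_of u"
    using u by blast
next
  fix w :: fn
  assume w: "continuous_on UNIV w \<and> (\<exists>C m. \<forall>x. norm (w x) \<le> C * (1 + norm x) ^ m) \<and> dist_of w = dist_of u"
  then obtain C m where wb: "\<And>x. norm (w x) \<le> C * (1 + norm x) ^ m" by blast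
  have [measurable]: "u \<in> borel_measurable borel" "w \<in> borel_measurable borel"
    using u w by (auto intro: borel_measurable_continuous_onI)
  have "\<forall>x. norm (u x) \<le> B * (1 + norm x) ^ 0" using u(2) by simp
  then have pb: "u \<in> poly_bounded" "w \<in> poly_bounded"
    using wb unfolding poly_bounded_def by blast+
  have i: "integrable lborel (\<lambda>x. z x * f x)" if "z \<in> poly_bounded" "z \<in> borel_measurable borel" "f \<in> schwartz" for z f
    using rapid_mult[OF that(1) schwartz_rapid[OF that(3)]] that schwartz_borel[OF that(3)] by (intro rapid_integrable) auto
  have "w x = u x" for x
  proof -
    \<comment> \<open>With this radius the cutoff equals 1 at x itself.\<close>
    define r where "r = 2 * norm x + 1"
    have r: "0 < r" by (simp add: r_def add_nonneg_pos)
    note cb = schwartz_borel[OF cut_schwartz[OF r]]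
    have m: "(\<lambda>x. z x * cut r x) \<in> moderate" if z: "z \<in> poly_bounded" "z \<in> borel_measurable borel" for z
    proof -
      have "integrable lborel (\<lambda>x. z x * cut r x)" by (rule i[OF z cut_schwartz[OF r]])
      then have "integrable lborel (\<lambda>x. z x * cut r x * of_real (decay x))"
        by (rule Bochner_Integration.integrable_bound)
          (use z cb decay_le_1 in \<open>auto simp: norm_mult intro!: AE_I2 mult_left_le\<close>)
      then show ?thesis using z cb by (simp add: moderate_def)
    qed
    have "dist_of (\<lambda>x. w x * cut r x) = dist_of (\<lambda>x. u x * cut r x)"
    proof
      fix f
      show "dist_of (\<lambda>x. w x * cut r x) f = dist_of (\<lambda>x. u x * cut r x) f"
      proof (cases "f \<in> schwartz")
        case f: True
        have s: "(\<lambda>x. cut r x * f x) \<in> schwartz" by (intro schwartz_mult cut_schwartz r f)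
        have "dist_of (\<lambda>x. w x * cut r x) f = dist_of w (\<lambda>x. cut r x * f x)"
          using f s cb by (simp add: dist_of_eq mult.assoc)
        also have "\<dots> = dist_of u (\<lambda>x. cut r x * f x)" using w by simp
        also have "\<dots> = dist_of (\<lambda>x. u x * cut r x) f"
          using f s cb by (simp add: dist_of_eq mult.assoc)
        finally show ?thesis .
      qed (simp add: dist_of_eq_0)
    qed
    then have "AE x in lborel. w x * cut r x = u x * cut r x" by (intro dist_of_inj m pb) auto
    then have "AE x in lborel. w x * cut r x - u x * cut r x = 0" by eventually_elim simp
    then have "w x * cut r x - u x * cut r x = 0"
      by (rule continuous_AE_zero[rotated]) (use w u schwartz_continuous[OF cut_schwartz[OF r]] in \<open>auto intro!: continuous_intros\<close>)
    moreover have "cut r x = 1" using r by (intro cut_one) (auto simp: r_def)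
    ultimately show ?thesis by simp
  qed
  then show "w = u" by (simp add: fun_eq_iff)
qed

text \<open>The continuous bounded function that represents u when its spectrum lies in the k-th
  annulus. The radius 2^(k+3) is 4R for the outer radius R = 2^(k+1).\<close>

definition spec :: "fn \<Rightarrow> int \<Rightarrow> fn" where
  "spec u k x = (1 / c0) * conv u (ker (2 powi (k + 3))) x"

text \<open>An application of \<open>spectral_reproducing\<close>. The constant 32 is the 4 of
  Bernstein's inequality times 8, since 2^(k+3) = 8 * 2^k.\<close>

lemma spec:
  assumes u: "u \<in> lfun" and s: "dist_support (dist_fourier (dist_of u)) \<subseteq> \<Gamma>_annulus k"
  shows "dist_of (spec u k) = dist_of u" "spec u k \<in> lfun" "fun_of_dist (dist_of u) = spec u k"
    "norm (spec u k x) \<le> 32 * K1 / norm c0 * 2 powi k * LN (dist_of u)"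
proof -
  have r: "0 < (2 powi (k + 3) :: real)" by simp
  have p3: "(2 powi (k + 3) :: real) = 8 * 2 powi k" "(2 powi (k + 1) :: real) = 2 * 2 powi k" by (simp_all add: power_int_add)
  have "\<Gamma>_annulus k \<subseteq> cball 0 (2 powi (k + 1))" by (auto simp: \<Gamma>_annulus_def)
  then have "dist_of u = dist_of (\<lambda>x. (1 / c0) * conv u (ker (4 * 2 powi (k + 1))) x)"
    using s by (intro spectral_reproducing lfun_moderate u) auto
  also have "(4 * 2 powi (k + 1) :: real) = 2 powi (k + 3)" by (simp add: p3)
  finally show 1: "dist_of (spec u k) = dist_of u" by (simp add: spec_def[abs_def])
  show "spec u k \<in> lfun" unfolding spec_def[abs_def] by (intro lfun_cmult conv_ker_lfun(2) u r)
  show 2: "norm (spec u k x) \<le> 32 * K1 / norm c0 * 2 powi k * LN (dist_of u)" for x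
    using divide_right_mono[OF bernstein'[OF u r, of x], of "norm c0"] by (simp add: spec_def norm_divide p3)
  have "continuous_on UNIV (spec u k)"
    unfolding spec_def[abs_def] by (intro continuous_on_mult continuous_on_const conv_ker_continuous lfun_moderate u r)
  then have "fun_of_dist (dist_of (spec u k)) = spec u k" using 2 by (rule fun_of_dist_eq)
  then show "fun_of_dist (dist_of u) = spec u k" by (simp add: 1)
qed

text \<open>Dividing the argument of the profile by 4 raises the index by one, so the multiplier is
  the difference of two cutoffs. Each contributes one K1.\<close>

lemma lp_\<Delta>_lfun:
  assumes w: "w \<in> lfun"
  shows "lp_\<Delta> \<phi> j (dist_of w) \<in> lorentz_space 3 q" "LN (lp_\<Delta> \<phi> j (dist_of w)) \<le> 2 * K1 * LN (dist_of w)"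
proof -
  define m where "m \<xi> = cut (2 powi (j + 1)) \<xi> - cut (2 powi j) \<xi>" for \<xi>
  have r: "0 < (2 powi j :: real)" "0 < (2 powi (j + 1) :: real)" by simp_all
  have ms: "m \<in> schwartz" unfolding m_def[abs_def] by (intro schwartz_diff cut_schwartz r)
  have "lp_\<psi> \<phi> (4 powi (- j) * (norm \<xi>)\<^sup>2) = m \<xi>" for \<xi>
  proof -
    have "4 powi (- j) * (norm \<xi>)\<^sup>2 / 4 = 4 powi (- (j + 1)) * (norm \<xi>)\<^sup>2"
      by (simp add: power_int_diff)
    then show ?thesis by (simp only: lp_\<psi>_def m_def cut_powi)
  qed
  then have "(\<lambda>\<xi>. lp_\<psi> \<phi> (4 powi (- j) * (norm \<xi>)\<^sup>2)) = m" by (intro ext)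
  then have "lp_\<Delta> \<phi> j (dist_of w) = dist_of (conv w (inv_fourier m))"
    unfolding lp_\<Delta>_def by (simp only:) (rule fourier_multiplier_dist_of[OF lfun_moderate[OF w] ms], simp add: m_def cut_minus)
  also have "inv_fourier m = (\<lambda>x. ker (2 powi (j + 1)) x - ker (2 powi j) x)"
  proof
    fix x
    note [measurable] = schwartz_borel[OF cut_schwartz[OF r(1)]] schwartz_borel[OF cut_schwartz[OF r(2)]] schwartz_borel[OF ms]
    have i: "integrable lborel (\<lambda>\<xi>. exp (\<i> * of_real (x \<bullet> \<xi>)) * c \<xi>)" if "c \<in> schwartz" for c
      using schwartz_integrable[OF schwartz_mult_slow[OF slow_exp[of "- x"] that]] by (simp add: inner_commute)
    show "inv_fourier m x = ker (2 powi (j + 1)) x - ker (2 powi j) x"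
      unfolding ker_def using i[OF cut_schwartz[OF r(1)]] i[OF cut_schwartz[OF r(2)]]
      by (simp add: inv_fourier_lborel) (simp add: m_def right_diff_distrib diff_divide_distrib)
  qed
  finally have eq: "lp_\<Delta> \<phi> j (dist_of w) = dist_of (\<lambda>x. conv w (ker (2 powi (j + 1))) x - conv w (ker (2 powi j)) x)"
  proof -
    assume a: "lp_\<Delta> \<phi> j (dist_of w) = dist_of (conv w (\<lambda>x. ker (2 powi (j + 1)) x - ker (2 powi j) x))"
    have i: "integrable lborel (\<lambda>y. w y * ker r (x - y))" if "0 < r" for r x
    proof -
      have "(\<lambda>y. ker r ((- 1) *\<^sub>R y + x)) \<in> schwartz" by (intro schwartz_affine ker_schwartz that) simp
      then show ?thesis using moderate_mult_schwartz[OF lfun_moderate[OF w]] by simp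
    qed
    have "conv w (\<lambda>x. ker (2 powi (j + 1)) x - ker (2 powi j) x) = (\<lambda>x. conv w (ker (2 powi (j + 1))) x - conv w (ker (2 powi j)) x)"
      unfolding conv_def[abs_def] using i[OF r(1)] i[OF r(2)] by (simp add: right_diff_distrib fun_eq_iff)
    then show ?thesis using a by simp
  qed
  have l: "(\<lambda>x. conv w (ker (2 powi (j + 1))) x - conv w (ker (2 powi j)) x) \<in> lfun"
    by (intro lfun_diff conv_ker_lfun(2) w r)
  then show "lp_\<Delta> \<phi> j (dist_of w) \<in> lorentz_space 3 q" unfolding eq lorentz_space_eq by blast
  have "lnorm 3 q (absf (\<lambda>x. conv w (ker (2 powi (j + 1))) x - conv w (ker (2 powi j)) x)) \<le>
      lnorm 3 q (absf (conv w (ker (2 powi (j + 1))))) + lnorm 3 q (absf (conv w (ker (2 powi j))))"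
    by (intro F.norm_diff lfun_borel conv_ker_lfun(2) w r)
  also have "\<dots> \<le> ennreal K1 * lnorm 3 q (absf w) + ennreal K1 * lnorm 3 q (absf w)"
    by (intro add_mono conv_ker_lfun(1) w r)
  also have "\<dots> = ennreal (2 * K1 * LN (dist_of w))"
    unfolding ennreal_LN[OF w, symmetric] using K1 by (simp add: ennreal_mult[symmetric] ennreal_plus[symmetric] del: ennreal_plus)
  finally show "LN (lp_\<Delta> \<phi> j (dist_of w)) \<le> 2 * K1 * LN (dist_of w)"
    unfolding eq using K1 by (intro LN_leI l) auto
qed

text \<open>The reproducing kernels have spectral radii 2^(k+3) and 2^(l+3). For k, l <= j - 5 their
  sum is at most 2^(j-1), and on that ball both cutoffs in the multiplier equal 1. This fixes the
  threshold -5.\<close>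

lemma lp_\<Delta>_product_zero:
  assumes u: "u \<in> lfun" and v: "v \<in> lfun"
    and su: "dist_support (dist_fourier (dist_of u)) \<subseteq> \<Gamma>_annulus k" and sv: "dist_support (dist_fourier (dist_of v)) \<subseteq> \<Gamma>_annulus l"
    and j: "max (k - j) (l - j) \<le> - 5"
  shows "lp_\<Delta> \<phi> j (dist_of (\<lambda>x. spec u k x * spec v l x)) = (\<lambda>f. 0)"
proof
  fix f
  define m where "m \<xi> = lp_\<psi> \<phi> (4 powi (- j) * (norm \<xi>)\<^sup>2)" for \<xi> :: R3
  have r: "0 < (2 powi j :: real)" "0 < (2 powi (j + 1) :: real)" "0 < (2 powi (k + 3) :: real)" "0 < (2 powi (l + 3) :: real)" by simp_all
  have meq: "m \<xi> = cut (2 powi (j + 1)) \<xi> - cut (2 powi j) \<xi>" for \<xi>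
  proof -
    have "4 powi (- j) * (norm \<xi>)\<^sup>2 / 4 = 4 powi (- (j + 1)) * (norm \<xi>)\<^sup>2"
      by (simp add: power_int_diff)
    then show ?thesis by (simp only: lp_\<psi>_def m_def cut_powi)
  qed
  have ms: "m \<in> schwartz" unfolding meq[abs_def] by (intro schwartz_diff cut_schwartz r)
  have mz: "m \<xi> = 0" if "norm \<xi> \<le> 2 powi (k + 3) + 2 powi (l + 3)" for \<xi>
  proof -
    have "(2 powi (k + 3) :: real) \<le> 2 powi (j - 2)" "(2 powi (l + 3) :: real) \<le> 2 powi (j - 2)"
      using j by (intro power_int_increasing; simp)+
    moreover have "(2 powi (j - 2) :: real) = 2 powi j / 4" by (simp add: power_int_diff)
    ultimately have n: "norm \<xi> \<le> 2 powi j / 2" using that by simp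
    then have "cut (2 powi j) \<xi> = 1" by (intro cut_one r)
    moreover have "cut (2 powi (j + 1)) \<xi> = 1" using n norm_ge_zero[of \<xi>] by (intro cut_one r) (simp add: power_int_add del: norm_ge_zero)
    ultimately show ?thesis by (simp add: meq)
  qed
  show "lp_\<Delta> \<phi> j (dist_of (\<lambda>x. spec u k x * spec v l x)) f = 0"
  proof (cases "f \<in> schwartz")
    case f: True
    let ?G = "fourier (\<lambda>\<xi>. m \<xi> * inv_fourier f \<xi>)"
    have s: "(\<lambda>\<xi>. m \<xi> * inv_fourier f \<xi>) \<in> schwartz" by (intro schwartz_mult ms inv_fourier_schwartz f)
    note [measurable] = lfun_borel[OF spec(2)[OF u su]] lfun_borel[OF spec(2)[OF v sv]]
    have "lp_\<Delta> \<phi> j (dist_of (\<lambda>x. spec u k x * spec v l x)) f = dist_of (\<lambda>x. spec u k x * spec v l x) ?G"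
      using f s inv_fourier_schwartz[OF f]
      by (simp add: lp_\<Delta>_def fourier_multiplier_def dist_inv_fourier_def dist_smult_def dist_fourier_def on_schwartz_def m_def)
    also have "\<dots> = (LINT x|lborel. (spec u k x * spec v l x) * ?G x)"
      by (rule dist_of_eq) (auto intro: fourier_schwartz s)
    also have "\<dots> = (LINT x|lborel. (1 / c0 ^ 2) * (conv u (ker (2 powi (k + 3))) x * conv v (ker (2 powi (l + 3))) x * ?G x))"
      by (simp add: spec_def power2_eq_square)
    also have "\<dots> = (1 / c0 ^ 2) * (LINT x|lborel. conv u (ker (2 powi (k + 3))) x * conv v (ker (2 powi (l + 3))) x * ?G x)"
      by (rule integral_mult_right_zero)
    also have "(LINT x|lborel. conv u (ker (2 powi (k + 3))) x * conv v (ker (2 powi (l + 3))) x * ?G x) = 0"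
      by (rule product_multiplier_zero[OF lfun_moderate[OF u] lfun_moderate[OF v] r(3,4) bernstein'[OF u r(3)] ms mz f])
    finally show ?thesis by simp
  qed (simp add: lp_\<Delta>_def fourier_multiplier_def dist_inv_fourier_def on_schwartz_def)
qed

text \<open>The bound 2 K1 of the Littlewood--Paley operator times the sup-norm constant 32 K1 /
  |c0| of \<open>spec\<close>.\<close>

definition prod_const :: real where "prod_const = 64 * K1 ^ 2 / norm c0"

definition good_seq :: "int \<Rightarrow> real" where
  "good_seq n = (if n \<le> - 5 then 0 else prod_const * 2 powi (- n))"

lemma good_seq_nonneg: "0 \<le> good_seq n"
  using K1 by (simp add: good_seq_def prod_const_def)

lemma good_seq_summable: "good_seq summable_on UNIV"
proof -
  have "summable (\<lambda>n. prod_const * 16 * (1 / 2) ^ n)" by (intro summable_mult summable_geometric) simp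
  then have "(\<lambda>n::nat. prod_const * 16 * (1 / 2) ^ n) summable_on UNIV"
    using K1 by (intro norm_summable_imp_summable_on) (simp add: prod_const_def)
  \<comment> \<open>The first index not sent to 0 is -4, and 16 = 2^4 is the power of two
    there.\<close>
  moreover have "good_seq (int n - 4) = prod_const * 16 * (1 / 2) ^ n" for n
  proof -
    have "(2::real) powi (- (int n - 4)) = 2 powi 4 * 2 powi (- int n)"
      by (subst power_int_add[symmetric]) auto
    also have "(2::real) powi (- int n) = (1 / 2) ^ n" by (simp add: power_int_minus power_one_over inverse_eq_divide)
    finally show ?thesis by (simp add: good_seq_def)
  qed
  ultimately have "(good_seq \<circ> (\<lambda>n. int n - 4)) summable_on UNIV" by (simp add: o_def)
  then have "good_seq summable_on range (\<lambda>n. int n - 4)"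
    by (subst summable_on_reindex) (auto simp: inj_on_def)
  moreover have z: "good_seq n = 0" if "n \<notin> range (\<lambda>n. int n - 4)" for n
  proof (rule ccontr)
    assume "good_seq n \<noteq> 0"
    then have "n = int (nat (n + 4)) - 4" by (auto simp: good_seq_def split: if_splits)
    then show False using that by blast
  qed
  moreover have "good_seq summable_on UNIV \<longleftrightarrow> good_seq summable_on range (\<lambda>n. int n - 4)"
    by (rule summable_on_cong_neutral) (use z in auto)
  ultimately show ?thesis by simp
qed

text \<open>Either factor may take the L^\<infinity> bound while the other keeps its Lorentz norm,
  which gives both 2^k and 2^l. As \<open>spec u k\<close> and u are the same distribution,
  replacing one by the other does not change the norm.\<close>

lemma product_estimate:
  assumes T: "T \<in> lorentz_space 3 q" "U \<in> lorentz_space 3 q"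
    and s: "dist_support (dist_fourier T) \<subseteq> \<Gamma>_annulus k" "dist_support (dist_fourier U) \<subseteq> \<Gamma>_annulus l"
  shows "lp_\<Delta> \<phi> j (dist_mult T U) \<in> lorentz_space 3 q"
    "LN (lp_\<Delta> \<phi> j (dist_mult T U)) \<le> good_seq (max (k - j) (l - j)) * 2 powi (k + l - j) * LN T * LN U"
proof -
  obtain u where u: "u \<in> lfun" "T = dist_of u" using T unfolding lorentz_space_eq by blast
  obtain v where v: "v \<in> lfun" "U = dist_of v" using T unfolding lorentz_space_eq by blast
  note su = spec[OF u(1) s(1)[unfolded u(2)]] and sv = spec[OF v(1) s(2)[unfolded v(2)]]
  define w where "w x = spec u k x * spec v l x" for x
  define D where "D = 32 * K1 / norm c0"
  have D0: "0 \<le> D" using K1 by (simp add: D_def)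
  have m: "dist_mult T U = dist_of w" unfolding dist_mult_def u(2) v(2) su(3) sv(3) w_def[abs_def] ..
  have half: "lnorm 3 q (absf (\<lambda>x. a x * b x)) \<le> ennreal (D * 2 powi i * LN (dist_of b') * LN (dist_of b))"
    if "\<And>x. norm (a x) \<le> D * 2 powi i * LN (dist_of b')" "b \<in> lfun" for a b b' and i :: int
  proof -
    have "lnorm 3 q (absf (\<lambda>x. a x * b x)) \<le> ennreal (D * 2 powi i * LN (dist_of b')) * lnorm 3 q (absf b)"
      by (rule lnorm_mult_bounded[OF q lfun_borel[OF that(2)] _ that(1)]) (use D0 in auto)
    then show ?thesis unfolding ennreal_LN[OF that(2), symmetric] using D0 by (simp add: ennreal_mult)
  qed
  have h1: "lnorm 3 q (absf w) \<le> ennreal (D * 2 powi k * LN T * LN U)"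
    using half[of "spec u k" k u "spec v l"] su(4) sv(1,2) unfolding w_def[abs_def] u(2) v(2) D_def by simp
  have h2: "lnorm 3 q (absf w) \<le> ennreal (D * 2 powi l * LN T * LN U)"
    using half[of "spec v l" l v "spec u k"] sv(4) su(1,2) unfolding w_def[abs_def] u(2) v(2) D_def by (simp add: mult_ac)
  have wl: "w \<in> lfun"
    using order_le_less_trans[OF h1] lfun_borel[OF su(2)] lfun_borel[OF sv(2)] by (auto simp: lfun_def w_def[abs_def])
  have "LN (dist_of w) \<le> D * 2 powi k * LN T * LN U" "LN (dist_of w) \<le> D * 2 powi l * LN T * LN U"
    using D0 by (intro LN_leI wl h1 h2; simp)+
  then have Lw: "LN (dist_of w) \<le> D * 2 powi (min k l) * LN T * LN U" by (auto simp: min_def)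
  show "lp_\<Delta> \<phi> j (dist_mult T U) \<in> lorentz_space 3 q" unfolding m by (rule lp_\<Delta>_lfun(1)[OF wl])
  show "LN (lp_\<Delta> \<phi> j (dist_mult T U)) \<le> good_seq (max (k - j) (l - j)) * 2 powi (k + l - j) * LN T * LN U"
  proof (cases "max (k - j) (l - j) \<le> - 5")
    case True
    have "lp_\<Delta> \<phi> j (dist_of w) = (\<lambda>f. 0)"
      unfolding w_def[abs_def] by (rule lp_\<Delta>_product_zero[OF u(1) v(1) s(1)[unfolded u(2)] s(2)[unfolded v(2)] True])
    moreover have "LN (\<lambda>f. 0) = 0" using ennreal_LN[OF lfun_zero] dist_of_zero F.zero by simp
    ultimately show ?thesis unfolding m using good_seq_nonneg by simp
  next
    case False
    have "(2 powi (min k l) :: real) = 2 powi (- max (k - j) (l - j)) * 2 powi (k + l - j)"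
      by (subst power_int_add[symmetric]) (auto simp: min_def max_def)
    moreover have "good_seq (max (k - j) (l - j)) = prod_const * 2 powi (- max (k - j) (l - j))"
      by (simp only: good_seq_def False if_False)
    ultimately have e: "2 * K1 * (D * 2 powi (min k l) * LN T * LN U) = good_seq (max (k - j) (l - j)) * 2 powi (k + l - j) * LN T * LN U"
      by (simp add: prod_const_def D_def power2_eq_square mult_ac)
    have "LN (lp_\<Delta> \<phi> j (dist_mult T U)) \<le> 2 * K1 * LN (dist_of w)" unfolding m by (rule lp_\<Delta>_lfun(2)[OF wl])
    also have "\<dots> \<le> 2 * K1 * (D * 2 powi (min k l) * LN T * LN U)" using Lw K1 by (intro mult_left_mono) auto
    finally show ?thesis unfolding e .
  qed
qed

end

section \<open>Weak \<open>L\<^sup>3\<close> and the pairing with \<open>L\<^bsup>(3/2,1)\<^esup>\<close>\<close>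

lemma lnorm_1: "lnorm p 1 g = (\<integral>\<^sup>+t. ennreal (t powr (1 / p - 1)) * kfun t g \<partial>log_measure)"
  by (simp add: lnorm_def log_norm_def lq_norm_def)

text \<open>For a set S of measure m on which |u| >= s, pairing with its indicator gives s m <= K(m)
  <= L m^(2/3), hence m^(1/3) <= L/s.\<close>

lemma weak_type:
  assumes [measurable]: "u \<in> borel_measurable borel" and L: "0 \<le> L" "lnorm 3 \<infinity> (absf u) \<le> ennreal L" and s: "0 < s"
  shows "emeasure lborel {x. s \<le> norm (u x)} \<le> ennreal ((L / s) ^ 3)"
proof -
  \<comment> \<open>Intersection with balls makes the measure finite, so that it can serve as the
    parameter t of the K-functional.\<close>
  define S where "S n = {x. s \<le> norm (u x)} \<inter> cball 0 (real n)" for n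
  have [measurable]: "cball (0::R3) (real n) \<in> sets borel" for n by simp
  have [measurable]: "S n \<in> sets borel" for n unfolding S_def by measurable
  have bd: "emeasure lborel (S n) \<le> ennreal ((L / s) ^ 3)" for n
  proof -
    have "emeasure lborel (S n) \<le> emeasure lborel (cball (0::R3) (real n))" by (intro emeasure_mono) (auto simp: S_def)
    also have "\<dots> < top" using emeasure_lborel_cball_finite by (simp add: less_top)
    finally obtain m where m: "0 \<le> m" "emeasure lborel (S n) = ennreal m" by (cases "emeasure lborel (S n)") auto
    show ?thesis
    proof (cases "m = 0")
      case True
      then show ?thesis using m by simp
    next
      case False
      then have m0: "0 < m" using m by simp
      have "ennreal (s * m) = (\<integral>\<^sup>+x. ennreal s * indicator (S n) x \<partial>lborel)"
        using m s by (simp add: nn_integral_cmult_indicator ennreal_mult)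
      also have "\<dots> \<le> (\<integral>\<^sup>+x. absf u x * indicator (S n) x \<partial>lborel)"
        by (intro nn_integral_mono) (auto simp: S_def split: split_indicator intro!: ennreal_leI)
      also have "\<dots> \<le> ennreal 1 * kfun m (absf u)"
        by (rule kfun_pairing) (use m in \<open>auto split: split_indicator\<close>)
      finally have 1: "ennreal (s * m) \<le> kfun m (absf u)" by simp
      have "ennreal (m powr (1 / 3 - 1)) * kfun m (absf u) \<le> lnorm 3 \<infinity> (absf u)"
        unfolding lnorm_def log_norm_def using m0 by (auto intro!: SUP_upper2[of m])
      also note L(2)
      finally have "ennreal (m powr (1 / 3 - 1)) * ennreal (s * m) \<le> ennreal L"
        using mult_left_mono[OF 1, of "ennreal (m powr (1 / 3 - 1))"] by (auto intro: order_trans)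
      then have "m powr (1 / 3 - 1) * (s * m) \<le> L" using L s m by (simp add: ennreal_mult[symmetric])
      moreover have "m powr (1 / 3 - 1) * m = m powr (1 / 3)" using m0 powr_add[of m "1 / 3 - 1" 1] by simp
      moreover have "m powr (1 / 3 - 1) * (s * m) = s * (m powr (1 / 3 - 1) * m)" by (simp only: mult_ac)
      ultimately have "s * m powr (1 / 3) \<le> L" by (simp only:)
      then have "m powr (1 / 3) \<le> L / s" using s by (simp add: pos_le_divide_eq mult.commute)
      then have "(m powr (1 / 3)) ^ 3 \<le> (L / s) ^ 3" by (intro power_mono) auto
      moreover have "(m powr (1 / 3)) ^ 3 = m" using m0 by (simp add: powr_power)
      ultimately show ?thesis using m by (simp add: ennreal_leI)
    qed
  qed
  have "{x. s \<le> norm (u x)} = (\<Union>n. S n)"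
    unfolding S_def using real_arch_simple by (auto simp: dist_norm)
  also have "emeasure lborel \<dots> = (SUP n. emeasure lborel (S n))"
    by (rule SUP_emeasure_incseq[symmetric]) (auto simp: incseq_def S_def)
  also have "\<dots> \<le> ennreal ((L / s) ^ 3)" by (rule SUP_least) (rule bd)
  finally show ?thesis .
qed

text \<open>At s = A t^(-1/3) the assumed bound on the measure is exactly t, so s bounds the
  rearrangement at t.\<close>

lemma quasinorm_weak:
  assumes A: "0 < A" and w: "\<And>s. 0 < s \<Longrightarrow> emeasure lebesgue {x. s < norm (u x)} \<le> ennreal ((A / s) ^ 3)"
  shows "lorentz_quasinorm 3 \<infinity> u \<le> ennreal A"
  unfolding lorentz_quasinorm_def
proof (simp, rule SUP_least)
  fix t :: real assume t: "t \<in> {0<..}"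
  define s where "s = A * t powr (- 1 / 3)"
  have s: "0 < s" using A t by (simp add: s_def)
  have "A / s = t powr (1 / 3)" using A t by (simp add: s_def powr_minus field_simps)
  then have "(A / s) ^ 3 = t" using t by (simp add: powr_power)
  then have "decreasing_rearrangement u t \<le> ennreal s" using w[OF s] s by (intro rearrangement_le) auto
  then have "ennreal (t powr (1 / 3)) * decreasing_rearrangement u t \<le> ennreal (t powr (1 / 3)) * ennreal s"
    by (intro mult_left_mono) auto
  also have "\<dots> = ennreal A"
    using s t A by (simp add: s_def ennreal_mult[symmetric] powr_minus field_simps)
  finally show "ennreal (t powr (1 / 3)) * decreasing_rearrangement u t \<le> ennreal A" .
qed

text \<open>A layer formula: |u| is A/3 times the integral of t^(-4/3) over t >= (A/|u|)^3, that is,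
  over those t with |u| >= A t^(-1/3). This level set has measure at most t, so |f| integrates over
  it to at most its K-functional at t, and t^(-4/3) dt is the weight of the norm for p = 3/2, q =
  1.\<close>

lemma lorentz_hoelder:
  assumes [measurable]: "u \<in> borel_measurable borel" "f \<in> borel_measurable borel"
    and A: "0 < A" and w: "\<And>s. 0 < s \<Longrightarrow> emeasure lborel {x. s \<le> norm (u x)} \<le> ennreal ((A / s) ^ 3)"
  shows "(\<integral>\<^sup>+x. absf u x * absf f x \<partial>lborel) \<le> ennreal (A / 3) * lnorm (3 / 2) 1 (absf f)"
proof -
  define k where "k t x = (if 0 < t \<and> A * t powr (- 1 / 3) \<le> norm (u x) then ennreal (t powr (- 4 / 3)) else 0)" for t :: real and x
  have layer: "absf u x \<le> ennreal (A / 3) * (\<integral>\<^sup>+t. k t x \<partial>lborel)" for x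
  proof (cases "u x = 0")
    case False
    define y where "y = norm (u x)"
    define a where "a = (A / y) ^ 3"
    have y: "0 < y" using False by (simp add: y_def)
    have a: "0 < a" using A y by (simp add: a_def)
    have apow: "a powr (- 1 / 3) = y / A"
    proof -
      have "a powr (- 1 / 3) = ((A / y) powr 3) powr (- 1 / 3)" using A y by (simp add: a_def)
      also have "\<dots> = y / A" using A y by (simp only: powr_powr) (simp add: powr_minus)
      finally show ?thesis .
    qed
    have "ennreal (3 * (y / A)) = (\<integral>\<^sup>+t. ennreal (t powr (- 4 / 3)) * indicator {a..} t \<partial>lborel)"
      using nn_integral_has_integral_lebesgue'[OF _ has_integral_powr_to_inf[of "- 4 / 3" a]] a apow by (simp add: mult.commute)
    also have "\<dots> \<le> (\<integral>\<^sup>+t. k t x \<partial>lborel)"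
    proof (rule nn_integral_mono)
      fix t
      show "ennreal (t powr (- 4 / 3)) * indicator {a..} t \<le> k t x"
      proof (cases "a \<le> t")
        case True
        then have "t powr (- 1 / 3) \<le> a powr (- 1 / 3)" using a by (intro powr_mono2') auto
        then have "A * t powr (- 1 / 3) \<le> y" using A unfolding apow by (simp add: field_simps)
        then show ?thesis using True a by (simp add: k_def y_def)
      qed simp
    qed
    finally have "ennreal (A / 3) * ennreal (3 * (y / A)) \<le> ennreal (A / 3) * (\<integral>\<^sup>+t. k t x \<partial>lborel)"
      by (intro mult_left_mono) auto
    moreover have "ennreal (A / 3) * ennreal (3 * (y / A)) = ennreal y" using A y by (simp add: ennreal_mult[symmetric])
    ultimately show ?thesis by (simp add: y_def)
  qed simp
  have [measurable]: "(\<lambda>(t, x). k t x) \<in> borel_measurable (lborel \<Otimes>\<^sub>M lborel)"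
    unfolding k_def by measurable
  have [measurable]: "(\<lambda>t. k t x) \<in> borel_measurable borel" for x unfolding k_def by measurable
  have [measurable]: "(\<lambda>x. k t x) \<in> borel_measurable borel" for t unfolding k_def by measurable
  have "(\<integral>\<^sup>+x. absf u x * absf f x \<partial>lborel) \<le> (\<integral>\<^sup>+x. ennreal (A / 3) * (\<integral>\<^sup>+t. k t x * absf f x \<partial>lborel) \<partial>lborel)"
  proof (rule nn_integral_mono)
    fix x
    have "absf u x * absf f x \<le> (ennreal (A / 3) * (\<integral>\<^sup>+t. k t x \<partial>lborel)) * absf f x" by (intro mult_right_mono layer) auto
    also have "\<dots> = ennreal (A / 3) * (\<integral>\<^sup>+t. k t x * absf f x \<partial>lborel)" by (simp add: nn_integral_multc mult.assoc)
    finally show "absf u x * absf f x \<le> ennreal (A / 3) * (\<integral>\<^sup>+t. k t x * absf f x \<partial>lborel)" .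
  qed
  also have "\<dots> = ennreal (A / 3) * (\<integral>\<^sup>+x. (\<integral>\<^sup>+t. k t x * absf f x \<partial>lborel) \<partial>lborel)"
    by (rule nn_integral_cmult) measurable
  also have "(\<integral>\<^sup>+x. (\<integral>\<^sup>+t. k t x * absf f x \<partial>lborel) \<partial>lborel) = (\<integral>\<^sup>+t. (\<integral>\<^sup>+x. k t x * absf f x \<partial>lborel) \<partial>lborel)"
    by (rule lborel_pair.Fubini') measurable
  also have "\<dots> \<le> (\<integral>\<^sup>+t\<in>{0<..}. (ennreal (t powr (1 / (3 / 2) - 1)) * kfun t (absf f)) * ennreal (1 / t) \<partial>lborel)"
  proof (rule nn_integral_mono)
    fix t :: real
    show "(\<integral>\<^sup>+x. k t x * absf f x \<partial>lborel) \<le> ennreal (t powr (1 / (3 / 2) - 1)) * kfun t (absf f) * ennreal (1 / t) * indicator {0<..} t"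
    proof (cases "0 < t")
      case True
      define s where "s = A * t powr (- 1 / 3)"
      have s: "0 < s" using A True by (simp add: s_def)
      have "A / s = t powr (1 / 3)" using A True by (simp add: s_def powr_minus field_simps)
      then have st: "(A / s) ^ 3 = t" using True by (simp add: powr_power)
      have "(\<integral>\<^sup>+x. k t x * absf f x \<partial>lborel) = (\<integral>\<^sup>+x. ennreal (t powr (- 4 / 3)) * (absf f x * indicator {x. s \<le> norm (u x)} x) \<partial>lborel)"
        using True by (intro nn_integral_cong) (simp add: k_def s_def)
      also have "\<dots> = ennreal (t powr (- 4 / 3)) * (\<integral>\<^sup>+x. absf f x * indicator {x. s \<le> norm (u x)} x \<partial>lborel)"
        by (rule nn_integral_cmult) measurable
      also have "\<dots> \<le> ennreal (t powr (- 4 / 3)) * (ennreal 1 * kfun t (absf f))"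
        by (intro mult_left_mono kfun_pairing) (use True w[OF s] st in \<open>auto split: split_indicator\<close>)
      also have "t powr (- 4 / 3) = t powr (1 / (3 / 2) - 1) * (1 / t)"
        using True powr_add[of t "1 / (3 / 2) - 1" "- 1"] by (simp add: powr_minus_divide)
      also have "ennreal (t powr (1 / (3 / 2) - 1) * (1 / t)) = ennreal (t powr (1 / (3 / 2) - 1)) * ennreal (1 / t)"
        using True by (intro ennreal_mult) auto
      finally show ?thesis using True by (simp add: mult_ac)
    qed (simp add: k_def)
  qed
  also have "\<dots> = lnorm (3 / 2) 1 (absf f)"
    unfolding lnorm_1 by (rule nn_integral_log_measure[symmetric]) measurable
  finally show ?thesis by (simp add: mult_left_mono)
qed

section \<open>A weighted \<open>L\<^sup>2\<close> space\<close>

text \<open>The weight 1/\<open>decay\<close> grows at infinity. It is at least 1, which gives L^2,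
  and its inverse is integrable, which gives L^1; so L^2 of this measure lies in both
  spaces.\<close>

definition wt :: "R3 measure" where
  "wt = density lborel (\<lambda>x. ennreal (1 / decay x))"

lemma sets_wt [measurable_cong]: "sets wt = sets borel"
  by (simp add: wt_def)

lemma space_wt [simp]: "space wt = UNIV"
  by (simp add: wt_def)

lemma nn_integral_wt: "h \<in> borel_measurable borel \<Longrightarrow> (\<integral>\<^sup>+x. h x \<partial>wt) = (\<integral>\<^sup>+x. ennreal (1 / decay x) * h x \<partial>lborel)"
  unfolding wt_def by (subst nn_integral_density) auto

lemma AE_wt: "AE x in lborel. P x \<Longrightarrow> AE x in wt. P x"
  unfolding wt_def by (subst AE_density) auto

definition hil :: "fn set" where
  "hil = {f. f \<in> borel_measurable borel \<and> integrable wt (\<lambda>x. (norm (f x))\<^sup>2)}"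

definition hsq :: "fn \<Rightarrow> real" where
  "hsq f = (LINT x|wt. (norm (f x))\<^sup>2)"

lemma hsq_nonneg [simp]: "0 \<le> hsq f"
  by (simp add: hsq_def)

lemma hil_borel: "f \<in> hil \<Longrightarrow> f \<in> borel_measurable borel"
  by (simp add: hil_def)

lemma ennpowr_2: "0 \<le> r \<Longrightarrow> ennpowr (ennreal r) 2 = ennreal (r\<^sup>2)"
  by (cases "r = 0") (auto simp: ennpowr_ennreal)

lemma lq_norm_wt:
  assumes f: "f \<in> hil"
  shows "lq_norm wt 2 (absf f) = ennreal (sqrt (hsq f))"
proof -
  have "(\<integral>\<^sup>+x. ennpowr (absf f x) 2 \<partial>wt) = (\<integral>\<^sup>+x. ennreal ((norm (f x))\<^sup>2) \<partial>wt)"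
    by (simp add: ennpowr_2)
  also have "\<dots> = ennreal (hsq f)"
    unfolding hsq_def using f by (intro nn_integral_eq_integral) (auto simp: hil_def)
  finally show ?thesis unfolding lq_norm_def by (simp add: ennpowr_ennreal powr_half_sqrt)
qed

lemma hil_iff:
  assumes f: "f \<in> borel_measurable borel"
  shows "f \<in> hil \<longleftrightarrow> lq_norm wt 2 (absf f) < top"
proof
  assume "f \<in> hil" then show "lq_norm wt 2 (absf f) < top" using lq_norm_wt by simp
next
  assume "lq_norm wt 2 (absf f) < top"
  then have "(\<integral>\<^sup>+x. ennpowr (absf f x) 2 \<partial>wt) < top" by (simp add: lq_norm_def less_top[symmetric])
  then have "(\<integral>\<^sup>+x. ennreal ((norm (f x))\<^sup>2) \<partial>wt) < top" by (simp add: ennpowr_2)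
  moreover have "(\<lambda>x. (norm (f x))\<^sup>2) \<in> borel_measurable wt" using f by measurable
  ultimately show "f \<in> hil" unfolding hil_def using f by (auto intro!: integrableI_bounded)
qed

lemma function_norm_wt: "function_norm (lq_norm wt 2) (1 + decay_mass)"
proof
  fix g h :: "R3 \<Rightarrow> ennreal" assume "AE x in lborel. g x \<le> h x"
  then show "lq_norm wt 2 g \<le> lq_norm wt 2 h" by (intro lq_norm_mono AE_wt) auto
next
  fix g :: "nat \<Rightarrow> R3 \<Rightarrow> ennreal" assume [measurable]: "\<And>n. g n \<in> borel_measurable borel"
  show "lq_norm wt 2 (\<lambda>x. \<Sum>n. g n x) \<le> (\<Sum>n. lq_norm wt 2 (g n))" by (rule lq_norm_suminf) auto
next
  fix c :: real and g :: "R3 \<Rightarrow> ennreal" assume [measurable]: "g \<in> borel_measurable borel"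
  show "lq_norm wt 2 (\<lambda>x. ennreal c * g x) = ennreal c * lq_norm wt 2 g" by (rule lq_norm_cmult) auto
next
  fix g :: "R3 \<Rightarrow> ennreal" assume [measurable]: "g \<in> borel_measurable borel"
  define B where "B = 1 + decay_mass"
  have B: "0 \<le> B" "1 + decay_mass \<le> B" by (auto simp: B_def decay_mass_def)
  have le: "(\<integral>\<^sup>+x. g x * ennreal (decay x) \<partial>lborel) \<le> ennreal (a * B)" if a: "0 < a" "lq_norm wt 2 g \<le> ennreal a" for a
  proof -
    have i: "(\<integral>\<^sup>+x. ennpowr (g x) 2 \<partial>wt) \<le> ennreal (a\<^sup>2)"
      using a by (simp add: lq_norm_le_iff ennpowr_2)
    \<comment> \<open>If g <= a the second term suffices, otherwise the first, as g <= g^2/a and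
      \<open>decay\<close> is at most 1. Integrated with a the norm of g, the two terms give a and a
      times the mass of \<open>decay\<close>.\<close>
    have pw: "g x * ennreal (decay x) \<le> ennreal (1 / a) * (ennreal (1 / decay x) * ennpowr (g x) 2) + ennreal a * ennreal (decay x)" for x
    proof (cases "g x")
      case (real r)
      have "r * decay x \<le> 1 / a * (1 / decay x * r\<^sup>2) + a * decay x"
      proof (cases "r \<le> a")
        case True
        then have "r * decay x \<le> a * decay x" by (intro mult_right_mono) auto
        then show ?thesis using a by (simp add: add_increasing)
      next
        case False
        have "r * decay x \<le> r * 1" using real decay_le_1 by (intro mult_left_mono) auto
        also have "\<dots> \<le> 1 / a * (1 * r\<^sup>2)" using False a by (simp add: power2_eq_square field_simps)
        also have "\<dots> \<le> 1 / a * (1 / decay x * r\<^sup>2)"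
          using a decay_le_1[of x] by (intro mult_left_mono mult_right_mono) (auto simp: pos_le_divide_eq)
        also have "\<dots> \<le> 1 / a * (1 / decay x * r\<^sup>2) + a * decay x" using a by simp
        finally show ?thesis .
      qed
      then have "ennreal (r * decay x) \<le> ennreal (1 / a * (1 / decay x * r\<^sup>2) + a * decay x)" by (rule ennreal_leI)
      then show ?thesis using real a by (simp add: ennreal_mult ennpowr_2 del: ennreal_plus) (simp add: ennreal_mult[symmetric] ennreal_plus[symmetric] del: ennreal_plus)
    next
      case top
      then show ?thesis using a by (simp add: ennreal_mult_top)
    qed
    have "(\<integral>\<^sup>+x. g x * ennreal (decay x) \<partial>lborel) \<le>
        (\<integral>\<^sup>+x. ennreal (1 / a) * (ennreal (1 / decay x) * ennpowr (g x) 2) + ennreal a * ennreal (decay x) \<partial>lborel)"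
      by (intro nn_integral_mono pw)
    also have "\<dots> = ennreal (1 / a) * (\<integral>\<^sup>+x. ennpowr (g x) 2 \<partial>wt) + ennreal a * ennreal (LINT x|lborel. decay x)"
      by (simp add: nn_integral_add nn_integral_cmult nn_integral_wt nn_integral_decay)
    also have "\<dots> \<le> ennreal (1 / a) * ennreal (a\<^sup>2) + ennreal a * ennreal decay_mass"
      by (intro add_mono mult_left_mono i ennreal_leI) (auto simp: decay_mass_def)
    also have "\<dots> = ennreal (a * B)"
      using a by (simp add: B_def decay_mass_def ennreal_mult[symmetric] ennreal_plus[symmetric] power2_eq_square distrib_left del: ennreal_plus)
    finally show ?thesis .
  qed
  show "(\<integral>\<^sup>+x. g x * ennreal (decay x) \<partial>lborel) \<le> ennreal (1 + decay_mass) * lq_norm wt 2 g"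
  proof (cases "lq_norm wt 2 g")
    case (real a)
    have "(\<integral>\<^sup>+x. g x * ennreal (decay x) \<partial>lborel) \<le> ennreal (a * B) + ennreal e" if "0 < e" for e
    proof -
      have B0: "0 < B" using B by (simp add: B_def decay_mass_def)
      have "0 < a + e / B" "lq_norm wt 2 g \<le> ennreal (a + e / B)" using real that B0 by (auto simp: add_nonneg_pos intro!: ennreal_leI)
      from le[OF this] show ?thesis using B0 real that by (simp add: distrib_right ennreal_plus[symmetric] del: ennreal_plus)
    qed
    then have "(\<integral>\<^sup>+x. g x * ennreal (decay x) \<partial>lborel) \<le> ennreal (a * B)" by (rule ennreal_le_epsilon)
    then show ?thesis using real B by (simp add: B_def ennreal_mult mult.commute)
  next
    case top
    have "0 < 1 + decay_mass" by (simp add: decay_mass_def)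
    then have "ennreal (1 + decay_mass) \<noteq> 0" by (simp add: ennreal_eq_0_iff)
    then show ?thesis using top by (simp add: ennreal_mult_top)
  qed
qed

interpretation W: function_norm "lq_norm wt 2" "1 + decay_mass"
  by (rule function_norm_wt)

lemma hil_add:
  assumes "f \<in> hil" "g \<in> hil"
  shows "(\<lambda>x. f x + g x) \<in> hil"
proof -
  have b: "(\<lambda>x. f x + g x) \<in> borel_measurable borel" using assms by (auto simp: hil_def)
  show ?thesis unfolding hil_iff[OF b]
    by (rule order_le_less_trans[OF W.norm_add]) (use assms in \<open>auto simp: hil_borel hil_iff[symmetric]\<close>)
qed

lemma hil_cmult:
  assumes "f \<in> hil"
  shows "(\<lambda>x. c * f x) \<in> hil"
proof -
  have b: "(\<lambda>x. c * f x) \<in> borel_measurable borel" using assms by (auto simp: hil_def)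
  show ?thesis unfolding hil_iff[OF b] W.norm_cmult[OF hil_borel[OF assms]]
    using assms by (auto simp: ennreal_mult_less_top hil_borel hil_iff[symmetric])
qed

lemma hil_diff: "f \<in> hil \<Longrightarrow> g \<in> hil \<Longrightarrow> (\<lambda>x. f x - g x) \<in> hil"
  using hil_add[OF _ hil_cmult[of g "-1"]] by simp

lemma hsq_cmult: "hsq (\<lambda>x. c * f x) = (norm c)\<^sup>2 * hsq f"
  by (simp add: hsq_def norm_mult power_mult_distrib)

lemma hsq_triangle:
  assumes "f \<in> hil" "g \<in> hil"
  shows "sqrt (hsq (\<lambda>x. f x + g x)) \<le> sqrt (hsq f) + sqrt (hsq g)"
  using W.norm_add[of f g] assms
  by (simp add: hil_borel lq_norm_wt hil_add ennreal_plus[symmetric] del: ennreal_plus)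

lemma hsq_parallelogram:
  assumes "f \<in> hil" "g \<in> hil"
  shows "hsq (\<lambda>x. f x + g x) + hsq (\<lambda>x. f x - g x) = 2 * hsq f + 2 * hsq g"
proof -
  have i: "integrable wt (\<lambda>x. (norm (h x))\<^sup>2)" if "h \<in> hil" for h using that by (simp add: hil_def)
  have "hsq (\<lambda>x. f x + g x) + hsq (\<lambda>x. f x - g x) = (LINT x|wt. (norm (f x + g x))\<^sup>2 + (norm (f x - g x))\<^sup>2)"
    unfolding hsq_def by (rule Bochner_Integration.integral_add[symmetric]) (intro i hil_add hil_diff assms)+
  also have "\<dots> = (LINT x|wt. 2 * (norm (f x))\<^sup>2 + 2 * (norm (g x))\<^sup>2)"
    by (intro Bochner_Integration.integral_cong refl, unfold cmod_power2) (simp add: power2_eq_square algebra_simps)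
  also have "\<dots> = 2 * hsq f + 2 * hsq g"
    unfolding hsq_def using i[OF assms(1)] i[OF assms(2)] by simp
  finally show ?thesis .
qed

definition hip :: "fn \<Rightarrow> fn \<Rightarrow> complex" where
  "hip v g = (LINT x|wt. cnj (v x) * g x)"

lemma hip_integrable:
  assumes "v \<in> hil" "g \<in> hil"
  shows "integrable wt (\<lambda>x. cnj (v x) * g x)"
proof (rule Bochner_Integration.integrable_bound)
  have [measurable]: "v \<in> borel_measurable borel" "g \<in> borel_measurable borel" using assms by (auto simp: hil_def)
  have [measurable]: "(\<lambda>x. cnj (v x)) \<in> borel_measurable borel"
    by (rule borel_measurable_continuous_on[of cnj]) (auto intro: continuous_intros)
  show "integrable wt (\<lambda>x. (norm (v x))\<^sup>2 + (norm (g x))\<^sup>2)" using assms by (auto simp: hil_def)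
  show "(\<lambda>x. cnj (v x) * g x) \<in> borel_measurable wt" by measurable
  have "a * b \<le> a\<^sup>2 + b\<^sup>2" if "0 \<le> a" "0 \<le> b" for a b :: real
    using sum_squares_bound[of a b] mult_nonneg_nonneg[OF that] by linarith
  then show "AE x in wt. norm (cnj (v x) * g x) \<le> norm ((norm (v x))\<^sup>2 + (norm (g x))\<^sup>2)"
    by (intro AE_I2) (simp add: norm_mult)
qed

lemma hsq_expand:
  assumes "v \<in> hil" "g \<in> hil"
  shows "hsq (\<lambda>x. v x + of_real t * g x) = hsq v + 2 * t * Re (hip v g) + t\<^sup>2 * hsq g"
proof -
  have i: "integrable wt (\<lambda>x. (norm (v x))\<^sup>2)" "integrable wt (\<lambda>x. (norm (g x))\<^sup>2)"
    using assms by (auto simp: hil_def)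
  have i3: "integrable wt (\<lambda>x. Re (cnj (v x) * g x))" by (rule integrable_Re[OF hip_integrable[OF assms]])
  have "hsq (\<lambda>x. v x + of_real t * g x) = (LINT x|wt. (norm (v x))\<^sup>2 + 2 * t * Re (cnj (v x) * g x) + t\<^sup>2 * (norm (g x))\<^sup>2)"
    unfolding hsq_def
    by (intro Bochner_Integration.integral_cong refl, unfold cmod_power2) (simp add: power2_eq_square algebra_simps)
  also have "\<dots> = (LINT x|wt. (norm (v x))\<^sup>2) + (LINT x|wt. 2 * t * Re (cnj (v x) * g x)) + (LINT x|wt. t\<^sup>2 * (norm (g x))\<^sup>2)"
    by (subst Bochner_Integration.integral_add, intro Bochner_Integration.integrable_add integrable_mult_right i i3,
        intro integrable_mult_right i, subst Bochner_Integration.integral_add, rule i, intro integrable_mult_right i3, rule refl)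
  also have "(LINT x|wt. 2 * t * Re (cnj (v x) * g x)) = 2 * t * (LINT x|wt. Re (cnj (v x) * g x))"
    by (rule integral_mult_right_zero)
  also have "(LINT x|wt. Re (cnj (v x) * g x)) = Re (hip v g)"
    unfolding hip_def by (rule integral_Re[OF hip_integrable[OF assms]])
  also have "(LINT x|wt. t\<^sup>2 * (norm (g x))\<^sup>2) = t\<^sup>2 * (LINT x|wt. (norm (g x))\<^sup>2)"
    by (rule integral_mult_right_zero)
  finally show ?thesis by (simp add: hsq_def)
qed

lemma quadratic_nonneg_linear_zero:
  fixes a b :: real
  assumes a: "0 \<le> a" and nn: "\<And>t. 0 \<le> a * t\<^sup>2 + 2 * b * t"
  shows "b = 0"
proof (rule ccontr)
  assume b: "b \<noteq> 0"
  \<comment> \<open>Dividing by a + 1 instead of a covers the case a = 0.\<close>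
  define t where "t = - b / (a + 1)"
  have "a * t\<^sup>2 + 2 * b * t = - (b\<^sup>2 * (a + 2)) / (a + 1)\<^sup>2"
    using a by (simp add: t_def power2_eq_square divide_simps) (simp add: algebra_simps)
  also have "\<dots> < 0" using a b by (intro divide_neg_pos) (auto simp: zero_less_power2)
  finally show False using nn[of t] by simp
qed

text \<open>The representing vector minimises \<open>\<parallel>f\<parallel>\<^sup>2 - 2 Re (l f)\<close>.\<close>

lemma hil_riesz:
  assumes add: "\<And>f g. f \<in> hil \<Longrightarrow> g \<in> hil \<Longrightarrow> l (\<lambda>x. f x + g x) = l f + l g"
    and cm: "\<And>c f. f \<in> hil \<Longrightarrow> l (\<lambda>x. c * f x) = c * l f"
    and bd: "\<And>f. f \<in> hil \<Longrightarrow> norm (l f) \<le> C * sqrt (hsq f)" and C: "0 \<le> C"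
  obtains v where "v \<in> hil" "\<And>g. g \<in> hil \<Longrightarrow> l g = hip v g"
proof -
  define J where "J f = hsq f - 2 * Re (l f)" for f
  have J: "- C\<^sup>2 \<le> J f" if "f \<in> hil" for f
  proof -
    have "Re (l f) \<le> sqrt (hsq f) * C"
      using bd[OF that] complex_Re_le_cmod[of "l f"] by (simp add: mult.commute)
    moreover have "0 \<le> (sqrt (hsq f) - C)\<^sup>2" by simp
    ultimately show ?thesis by (simp add: J_def power2_diff)
  qed
  have z: "(\<lambda>x. 0) \<in> hil" by (simp add: hil_def)
  define d where "d = (INF f\<in>hil. J f)"
  have bb: "bdd_below (J ` hil)" using J by (intro bdd_belowI2)
  have dle: "d \<le> J f" if "f \<in> hil" for f unfolding d_def using bb that by (rule cINF_lower)
  have "\<exists>f\<in>hil. J f < d + 1 / real (Suc n)" for n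
  proof -
    have "(INF f\<in>hil. J f) < d + 1 / real (Suc n)" by (simp add: d_def)
    then show ?thesis using bb z by (subst (asm) cINF_less_iff) auto
  qed
  then obtain F where F: "\<And>n. F n \<in> hil" "\<And>n. J (F n) < d + 1 / real (Suc n)" by metis
  \<comment> \<open>The midpoint of two near-minimisers cannot have a value of J below d, so the
    parallelogram law forces them to be close.\<close>
  have cau: "hsq (\<lambda>x. F m x - F n x) \<le> 2 / real (Suc m) + 2 / real (Suc n)" for m n
  proof -
    let ?s = "\<lambda>x. F m x + F n x"
    have s: "?s \<in> hil" by (intro hil_add F)
    have "d \<le> J (\<lambda>x. (1 / 2) * ?s x)" by (intro dle hil_cmult s)
    also have "\<dots> = hsq ?s / 4 - (Re (l (F m)) + Re (l (F n)))"
      unfolding J_def hsq_cmult cm[OF s] add[OF F(1) F(1)] by (simp add: power2_eq_square field_simps)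
    finally have "4 * d \<le> hsq ?s - 4 * (Re (l (F m)) + Re (l (F n)))" by simp
    then have "hsq (\<lambda>x. F m x - F n x) \<le> 2 * J (F m) + 2 * J (F n) - 4 * d"
      using hsq_parallelogram[OF F(1) F(1), of m n] by (simp add: J_def)
    also have "\<dots> \<le> 2 * (1 / real (Suc m)) + 2 * (1 / real (Suc n))"
      using F(2)[of m] F(2)[of n] by (smt (verit))
    finally show ?thesis by simp
  qed
  obtain v where v: "v \<in> borel_measurable borel" "lq_norm wt 2 (absf v) < top" "(\<lambda>n. lq_norm wt 2 (absf (\<lambda>x. F n x - v x))) \<longlonglongrightarrow> 0"
  proof (rule W.riesz_fischer[of F])
    show "\<And>n. F n \<in> borel_measurable borel" "\<And>n. lq_norm wt 2 (absf (F n)) < top" using F(1) by (auto simp: hil_iff[symmetric] hil_borel)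
    fix e :: real assume e: "0 < e"
    obtain M where M: "4 / e\<^sup>2 < real M" using reals_Archimedean2 by blast
    have "lq_norm wt 2 (absf (\<lambda>x. F m x - F n x)) < ennreal e" if "M \<le> m" "M \<le> n" for m n
    proof -
      have "2 / real (Suc k) < e\<^sup>2 / 2" if "M \<le> k" for k
      proof -
        have "4 / e\<^sup>2 < real (Suc k)" using M that by simp
        then show ?thesis using e by (simp add: field_simps)
      qed
      from this[OF that(1)] this[OF that(2)] have "hsq (\<lambda>x. F m x - F n x) < e\<^sup>2" using cau[of m n] by simp
      then have "sqrt (hsq (\<lambda>x. F m x - F n x)) < e" using e by (simp add: real_less_lsqrt)
      then show ?thesis using e by (simp add: lq_norm_wt hil_diff F ennreal_less_iff)
    qed
    then show "\<exists>M. \<forall>m\<ge>M. \<forall>n\<ge>M. lq_norm wt 2 (absf (\<lambda>x. F m x - F n x)) < ennreal e" by blast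
  qed
  have vh: "v \<in> hil" using v by (simp add: hil_iff)
  have lim: "(\<lambda>n. sqrt (hsq (\<lambda>x. F n x - v x))) \<longlonglongrightarrow> 0"
  proof (rule tendsto_ennrealD)
    show "(\<lambda>n. ennreal (sqrt (hsq (\<lambda>x. F n x - v x)))) \<longlonglongrightarrow> ennreal 0"
      using v(3) by (simp add: lq_norm_wt hil_diff F vh)
  qed auto
  have ls: "(\<lambda>n. sqrt (hsq (F n))) \<longlonglongrightarrow> sqrt (hsq v)"
  proof (rule LIM_zero_cancel, rule tendsto_rabs_zero_cancel, rule tendsto_sandwich[OF _ _ tendsto_const lim])
    show "\<forall>\<^sub>F n in sequentially. \<bar>sqrt (hsq (F n)) - sqrt (hsq v)\<bar> \<le> sqrt (hsq (\<lambda>x. F n x - v x))"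
    proof (rule always_eventually, rule allI)
      fix n
      have "sqrt (hsq (\<lambda>x. (F n x - v x) + v x)) \<le> sqrt (hsq (\<lambda>x. F n x - v x)) + sqrt (hsq v)"
        by (intro hsq_triangle hil_diff F vh)
      moreover have "sqrt (hsq (\<lambda>x. (-1) * (F n x - v x) + F n x)) \<le> sqrt (hsq (\<lambda>x. (-1) * (F n x - v x))) + sqrt (hsq (F n))"
        by (intro hsq_triangle hil_cmult hil_diff F vh)
      moreover have "hsq (\<lambda>x. (-1) * (F n x - v x)) = hsq (\<lambda>x. F n x - v x)" by (simp only: hsq_cmult) simp
      ultimately show "\<bar>sqrt (hsq (F n)) - sqrt (hsq v)\<bar> \<le> sqrt (hsq (\<lambda>x. F n x - v x))" by simp
    qed
  qed auto
  have ll: "(\<lambda>n. l (F n)) \<longlonglongrightarrow> l v"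
  proof (rule LIM_zero_cancel, rule tendsto_norm_zero_cancel, rule tendsto_sandwich[OF _ _ tendsto_const])
    show "(\<lambda>n. C * sqrt (hsq (\<lambda>x. F n x - v x))) \<longlonglongrightarrow> 0" using tendsto_mult_right_zero[OF lim] by simp
    have "l (F n) - l v = l (\<lambda>x. F n x - v x)" for n
      using add[OF F(1)[of n] hil_cmult[OF vh, of "-1"]] cm[OF vh, of "-1"] by simp
    then show "\<forall>\<^sub>F n in sequentially. norm (l (F n) - l v) \<le> C * sqrt (hsq (\<lambda>x. F n x - v x))"
      using bd[OF hil_diff[OF F(1) vh]] by simp
  qed auto
  have "(\<lambda>n. (sqrt (hsq (F n)))\<^sup>2 - 2 * Re (l (F n))) \<longlonglongrightarrow> (sqrt (hsq v))\<^sup>2 - 2 * Re (l v)"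
    by (intro tendsto_intros ls ll)
  then have lJ: "(\<lambda>n. J (F n)) \<longlonglongrightarrow> J v" by (simp add: J_def)
  have "(\<lambda>n. d + 1 / real (Suc n)) \<longlonglongrightarrow> d + 0"
    by (intro tendsto_intros LIMSEQ_Suc[OF lim_1_over_n])
  then have "J v \<le> d + 0" by (rule LIMSEQ_le[OF lJ]) (use F(2) less_imp_le in blast)
  then have Jv: "J v \<le> J f" if "f \<in> hil" for f using dle[OF that] by simp
  \<comment> \<open>The first variation along v + t g with real t vanishes, which identifies real
    parts; testing with \<open>\<i>\<close> g then gives the imaginary parts.\<close>
  have re: "Re (hip v g) = Re (l g)" if g: "g \<in> hil" for g
  proof -
    have "0 \<le> hsq g * t\<^sup>2 + 2 * (Re (hip v g) - Re (l g)) * t" for t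
    proof -
      have "J v \<le> J (\<lambda>x. v x + of_real t * g x)" by (intro Jv hil_add hil_cmult vh g)
      also have "\<dots> = hsq v + 2 * t * Re (hip v g) + t\<^sup>2 * hsq g - 2 * (Re (l v) + t * Re (l g))"
        unfolding J_def hsq_expand[OF vh g] add[OF vh hil_cmult[OF g]] cm[OF g] by simp
      finally show ?thesis by (simp add: J_def algebra_simps)
    qed
    from quadratic_nonneg_linear_zero[OF _ this] show ?thesis by simp
  qed
  have "l g = hip v g" if g: "g \<in> hil" for g
  proof (rule complex_eqI)
    show "Re (l g) = Re (hip v g)" using re[OF g] by simp
    have "hip v (\<lambda>x. \<i> * g x) = \<i> * hip v g"
      unfolding hip_def by (simp only: mult.left_commute[of _ \<i>] integral_mult_right_zero)
    then show "Im (l g) = Im (hip v g)" using re[OF hil_cmult[OF g, of \<i>]] cm[OF g, of \<i>] by simp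
  qed
  then show ?thesis using that vh by blast
qed

text \<open>Small \<open>t\<close> is controlled by the \<open>L\<^sup>2\<close> norm, large \<open>t\<close> by the \<open>L\<^sup>1\<close> norm.\<close>

lemma hil_lnorm:
  shows "\<exists>C\<ge>0. \<forall>f\<in>hil. \<forall>J>0. hsq f \<le> J \<longrightarrow> lnorm (3 / 2) 1 (absf f) \<le> ennreal (C * sqrt J)"
proof -
  define I where "I = (\<integral>\<^sup>+t. ennreal (t powr (- (1 / 3)) * min 1 (t powr (1 / 2))) \<partial>log_measure)"
  have I: "I < \<infinity>" unfolding I_def by (rule nn_integral_log_powr_min) auto
  define c where "c = 2 + decay_mass"
  have c: "2 \<le> c" "1 + decay_mass \<le> c" by (auto simp: c_def decay_mass_def)
  have "lnorm (3 / 2) 1 (absf f) \<le> ennreal (c * enn2real I * sqrt J)" if f: "f \<in> hil" and J: "0 < J" "hsq f \<le> J" for f J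
  proof -
    have [measurable]: "f \<in> borel_measurable borel" using f by (rule hil_borel)
    \<comment> \<open>Working with any J > 0 above the squared norm keeps a positive, so that
      division by a is possible even for a null function.\<close>
    define a where "a = sqrt J"
    have a: "0 < a" "a\<^sup>2 = J" using J by (auto simp: a_def)
    have i: "(\<integral>\<^sup>+x. ennreal (1 / decay x * (norm (f x))\<^sup>2) \<partial>lborel) \<le> ennreal (a\<^sup>2)"
    proof -
      have "(\<integral>\<^sup>+x. ennreal (1 / decay x * (norm (f x))\<^sup>2) \<partial>lborel) = (\<integral>\<^sup>+x. ennreal ((norm (f x))\<^sup>2) \<partial>wt)"
        by (subst nn_integral_wt) (auto simp: ennreal_mult[symmetric])
      also have "\<dots> = ennreal (hsq f)"
        unfolding hsq_def using f by (intro nn_integral_eq_integral) (auto simp: hil_def)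
      finally show ?thesis using J a by (simp add: ennreal_leI)
    qed
    \<comment> \<open>Either |f| <= a \<open>decay\<close>, or |f| <= |f|^2/(a
      \<open>decay\<close>); both majorants have integral at most a multiple of a.\<close>
    have k1: "kfun t (absf f) \<le> ennreal (c * a)" for t
    proof -
      have "kfun t (absf f) \<le> (\<integral>\<^sup>+x. absf f x \<partial>lborel)" by (rule kfun_le_integral)
      also have "\<dots> \<le> (\<integral>\<^sup>+x. ennreal (1 / a) * ennreal (1 / decay x * (norm (f x))\<^sup>2) + ennreal a * ennreal (decay x) \<partial>lborel)"
      proof (rule nn_integral_mono)
        fix x
        have "norm (f x) \<le> 1 / a * (1 / decay x * (norm (f x))\<^sup>2) + a * decay x"
        proof (cases "norm (f x) \<le> a * decay x")
          case True
          then show ?thesis using a by (simp add: add_increasing)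
        next
          case False
          then have "norm (f x) * (a * decay x) \<le> norm (f x) * norm (f x)" by (intro mult_left_mono) auto
          then have "norm (f x) \<le> norm (f x) * norm (f x) / (a * decay x)" using a by (simp add: pos_le_divide_eq)
          also have "\<dots> = 1 / a * (1 / decay x * (norm (f x))\<^sup>2)" by (simp add: power2_eq_square)
          also have "\<dots> \<le> \<dots> + a * decay x" using a by simp
          finally show ?thesis .
        qed
        then have "absf f x \<le> ennreal (1 / a * (1 / decay x * (norm (f x))\<^sup>2) + a * decay x)" by (rule ennreal_leI)
        also have "\<dots> = ennreal (1 / a) * ennreal (1 / decay x * (norm (f x))\<^sup>2) + ennreal a * ennreal (decay x)"
        proof -
          have "0 \<le> 1 / a" "0 \<le> 1 / decay x * (norm (f x))\<^sup>2" "0 \<le> a" "0 \<le> decay x"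
            "0 \<le> 1 / a * (1 / decay x * (norm (f x))\<^sup>2)" "0 \<le> a * decay x" using a by auto
          then show ?thesis by (simp only: ennreal_plus ennreal_mult)
        qed
        finally show "absf f x \<le> ennreal (1 / a) * ennreal (1 / decay x * (norm (f x))\<^sup>2) + ennreal a * ennreal (decay x)" .
      qed
      also have "\<dots> = ennreal (1 / a) * (\<integral>\<^sup>+x. ennreal (1 / decay x * (norm (f x))\<^sup>2) \<partial>lborel) + ennreal a * ennreal (LINT x|lborel. decay x)"
        by (simp add: nn_integral_add nn_integral_cmult nn_integral_decay)
      also have "\<dots> \<le> ennreal (1 / a) * ennreal (a\<^sup>2) + ennreal a * ennreal decay_mass"
        by (intro add_mono mult_left_mono i ennreal_leI) (auto simp: decay_mass_def)
      also have "\<dots> = ennreal ((1 + decay_mass) * a)"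
      proof -
        have "0 \<le> decay_mass" by (simp add: decay_mass_def)
        moreover have "1 / a * a\<^sup>2 = a" using a(1) by (simp add: power2_eq_square)
        ultimately show ?thesis
          using a(1) by (simp add: ennreal_mult[symmetric] ennreal_plus[symmetric] algebra_simps del: ennreal_plus)
      qed
      also have "\<dots> \<le> ennreal (c * a)" using c a by (intro ennreal_leI mult_right_mono) auto
      finally show ?thesis .
    qed
    have k2: "kfun t (absf f) \<le> ennreal (c * a * t powr (1 / 2))" if t: "0 < t" for t
    proof -
      \<comment> \<open>This level balances the two costs: the excess has integral at most a^2/s = a
        t^(1/2), and t s = a t^(1/2).\<close>
      define s where "s = a * t powr (- (1 / 2))"
      have s: "0 < s" using a t by (simp add: s_def)
      have "kfun t (absf f) \<le> (\<integral>\<^sup>+x. (absf f x - ennreal s) \<partial>lborel) + ennreal (t * s)" using s by (intro kfun_le) auto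
      also have "(\<integral>\<^sup>+x. (absf f x - ennreal s) \<partial>lborel) \<le> (\<integral>\<^sup>+x. ennreal (1 / s) * ennreal (1 / decay x * (norm (f x))\<^sup>2) \<partial>lborel)"
      proof (rule nn_integral_mono)
        fix x
        have "norm (f x) - s \<le> 1 / s * (1 / decay x * (norm (f x))\<^sup>2)"
        proof (cases "norm (f x) \<le> s")
          case True
          have "0 \<le> 1 / s * (1 / decay x * (norm (f x))\<^sup>2)" using s by (intro mult_nonneg_nonneg) auto
          then show ?thesis using True by linarith
        next
          case False
          then have "norm (f x) * s \<le> norm (f x) * norm (f x)" by (intro mult_left_mono) auto
          then have "norm (f x) \<le> 1 / s * (1 * (norm (f x))\<^sup>2)" using s by (simp add: pos_le_divide_eq power2_eq_square)
          also have "\<dots> \<le> 1 / s * (1 / decay x * (norm (f x))\<^sup>2)"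
            using s decay_le_1[of x] by (intro mult_left_mono mult_right_mono) (auto simp: pos_le_divide_eq)
          finally show ?thesis using s by linarith
        qed
        then have "ennreal (norm (f x) - s) \<le> ennreal (1 / s * (1 / decay x * (norm (f x))\<^sup>2))" by (rule ennreal_leI)
        then show "absf f x - ennreal s \<le> ennreal (1 / s) * ennreal (1 / decay x * (norm (f x))\<^sup>2)"
          using s by (simp add: ennreal_minus ennreal_mult[symmetric])
      qed
      also have "\<dots> = ennreal (1 / s) * (\<integral>\<^sup>+x. ennreal (1 / decay x * (norm (f x))\<^sup>2) \<partial>lborel)"
        by (rule nn_integral_cmult) measurable
      also have "\<dots> \<le> ennreal (1 / s) * ennreal (a\<^sup>2)" by (intro mult_left_mono i) auto
      finally have "kfun t (absf f) \<le> ennreal (1 / s) * ennreal (a\<^sup>2) + ennreal (t * s)" by (simp add: add_right_mono)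
      also have "\<dots> = ennreal (2 * a * t powr (1 / 2))"
      proof -
        have "1 / s * a\<^sup>2 = a * t powr (1 / 2)" using a(1) t by (simp add: s_def powr_minus power2_eq_square field_simps)
        moreover have "t * s = a * t powr (1 / 2)"
        proof -
          have "t powr 1 * t powr (- (1 / 2)) = t powr (1 / 2)" using t by (simp only: powr_add[symmetric]) simp
          then show ?thesis using t by (simp add: s_def mult.left_commute)
        qed
        ultimately show ?thesis using a(1) t s by (simp add: ennreal_mult[symmetric] ennreal_plus[symmetric] del: ennreal_plus)
      qed
      also have "\<dots> \<le> ennreal (c * a * t powr (1 / 2))" using c a t by (intro ennreal_leI mult_right_mono) auto
      finally show ?thesis .
    qed
    have "lnorm (3 / 2) 1 (absf f) \<le> (\<integral>\<^sup>+t. ennreal (c * a) * ennreal (t powr (- (1 / 3)) * min 1 (t powr (1 / 2))) \<partial>log_measure)"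
      unfolding lnorm_1
    proof (intro nn_integral_mono_AE AE_log_measure)
      fix t :: real assume t: "0 < t"
      have "kfun t (absf f) \<le> ennreal (c * a * min 1 (t powr (1 / 2)))" using k1 k2[OF t] by (simp add: min_def)
      then have "ennreal (t powr (1 / (3 / 2) - 1)) * kfun t (absf f) \<le> ennreal (t powr (- (1 / 3))) * ennreal (c * a * min 1 (t powr (1 / 2)))"
        by (intro mult_mono) auto
      also have "\<dots> = ennreal (c * a) * ennreal (t powr (- (1 / 3)) * min 1 (t powr (1 / 2)))"
        using a c t by (simp add: ennreal_mult[symmetric] mult_ac)
      finally show "ennreal (t powr (1 / (3 / 2) - 1)) * kfun t (absf f) \<le> ennreal (c * a) * ennreal (t powr (- (1 / 3)) * min 1 (t powr (1 / 2)))" .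
    qed
    also have "\<dots> = ennreal (c * a) * I" unfolding I_def by (rule nn_integral_cmult) measurable
    also have "I = ennreal (enn2real I)" using I by simp
    also have "ennreal (c * a) * ennreal (enn2real I) = ennreal (c * enn2real I * sqrt J)"
      using a c by (simp add: ennreal_mult[symmetric] a_def mult_ac)
    finally show ?thesis .
  qed
  moreover have "0 \<le> c * enn2real I" using c by simp
  ultimately show ?thesis by blast
qed

section \<open>Weak \<open>L\<^sup>3\<close> as a dual space\<close>

lemma le_from_perturbation:
  fixes x y b :: real
  assumes "\<And>d. 0 < d \<Longrightarrow> x \<le> y + d * b" and b: "0 \<le> b"
  shows "x \<le> y"
proof (rule field_le_epsilon)
  fix e :: real assume e: "0 < e"
  have "x \<le> y + e / (b + 1) * b" using assms(1)[of "e / (b + 1)"] e b by simp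
  also have "e / (b + 1) * b \<le> e" using e b by (simp add: field_simps)
  finally show "x \<le> y + e" by simp
qed

lemma dual_norm_bound:
  assumes V: "subspace_on V" "norm_on V N" and L: "L \<in> dual_on V N" and f: "f \<in> V"
  shows "norm (L f) \<le> dual_norm_on V N L * N f"
proof (cases "N f = 0")
  case True
  then have f0: "f = (\<lambda>_. 0)" using V f by (auto simp: norm_on_def)
  have "L (\<lambda>a. 0 * f a) = 0 * L f" using L f unfolding dual_on_def by blast
  then show ?thesis using True f0 by simp
next
  case False
  have Nf: "0 < N f" using False V f by (auto simp: norm_on_def less_le)
  obtain C where C: "\<And>g. g \<in> V \<Longrightarrow> norm (L g) \<le> C * N g" using L unfolding dual_on_def by blast
  define g where "g = (\<lambda>a. of_real (1 / N f) * f a)"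
  have g: "g \<in> V" using V f unfolding g_def subspace_on_def by blast
  have "N g = norm (complex_of_real (1 / N f)) * N f" using V f unfolding g_def norm_on_def by blast
  then have Ng: "N g \<le> 1" using Nf by (simp add: norm_divide)
  have Lg: "L g = of_real (1 / N f) * L f" using L f unfolding g_def dual_on_def by blast
  have "bdd_above ((\<lambda>f. norm (L f)) ` {f \<in> V. N f \<le> 1})"
  proof (rule bdd_aboveI2)
    fix h assume h: "h \<in> {f \<in> V. N f \<le> 1}"
    then have "0 \<le> N h" using V by (auto simp: norm_on_def)
    then have "C * N h \<le> \<bar>C\<bar> * 1" using h by (intro mult_mono) auto
    then show "norm (L h) \<le> \<bar>C\<bar>" using C[of h] h by simp
  qed
  then have "norm (L g) \<le> dual_norm_on V N L"
    unfolding dual_norm_on_def using g Ng by (intro cSUP_upper) auto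
  then have "norm (L f) / N f \<le> dual_norm_on V N L" unfolding Lg using Nf by (simp add: norm_mult norm_divide)
  then show ?thesis using Nf by (simp add: pos_divide_le_eq)
qed

lemma dual_norm_le:
  assumes V: "subspace_on V" "norm_on V N" and C: "0 \<le> C" "\<And>f. f \<in> V \<Longrightarrow> norm (L f) \<le> C * N f"
  shows "dual_norm_on V N L \<le> C"
  unfolding dual_norm_on_def
proof (rule cSUP_least)
  have "(\<lambda>_. 0) \<in> V" using V by (simp add: subspace_on_def)
  moreover from this have "N (\<lambda>_. 0) = 0" using V by (auto simp: norm_on_def)
  ultimately show "{f \<in> V. N f \<le> 1} \<noteq> {}" by auto
next
  fix f assume f: "f \<in> {f \<in> V. N f \<le> 1}"
  then have "C * N f \<le> C * 1" using C by (intro mult_left_mono) auto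
  then show "norm (L f) \<le> C" using C(2)[of f] f by simp
qed

lemma hil_decay:
  assumes [measurable]: "f \<in> borel_measurable borel" and b: "\<And>x. norm (f x) \<le> C * decay x"
  shows "f \<in> hil"
proof -
  have "integrable lborel (\<lambda>x. (1 / decay x) *\<^sub>R (norm (f x))\<^sup>2)"
  proof (rule Bochner_Integration.integrable_bound)
    show "integrable lborel (\<lambda>x. C\<^sup>2 * decay x)" using integrable_decay by simp
    show "AE x in lborel. norm ((1 / decay x) *\<^sub>R (norm (f x))\<^sup>2) \<le> norm (C\<^sup>2 * decay x)"
    proof (rule AE_I2)
      fix x
      have "(norm (f x))\<^sup>2 \<le> (C * decay x)\<^sup>2" by (intro power_mono b) auto
      then have "(1 / decay x) * (norm (f x))\<^sup>2 \<le> (1 / decay x) * (C * decay x)\<^sup>2" by (intro mult_left_mono) auto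
      also have "\<dots> = C\<^sup>2 * decay x" by (simp add: power2_eq_square)
      finally show "norm ((1 / decay x) *\<^sub>R (norm (f x))\<^sup>2) \<le> norm (C\<^sup>2 * decay x)" by simp
    qed
  qed measurable
  then have "integrable wt (\<lambda>x. (norm (f x))\<^sup>2)"
    unfolding wt_def by (subst integrable_density) auto
  then show ?thesis by (simp add: hil_def)
qed

lemma hip_lborel:
  assumes "v \<in> hil" "g \<in> hil"
  defines "u \<equiv> \<lambda>x. of_real (1 / decay x) * cnj (v x)"
  shows "hip v g = (LINT x|lborel. u x * g x)" "integrable lborel (\<lambda>x. u x * g x)"
proof -
  have [measurable]: "v \<in> borel_measurable borel" "g \<in> borel_measurable borel" using assms by (auto simp: hil_def)
  have [measurable]: "(\<lambda>x. cnj (v x)) \<in> borel_measurable borel"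
    by (rule borel_measurable_continuous_on[of cnj]) (auto intro: continuous_intros)
  have e: "(\<lambda>x. (1 / decay x) *\<^sub>R (cnj (v x) * g x)) = (\<lambda>x. u x * g x)"
    by (simp add: u_def scaleR_conv_of_real mult.assoc)
  show "hip v g = (LINT x|lborel. u x * g x)"
    unfolding hip_def wt_def by (subst integral_density) (auto simp: e)
  show "integrable lborel (\<lambda>x. u x * g x)"
    using hip_integrable[OF assms(1,2)] unfolding wt_def by (subst (asm) integrable_density) (auto simp: e)
qed

text \<open>Test with the conjugate phase of u on a bounded part of {|u| > s}, of measure m: then s
  m <= B m^(2/3), that is, m^(1/3) <= B/s. The exponent 2/3 is that of the norm of an indicator in
  L^(3/2,1).\<close>

lemma weak_type_test:
  fixes u :: fn
  assumes [measurable]: "u \<in> borel_measurable borel" and B: "0 \<le> B" and s: "0 < s"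
    and test: "\<And>g S. g \<in> borel_measurable borel \<Longrightarrow> S \<in> sets borel \<Longrightarrow> bounded S \<Longrightarrow>
      (\<And>x. norm (g x) \<le> indicator S x) \<Longrightarrow>
      integrable lborel (\<lambda>x. u x * g x) \<and> norm (LINT x|lborel. u x * g x) \<le> B * measure lborel S powr (2 / 3)"
  shows "emeasure lborel {x. s < norm (u x)} \<le> ennreal ((B / s) ^ 3)"
proof -
  define S where "S n = {x. s < norm (u x)} \<inter> cball 0 (real n)" for n
  have [measurable]: "cball (0::R3) (real n) \<in> sets borel" for n by simp
  have Sm [measurable]: "S n \<in> sets borel" for n unfolding S_def by measurable
  have bd: "emeasure lborel (S n) \<le> ennreal ((B / s) ^ 3)" for n
  proof -
    have "emeasure lborel (S n) \<le> emeasure lborel (cball (0::R3) (real n))" by (intro emeasure_mono) (auto simp: S_def)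
    also have "\<dots> < top" using emeasure_lborel_cball_finite by (simp add: less_top)
    finally have fin: "emeasure lborel (S n) < top" .
    define m where "m = measure lborel (S n)"
    have m: "0 \<le> m" "emeasure lborel (S n) = ennreal m" using fin by (auto simp: m_def emeasure_eq_ennreal_measure less_top)
    show ?thesis
    proof (cases "m = 0")
      case False
      then have m0: "0 < m" using m by simp
      define g where "g x = indicator (S n) x * cnj (sgn (u x))" for x
      have [measurable]: "(\<lambda>x. cnj (sgn (u x))) \<in> borel_measurable borel"
        by (rule borel_measurable_continuous_on[of cnj]) (auto intro: continuous_intros)
      have gm: "g \<in> borel_measurable borel" unfolding g_def by measurable
      have gS: "norm (g x) \<le> indicator (S n) x" for x by (auto simp: g_def norm_sgn split: split_indicator)
      have bS: "bounded (S n)" by (rule bounded_subset[OF bounded_cball[of 0 "real n"]]) (auto simp: S_def)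
      note t = test[OF gm Sm bS gS]
      have ug: "u x * g x = of_real (norm (u x) * indicator (S n) x)" for x
      proof -
        have "u x * cnj (sgn (u x)) = of_real (norm (u x))"
        proof (cases "u x = 0")
          case False
          have "u x * cnj (sgn (u x)) = (u x * cnj (u x)) / of_real (norm (u x))"
            by (simp add: sgn_div_norm scaleR_conv_of_real divide_inverse mult_ac)
          also have "\<dots> = of_real (norm (u x))" using False unfolding complex_norm_square[symmetric] by (simp add: power2_eq_square)
          finally show ?thesis .
        qed simp
        then show ?thesis by (auto simp: g_def split: split_indicator)
      qed
      have i: "integrable lborel (\<lambda>x. norm (u x) * indicator (S n) x)"
        using t unfolding ug by (simp only: complex_of_real_integrable_eq)
      have "s * m = (LINT x|lborel. s * indicator (S n) x)" using fin by (simp add: m_def)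
      also have "\<dots> \<le> (LINT x|lborel. norm (u x) * indicator (S n) x)"
        using fin by (intro integral_mono i integrable_mult_right integrable_real_indicator) (auto simp: S_def split: split_indicator)
      also have "\<dots> \<le> norm (LINT x|lborel. u x * g x)"
        unfolding ug by (simp only: integral_complex_of_real norm_of_real)
      also have "\<dots> \<le> B * m powr (2 / 3)" using t by (simp add: m_def)
      finally have le: "s * m \<le> B * m powr (2 / 3)" .
      have "m powr (1 / 3) * m powr (2 / 3) = m" using m0 by (simp add: powr_add[symmetric])
      then have "(s * m powr (1 / 3)) * m powr (2 / 3) \<le> B * m powr (2 / 3)" using le by (simp add: mult.assoc)
      then have "s * m powr (1 / 3) \<le> B" using m0 by simp
      then have "m powr (1 / 3) \<le> B / s" using s by (simp add: pos_le_divide_eq mult.commute)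
      then have "(m powr (1 / 3)) ^ 3 \<le> (B / s) ^ 3" by (intro power_mono) auto
      moreover have "(m powr (1 / 3)) ^ 3 = m" using m0 by (simp add: powr_power)
      ultimately show ?thesis using m by (simp add: ennreal_leI)
    qed (use m in simp)
  qed
  have "{x. s < norm (u x)} = (\<Union>n. S n)"
    unfolding S_def using real_arch_simple by (auto simp: dist_norm)
  also have "emeasure lborel \<dots> = (SUP n. emeasure lborel (S n))"
    by (rule SUP_emeasure_incseq[symmetric]) (auto simp: incseq_def S_def)
  also have "\<dots> \<le> ennreal ((B / s) ^ 3)" by (rule SUP_least) (rule bd)
  finally show ?thesis .
qed

text \<open>The two instances are weak L^3 and its predual; 3 and 3/2 are conjugate exponents, and
  so are \<infinity> and 1.\<close>

locale weak3 = E: lorentz \<phi> 3 \<infinity> + X: lorentz \<phi> "3 / 2" 1 for \<phi>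
begin

text \<open>The nonnegativity of \<open>E.LN\<close> with \<open>top\<close>, the form into which
  simplification rewrites \<open>\<infinity>\<close>.\<close>

lemma LN_top_nonneg [simp]: "0 \<le> lorentz.LN 3 top T"
  using E.LN_nonneg by simp

text \<open>For a function of zero norm, \<open>hil_lnorm\<close> is used with arbitrarily small J =
  d^2.\<close>

lemma hil_LN:
  obtains C where "0 \<le> C" "\<And>f. f \<in> hil \<Longrightarrow> f \<in> X.lfun \<and> X.LN (dist_of f) \<le> C * sqrt (hsq f)"
proof -
  obtain C where C: "0 \<le> C" "\<And>f J. f \<in> hil \<Longrightarrow> 0 < J \<Longrightarrow> hsq f \<le> J \<Longrightarrow> lnorm (3 / 2) 1 (absf f) \<le> ennreal (C * sqrt J)"
    using hil_lnorm by metis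
  have "f \<in> X.lfun \<and> X.LN (dist_of f) \<le> C * sqrt (hsq f)" if f: "f \<in> hil" for f
  proof -
    have "0 < hsq f + 1" by (simp add: add_nonneg_pos)
    then have fl: "f \<in> X.lfun" unfolding X.lfun_def using order_le_less_trans[OF C(2)[OF f, of "hsq f + 1"]] f
      by (simp add: hil_borel)
    have le: "X.LN (dist_of f) \<le> C * sqrt J" if "0 < J" "hsq f \<le> J" for J
      using C(2)[OF f that] C(1) that by (intro X.LN_leI fl) auto
    have "X.LN (dist_of f) \<le> C * sqrt (hsq f)"
    proof (cases "hsq f = 0")
      case True
      have "X.LN (dist_of f) \<le> 0 + d * C" if "0 < d" for d
        using le[of "d\<^sup>2"] True that by (simp add: mult.commute)
      then have "X.LN (dist_of f) \<le> 0" using C(1) by (rule le_from_perturbation)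
      then show ?thesis using True by simp
    next
      case False
      then show ?thesis using le[of "hsq f"] hsq_nonneg[of f] by linarith
    qed
    then show ?thesis using fl by blast
  qed
  then show ?thesis using that C(1) by blast
qed

text \<open>Restricted to the weighted L^2 space, the functional is bounded and has a density u.
  Bounded functions of bounded support belong to that space, and they are enough to test the
  weak-type bound of u.\<close>

lemma functional_representation:
  obtains C where "0 < C" "\<And>L K. L \<in> dual_on (lorentz_space (3 / 2) 1) X.LN \<Longrightarrow> 0 < K \<Longrightarrow>
    (\<And>T. T \<in> lorentz_space (3 / 2) 1 \<Longrightarrow> norm (L T) \<le> K * X.LN T) \<Longrightarrow>
    \<exists>u\<in>E.lfun. on_schwartz (L \<circ> dist_of) = dist_of u \<and> E.LN (dist_of u) \<le> C * K"
proof -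
  obtain C0 where C0: "0 < C0" "\<And>f. f \<in> borel_measurable lebesgue \<Longrightarrow> lnorm 3 \<infinity> (absf f) \<le> ennreal C0 * lorentz_quasinorm 3 \<infinity> f"
    using lorentz_quasinorm_equiv[OF E.p E.q] by blast
  define c where "c = enn2real (lnorm_const (3 / 2) 1) + 1"
  have c: "0 < c" by (simp add: c_def add_nonneg_pos)
  obtain C1 where C1: "0 \<le> C1" "\<And>f. f \<in> hil \<Longrightarrow> f \<in> X.lfun \<and> X.LN (dist_of f) \<le> C1 * sqrt (hsq f)"
    using hil_LN by blast
  have rep: "\<exists>u\<in>E.lfun. on_schwartz (L \<circ> dist_of) = dist_of u \<and> E.LN (dist_of u) \<le> (C0 * c) * K"
    if L: "L \<in> dual_on (lorentz_space (3 / 2) 1) X.LN" and K: "0 < K"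
      and LK: "\<And>T. T \<in> lorentz_space (3 / 2) 1 \<Longrightarrow> norm (L T) \<le> K * X.LN T" for L K
  proof -
    define l where "l f = L (dist_of f)" for f
    have Xs: "dist_of f \<in> lorentz_space (3 / 2) 1" if "f \<in> X.lfun" for f using that by (simp add: X.lorentz_space_eq)
    obtain v where v: "v \<in> hil" "\<And>g. g \<in> hil \<Longrightarrow> l g = hip v g"
    proof (rule hil_riesz[of l "K * C1"])
      fix f g assume fg: "f \<in> hil" "g \<in> hil"
      then have fg: "f \<in> X.lfun" "g \<in> X.lfun" using C1 by auto
      then have "L (\<lambda>a. dist_of f a + dist_of g a) = l f + l g"
        using L Xs unfolding dual_on_def l_def by blast
      then show "l (\<lambda>x. f x + g x) = l f + l g" by (simp add: l_def X.dist_of_lfun_add fg)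
    next
      fix b f assume "f \<in> hil"
      then have f: "f \<in> X.lfun" using C1 by auto
      then have "L (\<lambda>a. b * dist_of f a) = b * l f"
        using L Xs unfolding dual_on_def l_def by blast
      then show "l (\<lambda>x. b * f x) = b * l f" by (simp add: l_def X.dist_of_lfun_cmult f)
    next
      fix f assume f: "f \<in> hil"
      have "norm (l f) \<le> K * X.LN (dist_of f)" unfolding l_def by (intro LK Xs) (use C1(2)[OF f] in blast)
      also have "\<dots> \<le> K * (C1 * sqrt (hsq f))" using C1(2)[OF f] K by (intro mult_left_mono) auto
      finally show "norm (l f) \<le> K * C1 * sqrt (hsq f)" by (simp add: mult.assoc)
    qed (use K C1 in auto)
    \<comment> \<open>The Riesz vector v represents the functional with respect to the weighted
      measure; dividing by \<open>decay\<close> gives the density with respect to Lebesgue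
      measure.\<close>
    define u where "u = (\<lambda>x. of_real (1 / decay x) * cnj (v x))"
    have um [measurable]: "u \<in> borel_measurable borel"
    proof -
      have [measurable]: "(\<lambda>x. cnj (v x)) \<in> borel_measurable borel"
        by (rule borel_measurable_continuous_on[of cnj]) (auto intro: continuous_intros hil_borel v)
      show ?thesis unfolding u_def by measurable
    qed
    have lu: "l g = (LINT x|lborel. u x * g x)" "integrable lborel (\<lambda>x. u x * g x)" if "g \<in> hil" for g
      using hip_lborel[OF v(1) that] v(2)[OF that] by (simp_all add: u_def)
    have Kc: "0 < K * c" using K c by simp
    have w: "emeasure lborel {x. s < norm (u x)} \<le> ennreal ((K * c / s) ^ 3)" if s: "0 < s" for s
    proof (rule weak_type_test[OF um _ s])
      fix g :: fn and S assume g: "g \<in> borel_measurable borel" "\<And>x. norm (g x) \<le> indicator S x"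
        and S: "S \<in> sets borel" "bounded S"
      have [measurable]: "S \<in> sets borel" by fact
      obtain R where R: "\<And>x. x \<in> S \<Longrightarrow> norm x \<le> R" using S(2) by (auto simp: bounded_iff)
      have gh: "g \<in> hil"
      proof (rule hil_decay[OF g(1)])
        fix x
        have "indicator S x \<le> (1 + max 0 R) ^ 5 * decay x"
        proof (cases "x \<in> S")
          case True
          then have "(1 + norm x) ^ 5 \<le> (1 + max 0 R) ^ 5" using R[of x] by (intro power_mono) auto
          then show ?thesis using True by (simp add: decay_def pos_le_divide_eq zero_less_power add_pos_nonneg)
        qed simp
        then show "norm (g x) \<le> (1 + max 0 R) ^ 5 * decay x" using g(2)[of x] by linarith
      qed
      have fin: "emeasure lborel S < top" using emeasure_bounded_finite[OF S(2)] by (simp add: less_top)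
      define m where "m = measure lborel S"
      have m: "0 \<le> m" "emeasure lborel S = ennreal m" using fin by (auto simp: m_def emeasure_eq_ennreal_measure less_top)
      \<comment> \<open>A function bounded by 1 and supported in S satisfies \<open>lnorm_le\<close>
        with A = 1 and T = |S|. Null sets are treated apart because T must be positive
        there.\<close>
      have ln: "X.LN (dist_of g) \<le> c * m powr (2 / 3)"
      proof -
        have gi: "(\<integral>\<^sup>+x. absf g x \<partial>lborel) \<le> ennreal m"
        proof -
          have "(\<integral>\<^sup>+x. absf g x \<partial>lborel) \<le> (\<integral>\<^sup>+x. indicator S x \<partial>lborel)"
          proof (rule nn_integral_mono)
            fix x show "absf g x \<le> indicator S x" using g(2)[of x] by (auto split: split_indicator)
          qed
          then show ?thesis using m by simp
        qed
        have gl: "g \<in> X.lfun" using C1(2)[OF gh] by blast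
        have lt: "X.LN (dist_of g) \<le> c * t powr (2 / 3)" if t: "m \<le> t" "0 < t" for t
        proof (rule X.LN_leI[OF gl])
          have "lnorm (3 / 2) 1 (absf g) \<le> ennreal (1 * t powr (1 / (3 / 2))) * lnorm_const (3 / 2) 1"
          proof (rule lnorm_le[OF X.p X.q])
            show "absf g x \<le> ennreal 1" for x using g(2)[of x] by (auto split: split_indicator_asm)
            show "(\<integral>\<^sup>+x. absf g x \<partial>lborel) \<le> ennreal (1 * t)" using order_trans[OF gi] t by (simp add: ennreal_leI)
          qed (use t in auto)
          also have "lnorm_const (3 / 2) 1 = ennreal (c - 1)"
            using lnorm_const_finite[OF X.p X.q] by (simp add: c_def)
          also have "ennreal (1 * t powr (1 / (3 / 2))) * ennreal (c - 1) \<le> ennreal (c * t powr (2 / 3))"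
          proof -
            have "t powr (2 / 3) * (c - 1) \<le> c * t powr (2 / 3)" by (simp add: algebra_simps)
            moreover have "0 \<le> c - 1" by (simp add: c_def)
            ultimately show ?thesis by (simp add: ennreal_mult[symmetric] ennreal_leI)
          qed
          finally show "lnorm (3 / 2) 1 (absf g) \<le> ennreal (c * t powr (2 / 3))" .
        qed (use c in auto)
        show ?thesis
        proof (cases "m = 0")
          case False
          then show ?thesis using lt[of m] m by simp
        next
          case True
          have "lnorm (3 / 2) 1 (absf g) = lnorm (3 / 2) 1 (absf (\<lambda>x. 0))"
          proof (rule X.lnorm_cong_AE)
            have "(\<integral>\<^sup>+x. absf g x \<partial>lborel) = 0" using gi True by simp
            then have "AE x in lborel. absf g x = 0" using g(1) by (subst (asm) nn_integral_0_iff_AE) auto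
            then show "AE x in lborel. g x = 0" by eventually_elim simp
          qed
          then have "lnorm (3 / 2) 1 (absf g) \<le> ennreal 0" using X.F.zero by simp
          then show ?thesis using X.LN_leI[OF gl, of 0] True by simp
        qed
      qed
      have "norm (l g) \<le> K * X.LN (dist_of g)" unfolding l_def by (intro LK Xs) (use C1(2)[OF gh] in blast)
      also have "\<dots> \<le> K * (c * m powr (2 / 3))" using ln K by (intro mult_left_mono) auto
      finally show "integrable lborel (\<lambda>x. u x * g x) \<and> norm (LINT x|lborel. u x * g x) \<le> K * c * measure lborel S powr (2 / 3)"
        using lu[OF gh] by (simp add: m_def mult.assoc)
    qed (use Kc in simp)
    have "lorentz_quasinorm 3 \<infinity> u \<le> ennreal (K * c)"
    proof (rule quasinorm_weak[OF Kc])
      fix s :: real assume "0 < s"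
      moreover have "{x. s < norm (u x)} \<in> sets borel" by measurable
      ultimately show "emeasure lebesgue {x. s < norm (u x)} \<le> ennreal ((K * c / s) ^ 3)" using w by simp
    qed
    then have "ennreal C0 * lorentz_quasinorm 3 \<infinity> u \<le> ennreal C0 * ennreal (K * c)" by (intro mult_left_mono) auto
    moreover have "lnorm 3 \<infinity> (absf u) \<le> ennreal C0 * lorentz_quasinorm 3 \<infinity> u" by (intro C0 measurable_completion) simp
    ultimately have ln: "lnorm 3 \<infinity> (absf u) \<le> ennreal (C0 * c * K)"
      using C0 Kc by (simp add: ennreal_mult[symmetric] mult_ac)
    then have ul: "u \<in> E.lfun" unfolding E.lfun_def mem_Collect_eq using order_le_less_trans[OF ln] um by simp
    moreover have "E.LN (dist_of u) \<le> C0 * c * K" using C0 c K ln by (intro E.LN_leI ul) auto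
    moreover have "on_schwartz (L \<circ> dist_of) = dist_of u"
    proof
      fix f
      show "on_schwartz (L \<circ> dist_of) f = dist_of u f"
      proof (cases "f \<in> schwartz")
        case True
        then have "f \<in> hil" by (intro hil_decay[of _ "schwartz_norm 5 f"] schwartz_borel schwartz_norm_decay)
        then show ?thesis using lu(1) True by (simp add: on_schwartz_def dist_of_eq l_def)
      qed (simp add: on_schwartz_def dist_of_eq_0)
    qed
    ultimately show ?thesis by blast
  qed
  show ?thesis by (rule that[of "C0 * c"]) (use C0 c rep in auto)
qed

text \<open>\<open>weak_type\<close> turns the norm of u into the level-set bound required by
  \<open>lorentz_hoelder\<close>, whose constant is the source of the factor 1/3. Enlarging the norm
  by d makes A positive; the estimate follows by letting d tend to 0.\<close>

lemma weak_pairing: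
  assumes u: "u \<in> E.lfun" and g: "g \<in> X.lfun"
  shows "integrable lborel (\<lambda>x. u x * g x)"
    and "norm (LINT x|lborel. u x * g x) \<le> E.LN (dist_of u) / 3 * X.LN (dist_of g)"
proof -
  note [measurable] = E.lfun_borel[OF u] X.lfun_borel[OF g]
  have le: "(\<integral>\<^sup>+x. absf u x * absf g x \<partial>lborel) \<le> ennreal ((E.LN (dist_of u) + d) / 3 * X.LN (dist_of g))" if d: "0 < d" for d
  proof -
    have A: "0 < E.LN (dist_of u) + d" using d by (simp add: add_nonneg_pos)
    have "(\<integral>\<^sup>+x. absf u x * absf g x \<partial>lborel) \<le> ennreal ((E.LN (dist_of u) + d) / 3) * lnorm (3 / 2) 1 (absf g)"
    proof (rule lorentz_hoelder[OF _ _ A])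
      fix s :: real assume "0 < s"
      moreover have "lnorm 3 \<infinity> (absf u) \<le> ennreal (E.LN (dist_of u) + d)"
        unfolding E.ennreal_LN[OF u, symmetric] using d by (intro ennreal_leI) simp
      ultimately show "emeasure lborel {x. s \<le> norm (u x)} \<le> ennreal (((E.LN (dist_of u) + d) / s) ^ 3)"
        using A by (intro weak_type) auto
    qed auto
    also have "\<dots> = ennreal ((E.LN (dist_of u) + d) / 3 * X.LN (dist_of g))"
      unfolding X.ennreal_LN[OF g, symmetric] using A by (intro ennreal_mult[symmetric]) auto
    finally show ?thesis .
  qed
  have n: "(\<integral>\<^sup>+x. ennreal (norm (u x * g x)) \<partial>lborel) = (\<integral>\<^sup>+x. absf u x * absf g x \<partial>lborel)"
    by (simp add: norm_mult ennreal_mult)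
  show "integrable lborel (\<lambda>x. u x * g x)"
    using order_le_less_trans[OF le[of 1]] by (intro integrableI_bounded) (auto simp: n)
  show "norm (LINT x|lborel. u x * g x) \<le> E.LN (dist_of u) / 3 * X.LN (dist_of g)"
  proof (rule le_from_perturbation)
    fix d :: real assume d: "0 < d"
    have "ennreal (norm (LINT x|lborel. u x * g x)) \<le> ennreal ((E.LN (dist_of u) + d) / 3 * X.LN (dist_of g))"
      using order_trans[OF norm_integral_le_nn le[OF d, folded n]] .
    then have "norm (LINT x|lborel. u x * g x) \<le> (E.LN (dist_of u) + d) / 3 * X.LN (dist_of g)"
      using d by (subst (asm) ennreal_le_iff) (auto intro!: mult_nonneg_nonneg add_nonneg_nonneg)
    then show "norm (LINT x|lborel. u x * g x) \<le> E.LN (dist_of u) / 3 * X.LN (dist_of g) + d * (X.LN (dist_of g) / 3)"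
      by (simp add: algebra_simps add_divide_distrib)
  qed simp
qed

text \<open>The functional must act on distributions, so it integrates u against a chosen density;
  the value does not depend on the choice because densities are unique almost everywhere.\<close>

lemma functional_of_weak:
  assumes u: "u \<in> E.lfun"
  shows "\<exists>L\<in>dual_on (lorentz_space (3 / 2) 1) X.LN. on_schwartz (L \<circ> dist_of) = dist_of u"
proof -
  define rep where "rep T = (SOME g. g \<in> X.lfun \<and> dist_of g = T)" for T
  define L where "L T = (if T \<in> lorentz_space (3 / 2) 1 then LINT x|lborel. u x * rep T x else 0)" for T
  have L: "L (dist_of g) = (LINT x|lborel. u x * g x)" if g: "g \<in> X.lfun" for g
  proof -
    have r: "rep (dist_of g) \<in> X.lfun \<and> dist_of (rep (dist_of g)) = dist_of g"
      unfolding rep_def by (rule someI[of _ g]) (use g in simp)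
    then have "AE x in lborel. rep (dist_of g) x = g x" using g by (intro X.dist_of_lfun_inj) auto
    then have "AE x in lborel. u x * rep (dist_of g) x = u x * g x" by eventually_elim simp
    moreover have "rep (dist_of g) \<in> borel_measurable borel" "g \<in> borel_measurable borel" "u \<in> borel_measurable borel"
      using r g u by (auto intro: X.lfun_borel E.lfun_borel)
    ultimately have "(LINT x|lborel. u x * rep (dist_of g) x) = (LINT x|lborel. u x * g x)"
      by (intro integral_cong_AE) auto
    then show ?thesis using g by (simp add: L_def X.lorentz_space_eq)
  qed
  have "L \<in> dual_on (lorentz_space (3 / 2) 1) X.LN"
    unfolding dual_on_def mem_Collect_eq
  proof (intro conjI)
    show "\<forall>f. f \<notin> lorentz_space (3 / 2) 1 \<longrightarrow> L f = 0" by (simp add: L_def)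
    show "\<forall>f\<in>lorentz_space (3 / 2) 1. \<forall>g\<in>lorentz_space (3 / 2) 1. L (\<lambda>a. f a + g a) = L f + L g"
      unfolding X.lorentz_space_eq
      by (auto simp: X.dist_of_lfun_add L X.lfun_add distrib_left weak_pairing(1)[OF u])
    show "\<forall>c. \<forall>f\<in>lorentz_space (3 / 2) 1. L (\<lambda>a. c * f a) = c * L f"
      unfolding X.lorentz_space_eq
      by (auto simp: X.dist_of_lfun_cmult L X.lfun_cmult mult.left_commute[of _ "_::complex"])
    have "norm (L f) \<le> E.LN (dist_of u) / 3 * X.LN f" if "f \<in> lorentz_space (3 / 2) 1" for f
      using that weak_pairing(2)[OF u] unfolding X.lorentz_space_eq by (auto simp: L)
    then show "\<exists>C. \<forall>f\<in>lorentz_space (3 / 2) 1. norm (L f) \<le> C * X.LN f" by blast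
  qed
  moreover have "on_schwartz (L \<circ> dist_of) = dist_of u"
    using E.lfun_borel[OF u] by (auto simp: fun_eq_iff on_schwartz_def L X.schwartz_lfun(1) dist_of_eq dist_of_eq_0)
  ultimately show ?thesis by blast
qed

text \<open>L is known to be the pairing with u on Schwartz functions only. They are dense in
  L^(3/2,1), and L is continuous, so the bound for the pairing extends to all of the
  predual.\<close>

lemma dual_norm_le_weak:
  assumes L: "L \<in> dual_on (lorentz_space (3 / 2) 1) X.LN" and u: "u \<in> E.lfun" "on_schwartz (L \<circ> dist_of) = dist_of u"
  shows "dual_norm_on (lorentz_space (3 / 2) 1) X.LN L \<le> E.LN (dist_of u) / 3"
proof (rule dual_norm_le[OF X.subspace_lorentz X.norm_LN])
  fix T assume T: "T \<in> lorentz_space (3 / 2) 1"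
  define K where "K = dual_norm_on (lorentz_space (3 / 2) 1) X.LN L"
  have LK: "norm (L S) \<le> K * X.LN S" if "S \<in> lorentz_space (3 / 2) 1" for S
    unfolding K_def by (rule dual_norm_bound[OF X.subspace_lorentz X.norm_LN L that])
  let ?b = "E.LN (dist_of u) / 3"
  have b: "0 \<le> ?b" by simp
  show "norm (L T) \<le> ?b * X.LN T"
  proof (rule le_from_perturbation)
    fix d :: real assume d: "0 < d"
    obtain f where f: "f \<in> schwartz" "X.LN (\<lambda>a. T a - dist_of f a) < d"
      using X.schwartz_dense_LN T d unfolding schwartz_dense_def by auto
    obtain h where h: "h \<in> X.lfun" "T = dist_of h" using T unfolding X.lorentz_space_eq by blast
    note fl = X.schwartz_lfun(1)[OF f(1)]
    define D where "D = dist_of (\<lambda>x. h x - f x)"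
    have DX: "D \<in> lorentz_space (3 / 2) 1" "dist_of f \<in> lorentz_space (3 / 2) 1" unfolding X.lorentz_space_eq D_def by (auto intro: X.lfun_diff h fl)
    have Dd: "X.LN D < d" using f(2) unfolding h(2) X.dist_of_lfun_diff[OF h(1) fl] D_def .
    have sum: "T = (\<lambda>a. D a + dist_of f a)" unfolding h(2) D_def X.dist_of_lfun_diff[OF h(1) fl, symmetric] by simp
    have "X.LN (dist_of f) = X.LN (\<lambda>a. T a + (-1) * D a)" unfolding sum by simp
    also have "\<dots> \<le> X.LN T + X.LN (\<lambda>a. (-1) * D a)"
    proof -
      have neg: "(\<lambda>a. (-1) * D a) \<in> lorentz_space (3 / 2) 1" using X.subspace_lorentz DX unfolding subspace_on_def by blast
      show ?thesis using X.norm_LN[unfolded norm_on_def, THEN conjunct2, THEN conjunct1, rule_format, OF T neg] .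
    qed
    also have "X.LN (\<lambda>a. (-1) * D a) = norm (-1 :: complex) * X.LN D" using X.norm_LN DX unfolding norm_on_def by blast
    finally have "X.LN (dist_of f) \<le> X.LN T + norm (-1 :: complex) * X.LN D" .
    then have nf: "X.LN (dist_of f) \<le> X.LN T + d" using Dd by simp
    have "L T = L D + L (dist_of f)" unfolding sum using L DX unfolding dual_on_def by blast
    then have "norm (L T) \<le> norm (L D) + norm (L (dist_of f))" by (simp add: norm_triangle_ineq)
    also have "norm (L D) \<le> K * X.LN D" by (rule LK[OF DX(1)])
    also have "K * X.LN D \<le> \<bar>K\<bar> * d" using Dd by (intro mult_mono) auto
    also have "L (dist_of f) = dist_of u f" using fun_cong[OF u(2), of f] f(1) by (simp add: on_schwartz_def)
    also have "norm (dist_of u f) \<le> ?b * X.LN (dist_of f)"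
      using weak_pairing(2)[OF u(1) fl] f(1) E.lfun_borel[OF u(1)] by (simp add: dist_of_eq)
    also have "?b * X.LN (dist_of f) \<le> ?b * (X.LN T + d)" by (intro mult_left_mono nf b)
    finally show "norm (L T) \<le> ?b * X.LN T + d * (\<bar>K\<bar> + ?b)" by (simp add: algebra_simps)
  qed (use b in simp)
qed simp

lemma is_dual_of_weak:
  assumes N: "lorentz_norm 3 \<infinity> N"
  shows "is_dual_of (lorentz_space 3 \<infinity>) N dist_of (lorentz_space (3 / 2) 1) X.LN"
proof -
  let ?X = "lorentz_space (3 / 2) 1"
  obtain C where C: "0 < C" "\<And>L K. L \<in> dual_on ?X X.LN \<Longrightarrow> 0 < K \<Longrightarrow>
    (\<And>T. T \<in> ?X \<Longrightarrow> norm (L T) \<le> K * X.LN T) \<Longrightarrow>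
    \<exists>u\<in>E.lfun. on_schwartz (L \<circ> dist_of) = dist_of u \<and> E.LN (dist_of u) \<le> C * K"
    using functional_representation by blast
  obtain a b where ab: "0 < a" "0 < b" "\<And>T. T \<in> lorentz_space 3 \<infinity> \<Longrightarrow> a * E.LN T \<le> N T \<and> N T \<le> b * E.LN T"
    using E.lorentz_norm_equiv[OF N] by metis
  have rep: "on_schwartz (L \<circ> dist_of) \<in> lorentz_space 3 \<infinity> \<and>
      dual_norm_on ?X X.LN L \<le> E.LN (on_schwartz (L \<circ> dist_of)) / 3 \<and>
      E.LN (on_schwartz (L \<circ> dist_of)) \<le> C * dual_norm_on ?X X.LN L" if L: "L \<in> dual_on ?X X.LN" for L
  proof -
    define D where "D = dual_norm_on ?X X.LN L"
    have LD: "norm (L T) \<le> D * X.LN T" if "T \<in> ?X" for T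
      unfolding D_def by (rule dual_norm_bound[OF X.subspace_lorentz X.norm_LN L that])
    have D0: "0 \<le> D"
    proof -
      obtain K where K: "\<And>T. T \<in> ?X \<Longrightarrow> norm (L T) \<le> K * X.LN T" using L unfolding dual_on_def by blast
      have "(\<lambda>_. 0) \<in> ?X" using X.subspace_lorentz by (simp add: subspace_on_def)
      moreover from this have "X.LN (\<lambda>_. 0) = 0" using X.norm_LN by (auto simp: norm_on_def)
      moreover have "bdd_above ((\<lambda>f. norm (L f)) ` {f \<in> ?X. X.LN f \<le> 1})"
      proof (rule bdd_aboveI2)
        fix h assume h: "h \<in> {f \<in> ?X. X.LN f \<le> 1}"
        then have "K * X.LN h \<le> \<bar>K\<bar> * 1" by (intro mult_mono) auto
        then show "norm (L h) \<le> \<bar>K\<bar>" using K[of h] h by simp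
      qed
      ultimately have "norm (L (\<lambda>_. 0)) \<le> D" unfolding D_def dual_norm_on_def
        by (intro cSUP_upper) auto
      then show ?thesis using norm_ge_zero order_trans by blast
    qed
    \<comment> \<open>The representation lemma requires a positive bound, and the dual norm D may be
      zero; d is removed afterwards. The density may vary with d, but its distribution is determined
      by L.\<close>
    have ex: "\<exists>u\<in>E.lfun. on_schwartz (L \<circ> dist_of) = dist_of u \<and> E.LN (dist_of u) \<le> C * (D + d)" if d: "0 < d" for d
    proof (rule C(2)[OF L])
      show "0 < D + d" using D0 d by simp
      fix T assume "T \<in> ?X"
      then show "norm (L T) \<le> (D + d) * X.LN T" using LD[of T] d mult_right_mono[of D "D + d" "X.LN T"] by simp
    qed
    obtain u where u: "u \<in> E.lfun" "on_schwartz (L \<circ> dist_of) = dist_of u" using ex[of 1] by auto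
    have "E.LN (dist_of u) \<le> C * D"
    proof (rule le_from_perturbation)
      fix d :: real assume "0 < d"
      then show "E.LN (dist_of u) \<le> C * D + d * C" using ex[of d] u(2) by (auto simp: algebra_simps)
    qed (use C in simp)
    then show ?thesis using dual_norm_le_weak[OF L u] u(1) unfolding u(2) D_def E.lorentz_space_eq by blast
  qed
  have "lorentz_space 3 \<infinity> = (\<lambda>L. on_schwartz (L \<circ> dist_of)) ` dual_on ?X X.LN"
  proof
    show "lorentz_space 3 \<infinity> \<subseteq> (\<lambda>L. on_schwartz (L \<circ> dist_of)) ` dual_on ?X X.LN"
    proof
      fix T assume "T \<in> lorentz_space 3 \<infinity>"
      then obtain u where "u \<in> E.lfun" "T = dist_of u" unfolding E.lorentz_space_eq by blast
      then show "T \<in> (\<lambda>L. on_schwartz (L \<circ> dist_of)) ` dual_on ?X X.LN" using functional_of_weak[of u] by force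
    qed
  qed (use rep in blast)
  \<comment> \<open>The factor 3 inverts the 1/3 of \<open>dual_norm_le_weak\<close>; a and b
    compare N with \<open>E.LN\<close>.\<close>
  moreover have "3 * a * dual_norm_on ?X X.LN L \<le> N (on_schwartz (L \<circ> dist_of)) \<and>
      N (on_schwartz (L \<circ> dist_of)) \<le> b * C * dual_norm_on ?X X.LN L" if L: "L \<in> dual_on ?X X.LN" for L
  proof -
    note r = rep[OF L]
    have "a * (3 * dual_norm_on ?X X.LN L) \<le> a * E.LN (on_schwartz (L \<circ> dist_of))"
      "b * E.LN (on_schwartz (L \<circ> dist_of)) \<le> b * (C * dual_norm_on ?X X.LN L)"
      using r ab(1,2) by (auto intro!: mult_left_mono)
    then show ?thesis using ab(3)[of "on_schwartz (L \<circ> dist_of)"] r by (simp add: mult_ac)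
  qed
  ultimately show ?thesis unfolding is_dual_of_def
    using ab C(1) by (intro conjI exI[of _ "3 * a"] exI[of _ "b * C"]) auto
qed

end

section \<open>From the interpolation norm to arbitrary Lorentz norms\<close>

context lorentz3
begin

lemma functional_space_lorentz:
  assumes N: "lorentz_norm 3 q N"
  shows "functional_space \<phi> (lorentz_space 3 q) N"
proof -
  obtain a b where ab: "0 < a" "0 < b" "\<And>T. T \<in> lorentz_space 3 q \<Longrightarrow> a * LN T \<le> N T \<and> N T \<le> b * LN T"
    using lorentz_norm_equiv[OF N] by metis
  have se: "schwartz_embeds dist_of (lorentz_space 3 q) N"
  proof -
    obtain C m where C: "\<And>f. f \<in> schwartz \<Longrightarrow> LN (dist_of f) \<le> C * schwartz_norm m f"
      using schwartz_embeds_LN unfolding schwartz_embeds_def by blast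
    have "N (dist_of f) \<le> (b * C) * schwartz_norm m f" if f: "f \<in> schwartz" for f
    proof -
      have "dist_of f \<in> lorentz_space 3 q" unfolding lorentz_space_eq using schwartz_lfun(1)[OF f] by blast
      then have "N (dist_of f) \<le> b * LN (dist_of f)" using ab by blast
      also have "\<dots> \<le> b * (C * schwartz_norm m f)" using ab C[OF f] by (intro mult_left_mono) auto
      finally show ?thesis by simp
    qed
    then show ?thesis using schwartz_embeds_LN unfolding schwartz_embeds_def by blast
  qed
  have "\<exists>C. \<forall>T\<in>lorentz_space 3 q. norm (T f) \<le> C * N T" if f: "f \<in> schwartz" for f
  proof (intro exI ballI)
    fix T assume T: "T \<in> lorentz_space 3 q"
    then obtain u where u: "u \<in> lfun" "T = dist_of u" unfolding lorentz_space_eq by blast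
    let ?c = "decay_mass * 4 * schwartz_norm 5 f"
    have c: "0 \<le> ?c" using schwartz_norm_nonneg[OF f, of 5] by (simp add: decay_mass_def)
    have "norm (T f) \<le> ?c * LN T" using pairing_bound[OF u(1) f] u(2) by (simp add: mult_ac)
    also have "\<dots> \<le> ?c * (N T / a)" using ab(1) ab(3)[OF T] by (intro mult_left_mono c) (simp add: pos_le_divide_eq mult.commute)
    finally show "norm (T f) \<le> (?c / a) * N T" by simp
  qed
  moreover have "schwartz_dense dist_of (lorentz_space 3 q) N \<or>
      (\<exists>(\<iota> :: fn \<Rightarrow> dist) X M. banach_on X M \<and> schwartz_dense \<iota> X M \<and> is_dual_of (lorentz_space 3 q) N \<iota> X M)"
  proof (cases "q = \<infinity>")
    case True
    \<comment> \<open>The predual is itself a Banach space of distributions, embedded by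
      \<open>dist_of\<close>, and Schwartz functions are dense in it because its second index is
      finite.\<close>
    interpret W: weak3 \<phi> by unfold_locales auto
    have "schwartz_dense dist_of (lorentz_space (3 / 2) 1) W.X.LN" by (rule W.X.schwartz_dense_LN) simp
    then show ?thesis using W.X.banach_LN W.is_dual_of_weak N unfolding True by blast
  next
    case False
    have "schwartz_dense dist_of (lorentz_space 3 q) N"
      unfolding schwartz_dense_def
    proof (intro conjI se ballI allI impI)
      fix v and e :: real assume v: "v \<in> lorentz_space 3 q" and e: "0 < e"
      then obtain f where f: "f \<in> schwartz" "LN (\<lambda>a. v a - dist_of f a) < e / b"
        using schwartz_dense_LN[OF False] ab(2) unfolding schwartz_dense_def by (meson divide_pos_pos)
      obtain h where h: "h \<in> lfun" "v = dist_of h" using v unfolding lorentz_space_eq by blast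
      have "(\<lambda>a. v a - dist_of f a) \<in> lorentz_space 3 q"
        unfolding h(2) dist_of_lfun_diff[OF h(1) schwartz_lfun(1)[OF f(1)]] lorentz_space_eq
        by (intro imageI lfun_diff h schwartz_lfun f)
      then have "N (\<lambda>a. v a - dist_of f a) \<le> b * LN (\<lambda>a. v a - dist_of f a)" using ab by blast
      also have "\<dots> < e" using f(2) ab(2) by (simp add: pos_less_divide_eq mult.commute)
      finally show "\<exists>f\<in>schwartz. N (\<lambda>a. v a - dist_of f a) < e" using f by blast
    qed
    then show ?thesis by blast
  qed
  moreover have "\<forall>T\<in>lorentz_space 3 q. \<forall>f\<in>schwartz. ((\<lambda>j. lp_S \<phi> j T f) \<longlongrightarrow> 0) at_bot"
    using lp_S_tendsto by blast
  ultimately show ?thesis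
    unfolding functional_space_def using N se lorentz_tempered by (auto simp: lorentz_norm_def)
qed

lemma good_space_lorentz:
  assumes N: "lorentz_norm 3 q N"
  shows "good_space \<phi> (lorentz_space 3 q) N"
proof -
  obtain a b where ab: "0 < a" "0 < b" "\<And>T. T \<in> lorentz_space 3 q \<Longrightarrow> a * LN T \<le> N T \<and> N T \<le> b * LN T"
    using lorentz_norm_equiv[OF N] by metis
  have "1 / b * N T \<le> LN T \<and> LN T \<le> 1 / a * N T" if "T \<in> lorentz_space 3 q" for T
    using ab(1,2) ab(3)[OF that] by (simp add: field_simps)
  then have "\<exists>c>0. \<exists>C>0. \<forall>T\<in>lorentz_space 3 q. c * N T \<le> LN T \<and> LN T \<le> C * N T"
    using ab(1,2) by (intro exI[of _ "1 / b"] exI[of _ "1 / a"] conjI) auto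
  then have "equivalent_norm_on (lorentz_space 3 q) N LN" by (simp add: equivalent_norm_on_def norm_LN)
  then show ?thesis
    unfolding good_space_def
    using functional_space_lorentz[OF N] invariant_LN good_seq_nonneg good_seq_summable product_estimate by blast
qed

end

theorem proposition20:
  fixes \<phi> :: "real \<Rightarrow> complex" and q :: ennreal
  assumes "lp_cutoff \<phi>" and "1 \<le> q"
  shows "(\<exists>N. lorentz_norm 3 q N) \<and>
    (\<forall>N. lorentz_norm 3 q N \<longrightarrow> good_space \<phi> (lorentz_space 3 q) N)"
proof -
  interpret lorentz3 \<phi> q by unfold_locales (use assms in auto)
  show ?thesis using lorentz_norm_LN good_space_lorentz by blast
qed

end
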